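(* Let $u_0\in C^2([-d,d])$ with $u_0'\neq0$ on $[-d,d]$, and let $$\beta>\max\{(u_0'')_{\max},\ \lambda_1^{-1}(0,u_{0,\min})\},\qquad L\ge\frac{2\pi}{\sqrt{-\lambda_1(\beta,u_{0,\min})}} .$$ Then the shear flow $(u_0,0)$, as a steady solution of the $\beta$-plane equation in $D_L=\mathbb T_L\times[-d,d]$ with $v=0$ on $y=\pm d$, is nonlinearly Lyapunov stable in $L^2$ of the vorticity, but nonlinear inviscid damping fails near $(u_0,0)$ in $C^2$.
   Context: Let $L,d>0$, $\mathbb T_L=\mathbb R/L\mathbb Z$, $D_L=\mathbb T_L\times[-d,d]$. For a constant $\beta\ge0$, the $\beta$-plane equation on $D_L$ is $$u_t+uu_x+vu_y-\beta yv=-P_x,\quad v_t+uv_x+vv_y+\beta yu=-P_y,\quad u_x+v_y=0,$$ with boundary condition $v=0$ on $y=\pm d$ ($P$ is the pressure). The vorticity is $\gamma=\partial_xv-\partial_yu$, satisfying $\partial_t\gamma+u\gamma_x+v\gamma_y+\beta v=0$; the vorticity of $(u_0,0)$ is $\gamma_0=-u_0'$. $(u_0'')_{\max}$ is the maximum of $u_0''$ on $[-d,d]$ and $u_{0,\min}=\min_{[-d,d]}u_0$. For $\beta\in\mathbb R$, $$\lambda_1(\beta,u_{0,\min})=\inf_{\phi\in H_0^1(-d,d),\ \|\phi\|_{L^2}=1}\int_{-d}^d\left(|\phi'|^2-\frac{\beta-u_0''}{u_0-u_{0,\min}}|\phi|^2\right)dy .$$ As a function of $\beta$ it is continuous and decreasing,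 positive for $\beta<(u_0'')_{\min}$, and tends to $-\infty$ as $\beta\to\infty$; $\lambda_1^{-1}(0,u_{0,\min})$ denotes the unique $\beta\in[(u_0'')_{\min},\infty)$ with $\lambda_1(\beta,u_{0,\min})=0$. Nonlinear Lyapunov stability in (vorticity) $L^2$: for every $\varepsilon>0$ there is $\delta>0$ such that every classical global solution (velocity and vorticity $C^1$) with $\|\gamma(0)-\gamma_0\|_{L^2(D_L)}<\delta$ satisfies $\|\gamma(t)-\gamma_0\|_{L^2(D_L)}<\varepsilon$ for all $t>0$. Failure of nonlinear inviscid damping near $(u_0,0)$ in $C^2$: for every $\varepsilon>0$ there is a global solution whose initial velocity is within $\varepsilon$ of $(u_0,0)$ in $C^2(D_L)$ and whose velocity does not converge (in $L^2(D_L)$) to a shear flow, i.e. to a velocity field of the form $(U(y),0)$, as $t\to\infty$. *)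

theory Defs
  imports "HOL-Analysis.Analysis"
begin

section \<open>Classes $C^k$ on sets with boundary\<close>

text \<open>
  Derivatives are taken within the set, hence one-sided at boundary points. The sets used below
  (an interval, a strip, a slab) are convex with nonempty interior, so these derivatives are unique.
\<close>

definition partial_within ::
    "'a::euclidean_space set \<Rightarrow> 'a \<Rightarrow> ('a \<Rightarrow> real) \<Rightarrow> 'a \<Rightarrow> real" where
  "partial_within S e f = (\<lambda>p. frechet_derivative f (at p within S) e)"

primrec Ck_on :: "nat \<Rightarrow> 'a::euclidean_space set \<Rightarrow> ('a \<Rightarrow> real) \<Rightarrow> bool" where
  "Ck_on 0 S f \<longleftrightarrow> continuous_on S f"
| "Ck_on (Suc k) S f \<longleftrightarrow>
     f differentiable_on S \<and> (\<forall>b\<in>Basis. Ck_on k S (partial_within S b f))"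

text \<open>
  The maximum over all partial derivatives of order at most \<open>k\<close> of their suprema. It is only
  applied to \<open>C\<^sup>k\<close> functions on a strip that are periodic in the first variable, for which
  all these suprema are finite.
\<close>

primrec Ck_norm :: "nat \<Rightarrow> 'a::euclidean_space set \<Rightarrow> ('a \<Rightarrow> real) \<Rightarrow> real" where
  "Ck_norm 0 S f = (SUP p\<in>S. \<bar>f p\<bar>)"
| "Ck_norm (Suc k) S f =
     max (SUP p\<in>S. \<bar>f p\<bar>) (Max ((\<lambda>b. Ck_norm k S (partial_within S b f)) ` Basis))"

section \<open>Square-integrable functions and the space $H^1_0(-d,d)$\<close>

definition in_L2 ::
    "'a::euclidean_space set \<Rightarrow> ('a \<Rightarrow> 'b::{banach, second_countable_topology}) \<Rightarrow> bool" where
  "in_L2 A f \<longleftrightarrow> set_borel_measurable lborel A f \<and> set_integrable lborel A (\<lambda>p. (norm (f p))\<^sup>2)"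

definition L2_norm ::
    "'a::euclidean_space set \<Rightarrow> ('a \<Rightarrow> 'b::{banach, second_countable_topology}) \<Rightarrow> real" where
  "L2_norm A f = sqrt (set_lebesgue_integral lborel A (\<lambda>p. (norm (f p))\<^sup>2))"

definition test_function :: "real \<Rightarrow> (real \<Rightarrow> real) \<Rightarrow> bool" where
  "test_function d \<psi> \<longleftrightarrow>
     (\<forall>k. Ck_on k UNIV \<psi>) \<and>
     (\<exists>K. compact K \<and> K \<subseteq> {-d<..<d} \<and> (\<forall>y. y \<notin> K \<longrightarrow> \<psi> y = 0))"

definition weak_derivative :: "real \<Rightarrow> (real \<Rightarrow> real) \<Rightarrow> (real \<Rightarrow> real) \<Rightarrow> bool" where
  "weak_derivative d \<phi> \<phi>' \<longleftrightarrow>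
     (\<forall>\<psi>. test_function d \<psi> \<longrightarrow>
        set_lebesgue_integral lborel {-d<..<d} (\<lambda>y. \<phi> y * deriv \<psi> y) =
        - set_lebesgue_integral lborel {-d<..<d} (\<lambda>y. \<phi>' y * \<psi> y))"

text \<open>
  \<open>H1 d \<phi> \<phi>'\<close> says that \<open>\<phi>\<close> represents an element of \<open>H\<^sup>1(-d,d)\<close> with weak derivative
  represented by \<open>\<phi>'\<close>; \<open>H10 d \<phi> \<phi>'\<close> says in addition that it lies in the closure of the
  test functions with respect to the \<open>H\<^sup>1\<close> norm.
\<close>

definition H1 :: "real \<Rightarrow> (real \<Rightarrow> real) \<Rightarrow> (real \<Rightarrow> real) \<Rightarrow> bool" where
  "H1 d \<phi> \<phi>' \<longleftrightarrow>
     in_L2 {-d<..<d} \<phi> \<and> in_L2 {-d<..<d} \<phi>' \<and> weak_derivative d \<phi> \<phi>'"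

definition H10 :: "real \<Rightarrow> (real \<Rightarrow> real) \<Rightarrow> (real \<Rightarrow> real) \<Rightarrow> bool" where
  "H10 d \<phi> \<phi>' \<longleftrightarrow>
     H1 d \<phi> \<phi>' \<and>
     (\<exists>\<psi>. (\<forall>n::nat. test_function d (\<psi> n)) \<and>
        (\<lambda>n. L2_norm {-d<..<d} (\<lambda>y. \<psi> n y - \<phi> y)) \<longlonglongrightarrow> 0 \<and>
        (\<lambda>n. L2_norm {-d<..<d} (\<lambda>y. deriv (\<psi> n) y - \<phi>' y)) \<longlonglongrightarrow> 0)"

section \<open>The eigenvalue $\lambda_1$\<close>

abbreviation D1 :: "real \<Rightarrow> (real \<Rightarrow> real) \<Rightarrow> real \<Rightarrow> real" where
  "D1 d f \<equiv> partial_within {-d..d} 1 f"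

abbreviation D2 :: "real \<Rightarrow> (real \<Rightarrow> real) \<Rightarrow> real \<Rightarrow> real" where
  "D2 d f \<equiv> D1 d (D1 d f)"

definition shear_min :: "real \<Rightarrow> (real \<Rightarrow> real) \<Rightarrow> real" where
  "shear_min d u0 = (INF y\<in>{-d..d}. u0 y)"

text \<open>
  For \<open>c = shear_min d u0\<close> the potential has a simple pole at an endpoint when \<open>D1 d u0\<close> does
  not vanish; the integrand is still integrable for all \<open>\<phi>\<close> in \<open>H\<^sub>0\<^sup>1\<close> by Hardy's inequality.
\<close>

definition lambda1 :: "real \<Rightarrow> (real \<Rightarrow> real) \<Rightarrow> real \<Rightarrow> real \<Rightarrow> real" where
  "lambda1 d u0 \<beta> c =
     Inf {set_lebesgue_integral lborel {-d<..<d}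
            (\<lambda>y. \<bar>\<phi>' y\<bar>\<^sup>2 - (\<beta> - D2 d u0 y) / (u0 y - c) * \<bar>\<phi> y\<bar>\<^sup>2)
          | \<phi> \<phi>'. H10 d \<phi> \<phi>' \<and> L2_norm {-d<..<d} \<phi> = 1}"

definition lambda1_inv0 :: "real \<Rightarrow> (real \<Rightarrow> real) \<Rightarrow> real" where
  "lambda1_inv0 d u0 =
     (THE b. (INF y\<in>{-d..d}. D2 d u0 y) \<le> b \<and> lambda1 d u0 b (shear_min d u0) = 0)"

section \<open>The $\beta$-plane equation\<close>

text \<open>
  Functions on \<open>\<T>\<^sub>L \<times> [-d,d]\<close> are functions of \<open>(x, y)\<close> in the strip that are \<open>L\<close>-periodic
  in \<open>x\<close>; time-dependent ones are functions of \<open>(t, x, y)\<close> in the slab. Integrals over the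
  domain are integrals over a period cell.
\<close>

definition strip :: "real \<Rightarrow> (real \<times> real) set" where
  "strip d = UNIV \<times> {-d..d}"

definition slab :: "real \<Rightarrow> (real \<times> real \<times> real) set" where
  "slab d = {0..} \<times> strip d"

definition cell :: "real \<Rightarrow> real \<Rightarrow> (real \<times> real) set" where
  "cell d L = {0..L} \<times> {-d..d}"

definition x_periodic :: "real \<Rightarrow> real \<Rightarrow> (real \<times> real \<times> real \<Rightarrow> real) \<Rightarrow> bool" where
  "x_periodic d L f \<longleftrightarrow> (\<forall>(t, x, y) \<in> slab d. f (t, x + L, y) = f (t, x, y))"

abbreviation Dt :: "real \<Rightarrow> (real \<times> real \<times> real \<Rightarrow> real) \<Rightarrow> real \<times> real \<times> real \<Rightarrow> real" where
  "Dt d \<equiv> partial_within (slab d) (1, 0, 0)"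

abbreviation Dx :: "real \<Rightarrow> (real \<times> real \<times> real \<Rightarrow> real) \<Rightarrow> real \<times> real \<times> real \<Rightarrow> real" where
  "Dx d \<equiv> partial_within (slab d) (0, 1, 0)"

abbreviation Dy :: "real \<Rightarrow> (real \<times> real \<times> real \<Rightarrow> real) \<Rightarrow> real \<times> real \<times> real \<Rightarrow> real" where
  "Dy d \<equiv> partial_within (slab d) (0, 0, 1)"

definition vorticity ::
    "real \<Rightarrow> (real \<times> real \<times> real \<Rightarrow> real) \<Rightarrow> (real \<times> real \<times> real \<Rightarrow> real) \<Rightarrow>
     real \<times> real \<times> real \<Rightarrow> real" where
  "vorticity d u v = (\<lambda>p. Dx d v p - Dy d u p)"

text \<open>
  The pressure is a function on the periodic domain at each time, so it is \<open>L\<close>-periodic too;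
  no regularity in time is imposed on it, whence its gradient is taken at fixed \<open>t\<close>.
\<close>

definition global_solution ::
    "real \<Rightarrow> real \<Rightarrow> real \<Rightarrow>
     (real \<times> real \<times> real \<Rightarrow> real) \<Rightarrow> (real \<times> real \<times> real \<Rightarrow> real) \<Rightarrow> bool" where
  "global_solution d L \<beta> u v \<longleftrightarrow>
     x_periodic d L u \<and> x_periodic d L v \<and>
     Ck_on 1 (slab d) u \<and> Ck_on 1 (slab d) v \<and> Ck_on 1 (slab d) (vorticity d u v) \<and>
     (\<exists>P. x_periodic d L P \<and>
        (\<forall>t\<ge>0. Ck_on 1 (strip d) (\<lambda>q. P (t, q))) \<and>
        (\<forall>(t, x, y) \<in> slab d.
           Dt d u (t, x, y) + u (t, x, y) * Dx d u (t, x, y) + v (t, x, y) * Dy d u (t, x, y)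
             - \<beta> * y * v (t, x, y)
             = - partial_within (strip d) (1, 0) (\<lambda>q. P (t, q)) (x, y) \<and>
           Dt d v (t, x, y) + u (t, x, y) * Dx d v (t, x, y) + v (t, x, y) * Dy d v (t, x, y)
             + \<beta> * y * u (t, x, y)
             = - partial_within (strip d) (0, 1) (\<lambda>q. P (t, q)) (x, y))) \<and>
     (\<forall>p \<in> slab d. Dx d u p + Dy d v p = 0) \<and>
     (\<forall>t\<ge>0. \<forall>x. v (t, x, -d) = 0 \<and> v (t, x, d) = 0)"

definition vorticity_deviation ::
    "real \<Rightarrow> real \<Rightarrow> (real \<Rightarrow> real) \<Rightarrow>
     (real \<times> real \<times> real \<Rightarrow> real) \<Rightarrow> (real \<times> real \<times> real \<Rightarrow> real) \<Rightarrow> real \<Rightarrow> real" where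
  "vorticity_deviation d L u0 u v t =
     L2_norm (cell d L) (\<lambda>(x, y). vorticity d u v (t, x, y) - (- D1 d u0 y))"

definition lyapunov_stable :: "real \<Rightarrow> real \<Rightarrow> real \<Rightarrow> (real \<Rightarrow> real) \<Rightarrow> bool" where
  "lyapunov_stable d L \<beta> u0 \<longleftrightarrow>
     (\<forall>\<epsilon>>0. \<exists>\<delta>>0. \<forall>u v. global_solution d L \<beta> u v \<and> vorticity_deviation d L u0 u v 0 < \<delta> \<longrightarrow>
        (\<forall>t>0. vorticity_deviation d L u0 u v t < \<epsilon>))"

definition converges_to_shear ::
    "real \<Rightarrow> real \<Rightarrow>
     (real \<times> real \<times> real \<Rightarrow> real) \<Rightarrow> (real \<times> real \<times> real \<Rightarrow> real) \<Rightarrow> bool" where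
  "converges_to_shear d L u v \<longleftrightarrow>
     (\<exists>U::real \<Rightarrow> real. in_L2 {-d..d} U \<and>
        ((\<lambda>t. L2_norm (cell d L) (\<lambda>(x, y). (u (t, x, y) - U y, v (t, x, y)))) \<longlongrightarrow> 0) at_top)"

definition inviscid_damping_fails :: "real \<Rightarrow> real \<Rightarrow> real \<Rightarrow> (real \<Rightarrow> real) \<Rightarrow> bool" where
  "inviscid_damping_fails d L \<beta> u0 \<longleftrightarrow>
     (\<forall>\<epsilon>>0. \<exists>u v. global_solution d L \<beta> u v \<and>
        Ck_on 2 (strip d) (\<lambda>q. u (0, q)) \<and> Ck_on 2 (strip d) (\<lambda>q. v (0, q)) \<and>
        Ck_norm 2 (strip d) (\<lambda>(x, y). u (0, x, y) - u0 y) < \<epsilon> \<and>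
        Ck_norm 2 (strip d) (\<lambda>q. v (0, q)) < \<epsilon> \<and>
        \<not> converges_to_shear d L u v)"

end

theory Submission
  imports Defs "HOL-Complex_Analysis.Complex_Analysis"
begin

text \<open>Stability: integrating the momentum equations around rectangles shows that the absolute vorticity
  \<open>\<gamma> + \<beta> y\<close> is transported. Its reference profile \<open>\<beta> y - u0'\<close> is increasing because \<open>\<beta>\<close> exceeds
  \<open>u0''\<close>, so with \<open>\<Phi>'\<close> the inverse of this profile the conserved integral of \<open>\<Phi> (\<gamma> + \<beta> y) - y (\<gamma> + \<beta> y)\<close>
  has a uniformly convex minimum at the shear flow.

  Failure of damping: there are periodic travelling waves near the flow. For a polynomial profile \<open>U\<close> let \<open>E\<close>
  and \<open>G\<close> be primitives of \<open>U - c\<close> and \<open>U'' - \<beta>\<close>. Displacing the level lines by \<open>e\<close> gives a wave of speed \<open>c\<close> as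
  soon as \<open>w = E (y + e) - E y\<close> solves \<open>\<Delta> w = G (y + e) - G y\<close>. The linearization at \<open>e = 0\<close> has the
  solution \<open>\<phi> y cos (k x)\<close> when \<open>\<phi>'' = (k\<^sup>2 - (\<beta> - U'') / (U - c)) \<phi>\<close>, and the nonlinear equation is
  solved by a contraction among functions holomorphic in a strip, where expansion in cosines loses no
  regularity; the vanishing of the first mode at the wall then fixes the correction of \<open>c\<close> by the intermediate
  value theorem. The neutral mode itself comes from \<open>k\<^sup>2 = (2 \<pi> / L)\<^sup>2 \<le> - \<lambda>\<^sub>1\<close>: after subtracting a small
  multiple of the squared distance to the minimum point from the profile, some test function makes the regularized form with \<open>c\<close> slightly below the minimum negative,
  so by Jacobi's inequality the shooting solution has an interior zero there, whereas it is positive for very negative \<open>c\<close>.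
  Hardy's inequality at the simple pole reduces \<open>\<lambda>\<^sub>1\<close> to test functions, and as an infimum of decreasing affine
  functions it is continuous and strictly decreasing in \<open>\<beta>\<close>.\<close>

section \<open>Derivatives on sets with boundary\<close>

text \<open>Velocity and pressure are merely C^1, so the curl of the momentum equations cannot be
  taken pointwise. This is why the vorticity equation is first proved in integrated form. For the
  waves, the function space must be an algebra that the inverse operator maps into itself. In the
  strip |Im z| < 1 the n-th cosine coefficient is O(exp(-n)), cos(n z) grows at most like exp(n),
  and the inverse gains (n+1)^(-2): the product is just summable, so the strip never shrinks. This
  needs entire \<open>E\<close> and \<open>G\<close>, hence a polynomial profile, which C^2
  closeness allows. The linearization is singular in mode 1 by design. The solvability condition is
  one scalar equation and the wave speed is the one free parameter; the crossing is transversal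
  because the integral of q \<phi>^2 / E' is positive, and there \<open>\<beta> > u0''\<close>
  enters a second time, after the monotonicity used for stability. Keeping the speed strictly below
  the range of the profile makes every equation of the construction regular; the simple pole occurs
  only in the analysis of \<lambda>_1. Since L may attain its lower bound, the form at the minimum
  speed has no slack for such a shift, so the slack is created by changing the profile.\<close>

definition thick :: "'a::euclidean_space set => bool" where
 "thick S \<longleftrightarrow> (\<forall>x\<in>S. \<forall>i\<in>Basis. \<forall>e>0. \<exists>r. 0 < \<bar>r\<bar> \<and> \<bar>r\<bar> < e \<and> x + r *\<^sub>R i \<in> S)"

text \<open>\<open>frechet_derivative\<close> is a choice. Approachability along every basis
  direction makes the derivative within \<open>S\<close> unique, boundary points included, so the
  choice agrees with any derivative that is exhibited.\<close>

lemma partial_within_eq: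
 assumes "thick S" "x \<in> S" "(f has_derivative f') (at x within S)"
 shows "partial_within S e f x = f' e"
proof -
 have "(f has_derivative frechet_derivative f (at x within S)) (at x within S)"
  using assms(3) differentiable_def frechet_derivative_works by blast
 then have "frechet_derivative f (at x within S) = f'" by (rule frechet_derivative_unique_within[OF _ assms(3)])
    (use assms(1,2) in \<open>auto simp: thick_def\<close>)
 then show ?thesis by (simp add: partial_within_def)
qed

lemma partial_within_cong:
 assumes "!!x. x \<in> S ==> f x = g x" "x \<in> S"
 shows "partial_within S e f x = partial_within S e g x"
proof -
 have "(f has_derivative h) (at x within S) \<longleftrightarrow> (g has_derivative h) (at x within S)" for h
  using assms by (metis has_derivative_transform)
 then show ?thesis by (simp add: partial_within_def frechet_derivative_def)
qed

lemma Ck_on_cong: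
 "(!!x. x \<in> S ==> f x = g x) ==> Ck_on k S f \<longleftrightarrow> Ck_on k S g"
proof (induction k arbitrary: f g)
 case 0
 then show ?case by (simp cong: continuous_on_cong)
next
 case (Suc k)
 have "f differentiable_on S \<longleftrightarrow> g differentiable_on S" unfolding differentiable_on_def differentiable_def
  using Suc.prems by (metis has_derivative_transform)
 moreover have "Ck_on k S (partial_within S b f) \<longleftrightarrow> Ck_on k S (partial_within S b g)" for b
  by (rule Suc.IH) (use Suc.prems partial_within_cong in blast)
 ultimately show ?case by simp
qed

lemma Ck_on_SucI:
 assumes "thick S" "!!x. x \<in> S ==> (f has_derivative F x) (at x within S)"
  "!!b. b \<in> Basis ==> Ck_on k S (%x. F x b)"
 shows "Ck_on (Suc k) S f" unfolding Ck_on.simps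
proof (intro conjI ballI)
 show "f differentiable_on S" using assms(2) by (auto simp: differentiable_on_def differentiable_def)
 fix b :: 'a assume b: "b \<in> Basis"
 show "Ck_on k S (partial_within S b f)" using Ck_on_cong[of S "partial_within S b f" "%x. F x b" k] assms b
   partial_within_eq[OF assms(1) _ assms(2)] by auto
qed

lemma Ck_on_mono1: "Ck_on (Suc k) S f ==> Ck_on k S f"
proof (induction k arbitrary: f)
 case 0
 then show ?case by (simp add: differentiable_imp_continuous_on)
next
 case (Suc k)
 then show ?case by simp
qed

lemma Ck_on_SucD:
 assumes "thick S" "Ck_on (Suc k) S f" "x \<in> S"
 shows "\<exists>f'. (f has_derivative f') (at x within S) \<and> (\<forall>e. f' e = partial_within S e f x)"
proof -
 have "f differentiable (at x within S)" using assms by (simp add: differentiable_on_def)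
 then obtain f' where f': "(f has_derivative f') (at x within S)" by (auto simp: differentiable_def)
 with partial_within_eq[OF assms(1,3) f'] show ?thesis by auto
qed

lemma has_derivative_along_line:
 assumes "(f has_derivative f') (at p within S)" "g x = p" "x \<in> T"
  "!!s. s \<in> T ==> g s \<in> S" "!!s. g s = p + (s - x) *\<^sub>R e"
 shows "((%s::real. f (g s)) has_real_derivative f' e) (at x within T)"
proof -
 have g: "(g has_derivative (%h. h *\<^sub>R e)) (at x within T)"
  unfolding assms(5)[abs_def] by (auto intro!: derivative_eq_intros)
 have "((%s. f (g s)) has_derivative (%h. f' (h *\<^sub>R e))) (at x within T)"
 proof (rule has_derivative_in_compose[OF g])
  show "(f has_derivative f') (at (g x) within g ` T)"
   by (rule has_derivative_subset[of _ _ _ S]) (use assms in auto)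
 qed
 moreover have "(%h. f' (h *\<^sub>R e)) = (*) (f' e)"
  using linear_scale[OF has_derivative_linear[OF assms(1)]] by (auto simp: mult.commute)
 ultimately show ?thesis by (simp add: has_field_derivative_def)
qed

lemma DERIV_transform_on:
 assumes "(f has_field_derivative D) (at x within S)" "x \<in> S" "!!s. s \<in> S ==> f s = g s"
 shows "(g has_field_derivative D) (at x within S)"
 by (rule has_field_derivative_transform_within[OF assms(1) zero_less_one]) (use assms in auto)

lemma DERIV_unique_thick:
 assumes "thick S" "x \<in> S" "(f has_real_derivative D) (at x within S)" "(f has_real_derivative D') (at x within S)"
 shows "D = D'"
 using partial_within_eq[OF assms(1,2), of f "(*) D" 1] partial_within_eq[OF assms(1,2), of f "(*) D'" 1] assms(3,4)
 by (simp add: has_field_derivative_def)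

lemma thick_Icc: "a < b ==> thick {a..b::real}" unfolding thick_def
proof (intro ballI allI impI)
 fix x i e :: real assume *: "a < b" "x \<in> {a..b}" "i \<in> Basis" "0 < e"
 define r where "r = (if x \<le> (a+b)/2 then min (e/2) ((b-a)/2) else - min (e/2) ((b-a)/2))"
 have "0 < \<bar>r\<bar> \<and> \<bar>r\<bar> < e \<and> x + r *\<^sub>R i \<in> {a..b}" using * by (auto simp: r_def min_def field_simps)
 then show "\<exists>r. 0 < \<bar>r\<bar> \<and> \<bar>r\<bar> < e \<and> x + r *\<^sub>R i \<in> {a..b}" by blast
qed

lemma rect_cbox: "cbox (a::real, b::real) (c, e) = {a..c} \<times> {b..e}" by (simp add: cbox_Pair_eq)

lemma thick_interval: "d > 0 ==> thick {-d..d::real}" by (rule thick_Icc) simp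

lemma thick_half_line: "thick ({0..} :: real set)" unfolding thick_def
proof (intro ballI allI impI)
 fix x i e :: real assume *: "x \<in> {0..}" "i \<in> Basis" "0 < e"
 then show "\<exists>r. 0 < \<bar>r\<bar> \<and> \<bar>r\<bar> < e \<and> x + r *\<^sub>R i \<in> {0..}" by (intro exI[of _ "e/2"]) auto
qed

lemma thick_UNIV: "thick (UNIV :: 'a::euclidean_space set)" unfolding thick_def
proof (intro ballI allI impI)
 fix x i :: 'a and e :: real assume "0 < e"
 then show "\<exists>r. 0 < \<bar>r\<bar> \<and> \<bar>r\<bar> < e \<and> x + r *\<^sub>R i \<in> UNIV" by (intro exI[of _ "e/2"]) auto
qed

lemma thick_Times:
 assumes "thick S" "thick T"
 shows "thick (S \<times> T)" unfolding thick_def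
proof (intro ballI allI impI)
 fix p i :: "'a \<times> 'b" and e :: real assume *: "p \<in> S \<times> T" "i \<in> Basis" "0 < e"
 obtain x y where p: "p = (x, y)" by (cases p)
 from *(2) consider j where "j \<in> Basis" "i = (j, 0)" | j where "j \<in> Basis" "i = (0, j)"
  by (auto simp: Basis_prod_def)
 then show "\<exists>r. 0 < \<bar>r\<bar> \<and> \<bar>r\<bar> < e \<and> p + r *\<^sub>R i \<in> S \<times> T"
 proof cases
  case 1
  with assms(1) * p obtain r where "0 < \<bar>r\<bar> \<and> \<bar>r\<bar> < e \<and> x + r *\<^sub>R j \<in> S"
   unfolding thick_def by (metis mem_Sigma_iff)
  with 1 p * show ?thesis by (intro exI[of _ r]) auto
 next
  case 2
  with assms(2) * p obtain r where "0 < \<bar>r\<bar> \<and> \<bar>r\<bar> < e \<and> y + r *\<^sub>R j \<in> T"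
   unfolding thick_def by (metis mem_Sigma_iff)
  with 2 p * show ?thesis by (intro exI[of _ r]) auto
 qed
qed

lemma thick_strip: "d > 0 ==> thick (strip d)" unfolding strip_def by (intro thick_Times thick_UNIV thick_interval)

lemma thick_slab: "d > 0 ==> thick (slab d)" unfolding slab_def by (intro thick_Times thick_half_line thick_strip)

text \<open>The two partials play different roles: the one in \<open>y\<close> must exist everywhere
  and be continuous, the one in \<open>x\<close> is needed only at the point in question.\<close>

lemma has_derivative_strip:
 fixes f :: "real \<times> real => real"
 assumes d: "d > 0" and p: "(x, y) \<in> strip d"
  and fx: "((%x. f (x, y)) has_real_derivative fx (x, y)) (at x)"
  and fy: "!!x y. y \<in> {-d..d} ==> ((%y. f (x, y)) has_real_derivative fy (x, y)) (at y within {-d..d})"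
  and cy: "continuous_on (strip d) fy"
 shows "(f has_derivative (%(h, k). fx (x, y) * h + fy (x, y) * k)) (at (x, y) within strip d)"
proof -
 have "((%(x, y). f (x, y)) has_derivative
   (%(tx, ty). fx (x, y) * tx + blinfun_apply (blinfun_mult_right (fy (x, y))) ty))
   (at (x, y) within UNIV \<times> {-d..d})"
 proof (rule has_derivative_partialsI)
  show "((%x. f (x, y)) has_derivative (*) (fx (x, y))) (at x within UNIV)"
   using fx by (simp add: has_field_derivative_def)
  show "((%y. f (x, y)) has_derivative blinfun_apply (blinfun_mult_right (fy (x, y)))) (at y within {-d..d})"
   if "y \<in> {-d..d}" for x y using fy[OF that, of x] by (simp add: has_field_derivative_def)
  have "continuous_on (UNIV \<times> {-d..d}) (%p. blinfun_mult_right (fy p))"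
   using cy unfolding strip_def by (intro bounded_linear.continuous_on[OF bounded_linear_blinfun_mult_right])
  then have "continuous (at (x, y) within UNIV \<times> {-d..d}) (%p. blinfun_mult_right (fy p))"
   using p by (auto simp: continuous_on_eq_continuous_within strip_def)
  then show "continuous (at (x, y) within UNIV \<times> {-d..d}) (%(x, y). blinfun_mult_right (fy (x, y)))"
   by (simp add: case_prod_unfold)
  show "y \<in> {-d..d}" using p by (auto simp: strip_def)
 qed auto
 then show ?thesis by (simp add: strip_def split_beta)
qed

lemma partials_of_C1_slab:
 assumes d: "d > 0" and f: "Ck_on (Suc k) (slab d) f" and p: "(t, x, y) \<in> slab d"
 shows "((%s. f (s, x, y)) has_real_derivative Dt d f (t, x, y)) (at t within {0..})"
  and "((%s. f (t, s, y)) has_real_derivative Dx d f (t, x, y)) (at x)"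
  and "((%s. f (t, x, s)) has_real_derivative Dy d f (t, x, y)) (at y within {-d..d})"
proof -
 obtain f' where f': "(f has_derivative f') (at (t, x, y) within slab d)"
  and e: "!!e. f' e = partial_within (slab d) e f (t, x, y)" using Ck_on_SucD[OF thick_slab[OF d] f p] by auto
 show "((%s. f (s, x, y)) has_real_derivative Dt d f (t, x, y)) (at t within {0..})" unfolding e[symmetric]
  by (rule has_derivative_along_line[OF f', where g="%s. (s, x, y)"]) (use p in \<open>auto simp: slab_def strip_def\<close>)
 show "((%s. f (t, s, y)) has_real_derivative Dx d f (t, x, y)) (at x)" unfolding e[symmetric]
  by (rule has_derivative_along_line[OF f', where g="%s. (t, s, y)"]) (use p in \<open>auto simp: slab_def strip_def\<close>)
 show "((%s. f (t, x, s)) has_real_derivative Dy d f (t, x, y)) (at y within {-d..d})" unfolding e[symmetric]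
  by (rule has_derivative_along_line[OF f', where g="%s. (t, x, s)"]) (use p in \<open>auto simp: slab_def strip_def\<close>)
qed

lemma Basis_real2: "(Basis :: (real \<times> real) set) = {(1, 0), (0, 1)}" by (auto simp: Basis_prod_def)

lemma Basis_real3: "(Basis :: (real \<times> real \<times> real) set) = {(1, 0, 0), (0, 1, 0), (0, 0, 1)}"
 by (auto simp: Basis_prod_def zero_prod_def)

lemma C1_slab_continuous:
 assumes f: "Ck_on 1 (slab d) f"
 shows "continuous_on (slab d) f" "continuous_on (slab d) (Dt d f)"
  "continuous_on (slab d) (Dx d f)" "continuous_on (slab d) (Dy d f)"
 using assms Ck_on_mono1[of 0 "slab d" f] unfolding One_nat_def Ck_on.simps by (auto simp: Basis_real3)

lemma partials_of_C1_strip: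
 assumes d: "d > 0" and f: "Ck_on (Suc k) (strip d) f" and p: "(x, y) \<in> strip d"
 shows "((%s. f (s, y)) has_real_derivative partial_within (strip d) (1, 0) f (x, y)) (at x)"
  and "((%s. f (x, s)) has_real_derivative partial_within (strip d) (0, 1) f (x, y)) (at y within {-d..d})"
proof -
 obtain f' where f': "(f has_derivative f') (at (x, y) within strip d)"
  and e: "!!e. f' e = partial_within (strip d) e f (x, y)" using Ck_on_SucD[OF thick_strip[OF d] f p] by auto
 show "((%s. f (s, y)) has_real_derivative partial_within (strip d) (1, 0) f (x, y)) (at x)" unfolding e[symmetric]
  by (rule has_derivative_along_line[OF f', where g="%s. (s, y)"]) (use p in \<open>auto simp: strip_def\<close>)
 show "((%s. f (x, s)) has_real_derivative partial_within (strip d) (0, 1) f (x, y)) (at y within {-d..d})"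
  unfolding e[symmetric]
  by (rule has_derivative_along_line[OF f', where g="%s. (x, s)"]) (use p in \<open>auto simp: strip_def\<close>)
qed

lemma partials_of_C1_interval:
 assumes d: "d > 0" and f: "Ck_on (Suc k) {-d..d} f" and p: "y \<in> {-d..d}"
 shows "(f has_real_derivative D1 d f y) (at y within {-d..d})"
proof -
 obtain f' where f': "(f has_derivative f') (at y within {-d..d})"
  and e: "!!e. f' e = partial_within {-d..d} e f y" using Ck_on_SucD[OF thick_interval[OF d] f p] by auto
 show ?thesis unfolding e[symmetric] by (rule has_derivative_along_line[OF f', where g="%s. s"]) (use p in auto)
qed

section \<open>Conservation laws of classical solutions\<close>

lemma continuous_on_slice:
 assumes "continuous_on C F" "continuous_on A g" "\<forall>x\<in>A. g x \<in> C"
 shows "continuous_on A (%x. F (g x))" by (rule continuous_on_compose2[OF assms(1,2)]) (use assms(3) in blast)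

text \<open>The indefinite integral is constant, and its derivative is \<open>g\<close>; at the
  endpoints the one-sided derivative is still unique.\<close>

lemma continuous_integral_zero:
 fixes g :: "real => real"
 assumes "a < b" "continuous_on {a..b} g" "!!s. s \<in> {a..b} ==> integral {a..s} g = 0" "x \<in> {a..b}"
 shows "g x = 0"
proof -
 have "((%s. integral {a..s} g) has_real_derivative g x) (at x within {a..b})"
  by (rule integral_has_real_derivative) (use assms in auto)
 then have "((%s. 0) has_real_derivative g x) (at x within {a..b})" by (rule DERIV_transform_on) (use assms in auto)
 moreover have "((%s. 0) has_real_derivative 0) (at x within {a..b})" by simp
 ultimately show ?thesis using DERIV_unique_thick thick_Icc assms by blast
qed

section \<open>Iterated integrals over rectangles\<close>

definition rect_int :: "real => real => real => real => (real => real => real) => real" where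
 "rect_int x1 x2 y1 y2 f = integral {x1..x2} (%x. integral {y1..y2} (f x))"

lemma continuous_on_inner_integral:
 fixes f :: "real => real => real"
 assumes "continuous_on ({x1..x2} \<times> {y1..y2}) (%(x, y). f x y)"
 shows "continuous_on {x1..x2} (%x. integral {y1..y2} (f x))"
 using integral_continuous_on_param[of "{x1..x2}" y1 y2 f] assms by simp

lemma rect_int_add:
 fixes f g :: "real => real => real"
 assumes "continuous_on ({x1..x2} \<times> {y1..y2}) (%(x, y). f x y)"
  "continuous_on ({x1..x2} \<times> {y1..y2}) (%(x, y). g x y)"
 shows "rect_int x1 x2 y1 y2 (%x y. f x y + g x y) = rect_int x1 x2 y1 y2 f + rect_int x1 x2 y1 y2 g"
proof -
 have c: "h x integrable_on {y1..y2}"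
  if "continuous_on ({x1..x2} \<times> {y1..y2}) (%(x, y). h x y)" "x \<in> {x1..x2}" for h :: "real => real => real" and x
  by (rule integrable_continuous_interval)
    (use continuous_on_slice[OF that(1), where g="Pair x" and A="{y1..y2}"] that(2) in \<open>simp add: continuous_on_Pair\<close>)
 have "rect_int x1 x2 y1 y2 (%x y. f x y + g x y) =
   integral {x1..x2} (%x. integral {y1..y2} (f x) + integral {y1..y2} (g x))"
  unfolding rect_int_def by (rule integral_cong) (rule integral_add; use assms c in blast)
 also have "... = rect_int x1 x2 y1 y2 f + rect_int x1 x2 y1 y2 g" unfolding rect_int_def
  by (rule integral_add; rule integrable_continuous_interval, rule continuous_on_inner_integral)
    (use assms in auto)
 finally show ?thesis .
qed

lemma rect_int_mult: "rect_int x1 x2 y1 y2 (%x y. c * f x y) = c * rect_int x1 x2 y1 y2 f" by (simp add: rect_int_def)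

lemma rect_int_cong:
 assumes "!!x y. x \<in> {x1..x2} ==> y \<in> {y1..y2} ==> f x y = g x y"
 shows "rect_int x1 x2 y1 y2 f = rect_int x1 x2 y1 y2 g"
 unfolding rect_int_def by (intro integral_cong) (use assms in auto)

lemma rect_int_prod:
 fixes f :: "real \<times> real => real"
 assumes "continuous_on ({x1..x2} \<times> {y1..y2}) f"
 shows "integral ({x1..x2} \<times> {y1..y2}) f = rect_int x1 x2 y1 y2 (%x y. f (x, y))"
 using integral_prod_continuous[of x1 y1 x2 y2 f] assms by (simp add: rect_int_def rect_cbox)

lemma rect_int_mono:
 assumes "continuous_on ({x1..x2} \<times> {y1..y2}) (%(x, y). f x y)"
  "continuous_on ({x1..x2} \<times> {y1..y2}) (%(x, y). g x y)"
  "!!x y. x \<in> {x1..x2} ==> y \<in> {y1..y2} ==> f x y \<le> g x y"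
 shows "rect_int x1 x2 y1 y2 f \<le> rect_int x1 x2 y1 y2 g"
proof -
 have "integral ({x1..x2} \<times> {y1..y2}) (%(x, y). f x y) \<le> integral ({x1..x2} \<times> {y1..y2}) (%(x, y). g x y)"
  by (rule integral_le) (use assms integrable_continuous[of "(x1, y1)" "(x2, y2)"] in \<open>auto simp: rect_cbox\<close>)
 then show ?thesis using assms by (simp add: rect_int_prod)
qed

lemma rect_int_deriv_y:
 fixes f :: "real => real => real"
 assumes "y1 \<le> y2"
  and "!!x y. x \<in> {x1..x2} ==> y \<in> {y1..y2} ==> ((%y. f x y) has_real_derivative fy x y) (at y within {y1..y2})"
 shows "rect_int x1 x2 y1 y2 fy = integral {x1..x2} (%x. f x y2 - f x y1)" unfolding rect_int_def
proof (rule integral_cong)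
 fix x assume "x \<in> {x1..x2}"
 then have "(fy x has_integral (f x y2 - f x y1)) {y1..y2}" using assms by (intro fundamental_theorem_of_calculus)
   (auto simp flip: has_real_derivative_iff_has_vector_derivative)
 then show "integral {y1..y2} (fy x) = f x y2 - f x y1" by (rule integral_unique)
qed

text \<open>Continuity of the derivative enters here, unlike in \<open>rect_int_deriv_y\<close>,
  because the order of integration has to be exchanged before the fundamental theorem
  applies.\<close>

lemma rect_int_deriv_x:
 fixes f :: "real => real => real"
 assumes "x1 \<le> x2"
  and "!!x y. x \<in> {x1..x2} ==> y \<in> {y1..y2} ==> ((%x. f x y) has_real_derivative fx x y) (at x within {x1..x2})"
  and "continuous_on ({x1..x2} \<times> {y1..y2}) (%(x, y). fx x y)"
 shows "rect_int x1 x2 y1 y2 fx = integral {y1..y2} (%y. f x2 y - f x1 y)"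
proof -
 have "rect_int x1 x2 y1 y2 fx = rect_int y1 y2 x1 x2 (%y x. fx x y)"
  using integral_swap_continuous[of x1 y1 x2 y2 fx] assms(3) by (simp add: rect_int_def rect_cbox)
 also have "... = integral {y1..y2} (%y. f x2 y - f x1 y)"
  by (rule rect_int_deriv_y[where f="%y x. f x y"]) (use assms in auto)
 finally show ?thesis .
qed

lemma rect_int_deriv_t:
 fixes f :: "real => real => real => real"
 assumes "!!t x y. t \<in> T ==> x \<in> {x1..x2} ==> y \<in> {y1..y2} ==>
   ((%t. f t x y) has_real_derivative ft t x y) (at t within T)"
  and ct: "continuous_on (T \<times> {x1..x2} \<times> {y1..y2}) (%(t, x, y). ft t x y)"
  and cf: "continuous_on (T \<times> {x1..x2} \<times> {y1..y2}) (%(t, x, y). f t x y)"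
  and t: "t \<in> T" "convex T"
 shows "((%t. rect_int x1 x2 y1 y2 (f t)) has_real_derivative rect_int x1 x2 y1 y2 (ft t)) (at t within T)"
proof -
 have *: "continuous_on ({x1..x2} \<times> {y1..y2}) (%(x, y). g t x y)"
  if "continuous_on (T \<times> {x1..x2} \<times> {y1..y2}) (%(t, x, y). g t x y)" "t \<in> T"
  for g :: "real => real => real => real" and t
  using continuous_on_slice[OF that(1), where g="Pair t" and A="{x1..x2} \<times> {y1..y2}"] that(2)
  by (simp add: continuous_on_Pair split_beta mem_Times_iff)
 have "((%t. integral (cbox (x1, y1) (x2, y2)) (%p. f t (fst p) (snd p))) has_field_derivative
   integral (cbox (x1, y1) (x2, y2)) (%p. ft t (fst p) (snd p))) (at t within T)"
 proof (rule leibniz_rule_field_derivative)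
  show "((%t. f t (fst p) (snd p)) has_field_derivative ft t (fst p) (snd p)) (at t within T)"
   if "t \<in> T" "p \<in> cbox (x1, y1) (x2, y2)" for t p using assms(1) that by (auto simp: rect_cbox)
  show "(%p. f t (fst p) (snd p)) integrable_on cbox (x1, y1) (x2, y2)" if "t \<in> T" for t
   by (rule integrable_continuous) (use *[OF cf that] in \<open>simp add: rect_cbox split_beta\<close>)
  show "continuous_on (T \<times> cbox (x1, y1) (x2, y2)) (%(t, p). ft t (fst p) (snd p))"
   using ct by (simp add: rect_cbox split_beta)
 qed (use t in auto)
 moreover have "integral (cbox (x1, y1) (x2, y2)) (%p. g t (fst p) (snd p)) = rect_int x1 x2 y1 y2 (g t)"
  if "continuous_on (T \<times> {x1..x2} \<times> {y1..y2}) (%(t, x, y). g t x y)" "t \<in> T"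
  for g :: "real => real => real => real" and t
  using rect_int_prod[of x1 x2 y1 y2 "%p. g t (fst p) (snd p)"] *[OF that] by (simp add: rect_cbox split_beta)
 ultimately show ?thesis using cf ct t(1) by (auto intro: DERIV_transform_on)
qed

text \<open>Localization: an identity between integrals over all rectangles becomes a pointwise
  equation up to the walls. The one-dimensional lemma is used once in each variable, first with the
  upper end of the \<open>y\<close>-range held fixed.\<close>

lemma continuous_rect_int_zero:
 assumes d: "d > 0" and c: "continuous_on (strip d) h"
  and z: "!!x1 x2 y1 y2. x1 \<le> x2 ==> -d \<le> y1 ==> y1 \<le> y2 ==> y2 \<le> d ==>
   rect_int x1 x2 y1 y2 (%x y. h (x, y)) = 0"
  and p: "(x, y) \<in> strip d"
 shows "h (x, y) = 0"
proof -
 have c': "continuous_on ({x1..x2} \<times> {y1..y2}) (%(x, y). h (x, y))" if "-d \<le> y1" "y2 \<le> d" for x1 x2 y1 y2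
  by (rule continuous_on_subset[of "strip d"]) (use c that in \<open>auto simp: strip_def\<close>)
 have g0: "integral {-d..s} (%y. h (x, y)) = 0" if "s \<in> {-d..d}" for s
  by (rule continuous_integral_zero[of x "x+1" "%x. integral {-d..s} (%y. h (x, y))"])
    (use z[of x _ "-d" s] that c'[of "-d" s x "x+1"] in \<open>auto simp: rect_int_def intro!: continuous_on_inner_integral\<close>)
 show ?thesis
 proof (rule continuous_integral_zero[of "-d" d "%y. h (x, y)"])
  show "continuous_on {-d..d} (%y. h (x, y))"
   using continuous_on_slice[OF c, where g="Pair x" and A="{-d..d}"] by (simp add: continuous_on_Pair strip_def)
 qed (use d g0 p in \<open>auto simp: strip_def\<close>)
qed

lemma bernoulli_derivative:
 assumes "(P has_real_derivative P') (at x within S)"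
  "(u has_real_derivative u') (at x within S)" "(v has_real_derivative v') (at x within S)"
 shows "((%s. P s + ((u s)\<^sup>2 + (v s)\<^sup>2) / 2) has_real_derivative P' + (u x * u' + v x * v')) (at x within S)"
 by (rule DERIV_cong, (rule assms DERIV_add DERIV_cdivide DERIV_power)+) (simp add: algebra_simps)

lemma flux_derivative_x:
 assumes "(u has_real_derivative u') (at x within S)" "(v has_real_derivative v') (at x within S)"
  "(z has_real_derivative z') (at x within S)" "(f has_real_derivative f') (at x within S)"
 shows "((%s. - u s * f s + y * u s * z s - (v s)\<^sup>2 / 2 + (u s)\<^sup>2 / 2 - \<beta> * y\<^sup>2 * u s / 2)
  has_real_derivative - (u' * f x + u x * f') + y * (u' * z x + u x * z') - v x * v' + u x * u' - \<beta> * y\<^sup>2 * u' / 2)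
  (at x within S)"
 by (rule DERIV_cong, (rule assms DERIV_const DERIV_ident DERIV_add DERIV_diff DERIV_mult DERIV_minus
   DERIV_cdivide DERIV_power)+) (simp add: algebra_simps power2_eq_square)

lemma flux_derivative_y:
 assumes "(u has_real_derivative u') (at y within S)" "(v has_real_derivative v') (at y within S)"
  "(z has_real_derivative z') (at y within S)" "(f has_real_derivative f') (at y within S)"
 shows "((%s. - v s * f s + s * v s * z s + u s * v s - \<beta> * s\<^sup>2 * v s / 2)
  has_real_derivative - (v' * f y + v y * f') + (v y * z y + y * (v' * z y + v y * z')) + u' * v y + u y * v'
   - \<beta> * (2 * y * v y + y\<^sup>2 * v') / 2)
  (at y within S)"
 by (rule DERIV_cong, (rule assms DERIV_const DERIV_ident DERIV_add DERIV_diff DERIV_mult DERIV_minus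
   DERIV_cdivide DERIV_power)+) (simp add: algebra_simps power2_eq_square)

section \<open>Classical solutions and their vorticity\<close>

locale flow =
 fixes d L \<beta> :: real and u v :: "real \<times> real \<times> real => real"
 assumes d: "d > 0" and L: "L > 0" and sol: "global_solution d L \<beta> u v"
begin

text \<open>The absolute vorticity. Adding \<beta> y absorbs the Coriolis terms of both momentum
  equations.\<close>

definition ze :: "real \<times> real \<times> real => real" where
 "ze p = vorticity d u v p + \<beta> * snd (snd p)"

lemma C1: "Ck_on 1 (slab d) u" "Ck_on 1 (slab d) v" "Ck_on 1 (slab d) (vorticity d u v)"
 using sol by (auto simp: global_solution_def)

lemmas cont = C1_slab_continuous[OF C1(1)] C1_slab_continuous[OF C1(2)] C1_slab_continuous[OF C1(3)]

lemmas der = partials_of_C1_slab[OF d C1(1)[unfolded One_nat_def]]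
 partials_of_C1_slab[OF d C1(2)[unfolded One_nat_def]]
 partials_of_C1_slab[OF d C1(3)[unfolded One_nat_def]]

lemma cont_ze: "continuous_on (slab d) ze" unfolding ze_def by (intro continuous_intros cont)

lemma der_ze:
 assumes "(t, x, y) \<in> slab d"
 shows "((%s. ze (s, x, y)) has_real_derivative Dt d (vorticity d u v) (t, x, y)) (at t within {0..})"
  and "((%s. ze (t, s, y)) has_real_derivative Dx d (vorticity d u v) (t, x, y)) (at x)"
  and "((%s. ze (t, x, s)) has_real_derivative Dy d (vorticity d u v) (t, x, y) + \<beta>) (at y within {-d..d})"
 unfolding ze_def by (auto intro!: derivative_eq_intros der assms)

lemma cont_t: "continuous_on (strip d) (%q. f (t, q))" if "continuous_on (slab d) f" "t \<ge> 0" for f :: "_ => real" and t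
 using continuous_on_slice[OF that(1), where g="Pair t" and A="strip d"] that(2)
 by (simp add: slab_def continuous_on_Pair)

lemma cont_rect: "continuous_on ({x1..x2} \<times> {y1..y2}) (%(x, y). f (t, x, y))"
 if "continuous_on (slab d) f" "t \<ge> 0" "-d \<le> y1" "y2 \<le> d" for f :: "_ => real" and t x1 x2 y1 y2
 by (rule continuous_on_subset[of "strip d"])
   (use cont_t[of f t] that in \<open>auto simp: split_beta strip_def\<close>)

lemma cont_box: "continuous_on ({0..} \<times> {x1..x2} \<times> {y1..y2}) (%(t, x, y). f (t, x, y))"
 if "continuous_on (slab d) f" "-d \<le> y1" "y2 \<le> d" for f :: "_ => real" and x1 x2 y1 y2
 by (rule continuous_on_subset[of "slab d"])
   (use that in \<open>auto simp: split_beta slab_def strip_def\<close>)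

lemma divergence_free: "p \<in> slab d ==> Dx d u p + Dy d v p = 0" using sol by (auto simp: global_solution_def)

text \<open>Lamb's form of the momentum equations: with the Bernoulli function B = P + (u^2 + v^2) /
  2, the field (u_t - v \<open>ze\<close>, v_t + u \<open>ze\<close>) is minus the gradient of B, so
  its circulation around a rectangle vanishes. Only first derivatives of P occur.\<close>

lemma circulation:
 assumes t: "t \<ge> 0" and x: "x1 \<le> x2" and y: "-d \<le> y1" "y1 \<le> y2" "y2 \<le> d"
 shows "integral {y1..y2} (%y. (Dt d v (t, x2, y) + u (t, x2, y) * ze (t, x2, y))
      - (Dt d v (t, x1, y) + u (t, x1, y) * ze (t, x1, y)))
    = integral {x1..x2} (%x. (Dt d u (t, x, y2) - v (t, x, y2) * ze (t, x, y2))
      - (Dt d u (t, x, y1) - v (t, x, y1) * ze (t, x, y1)))"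
proof -
 obtain P where P: "\<forall>t\<ge>0. Ck_on 1 (strip d) (%q. P (t, q))"
  and mom': "\<forall>(t, x, y) \<in> slab d.
      Dt d u (t, x, y) + u (t, x, y) * Dx d u (t, x, y) + v (t, x, y) * Dy d u (t, x, y)
       - \<beta> * y * v (t, x, y)
       = - partial_within (strip d) (1, 0) (%q. P (t, q)) (x, y) \<and>
      Dt d v (t, x, y) + u (t, x, y) * Dx d v (t, x, y) + v (t, x, y) * Dy d v (t, x, y)
       + \<beta> * y * u (t, x, y)
       = - partial_within (strip d) (0, 1) (%q. P (t, q)) (x, y)"
  using sol unfolding global_solution_def by blast
 note mom = bspec[OF mom', of "(_, _, _)", simplified prod.case]
 note dP = partials_of_C1_strip[OF d P[rule_format, OF t, unfolded One_nat_def]]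
 define B where "B x y = P (t, x, y) + ((u (t, x, y))\<^sup>2 + (v (t, x, y))\<^sup>2) / 2" for x y
 define F where "F x y = Dt d v (t, x, y) + u (t, x, y) * ze (t, x, y)" for x y
 define H where "H x y = Dt d u (t, x, y) - v (t, x, y) * ze (t, x, y)" for x y
 have Bx: "((%x. B x y) has_real_derivative - H x y) (at x)" if "y \<in> {-d..d}" for x y
 proof -
  have p: "(t, x, y) \<in> slab d" "(x, y) \<in> strip d" using that t by (auto simp: slab_def strip_def)
  have eq: "partial_within (strip d) (1, 0) (%q. P (t, q)) (x, y) + (u (t, x, y) * Dx d u (t, x, y) + v (t, x, y) * Dx d v (t, x, y)) = - H x y"
   using conjunct1[OF mom[OF p(1)]] unfolding H_def ze_def vorticity_def snd_conv by algebra
  have "((%x. B x y) has_real_derivative partial_within (strip d) (1, 0) (%q. P (t, q)) (x, y)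
    + (u (t, x, y) * Dx d u (t, x, y) + v (t, x, y) * Dx d v (t, x, y))) (at x)"
   unfolding B_def by (rule bernoulli_derivative[OF dP(1)[OF p(2)] der(2)[OF p(1)] der(5)[OF p(1)]])
  then show ?thesis by (rule DERIV_cong[OF _ eq])
 qed
 have By: "((%y. B x y) has_real_derivative - F x y) (at y within {-d..d})" if "y \<in> {-d..d}" for x y
 proof -
  have p: "(t, x, y) \<in> slab d" "(x, y) \<in> strip d" using that t by (auto simp: slab_def strip_def)
  have eq: "partial_within (strip d) (0, 1) (%q. P (t, q)) (x, y) + (u (t, x, y) * Dy d u (t, x, y) + v (t, x, y) * Dy d v (t, x, y)) = - F x y"
   using conjunct2[OF mom[OF p(1)]] unfolding F_def ze_def vorticity_def snd_conv by algebra
  have "((%y. B x y) has_real_derivative partial_within (strip d) (0, 1) (%q. P (t, q)) (x, y)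
    + (u (t, x, y) * Dy d u (t, x, y) + v (t, x, y) * Dy d v (t, x, y))) (at y within {-d..d})"
   unfolding B_def by (rule bernoulli_derivative[OF dP(2)[OF p(2)] der(3)[OF p(1)] der(6)[OF p(1)]])
  then show ?thesis by (rule DERIV_cong[OF _ eq])
 qed
 have F: "(F x has_integral (B x y1 - B x y2)) {y1..y2}" for x
 proof -
  have "((%y. - F x y) has_integral (B x y2 - B x y1)) {y1..y2}"
  proof (rule fundamental_theorem_of_calculus[OF y(2)])
   show "((%y. B x y) has_vector_derivative - F x y) (at y within {y1..y2})" if "y \<in> {y1..y2}" for y
    unfolding has_real_derivative_iff_has_vector_derivative[symmetric]
    by (rule DERIV_subset[OF By]) (use that y in auto)
  qed
  from has_integral_neg[OF this] show ?thesis by simp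
 qed
 have H: "((%x. H x y) has_integral (B x1 y - B x2 y)) {x1..x2}" if "y \<in> {-d..d}" for y
 proof -
  have "((%x. - H x y) has_integral (B x2 y - B x1 y)) {x1..x2}"
  proof (rule fundamental_theorem_of_calculus[OF x])
   show "((%x. B x y) has_vector_derivative - H x y) (at x within {x1..x2})" for x
    unfolding has_real_derivative_iff_has_vector_derivative[symmetric]
    by (rule has_field_derivative_at_within[OF Bx[OF that]])
  qed
  from has_integral_neg[OF this] show ?thesis by simp
 qed
 have "integral {y1..y2} (%y. F x2 y - F x1 y) = (B x2 y1 - B x2 y2) - (B x1 y1 - B x1 y2)"
  by (intro integral_unique has_integral_diff F)
 moreover have "integral {x1..x2} (%x. H x y2 - H x y1) = (B x1 y2 - B x2 y2) - (B x1 y1 - B x2 y1)"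
  by (intro integral_unique has_integral_diff H) (use y in auto)
 ultimately show ?thesis by (simp add: F_def H_def)
qed

text \<open>Green's formula for the vorticity holds at each time, and both sides are differentiated
  in time. The mixed derivatives v_xt and u_yt, which need not exist, never appear.\<close>

lemma circulation_rate:
 assumes t: "t \<ge> 0" and x: "x1 \<le> x2" and y: "-d \<le> y1" "y1 \<le> y2" "y2 \<le> d"
 shows "rect_int x1 x2 y1 y2 (%x y. Dt d (vorticity d u v) (t, x, y)) =
   integral {y1..y2} (%y. Dt d v (t, x2, y) - Dt d v (t, x1, y))
   - integral {x1..x2} (%x. Dt d u (t, x, y2) - Dt d u (t, x, y1))"
proof -
 have in_slab: "(t, x, y) \<in> slab d" if "t \<ge> 0" "y \<in> {y1..y2}" for t x y
  using that y by (auto simp: slab_def strip_def)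
 have cy: "continuous_on ({0..} \<times> {y1..y2}) (%(t, y). f (t, x, y))" if "continuous_on (slab d) f" for f :: "_ => real" and x
  using continuous_on_slice[OF that, where g="%q. (fst q, x, snd q)" and A="{0..} \<times> {y1..y2}"] in_slab
  by (simp add: split_beta mem_Times_iff continuous_on_Pair continuous_on_fst continuous_on_snd)
 have cx: "continuous_on ({0..} \<times> {x1..x2}) (%(t, x). f (t, x, y))" if "continuous_on (slab d) f" "y \<in> {y1..y2}" for f :: "_ => real" and y
  using continuous_on_slice[OF that(1), where g="%q. (fst q, snd q, y)" and A="{0..} \<times> {x1..x2}"] in_slab that(2)
  by (simp add: split_beta mem_Times_iff continuous_on_Pair continuous_on_fst continuous_on_snd)
 have iy: "(%y. f (t, x, y)) integrable_on {y1..y2}" if "continuous_on (slab d) f" "t \<ge> 0" for f :: "_ => real" and x t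
  by (rule integrable_continuous_interval)
    (use continuous_on_slice[OF cy[OF that(1), of x], where g="Pair t" and A="{y1..y2}"] that(2) in \<open>simp add: continuous_on_Pair\<close>)
 have ix: "(%x. f (t, x, y)) integrable_on {x1..x2}" if "continuous_on (slab d) f" "t \<ge> 0" "y \<in> {y1..y2}" for f :: "_ => real" and y t
  by (rule integrable_continuous_interval)
    (use continuous_on_slice[OF cx[OF that(1,3)], where g="Pair t" and A="{x1..x2}"] that(2) in \<open>simp add: continuous_on_Pair\<close>)
 have dy: "((%t. integral {y1..y2} (%y. v (t, x, y))) has_real_derivative
   integral {y1..y2} (%y. Dt d v (t, x, y))) (at t within {0..})" for x
  using leibniz_rule_field_derivative[of "{0..}" y1 y2 "%t y. v (t, x, y)" "%t y. Dt d v (t, x, y)" t]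
   der(4) in_slab iy cont cy t by simp
 have dx: "((%t. integral {x1..x2} (%x. u (t, x, y))) has_real_derivative
   integral {x1..x2} (%x. Dt d u (t, x, y))) (at t within {0..})" if "y \<in> {y1..y2}" for y
  using leibniz_rule_field_derivative[of "{0..}" x1 x2 "%t x. u (t, x, y)" "%t x. Dt d u (t, x, y)" t]
   der(1) in_slab ix cont cx t that by simp
 have E: "rect_int x1 x2 y1 y2 (%x y. vorticity d u v (t, x, y)) =
   integral {y1..y2} (%y. v (t, x2, y)) - integral {y1..y2} (%y. v (t, x1, y))
   - (integral {x1..x2} (%x. u (t, x, y2)) - integral {x1..x2} (%x. u (t, x, y1)))" if t: "t \<in> {0..}" for t
 proof -
  have cr: "continuous_on ({x1..x2} \<times> {y1..y2}) (%(x, y). f (t, x, y))" if "continuous_on (slab d) f" for f :: "_ => real"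
   using cont_rect that t y by simp
  have "rect_int x1 x2 y1 y2 (%x y. vorticity d u v (t, x, y)) =
    rect_int x1 x2 y1 y2 (%x y. Dx d v (t, x, y)) + rect_int x1 x2 y1 y2 (%x y. (-1) * Dy d u (t, x, y))"
   unfolding vorticity_def
   by (subst rect_int_add[symmetric]) (use cr[OF cont(7)] cr[OF cont(4)] in \<open>auto simp: split_beta intro!: continuous_intros\<close>)
  also have "rect_int x1 x2 y1 y2 (%x y. Dx d v (t, x, y)) = integral {y1..y2} (%y. v (t, x2, y) - v (t, x1, y))"
  proof (rule rect_int_deriv_x[OF x])
   show "((%x. v (t, x, y)) has_real_derivative Dx d v (t, x, y)) (at x within {x1..x2})" if "y \<in> {y1..y2}" for x y
    by (rule has_field_derivative_at_within) (use der(5) in_slab t that in auto)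
  qed (use cr cont in auto)
  also have "rect_int x1 x2 y1 y2 (%x y. (-1) * Dy d u (t, x, y)) = - integral {x1..x2} (%x. u (t, x, y2) - u (t, x, y1))"
  proof -
   have "((%y. u (t, x, y)) has_real_derivative Dy d u (t, x, y)) (at y within {y1..y2})" if "y \<in> {y1..y2}" for x y
    by (rule DERIV_subset[OF der(3)]) (use in_slab t that y in auto)
   then show ?thesis unfolding rect_int_mult by (subst rect_int_deriv_y[OF y(2), where f="%x y. u (t, x, y)"]) auto
  qed
  also have "integral {y1..y2} (%y. v (t, x2, y) - v (t, x1, y)) =
    integral {y1..y2} (%y. v (t, x2, y)) - integral {y1..y2} (%y. v (t, x1, y))"
   by (rule integral_diff) (use iy cont t in auto)
  also have "integral {x1..x2} (%x. u (t, x, y2) - u (t, x, y1)) =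
    integral {x1..x2} (%x. u (t, x, y2)) - integral {x1..x2} (%x. u (t, x, y1))"
   by (rule integral_diff) (use ix cont t y in auto)
  finally show ?thesis by simp
 qed
 have "((%t. rect_int x1 x2 y1 y2 (%x y. vorticity d u v (t, x, y))) has_real_derivative
   integral {y1..y2} (%y. Dt d v (t, x2, y)) - integral {y1..y2} (%y. Dt d v (t, x1, y))
   - (integral {x1..x2} (%x. Dt d u (t, x, y2)) - integral {x1..x2} (%x. Dt d u (t, x, y1)))) (at t within {0..})"
  by (rule DERIV_transform_on[OF _ _ E[symmetric]])
    (use t y in \<open>auto intro!: derivative_eq_intros dx dy\<close>)
 moreover have "((%t. rect_int x1 x2 y1 y2 (%x y. vorticity d u v (t, x, y))) has_real_derivative
   rect_int x1 x2 y1 y2 (%x y. Dt d (vorticity d u v) (t, x, y))) (at t within {0..})"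
  by (rule rect_int_deriv_t) (use der(7) in_slab cont_box[OF cont(9)] cont_box[OF cont(10)] y t in auto)
 ultimately have "rect_int x1 x2 y1 y2 (%x y. Dt d (vorticity d u v) (t, x, y)) =
   integral {y1..y2} (%y. Dt d v (t, x2, y)) - integral {y1..y2} (%y. Dt d v (t, x1, y))
   - (integral {x1..x2} (%x. Dt d u (t, x, y2)) - integral {x1..x2} (%x. Dt d u (t, x, y1)))"
  \<comment> \<open>Two derivatives of one function of time are compared; at time 0 both are
    one-sided.\<close>
  using DERIV_unique_thick[OF thick_half_line] t by (meson atLeast_iff)
 also have "integral {y1..y2} (%y. Dt d v (t, x2, y)) - integral {y1..y2} (%y. Dt d v (t, x1, y)) =
   integral {y1..y2} (%y. Dt d v (t, x2, y) - Dt d v (t, x1, y))"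
  by (rule integral_diff[symmetric]) (use iy cont t in auto)
 also have "integral {x1..x2} (%x. Dt d u (t, x, y2)) - integral {x1..x2} (%x. Dt d u (t, x, y1)) =
   integral {x1..x2} (%x. Dt d u (t, x, y2) - Dt d u (t, x, y1))"
  by (rule integral_diff[symmetric]) (use ix cont t y in auto)
 finally show ?thesis .
qed

end

section \<open>Linear equations depending on a parameter\<close>

lemma geometric_uniform_limit:
 fixes f :: "nat => 'a => 'b::banach"
 assumes "!!m x. x \<in> S ==> norm (f (Suc m) x - f m x) \<le> K * (1/2)^m"
 obtains g where "uniform_limit S f g sequentially"
proof -
 have "summable (%m. K * (1/2::real)^m)" by (intro summable_mult summable_geometric) simp
 then have "uniform_limit S (%n x. \<Sum>i<n. f (Suc i) x - f i x) (%x. suminf (%i. f (Suc i) x - f i x)) sequentially"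
  by (rule Weierstrass_m_test[rotated]) (use assms in auto)
 moreover have "(%n x. \<Sum>i<n. f (Suc i) x - f i x) = (%n x. f n x - f 0 x)" by (intro ext sum_lessThan_telescope)
 ultimately have "uniform_limit S (%n x. f n x - f 0 x) (%x. suminf (%i. f (Suc i) x - f i x)) sequentially" by simp
 then have "uniform_limit S (%n x. (f n x - f 0 x) + f 0 x) (%x. suminf (%i. f (Suc i) x - f i x) + f 0 x) sequentially"
  by (intro uniform_limit_add uniform_limit_const)
 with that show thesis by simp
qed

text \<open>The substitution s = a + \<tau> (y - a) moves the variable endpoint into the integrand,
  after which the theorem on parameter integrals over a fixed interval applies.\<close>

lemma continuous_on_indefinite_integral_param:
 fixes g :: "'a::topological_space \<times> real => real"
 assumes g: "continuous_on (C \<times> {a..b}) g"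
 shows "continuous_on (C \<times> {a..b}) (%(c, y). integral {a..y} (%s. g (c, s)))"
proof -
 have eq: "integral {a..y} (%s. g (c, s)) = integral {0..1} (%ta. (y - a) * g (c, a + ta * (y - a)))"
  if cy: "c \<in> C" "y \<in> {a..b}" for c y
 proof -
  have "((%ta. (y - a) *\<^sub>R g (c, a + ta * (y - a))) has_integral
    integral {a + 0 * (y - a)..a + 1 * (y - a)} (%s. g (c, s))) {0..1}"
  proof (rule has_integral_substitution[where c=a and d=b])
   have "a + ta * (y - a) \<in> {a..b}" if "ta \<in> {0..1}" for ta
   proof -
    have "ta * (y - a) \<le> 1 * (y - a)" by (rule mult_right_mono) (use cy that in auto)
    moreover have "0 \<le> ta * (y - a)" using cy that by simp
    ultimately show ?thesis using cy by auto
   qed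
   then show "(%ta. a + ta * (y - a)) ` {0..1} \<subseteq> {a..b}" by auto
   show "continuous_on {a..b} (%s. g (c, s))"
    using continuous_on_slice[OF g, where g="Pair c" and A="{a..b}"] cy by (simp add: continuous_on_Pair)
   show "((%ta. a + ta * (y - a)) has_real_derivative (y - a)) (at x within {0..1})" for x
    by (auto intro!: derivative_eq_intros)
  qed (use cy in auto)
  from integral_unique[OF this] show ?thesis by simp
 qed
 have "continuous_on (C \<times> {a..b}) (%p. integral (cbox 0 1) (%ta. (snd p - a) * g (fst p, a + ta * (snd p - a))))"
 proof (rule integral_continuous_on_param)
  have *: "a + ta * (y - a) \<in> {a..b}" if "ta \<in> {0..1}" "y \<in> {a..b}" for ta y
  proof -
   have "ta * (y - a) \<le> 1 * (y - a)" by (rule mult_right_mono) (use that in auto)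
   moreover have "0 \<le> ta * (y - a)" using that by simp
   ultimately show ?thesis using that by auto
  qed
  have "continuous_on ((C \<times> {a..b}) \<times> cbox 0 1) (%z. g (fst (fst z), a + snd z * (snd (fst z) - a)))"
   by (rule continuous_on_compose2[OF g]) (use * in \<open>auto intro!: continuous_intros\<close>)
  then show "continuous_on ((C \<times> {a..b}) \<times> cbox 0 1) (%(p, ta). (snd p - a) * g (fst p, a + ta * (snd p - a)))"
   unfolding split_beta by (intro continuous_intros)
 qed
 then show ?thesis by (rule continuous_on_eq) (auto simp: eq)
qed

text \<open>In the norm weighted by exp(ka (s - a)) each integration from \<open>a\<close> gains a
  factor 1/ka. This is what makes Picard iteration contract on the whole interval at once.\<close>

lemma integral_exp_weight_bound:
 fixes g :: "real => real"
 assumes "ka > 0" "a \<le> y" "K \<ge> 0" "continuous_on {a..y} g" "!!s. s \<in> {a..y} ==> \<bar>g s\<bar> \<le> K * exp (ka * (s - a))"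
 shows "\<bar>integral {a..y} g\<bar> \<le> K / ka * exp (ka * (y - a))"
proof -
 have "((%s. K * exp (ka * (s - a))) has_integral (K / ka * exp (ka * (y - a)) - K / ka * exp (ka * (a - a)))) {a..y}"
  by (rule fundamental_theorem_of_calculus[OF assms(2)])
    (use assms(1) in \<open>auto intro!: derivative_eq_intros simp flip: has_real_derivative_iff_has_vector_derivative\<close>)
 moreover have "(g has_integral integral {a..y} g) {a..y}" using assms(4) integrable_continuous_interval by blast
 ultimately have "norm (integral {a..y} g) \<le> K / ka * exp (ka * (y - a)) - K / ka * exp (ka * (a - a))"
  by (metis (no_types, lifting) assms(5) has_integral_integrable integral_norm_bound_integral integral_unique real_norm_def)
 moreover have "K / ka * exp (ka * (a - a)) \<ge> 0" using assms by simp
 ultimately show ?thesis by simp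
qed

text \<open>Picard iteration carried out for all parameters simultaneously: the uniform limit yields
  a solution jointly continuous in parameter and variable, as the shooting argument
  requires.\<close>

lemma linear_ode_solution:
 fixes p :: "real \<times> real => real"
 assumes ab: "a \<le> b" and C: "compact C" and p: "continuous_on (C \<times> {a..b}) p"
 obtains h h' where "continuous_on (C \<times> {a..b}) h" "continuous_on (C \<times> {a..b}) h'"
  "!!c y. c \<in> C ==> y \<in> {a..b} ==> ((%y. h (c, y)) has_real_derivative h' (c, y)) (at y within {a..b})"
  "!!c y. c \<in> C ==> y \<in> {a..b} ==> ((%y. h' (c, y)) has_real_derivative p (c, y) * h (c, y)) (at y within {a..b})"
  "!!c. c \<in> C ==> h (c, a) = A" "!!c. c \<in> C ==> h' (c, a) = (B::real)"
proof -
 have "bounded (p ` (C \<times> {a..b}))"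
  by (intro compact_imp_bounded compact_continuous_image[OF p] compact_Times C compact_Icc)
 then obtain N where N: "N > 0" "!!c y. c \<in> C ==> y \<in> {a..b} ==> \<bar>p (c, y)\<bar> \<le> N" unfolding bounded_pos by fastforce
 \<comment> \<open>Two integrations gain ka^(-2), so the iteration map has Lipschitz constant N /
   ka^2 = 1/2 in the weighted norm.\<close>
 define ka where "ka = sqrt (2 * N)"
 have ka: "ka > 0" "N / ka / ka = 1/2" using N by (auto simp: ka_def)
 define J where "J g = (%q::real \<times> real. integral {a..snd q} (%s. g (fst q, s)))" for g :: "real \<times> real => real"
 have Jc: "continuous_on (C \<times> {a..b}) (J g)" if "continuous_on (C \<times> {a..b}) g" for g
  using continuous_on_indefinite_integral_param[OF that] by (simp add: J_def split_beta)
 have slice: "continuous_on {a..y} (%s. g (c, s))" if "continuous_on (C \<times> {a..b}) g" "c \<in> C" "y \<le> b" for g :: "real \<times> real => real" and c y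
  using continuous_on_slice[OF that(1), where g="Pair c" and A="{a..y}"] that by (simp add: continuous_on_Pair)
 have Jb: "\<bar>J g (c, y)\<bar> \<le> K / ka * exp (ka * (y - a))"
  if "continuous_on (C \<times> {a..b}) g" "c \<in> C" "y \<in> {a..b}" "K \<ge> 0"
   "!!s. s \<in> {a..b} ==> \<bar>g (c, s)\<bar> \<le> K * exp (ka * (s - a))" for g c y K unfolding J_def fst_conv snd_conv
  by (rule integral_exp_weight_bound[OF ka(1) _ that(4) slice[OF that(1,2)]]) (use that in auto)
 define T where "T g = J (J (%q. p q * g q))" for g
 have Tc: "continuous_on (C \<times> {a..b}) (T g)" if "continuous_on (C \<times> {a..b}) g" for g
  unfolding T_def by (intro Jc continuous_intros p that)
 have Tb: "\<bar>T g (c, y)\<bar> \<le> K / 2 * exp (ka * (y - a))"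
  if g: "continuous_on (C \<times> {a..b}) g" and c: "c \<in> C" and y: "y \<in> {a..b}" and K: "K \<ge> 0"
   and b: "!!s. s \<in> {a..b} ==> \<bar>g (c, s)\<bar> \<le> K * exp (ka * (s - a))" for g c y K
 proof -
  have cpg: "continuous_on (C \<times> {a..b}) (%q. p q * g q)" by (intro continuous_intros p g)
  have 1: "\<bar>J (%q. p q * g q) (c, y)\<bar> \<le> (N * K) / ka * exp (ka * (y - a))" if "y \<in> {a..b}" for y
  proof (rule Jb[OF cpg c that])
   fix s assume s: "s \<in> {a..b}"
   have "\<bar>p (c, s)\<bar> * \<bar>g (c, s)\<bar> \<le> N * (K * exp (ka * (s - a)))" by (rule mult_mono) (use N c s b in auto)
   then show "\<bar>p (c, s) * g (c, s)\<bar> \<le> N * K * exp (ka * (s - a))" by (simp add: abs_mult mult.assoc)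
  qed (use N K in simp)
  have "\<bar>T g (c, y)\<bar> \<le> (N * K / ka) / ka * exp (ka * (y - a))"
   unfolding T_def by (rule Jb[OF Jc[OF cpg] c y]) (use N K ka 1 in auto)
  also have "N * K / ka / ka = K * (N / ka / ka)" by simp
  finally show ?thesis unfolding ka(2) by simp
 qed
 have Tdiff: "T g q - T g' q = T (%q. g q - g' q) q"
  if "continuous_on (C \<times> {a..b}) g" "continuous_on (C \<times> {a..b}) g'" "q \<in> C \<times> {a..b}" for g g' q
 proof -
  have Jd: "J f q - J f' q = J (%q. f q - f' q) q"
   if "continuous_on (C \<times> {a..b}) f" "continuous_on (C \<times> {a..b}) f'" "q \<in> C \<times> {a..b}" for f f' q unfolding J_def
   by (rule integral_diff[symmetric]; rule integrable_continuous_interval, rule slice) (use that in auto)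
  have cs: "continuous_on (C \<times> {a..b}) (%q. p q * g q)" "continuous_on (C \<times> {a..b}) (%q. p q * g' q)"
   by (intro continuous_intros p that)+
  have "T g q - T g' q = J (%q. J (%q. p q * g q) q - J (%q. p q * g' q) q) q"
   unfolding T_def by (rule Jd) (use that cs Jc in auto)
  also have "... = J (J (%q. p q * (g q - g' q))) q" unfolding J_def[of "%q. J _ q - J _ q"] J_def[of "J _"]
  proof (rule integral_cong)
   fix s assume "s \<in> {a..snd q}"
   then show "J (%q. p q * g q) (fst q, s) - J (%q. p q * g' q) (fst q, s) = J (%q. p q * (g q - g' q)) (fst q, s)"
    using Jd[OF cs, of "(fst q, s)"] that(3) by (auto simp: right_diff_distrib)
  qed
  finally show ?thesis by (simp add: T_def)
 qed
 define h0 where "h0 q = A + B * (snd q - a)" for q :: "real \<times> real"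
 define f where "f m = ((%g q. h0 q + T g q) ^^ m) (%_. 0)" for m
 have f_Suc: "f (Suc m) q = h0 q + T (f m) q" for m q by (simp add: f_def)
 have h0c: "continuous_on (C \<times> {a..b}) h0" unfolding h0_def by (intro continuous_intros)
 have fc: "continuous_on (C \<times> {a..b}) (f m)" for m
 proof (induction m)
  case 0 then show ?case by (simp add: f_def)
 next
  case (Suc m)
  then show ?case using continuous_on_add[OF h0c Tc] by (simp add: f_Suc[abs_def])
 qed
 define K where "K = \<bar>A\<bar> + \<bar>B\<bar> * (b - a)"
 have K: "K \<ge> 0" using ab by (simp add: K_def)
 have incr: "\<bar>f (Suc m) (c, y) - f m (c, y)\<bar> \<le> K * (1/2)^m * exp (ka * (y - a))" if "c \<in> C" "y \<in> {a..b}" for m c y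
  using that
 proof (induction m arbitrary: y)
  case 0
  have "\<bar>f (Suc 0) (c, y) - f 0 (c, y)\<bar> = \<bar>A + B * (y - a)\<bar>" by (simp add: f_def h0_def T_def J_def)
  also have "... \<le> \<bar>A\<bar> + \<bar>B\<bar> * \<bar>y - a\<bar>" by (metis abs_mult abs_triangle_ineq)
  also have "... \<le> K" unfolding K_def using 0 by (intro add_left_mono mult_left_mono) auto
  also have "... \<le> K * (1/2)^0 * exp (ka * (y - a))"
   using mult_left_mono[OF _ K, of 1 "exp (ka * (y - a))"] ka 0 by simp
  finally show ?case .
 next
  case (Suc m)
  have "f (Suc (Suc m)) (c, y) - f (Suc m) (c, y) = T (%q. f (Suc m) q - f m q) (c, y)"
   using Tdiff[OF fc[of "Suc m"] fc[of m], of "(c, y)"] Suc.prems f_Suc[of "Suc m"] f_Suc[of m] by simp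
  also have "\<bar>...\<bar> \<le> (K * (1/2)^m) / 2 * exp (ka * (y - a))"
   by (rule Tb) (use Suc K in \<open>auto intro!: continuous_intros fc\<close>)
  finally show ?case by simp
 qed
 have incr': "norm (f (Suc m) q - f m q) \<le> K * exp (ka * (b - a)) * (1/2)^m" if q': "q \<in> C \<times> {a..b}" for m q
 proof -
  obtain c y where q: "q = (c, y)" "c \<in> C" "y \<in> {a..b}" using q' by auto
  have "K * (1/2)^m * exp (ka * (y - a)) \<le> K * (1/2)^m * exp (ka * (b - a))"
   using q ka K by (intro mult_left_mono) auto
  with incr[OF q(2,3), of m] show ?thesis unfolding q by (simp add: mult_ac)
 qed
 obtain h where h: "uniform_limit (C \<times> {a..b}) f h sequentially"
  by (rule geometric_uniform_limit[of "C \<times> {a..b}" f]) (rule incr')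
 have hc: "continuous_on (C \<times> {a..b}) h" by (rule uniform_limit_theorem[OF _ h]) (use fc in auto)
 have fix_h: "h q = h0 q + T h q" if q: "q \<in> C \<times> {a..b}" for q
 proof -
  obtain c y where qq: "q = (c, y)" "c \<in> C" "y \<in> {a..b}" using q by auto
  have "(%m. T (f m) q) \<longlonglongrightarrow> T h q"
  proof (rule tendstoI)
   fix e :: real assume e: "e > 0"
   define M where "M = exp (ka * (b - a))"
   have M: "M > 0" by (simp add: M_def)
   from e M have "e / M > 0" by simp
   from uniform_limitD[OF h this]
   show "\<forall>\<^sub>F m in sequentially. dist (T (f m) q) (T h q) < e"
   proof eventually_elim
    case (elim m)
    have "\<bar>T (%q. f m q - h q) (c, y)\<bar> \<le> (e / M) / 2 * exp (ka * (y - a))"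
    proof (rule Tb[OF _ qq(2,3)])
     fix s assume s: "s \<in> {a..b}"
     have "\<bar>f m (c, s) - h (c, s)\<bar> \<le> e / M" using elim s qq(2) by (force simp: dist_real_def)
     also have "... \<le> e / M * exp (ka * (s - a))"
      using mult_left_mono[of 1 "exp (ka * (s - a))" "e / M"] ka s e M by simp
     finally show "\<bar>f m (c, s) - h (c, s)\<bar> \<le> e / M * exp (ka * (s - a))" .
    qed (use e M in \<open>auto intro!: continuous_intros fc hc\<close>)
    also have "... \<le> (e / M) / 2 * M" unfolding M_def using qq(3) ka e by (intro mult_left_mono) auto
    also have "... < e" using M e by simp
    finally show ?case using Tdiff[OF fc hc q] by (simp add: dist_real_def qq(1))
   qed
  qed
  then have "(%m. h0 q + T (f m) q) \<longlonglongrightarrow> h0 q + T h q" by (intro tendsto_intros)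
  then have "(%m. f (Suc m) q) \<longlonglongrightarrow> h0 q + T h q" by (simp add: f_Suc)
  moreover have "(%m. f (Suc m) q) \<longlonglongrightarrow> h q" using tendsto_uniform_limitI[OF h q] LIMSEQ_Suc by blast
  ultimately show ?thesis using LIMSEQ_unique by blast
 qed
 define h' where "h' q = B + J (%q. p q * h q) q" for q
 have cph: "continuous_on (C \<times> {a..b}) (%q. p q * h q)" by (intro continuous_intros p hc)
 have dJ: "((%y. J g (c, y)) has_real_derivative g (c, y)) (at y within {a..b})"
  if "continuous_on (C \<times> {a..b}) g" "c \<in> C" "y \<in> {a..b}" for g c y unfolding J_def fst_conv snd_conv
  by (rule integral_has_real_derivative[OF slice]) (use that in auto)
 show thesis
 proof (rule that[of h h'])
  show "continuous_on (C \<times> {a..b}) h'" unfolding h'_def by (intro continuous_intros Jc cph)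
  fix c assume c: "c \<in> C"
  show "((%y. h' (c, y)) has_real_derivative p (c, y) * h (c, y)) (at y within {a..b})" if y: "y \<in> {a..b}" for y
   unfolding h'_def using DERIV_add[OF DERIV_const dJ[OF cph c y]] by simp
  show "((%y. h (c, y)) has_real_derivative h' (c, y)) (at y within {a..b})" if y: "y \<in> {a..b}" for y
  proof (rule DERIV_transform_on[OF _ y])
   have "((%y. T h (c, y)) has_real_derivative J (%q. p q * h q) (c, y)) (at y within {a..b})"
    unfolding T_def by (rule dJ[OF Jc[OF cph] c y])
   then show "((%y. h0 (c, y) + T h (c, y)) has_real_derivative h' (c, y)) (at y within {a..b})"
    unfolding h0_def h'_def by (auto intro!: derivative_eq_intros)
   show "h0 (c, s) + T h (c, s) = h (c, s)" if "s \<in> {a..b}" for s using fix_h[of "(c, s)"] c that by simp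
  qed
  show "h (c, a) = A" using fix_h[of "(c, a)"] c ab by (simp add: h0_def T_def J_def)
  show "h' (c, a) = B" by (simp add: h'_def J_def)
 qed (rule hc)
qed

section \<open>Lyapunov stability\<close>

context flow begin

text \<open>Circulation around a rectangle, combined with its rate of change, says that the integral
  of \<open>ze\<close>_t + (u \<open>ze\<close>)_x + (v \<open>ze\<close>)_y over every rectangle is
  zero. Localization gives the divergence form, and incompressibility turns it into
  transport.\<close>

lemma transport:
 assumes p: "p \<in> slab d"
 shows "Dt d (vorticity d u v) p + u p * Dx d (vorticity d u v) p + v p * (Dy d (vorticity d u v) p + \<beta>) = 0"
proof -
 obtain t x y where pt: "p = (t, x, y)" by (cases p) auto
 have t: "t \<ge> 0" using p by (auto simp: pt slab_def)
 define f1 where "f1 p = Dx d u p * ze p + u p * Dx d (vorticity d u v) p" for p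
 define f2 where "f2 p = Dy d v p * ze p + v p * (Dy d (vorticity d u v) p + \<beta>)" for p
 define h where "h p = Dt d (vorticity d u v) p + (f1 p + f2 p)" for p
 have c: "continuous_on (slab d) f1" "continuous_on (slab d) f2" "continuous_on (slab d) h"
  unfolding h_def f1_def f2_def by (intro continuous_intros cont cont_ze)+
 have "h (t, x, y) = 0"
 proof (rule continuous_rect_int_zero[OF d, of "%q. h (t, q)"])
  show "continuous_on (strip d) (%q. h (t, q))" by (rule cont_t[OF c(3) t])
  show "(x, y) \<in> strip d" using p by (auto simp: pt slab_def)
  fix x1 x2 y1 y2 :: real assume xy: "x1 \<le> x2" "-d \<le> y1" "y1 \<le> y2" "y2 \<le> d"
  have in_slab: "(t, x, y) \<in> slab d" if "y \<in> {y1..y2}" for x y using that xy t by (auto simp: slab_def strip_def)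
  have cr: "continuous_on ({x1..x2} \<times> {y1..y2}) (%(x, y). f (t, x, y))" if "continuous_on (slab d) f" for f :: "_ => real"
   using cont_rect that t xy by simp
  have iy: "(%y. f (t, x, y)) integrable_on {y1..y2}" if "continuous_on (slab d) f" for f :: "_ => real" and x
   by (rule integrable_continuous_interval)
     (use continuous_on_slice[OF that, where g="%y. (t, x, y)" and A="{y1..y2}"] in_slab in \<open>simp add: continuous_on_Pair\<close>)
  have ix: "(%x. f (t, x, y)) integrable_on {x1..x2}" if "continuous_on (slab d) f" "y \<in> {y1..y2}" for f :: "_ => real" and y
   by (rule integrable_continuous_interval)
     (use continuous_on_slice[OF that(1), where g="%x. (t, x, y)" and A="{x1..x2}"] in_slab that(2) in \<open>simp add: continuous_on_Pair\<close>)
  have "rect_int x1 x2 y1 y2 (%x y. h (t, x, y)) = rect_int x1 x2 y1 y2 (%x y. Dt d (vorticity d u v) (t, x, y))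
    + rect_int x1 x2 y1 y2 (%x y. f1 (t, x, y) + f2 (t, x, y))"
   unfolding h_def by (rule rect_int_add) (use cr[OF cont(10)] cr[OF continuous_on_add[OF c(1,2)]] in auto)
  also have "rect_int x1 x2 y1 y2 (%x y. f1 (t, x, y) + f2 (t, x, y)) =
    rect_int x1 x2 y1 y2 (%x y. f1 (t, x, y)) + rect_int x1 x2 y1 y2 (%x y. f2 (t, x, y))"
   by (rule rect_int_add) (use cr c in auto)
  also have "rect_int x1 x2 y1 y2 (%x y. f1 (t, x, y)) =
    integral {y1..y2} (%y. u (t, x2, y) * ze (t, x2, y) - u (t, x1, y) * ze (t, x1, y))"
  proof (rule rect_int_deriv_x[OF xy(1), where f="%x y. u (t, x, y) * ze (t, x, y)"])
   show "((%x. u (t, x, y) * ze (t, x, y)) has_real_derivative f1 (t, x, y)) (at x within {x1..x2})"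
    if "y \<in> {y1..y2}" for x y unfolding f1_def by (rule has_field_derivative_at_within)
      (rule DERIV_cong[OF DERIV_mult[OF der(2) der_ze(2)]], use in_slab that in auto)
  qed (use cr c in auto)
  also have "rect_int x1 x2 y1 y2 (%x y. f2 (t, x, y)) =
    integral {x1..x2} (%x. v (t, x, y2) * ze (t, x, y2) - v (t, x, y1) * ze (t, x, y1))"
  proof (rule rect_int_deriv_y[OF xy(3), where f="%x y. v (t, x, y) * ze (t, x, y)"])
   show "((%y. v (t, x, y) * ze (t, x, y)) has_real_derivative f2 (t, x, y)) (at y within {y1..y2})"
    if "y \<in> {y1..y2}" for x y unfolding f2_def by (rule DERIV_subset[where s="{-d..d}"])
      (rule DERIV_cong[OF DERIV_mult[OF der(6) der_ze(3)]], use in_slab xy that in auto)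
  qed
  also have "rect_int x1 x2 y1 y2 (%x y. Dt d (vorticity d u v) (t, x, y)) =
   integral {y1..y2} (%y. Dt d v (t, x2, y) - Dt d v (t, x1, y))
   - integral {x1..x2} (%x. Dt d u (t, x, y2) - Dt d u (t, x, y1))" by (rule circulation_rate[OF t xy])
  finally have E: "rect_int x1 x2 y1 y2 (%x y. h (t, x, y)) =
   integral {y1..y2} (%y. Dt d v (t, x2, y) - Dt d v (t, x1, y))
   - integral {x1..x2} (%x. Dt d u (t, x, y2) - Dt d u (t, x, y1))
   + (integral {y1..y2} (%y. u (t, x2, y) * ze (t, x2, y) - u (t, x1, y) * ze (t, x1, y))
   + integral {x1..x2} (%x. v (t, x, y2) * ze (t, x, y2) - v (t, x, y1) * ze (t, x, y1)))" .
  have cu: "continuous_on (slab d) (%p. u p * ze p)" and cv: "continuous_on (slab d) (%p. v p * ze p)"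
   by (intro continuous_intros cont cont_ze)+
  have "integral {y1..y2} (%y. (Dt d v (t, x2, y) + u (t, x2, y) * ze (t, x2, y))
      - (Dt d v (t, x1, y) + u (t, x1, y) * ze (t, x1, y))) =
    integral {y1..y2} (%y. (Dt d v (t, x2, y) - Dt d v (t, x1, y)) + (u (t, x2, y) * ze (t, x2, y) - u (t, x1, y) * ze (t, x1, y)))"
   by (simp add: algebra_simps)
  also have "... = integral {y1..y2} (%y. Dt d v (t, x2, y) - Dt d v (t, x1, y)) +
    integral {y1..y2} (%y. u (t, x2, y) * ze (t, x2, y) - u (t, x1, y) * ze (t, x1, y))"
   by (rule integral_add; rule integrable_diff) (use iy cont iy[OF cu] in auto)
  finally have 1: "integral {y1..y2} (%y. (Dt d v (t, x2, y) + u (t, x2, y) * ze (t, x2, y))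
      - (Dt d v (t, x1, y) + u (t, x1, y) * ze (t, x1, y))) = ..." .
  have "integral {x1..x2} (%x. (Dt d u (t, x, y2) - v (t, x, y2) * ze (t, x, y2))
      - (Dt d u (t, x, y1) - v (t, x, y1) * ze (t, x, y1))) =
    integral {x1..x2} (%x. (Dt d u (t, x, y2) - Dt d u (t, x, y1)) - (v (t, x, y2) * ze (t, x, y2) - v (t, x, y1) * ze (t, x, y1)))"
   by (simp add: algebra_simps)
  also have "... = integral {x1..x2} (%x. Dt d u (t, x, y2) - Dt d u (t, x, y1)) -
    integral {x1..x2} (%x. v (t, x, y2) * ze (t, x, y2) - v (t, x, y1) * ze (t, x, y1))"
   by (rule integral_diff; rule integrable_diff) (use ix cont ix[OF cv] xy in auto)
  finally have 2: "integral {x1..x2} (%x. (Dt d u (t, x, y2) - v (t, x, y2) * ze (t, x, y2))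
      - (Dt d u (t, x, y1) - v (t, x, y1) * ze (t, x, y1))) = ..." .
  show "rect_int x1 x2 y1 y2 (%x y. h (t, x, y)) = 0" using circulation[OF t xy] unfolding E 1 2 by simp
 qed
 moreover have "(Dx d u p + Dy d v p) * ze p = 0" using divergence_free[OF p] by simp
 ultimately show ?thesis unfolding h_def f1_def f2_def pt by (simp add: algebra_simps)
qed

lemma periodic: "x_periodic d L u" "x_periodic d L v" using sol by (auto simp: global_solution_def)

lemma impermeable: "t \<ge> 0 ==> v (t, x, -d) = 0" "t \<ge> 0 ==> v (t, x, d) = 0"
 using sol by (auto simp: global_solution_def)

lemma x_periodicD: "x_periodic d L f ==> (t, x, y) \<in> slab d ==> f (t, x + L, y) = f (t, x, y)"
 by (auto simp: x_periodic_def)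

text \<open>\<open>Ph (ze)\<close> is transported, and the rate of change of the term - y
  \<open>ze\<close> is the divergence of y \<open>ze\<close> (u, v) minus v \<open>ze\<close>. The
  latter is itself a divergence: v (v_x - u_y) = ((v^2 - u^2) / 2)_x - (u v)_y by incompressibility,
  and \<beta> y v is the divergence of \<beta> y^2 (u, v) / 2. The total flux \<open>(A, B)\<close>
  cancels by periodicity and vanishes at the walls.\<close>

lemma casimir_momentum_conserved:
 assumes Ph: "!!s. (Ph has_real_derivative Y s) (at s)" and Y: "continuous_on UNIV Y" and t: "t \<ge> 0"
 shows "rect_int 0 L (-d) d (%x y. Ph (ze (t, x, y)) - y * ze (t, x, y))
    = rect_int 0 L (-d) d (%x y. Ph (ze (0, x, y)) - y * ze (0, x, y))"
proof -
 let ?\<Omega> = "vorticity d u v"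
 define E where "E t = rect_int 0 L (-d) d (%x y. Ph (ze (t, x, y)) - y * ze (t, x, y))" for t
 have Phc: "continuous_on UNIV Ph" using Ph by (auto intro: DERIV_continuous_on)
 have cPh: "continuous_on (slab d) (%p. Ph (ze p))" and cY: "continuous_on (slab d) (%p. Y (ze p))"
  by (auto intro: continuous_on_compose2[OF Phc cont_ze] continuous_on_compose2[OF Y cont_ze])
 have in_slab: "(t, x, y) \<in> slab d" if "y \<in> {-d..d}" "t \<in> {0..}" for t x y
  using that by (auto simp: slab_def strip_def)
 define e where "e p = Ph (ze p) - snd (snd p) * ze p" for p
 define et where "et p = (Y (ze p) - snd (snd p)) * Dt d ?\<Omega> p" for p
 define A where "A p = - u p * Ph (ze p) + snd (snd p) * u p * ze p - (v p)\<^sup>2 / 2 + (u p)\<^sup>2 / 2 - \<beta> * (snd (snd p))\<^sup>2 * u p / 2" for p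
 define B where "B p = - v p * Ph (ze p) + snd (snd p) * v p * ze p + u p * v p - \<beta> * (snd (snd p))\<^sup>2 * v p / 2" for p
 define Ax where "Ax p = - (Dx d u p * Ph (ze p) + u p * (Y (ze p) * Dx d ?\<Omega> p))
   + snd (snd p) * (Dx d u p * ze p + u p * Dx d ?\<Omega> p) - v p * Dx d v p + u p * Dx d u p
   - \<beta> * (snd (snd p))\<^sup>2 * Dx d u p / 2" for p
 define By where "By p = - (Dy d v p * Ph (ze p) + v p * (Y (ze p) * (Dy d ?\<Omega> p + \<beta>)))
   + (v p * ze p + snd (snd p) * (Dy d v p * ze p + v p * (Dy d ?\<Omega> p + \<beta>))) + Dy d u p * v p + u p * Dy d v p
   - \<beta> * (2 * snd (snd p) * v p + (snd (snd p))\<^sup>2 * Dy d v p) / 2" for p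
 have ce: "continuous_on (slab d) e" "continuous_on (slab d) et"
  unfolding e_def et_def by (intro continuous_intros cont cont_ze cPh cY)+
 have cAB: "continuous_on (slab d) Ax" "continuous_on (slab d) By"
  unfolding Ax_def By_def by (intro continuous_intros cont cont_ze cPh cY; simp)+
 have eq: "et p = Ax p + By p" if p: "p \<in> slab d" for p
 proof -
  have 1: "Dx d u p = - Dy d v p" using divergence_free[OF p] by simp
  have 2: "Dt d ?\<Omega> p = - (u p * Dx d ?\<Omega> p + v p * (Dy d ?\<Omega> p + \<beta>))" using transport[OF p] by simp
  have 3: "Dx d v p = ze p - \<beta> * snd (snd p) + Dy d u p" by (simp add: ze_def vorticity_def)
  show ?thesis unfolding et_def Ax_def By_def 1 2 3 by (simp add: algebra_simps power2_eq_square add_divide_distrib)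
 qed
 have dE: "(E has_real_derivative 0) (at t within {0..})" if t: "t \<in> {0..}" for t
 proof -
  have "(E has_real_derivative rect_int 0 L (-d) d (%x y. et (t, x, y))) (at t within {0..})"
  proof -
   have "((%t. rect_int 0 L (-d) d (%x y. e (t, x, y))) has_real_derivative rect_int 0 L (-d) d (%x y. et (t, x, y))) (at t within {0..})"
   proof (rule rect_int_deriv_t)
    show "((%t. e (t, x, y)) has_real_derivative et (t, x, y)) (at t within {0..})"
     if "t \<in> {0..}" "y \<in> {-d..d}" for t x y unfolding e_def et_def
     using DERIV_diff[OF DERIV_chain2[OF Ph der_ze(1)[OF in_slab[OF that(2,1), of x]]]
       DERIV_cmult[OF der_ze(1)[OF in_slab[OF that(2,1), of x]], of y]] by (simp add: left_diff_distrib)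
   qed (use cont_box[OF ce(1)] cont_box[OF ce(2)] t in auto)
   then show ?thesis by (simp add: E_def[abs_def] e_def)
  qed
  also have "rect_int 0 L (-d) d (%x y. et (t, x, y)) = rect_int 0 L (-d) d (%x y. Ax (t, x, y) + By (t, x, y))"
   by (rule rect_int_cong) (use eq in_slab t in auto)
  also have "... = rect_int 0 L (-d) d (%x y. Ax (t, x, y)) + rect_int 0 L (-d) d (%x y. By (t, x, y))"
   by (rule rect_int_add) (use cont_rect[OF cAB(1)] cont_rect[OF cAB(2)] t in auto)
  also have "rect_int 0 L (-d) d (%x y. Ax (t, x, y)) = integral {-d..d} (%y. A (t, L, y) - A (t, 0, y))"
  proof (rule rect_int_deriv_x[where f="%x y. A (t, x, y)"])
   show "((%x. A (t, x, y)) has_real_derivative Ax (t, x, y)) (at x within {0..L})" if "y \<in> {-d..d}" for x y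
    unfolding A_def Ax_def snd_conv by (rule has_field_derivative_at_within, rule flux_derivative_x)
      (use der(2,5) der_ze(2) DERIV_chain2[OF Ph der_ze(2)] in_slab that t in blast)+
  qed (use L cont_rect[OF cAB(1)] t in auto)
  also have "... = integral {-d..d} (%y. 0)"
  proof (rule integral_cong)
   fix y assume y: "y \<in> {-d..d}"
   have uv: "u (t, x + L, y) = u (t, x, y)" "v (t, x + L, y) = v (t, x, y)" for x
    using x_periodicD[OF periodic(1) in_slab[OF y t]] x_periodicD[OF periodic(2) in_slab[OF y t]] by auto
   \<comment> \<open>Periodicity is assumed of the velocity alone; that of its derivatives, hence of
     the vorticity, is deduced by uniqueness of derivatives.\<close>
   have dL: "Dx d f (t, L, y) = Dx d f (t, 0, y)" "Dy d f (t, L, y) = Dy d f (t, 0, y)"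
    if f: "Ck_on 1 (slab d) f" and p: "x_periodic d L f" for f
   proof -
    have "((%x. f (t, x + L, y)) has_real_derivative Dx d f (t, L, y)) (at 0)"
     using partials_of_C1_slab(2)[OF d f[unfolded One_nat_def] in_slab[OF y t], of L]
     using DERIV_shift[of "%x. f (t, x, y)" "Dx d f (t, L, y)" 0 L] by simp
    moreover have "(%x. f (t, x + L, y)) = (%x. f (t, x, y))" using x_periodicD[OF p in_slab[OF y t]] by auto
    ultimately have "((%x. f (t, x, y)) has_real_derivative Dx d f (t, L, y)) (at 0)" by simp
    then show "Dx d f (t, L, y) = Dx d f (t, 0, y)"
     using partials_of_C1_slab(2)[OF d f[unfolded One_nat_def] in_slab[OF y t], of 0] DERIV_unique by blast
    have fe: "f (t, L, y) = f (t, 0, y)" if "y \<in> {-d..d}" for y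
     using x_periodicD[OF p in_slab[OF that t, of 0]] by simp
    have "((%y. f (t, 0, y)) has_real_derivative Dy d f (t, L, y)) (at y within {-d..d})"
     by (rule DERIV_transform_on[OF partials_of_C1_slab(3)[OF d f[unfolded One_nat_def] in_slab[OF y t], of L] y fe])
    then show "Dy d f (t, L, y) = Dy d f (t, 0, y)"
     using partials_of_C1_slab(3)[OF d f[unfolded One_nat_def] in_slab[OF y t], of 0]
      DERIV_unique_thick[OF thick_interval[OF d] y] by blast
   qed
   have "ze (t, L, y) = ze (t, 0, y)"
    using dL[OF C1(1) periodic(1)] dL[OF C1(2) periodic(2)] unfolding ze_def vorticity_def by simp
   then show "A (t, L, y) - A (t, 0, y) = 0" using uv[of 0] by (simp add: A_def)
  qed
  also have "rect_int 0 L (-d) d (%x y. By (t, x, y)) = integral {0..L} (%x. B (t, x, d) - B (t, x, -d))"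
  proof (rule rect_int_deriv_y[where f="%x y. B (t, x, y)"])
   show "((%y. B (t, x, y)) has_real_derivative By (t, x, y)) (at y within {-d..d})" if "y \<in> {-d..d}" for x y
    unfolding B_def By_def snd_conv by (rule flux_derivative_y)
      (use der(3,6) der_ze(3) DERIV_chain2[OF Ph der_ze(3)] in_slab that t in blast)+
  qed (use d in auto)
  also have "... = integral {0..L} (%x. 0)" by (rule integral_cong) (use impermeable t in \<open>auto simp: B_def\<close>)
  finally show ?thesis by simp
 qed
 obtain c where "\<forall>t\<in>{0..}. E t = c" using has_field_derivative_zero_constant[OF _ dE] by blast
 then have "E t = E 0" using t by simp
 then show ?thesis unfolding E_def .
qed

end

lemma Icc_derivative_attains:
 fixes f :: "real => real"
 assumes "!!y. y \<in> {a..b} ==> (f has_real_derivative f' y) (at y within {a..b})"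
  "a \<le> y1" "y1 < y2" "y2 \<le> b"
 obtains xi where "xi \<in> {y1<..<y2}" "f y2 - f y1 = f' xi * (y2 - y1)"
proof -
 have "\<exists>x\<in>{y1<..<y2}. f y2 - f y1 = (*) (f' x) (y2 - y1)"
 proof (rule mvt_simple[OF assms(3)])
  fix x assume "y1 \<le> x" "x \<le> y2"
  then have "(f has_real_derivative f' x) (at x within {y1..y2})"
   by (intro DERIV_subset[OF assms(1)]) (use assms in auto)
  then show "(f has_derivative (*) (f' x)) (at x within {y1..y2})" by (simp add: has_field_derivative_def)
 qed
 with that show thesis by auto
qed

text \<open>The Casimir density is the Legendre-type primitive of the inverse of the vorticity profile,
 continued affinely beyond its range, so that \<open>Ph(s) - y s\<close> has a quadratic minimum at
 the profile value.\<close>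

lemma convex_casimir:
 fixes f :: "real => real"
 assumes d: "d > 0" and m: "0 < m" "m \<le> M"
  and f: "!!y1 y2. -d \<le> y1 ==> y1 \<le> y2 ==> y2 \<le> d ==>
    m * (y2 - y1) \<le> f y2 - f y1 \<and> f y2 - f y1 \<le> M * (y2 - y1)"
 obtains Y Ph where "continuous_on UNIV Y" "!!s. (Ph has_real_derivative Y s) (at s)"
  "!!s y. y \<in> {-d..d} ==> (s - f y)\<^sup>2 / (2 * M) \<le> Ph s - Ph (f y) - y * (s - f y)"
  "!!s y. y \<in> {-d..d} ==> Ph s - Ph (f y) - y * (s - f y) \<le> (s - f y)\<^sup>2 / (2 * m)"
proof -
 define cl where "cl y = max (-d) (min y d)" for y
 define Z where "Z y = f (cl y) + m * (y - cl y)" for y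
 have Z: "m * (y2 - y1) \<le> Z y2 - Z y1 \<and> Z y2 - Z y1 \<le> M * (y2 - y1)" if "y1 \<le> y2" for y1 y2
 proof -
  have c: "-d \<le> cl y1" "cl y1 \<le> cl y2" "cl y2 \<le> d" "cl y2 - cl y1 \<le> y2 - y1" using that d by (auto simp: cl_def)
  have "m * ((y2 - y1) - (cl y2 - cl y1)) \<le> M * ((y2 - y1) - (cl y2 - cl y1))"
   by (rule mult_right_mono) (use m c in auto)
  then show ?thesis using f[OF c(1-3)] by (simp add: Z_def algebra_simps)
 qed
 have Zmono: "y1 \<le> y2" if "Z y1 \<le> Z y2" for y1 y2
 proof (rule ccontr)
  assume "\<not> y1 \<le> y2"
  then have "m * (y1 - y2) > 0" using m by simp
  then show False using Z[of y2 y1] that \<open>\<not> y1 \<le> y2\<close> by simp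
 qed
 have Zlip: "\<bar>Z y2 - Z y1\<bar> \<le> M * \<bar>y2 - y1\<bar>" for y1 y2
 proof (cases "y1 \<le> y2")
  case True
  have "0 \<le> m * (y2 - y1)" using True m by simp
  with Z[OF True] True show ?thesis by simp
 next
  case False
  then have "0 \<le> m * (y1 - y2)" using m by simp
  with Z[of y2 y1] False show ?thesis by simp
 qed
 have Zcont: "continuous_on UNIV Z"
  by (rule lipschitz_on_continuous_on[of M]) (use Zlip m in \<open>auto intro!: lipschitz_onI simp: dist_real_def\<close>)
 have "\<exists>y. Z y = s" for s
 proof -
  define a where "a = \<bar>s - Z 0\<bar> / m"
  have a: "0 \<le> a" "m * a = \<bar>s - Z 0\<bar>" using m by (auto simp: a_def)
  have "Z (-a) \<le> s" "s \<le> Z a" using Z[of "-a" 0] Z[of 0 a] a by auto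
  with IVT'[of Z "-a" s a] a Zcont show ?thesis
   by (meson continuous_on_subset subset_UNIV neg_le_0_iff_le order_trans)
 qed
 then obtain Y where Y: "Z (Y s) = s" for s by metis
 have Yb: "(s2 - s1) / M \<le> Y s2 - Y s1 \<and> Y s2 - Y s1 \<le> (s2 - s1) / m" if "s1 \<le> s2" for s1 s2
 proof -
  have "Y s1 \<le> Y s2" by (rule Zmono) (use Y that in simp)
  from Z[OF this] show ?thesis using m by (simp add: Y field_simps)
 qed
 have Ycont: "continuous_on UNIV Y"
 proof (rule lipschitz_on_continuous_on[of "1/m"], rule lipschitz_onI)
  fix s1 s2 :: real
  show "dist (Y s1) (Y s2) \<le> 1 / m * dist s1 s2"
  proof (cases "s1 \<le> s2")
   case True
   then have "0 \<le> (s2 - s1) / M" using m by simp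
   with Yb[OF True] True show ?thesis by (simp add: dist_real_def)
  next
   case False
   then have "0 \<le> (s1 - s2) / M" using m by simp
   with Yb[of s2 s1] False show ?thesis by (simp add: dist_real_def)
  qed
 qed (use m in auto)
 have "\<exists>F. \<forall>x::real. -\<infinity> < ereal x --> ereal x < \<infinity> --> (F has_vector_derivative Y x) (at x)"
  by (rule einterval_antiderivative)
    (use Ycont in \<open>auto simp: continuous_on_eq_continuous_at\<close>)
 then obtain Ph where Ph: "(Ph has_real_derivative Y s) (at s)" for s
  by (auto simp: has_real_derivative_iff_has_vector_derivative)
 have Yf: "Y (f y) = y" if "y \<in> {-d..d}" for y
 proof -
  have "Z y = f y" using that by (simp add: Z_def cl_def)
  then show ?thesis using Zmono Y by (metis order_antisym order_refl)
 qed
 have low: "(s - c)\<^sup>2 / (2 * M) \<le> Ph s - Ph c - Y c * (s - c)"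
  and up: "Ph s - Ph c - Y c * (s - c) \<le> (s - c)\<^sup>2 / (2 * m)" for s c
 proof -
  \<comment> \<open>Difference quotients of \<open>Y\<close> lie between 1/M and 1/m. Hence the
    derivative of \<open>g M\<close> has the sign of s - c and that of \<open>g m\<close> the
    opposite one, and both functions vanish at \<open>c\<close>.\<close>
  define g where "g K s = Ph s - Ph c - Y c * (s - c) - (s - c)\<^sup>2 / (2 * K)" for K s
  have g: "(g K has_real_derivative (Y s - Y c - (s - c) / K)) (at s)" for K s unfolding g_def[abs_def]
   by (rule DERIV_cong, (rule Ph DERIV_const DERIV_ident DERIV_diff DERIV_cmult DERIV_cdivide DERIV_power)+)
     (cases "K = 0"; simp add: field_simps)
  have sgn: "Y r - Y c - (r - c) / M \<ge> 0" "Y r - Y c - (r - c) / m \<le> 0" if "c \<le> r" for r using Yb[OF that] by auto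
  have sgn': "Y r - Y c - (r - c) / M \<le> 0" "Y r - Y c - (r - c) / m \<ge> 0" if "r \<le> c" for r
  proof -
   have e: "(r - c) / K = - ((c - r) / K)" for K by (simp add: minus_divide_left)
   show "Y r - Y c - (r - c) / M \<le> 0" "Y r - Y c - (r - c) / m \<ge> 0" unfolding e using Yb[OF that] by auto
  qed
  have gc: "g K c = 0" for K by (simp add: g_def)
  have "g M c \<le> g M s \<and> g m s \<le> g m c"
  proof (cases "c \<le> s")
   case True
   have "g M c \<le> g M s"
   proof (rule DERIV_nonneg_imp_nondecreasing[OF True])
    show "\<exists>y. (g M has_real_derivative y) (at r) \<and> 0 \<le> y" if "c \<le> r" for r
     using g[of M r] sgn(1)[OF that] by blast
   qed
   moreover have "g m s \<le> g m c"
   proof (rule DERIV_nonpos_imp_nonincreasing[OF True])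
    show "\<exists>y. (g m has_real_derivative y) (at r) \<and> y \<le> 0" if "c \<le> r" for r
     using g[of m r] sgn(2)[OF that] by blast
   qed
   ultimately show ?thesis ..
  next
   case False
   then have sc: "s \<le> c" by simp
   have "g M c \<le> g M s"
   proof (rule DERIV_nonpos_imp_nonincreasing[OF sc])
    show "\<exists>y. (g M has_real_derivative y) (at r) \<and> y \<le> 0" if "r \<le> c" for r
     using g[of M r] sgn'(1)[OF that] by blast
   qed
   moreover have "g m s \<le> g m c"
   proof (rule DERIV_nonneg_imp_nondecreasing[OF sc])
    show "\<exists>y. (g m has_real_derivative y) (at r) \<and> 0 \<le> y" if "r \<le> c" for r
     using g[of m r] sgn'(2)[OF that] by blast
   qed
   ultimately show ?thesis ..
  qed
  then show "(s - c)\<^sup>2 / (2 * M) \<le> Ph s - Ph c - Y c * (s - c)"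
   "Ph s - Ph c - Y c * (s - c) \<le> (s - c)\<^sup>2 / (2 * m)" unfolding gc by (simp_all add: g_def)
 qed
 show thesis by (rule that[OF Ycont Ph]) (metis low Yf, metis up Yf)
qed

section \<open>From the conserved functional to the L2 distance\<close>

lemma L2_norm_cell:
 fixes f :: "real \<times> real => real"
 assumes "continuous_on ({0..L} \<times> {-d..d}) f"
 shows "L2_norm (cell d L) f = sqrt (rect_int 0 L (-d) d (%x y. (f (x, y))\<^sup>2))"
proof -
 have c: "continuous_on ({0..L} \<times> {-d..d}) (%p. (f p)\<^sup>2)" by (intro continuous_intros assms)
 have "set_integrable lborel (cell d L) (%p. (f p)\<^sup>2)" unfolding set_integrable_def cell_def
  by (rule borel_integrable_compact) (use c compact_Times[OF compact_Icc compact_Icc] in auto)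
 from set_borel_integral_eq_integral(2)[OF this]
 show ?thesis unfolding L2_norm_def using rect_int_prod[OF c] by (simp add: cell_def)
qed

text \<open>Arnold's argument: the conserved energy-Casimir difference \<open>E\<close> lies between
  the squared distance divided by 2M and by 2m, where m and M are the extrema of \<beta> - u0''. No
  smallness of the perturbation enters.\<close>

theorem monotone_profile_stable:
 assumes d: "d > 0" and L: "L > 0" and u0: "Ck_on 2 {-d..d} u0"
  and \<beta>: "\<beta> > (SUP y\<in>{-d..d}. D2 d u0 y)"
 shows "lyapunov_stable d L \<beta> u0"
proof -
 have u1: "Ck_on (Suc 0) {-d..d} (D1 d u0)" using u0 by (simp add: numeral_2_eq_2)
 have du0: "(D1 d u0 has_real_derivative D2 d u0 y) (at y within {-d..d})" if "y \<in> {-d..d}" for y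
  by (rule partials_of_C1_interval[OF d u1 that])
 have cD1: "continuous_on {-d..d} (D1 d u0)" using du0 by (rule DERIV_continuous_on)
 have cD2: "continuous_on {-d..d} (D2 d u0)" using u1 by simp
 define f where "f y = \<beta> * y - D1 d u0 y" for y
 have df: "(f has_real_derivative (\<beta> - D2 d u0 y)) (at y within {-d..d})" if "y \<in> {-d..d}" for y
  unfolding f_def[abs_def] by (rule DERIV_cong, (rule DERIV_diff DERIV_cmult DERIV_ident du0 that)+) simp
 have ne: "{-d..d} \<noteq> {}" using d by simp
 have c: "continuous_on {-d..d} (%y. \<beta> - D2 d u0 y)" by (intro continuous_intros cD2)
 obtain ym where ym: "ym \<in> {-d..d}" "!!y. y \<in> {-d..d} ==> \<beta> - D2 d u0 ym \<le> \<beta> - D2 d u0 y"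
  using continuous_attains_inf[OF compact_Icc ne c] by blast
 obtain yM where yM: "yM \<in> {-d..d}" "!!y. y \<in> {-d..d} ==> \<beta> - D2 d u0 y \<le> \<beta> - D2 d u0 yM"
  using continuous_attains_sup[OF compact_Icc ne c] by blast
 define m M where "m = \<beta> - D2 d u0 ym" and "M = \<beta> - D2 d u0 yM"
 have "bdd_above (D2 d u0 ` {-d..d})"
  by (intro bounded_imp_bdd_above compact_imp_bounded compact_continuous_image[OF cD2 compact_Icc])
 then have m0: "0 < m" using cSUP_upper[OF ym(1)] \<beta> by (fastforce simp: m_def)
 have mM: "m \<le> M" using ym(2)[OF yM(1)] by (simp add: m_def M_def)
 have fb: "m * (y2 - y1) \<le> f y2 - f y1 \<and> f y2 - f y1 \<le> M * (y2 - y1)"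
  if y: "-d \<le> y1" "y1 \<le> y2" "y2 \<le> d" for y1 y2
 proof (cases "y1 = y2")
  case False
  with y have lt: "y1 < y2" by simp
  obtain xi where xi: "xi \<in> {y1<..<y2}" "f y2 - f y1 = (\<beta> - D2 d u0 xi) * (y2 - y1)"
   by (rule Icc_derivative_attains[OF df y(1) lt y(3)])
  have "m \<le> \<beta> - D2 d u0 xi" "\<beta> - D2 d u0 xi \<le> M" using ym(2)[of xi] yM(2)[of xi] xi(1) y by (auto simp: m_def M_def)
  then show ?thesis unfolding xi(2) using y by (auto intro: mult_right_mono)
 qed simp
 obtain Y Ph where Y: "continuous_on UNIV Y" and Ph: "!!s. (Ph has_real_derivative Y s) (at s)"
  and low: "!!s y. y \<in> {-d..d} ==> (s - f y)\<^sup>2 / (2 * M) \<le> Ph s - Ph (f y) - y * (s - f y)"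
  and up: "!!s y. y \<in> {-d..d} ==> Ph s - Ph (f y) - y * (s - f y) \<le> (s - f y)\<^sup>2 / (2 * m)"
  using convex_casimir[OF d m0 mM fb] by blast
 have Phc: "continuous_on UNIV Ph" using Ph by (auto intro: DERIV_continuous_on)
 have cf: "continuous_on {-d..d} f" unfolding f_def by (intro continuous_intros cD1)
 show ?thesis unfolding lyapunov_stable_def
 proof (intro allI impI)
  fix ep :: real assume ep: "ep > 0"
  \<comment> \<open>From q(t) / (2M) \<le> E(t) = E(0) \<le> q(0) / (2m), where q is the squared
    distance, the distance can grow at most by the factor sqrt(M/m).\<close>
  define de where "de = ep * sqrt (m / M)"
  have de: "de > 0" "de\<^sup>2 = ep\<^sup>2 * (m / M)" using ep m0 mM by (auto simp: de_def power_mult_distrib)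
  have "vorticity_deviation d L u0 u v t < ep"
   if sol: "global_solution d L \<beta> u v" and dev0: "vorticity_deviation d L u0 u v 0 < de" and t: "t > 0" for u v t
  proof -
   interpret flow d L \<beta> u v using d L sol by unfold_locales
   define q where "q t = rect_int 0 L (-d) d (%x y. (ze (t, x, y) - f y)\<^sup>2)" for t
   define E where "E t = rect_int 0 L (-d) d (%x y. Ph (ze (t, x, y)) - Ph (f y) - y * (ze (t, x, y) - f y))" for t
   have cz: "continuous_on ({0..L} \<times> {-d..d}) (%(x, y). ze (t, x, y))" if "t \<ge> 0" for t
    using cont_rect[OF cont_ze that] by simp
   have cfr: "continuous_on ({0..L} \<times> {-d..d}) (%p. f (snd p))"
    by (rule continuous_on_compose2[OF cf]) (auto intro!: continuous_intros)
   have cq: "continuous_on ({0..L} \<times> {-d..d}) (%(x, y). ze (t, x, y) - f y)" if "t \<ge> 0" for t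
    using continuous_on_diff[OF cz[OF that] cfr] by (simp add: split_beta)
   have cq2: "continuous_on ({0..L} \<times> {-d..d}) (%(x, y). (ze (t, x, y) - f y)\<^sup>2 / K)" if "t \<ge> 0" for t K
    using continuous_on_mult[OF continuous_on_power[OF cq[OF that], of 2] continuous_on_const[of _ "1/K"]] by (simp add: split_beta)
   have cPhf: "continuous_on ({0..L} \<times> {-d..d}) (%p. Ph (f (snd p)))"
    by (rule continuous_on_compose2[OF Phc cfr]) auto
   have cPhz: "continuous_on ({0..L} \<times> {-d..d}) (%p. Ph ((%(x, y). ze (t, x, y)) p))" if "t \<ge> 0" for t
    by (rule continuous_on_compose2[OF Phc cz[OF that]]) auto
   have cE: "continuous_on ({0..L} \<times> {-d..d}) (%(x, y). Ph (ze (t, x, y)) - Ph (f y) - y * (ze (t, x, y) - f y))" if "t \<ge> 0" for t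
    using continuous_on_diff[OF continuous_on_diff[OF cPhz[OF that] cPhf]
      continuous_on_mult[OF continuous_on_snd[OF continuous_on_id] cq[OF that]]] by (simp add: split_beta)
   have qdev: "vorticity_deviation d L u0 u v t = sqrt (q t)" if "t \<ge> 0" for t
   proof -
    have e: "(%(x, y). vorticity d u v (t, x, y) - (- D1 d u0 y)) = (%(x, y). ze (t, x, y) - f y)"
     by (auto simp: ze_def f_def)
    show ?thesis unfolding vorticity_deviation_def e using L2_norm_cell[OF cq[OF that]] by (simp add: q_def)
   qed
   have qE: "q t / (2 * M) \<le> E t" "E t \<le> q t / (2 * m)" if "t \<ge> 0" for t
   proof -
    have q: "rect_int 0 L (-d) d (%x y. (ze (t, x, y) - f y)\<^sup>2 / K) = q t / K" for K
     using rect_int_mult[of 0 L "-d" d "1/K" "%x y. (ze (t, x, y) - f y)\<^sup>2"] by (simp add: q_def)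
    show "q t / (2 * M) \<le> E t" "E t \<le> q t / (2 * m)" unfolding E_def q[symmetric]
     by (rule rect_int_mono; use cq2 cE low up that in auto)+
   qed
   \<comment> \<open>The remaining terms, y f and Ph f, do not depend on time, so \<open>E\<close>
     differs from the conserved functional by a constant.\<close>
   have Esplit: "E t = rect_int 0 L (-d) d (%x y. Ph (ze (t, x, y)) - y * ze (t, x, y))
      + rect_int 0 L (-d) d (%x y. y * f y - Ph (f y))" if "t \<ge> 0" for t
   proof -
    have "E t = rect_int 0 L (-d) d (%x y. (Ph (ze (t, x, y)) - y * ze (t, x, y)) + (y * f y - Ph (f y)))"
     unfolding E_def by (rule rect_int_cong) (simp add: algebra_simps)
    also have "... = rect_int 0 L (-d) d (%x y. Ph (ze (t, x, y)) - y * ze (t, x, y))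
      + rect_int 0 L (-d) d (%x y. y * f y - Ph (f y))"
    proof (rule rect_int_add)
     show "continuous_on ({0..L} \<times> {-d..d}) (%(x, y). Ph (ze (t, x, y)) - y * ze (t, x, y))"
      using continuous_on_diff[OF cPhz[OF that] continuous_on_mult[OF continuous_on_snd[OF continuous_on_id] cz[OF that]]]
      by (simp add: split_beta)
     show "continuous_on ({0..L} \<times> {-d..d}) (%(x, y). y * f y - Ph (f y))"
      using continuous_on_diff[OF continuous_on_mult[OF continuous_on_snd[OF continuous_on_id] cfr] cPhf]
      by (simp add: split_beta)
    qed
    finally show ?thesis .
   qed
   have "E t = E 0" using Esplit[of t] Esplit[of 0] casimir_momentum_conserved[OF Ph Y, of t] t by simp
   then have "q t / (2 * M) \<le> q 0 / (2 * m)" using qE(1)[of t] qE(2)[of 0] t by simp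
   moreover have "q 0 < de\<^sup>2"
    using dev0 qdev[of 0] by (metis order_refl real_sqrt_less_iff real_sqrt_abs abs_of_pos de(1))
   ultimately have "q t / (2 * M) < de\<^sup>2 / (2 * m)" using m0 by (smt (verit) divide_strict_right_mono)
   then have "q t < ep\<^sup>2" unfolding de(2) using m0 mM by (simp add: field_simps)
   then show ?thesis using qdev[of t] t ep real_sqrt_less_iff[of "q t" "ep\<^sup>2"] by simp
  qed
  then show "\<exists>de>0. \<forall>u v. global_solution d L \<beta> u v \<and> vorticity_deviation d L u0 u v 0 < de -->
    (\<forall>t>0. vorticity_deviation d L u0 u v t < ep)" using de(1) by blast
 qed
qed

section \<open>Second-order equations on an interval\<close>

text \<open>The equation w'' = p w + g as a first-order system for the pair (w, w'), with one-sided
  derivatives at the ends. Carrying w' explicitly lets Wronskians and initial data be written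
  without iterated derivatives.\<close>

definition sol2 :: "real => real => (real => real) => (real => real) => (real => real) => (real => real) => bool" where
 "sol2 a b p g w w' \<longleftrightarrow> (\<forall>y\<in>{a..b}. (w has_real_derivative w' y) (at y within {a..b}) \<and>
   (w' has_real_derivative p y * w y + g y) (at y within {a..b}))"

lemma sol2D:
 assumes "sol2 a b p g w w'" "y \<in> {a..b}"
 shows "(w has_real_derivative w' y) (at y within {a..b})"
  "(w' has_real_derivative p y * w y + g y) (at y within {a..b})" using assms by (auto simp: sol2_def)

lemma sol2_continuous:
 assumes "sol2 a b p g w w'"
 shows "continuous_on {a..b} w" "continuous_on {a..b} w'"
 using DERIV_continuous_on[of "{a..b}" w w'] DERIV_continuous_on[of "{a..b}" w' "%y. p y * w y + g y"] sol2D[OF assms]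
 by blast+

lemma sol2_linear:
 assumes "sol2 a b p g w w'" "sol2 a b p h z z'"
 shows "sol2 a b p (%y. g y + c * h y) (%y. w y + c * z y) (%y. w' y + c * z' y)" unfolding sol2_def
proof (intro ballI conjI)
 fix y assume y: "y \<in> {a..b}"
 show "((%y. w y + c * z y) has_real_derivative w' y + c * z' y) (at y within {a..b})"
  by (intro DERIV_add DERIV_cmult sol2D(1)[OF assms(1)] sol2D(1)[OF assms(2)] y)
 show "((%y. w' y + c * z' y) has_real_derivative p y * (w y + c * z y) + (g y + c * h y)) (at y within {a..b})"
  by (rule DERIV_cong[OF DERIV_add[OF sol2D(2)[OF assms(1) y] DERIV_cmult[OF sol2D(2)[OF assms(2) y]]]])
    (simp add: algebra_simps)
qed

lemma sol2_cong:
 assumes "sol2 a b p g w w'" "!!y. y \<in> {a..b} ==> p y * w y + g y = p' y * w y + g' y"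
 shows "sol2 a b p' g' w w'" using assms unfolding sol2_def by auto

section \<open>Wronskians, zeros and comparison\<close>

lemma wronskian_derivative:
 assumes "sol2 a b p1 g1 w1 w1'" "sol2 a b p2 g2 w2 w2'" "y \<in> {a..b}"
 shows "((%y. w1' y * w2 y - w1 y * w2' y) has_real_derivative
   ((p1 y - p2 y) * (w1 y * w2 y) + g1 y * w2 y - w1 y * g2 y)) (at y within {a..b})"
 by (rule DERIV_cong[OF DERIV_diff[OF DERIV_mult[OF sol2D(2)[OF assms(1,3)] sol2D(1)[OF assms(2,3)]]
    DERIV_mult[OF sol2D(1)[OF assms(1,3)] sol2D(2)[OF assms(2,3)]]]])
   (simp add: algebra_simps)

lemma wronskian_const:
 assumes "sol2 a b p (%_. 0) w1 w1'" "sol2 a b p (%_. 0) w2 w2'" "y \<in> {a..b}"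
 shows "w1' y * w2 y - w1 y * w2' y = w1' a * w2 a - w1 a * w2' a"
proof -
 have "((%y. w1' y * w2 y - w1 y * w2' y) has_real_derivative 0) (at y within {a..b})" if "y \<in> {a..b}" for y
  using wronskian_derivative[OF assms(1,2) that] by simp
 then obtain c where c: "\<forall>y\<in>{a..b}. w1' y * w2 y - w1 y * w2' y = c"
  using has_field_derivative_zero_constant[OF convex_real_interval(5)] by blast
 then show ?thesis using c[rule_format, of y] c[rule_format, of a] assms(3) by simp
qed

lemma ode_exists:
 assumes ab: "a \<le> b" and p: "continuous_on {a..b} p"
 obtains h h' where "sol2 a b p (%_. 0) h h'" "h a = A" "h' a = B"
proof -
 have c: "continuous_on ({0::real} \<times> {a..b}) (%q. p (snd q))"
  by (rule continuous_on_compose2[OF p]) (auto intro!: continuous_intros)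
 show thesis
 proof (rule linear_ode_solution[OF ab compact_sing c, where A=A and B=B])
  fix h h'
  assume h: "!!c y. c \<in> {0} ==> y \<in> {a..b} ==> ((%y. h (c, y)) has_real_derivative h' (c, y)) (at y within {a..b})"
   "!!c y. c \<in> {0} ==> y \<in> {a..b} ==> ((%y. h' (c, y)) has_real_derivative p (snd (c, y)) * h (c, y)) (at y within {a..b})"
   "!!c. c \<in> {0} ==> h (c, a) = A" "!!c. c \<in> {0} ==> h' (c, a) = B"
  show thesis by (rule that[of "%y. h (0, y)" "%y. h' (0, y)"]) (use h[of 0] in \<open>simp_all add: sol2_def\<close>)
 qed
qed

text \<open>The positive initial slope keeps \<open>h\<close> positive on a short interval (a, a +
  r], so the points of [a + r, b] where \<open>h\<close> is nonpositive form a compact set, whose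
  least element is the zero sought.\<close>

lemma first_zero:
 fixes h :: "real => real"
 assumes ab: "a < b" and c: "continuous_on {a..b} h" and h: "h a = 0" "(h has_real_derivative D) (at a within {a..b})" "D > 0"
  and y1: "y1 \<in> {a<..b}" "h y1 \<le> 0"
 obtains y0 where "y0 \<in> {a<..b}" "h y0 = 0" "!!y. y \<in> {a<..<y0} ==> h y > 0"
proof -
 obtain e where e: "e > 0" "!!s. s > 0 ==> a + s \<in> {a..b} ==> s < e ==> h a < h (a + s)"
  using has_real_derivative_pos_inc_right[OF h(2,3)] by blast
 define r where "r = min (e/2) ((y1 - a) / 2)"
 have r: "r > 0" "r < e" "a + r < y1" using e(1) y1 by (auto simp: r_def min_def field_simps)
 have pos: "h y > 0" if "y \<in> {a<..a+r}" for y using e(2)[of "y - a"] that r y1 h(1) by auto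
 define S where "S = {y\<in>{a+r..b}. h y \<in> {..0}}"
 have "continuous_on {a+r..b} h" by (rule continuous_on_subset[OF c]) (use r in auto)
 from continuous_closed_preimage[OF this closed_atLeastAtMost closed_atMost, of 0]
 have "closed S" unfolding S_def by (simp add: vimage_def Int_def)
 then have "compact S" unfolding compact_eq_bounded_closed by (auto intro: bounded_subset[of "{a+r..b}"] simp: S_def)
 moreover have "y1 \<in> S" using y1 r by (auto simp: S_def)
 ultimately obtain y0 where y0: "y0 \<in> S" "!!y. y \<in> S ==> y0 \<le> y" using compact_attains_inf[of S] by blast
 have posb: "h y > 0" if "y \<in> {a<..<y0}" for y using pos[of y] y0(2)[of y] that y0(1) by (force simp: S_def)
 have y0b: "y0 \<in> {a+r..b}" "h y0 \<le> 0" using y0(1) by (auto simp: S_def)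
 have "y0 \<noteq> a + r" using pos[of "a+r"] y0b r by auto
 have "h y0 = 0"
 proof (rule ccontr)
  assume "h y0 \<noteq> 0"
  then have neg: "h y0 < 0" using y0b by simp
  have "\<exists>x\<ge>a+r. x \<le> y0 \<and> h x = 0"
   by (rule IVT2') (use pos[of "a+r"] r neg y0b continuous_on_subset[OF c] in \<open>auto intro: less_imp_le\<close>)
  then obtain x where x: "a + r \<le> x" "x \<le> y0" "h x = 0" by blast
  then have "x \<in> S" using y0b by (auto simp: S_def)
  with y0(2) x have "x = y0" by force
  with x neg show False by simp
 qed
 with y0b r posb show thesis by (intro that[of y0]) auto
qed

lemma deriv_nonpos_at_zero:
 fixes h :: "real => real"
 assumes "(h has_real_derivative D) (at y0 within {a..b})" "y0 \<in> {a<..b}" "h y0 = 0" "!!y. y \<in> {a<..<y0} ==> h y > 0"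
 shows "D \<le> 0"
proof (rule ccontr)
 assume "\<not> D \<le> 0"
 then obtain e where e: "e > 0" "!!s. s > 0 ==> y0 - s \<in> {a..b} ==> s < e ==> h (y0 - s) < h y0"
  using has_real_derivative_pos_inc_left[OF assms(1)] by (metis not_le)
 define s where "s = min (e/2) ((y0 - a)/2)"
 have s: "s > 0" "s < e" "a < y0 - s" using e(1) assms(2) by (auto simp: s_def min_def field_simps)
 then show False using e(2)[of s] assms(3) assms(4)[of "y0 - s"] assms(2) by force
qed

text \<open>Sturm comparison. The Wronskian h' ph - h ph' is 0 at \<open>a\<close> and strictly
  increases up to a first zero of \<open>h\<close>; but at such a zero it equals h' ph, which is at
  most 0.\<close>

lemma sturm_positive:
 assumes ab: "a < b" and ph: "sol2 a b p1 (%_. 0) ph ph'" and h: "sol2 a b p2 (%_. 0) h h'"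
  and i: "ph a = 0" "h a = 0" "h' a > 0"
  and pos: "!!y. y \<in> {a<..<b} ==> ph y > 0" "ph b \<ge> 0"
  and p: "!!y. y \<in> {a<..<b} ==> p1 y < p2 y"
  and y: "y \<in> {a<..b}"
 shows "h y > 0"
proof (rule ccontr)
 assume "\<not> h y > 0"
 then have neg: "h y \<le> 0" by simp
 have "a \<in> {a..b}" using ab by simp
 from sol2D(1)[OF h this]
 obtain y0 where y0: "y0 \<in> {a<..b}" "h y0 = 0" "!!y. y \<in> {a<..<y0} ==> h y > 0"
  using first_zero[OF ab sol2_continuous(1)[OF h] i(2) _ i(3) y neg] by blast
 define W where "W y = h' y * ph y - h y * ph' y" for y
 have dW: "(W has_real_derivative ((p2 y - p1 y) * (h y * ph y))) (at y within {a..b})" if "y \<in> {a..b}" for y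
  using wronskian_derivative[OF h ph that] by (simp add: W_def[abs_def])
 obtain xi where xi: "xi \<in> {a<..<y0}" "W y0 - W a = ((p2 xi - p1 xi) * (h xi * ph xi)) * (y0 - a)"
  by (rule Icc_derivative_attains[OF dW, of a y0]) (use y0 in auto)
 have "W y0 - W a > 0" unfolding xi(2)
  using p[of xi] pos(1)[of xi] y0(3)[OF xi(1)] xi(1) y0(1) by (intro mult_pos_pos) auto
 moreover have "h' y0 \<le> 0" by (rule deriv_nonpos_at_zero[OF sol2D(1)[OF h] y0(1,2,3)]) (use y0 in auto)
 moreover have "ph y0 \<ge> 0" using pos y0(1) by (cases "y0 = b") (auto simp: less_imp_le)
 ultimately show False using i y0(2) mult_nonpos_nonneg[of "h' y0" "ph y0"] by (simp add: W_def)
qed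

text \<open>At a double zero the Wronskian with the solution having data (1, 0) would vanish,
  whereas it is constantly 1.\<close>

lemma simple_zero:
 assumes p: "a \<le> b" "continuous_on {a..b} p" and h: "sol2 a b p (%_. 0) h h'" and i: "h a = 0" "h' a = 1"
  and y: "y \<in> {a..b}" "h y = 0"
 shows "h' y \<noteq> 0"
proof
 assume z: "h' y = 0"
 obtain g g' where g: "sol2 a b p (%_. 0) g g'" "g a = 1" "g' a = 0" by (rule ode_exists[OF p, of 1 0]) blast
 from wronskian_const[OF h g(1) y(1)] show False using z y i g by simp
qed

text \<open>Take the least parameter at which the initial value solution touches a nonpositive value
  on (a, b]. There it is nonnegative as a limit of positive solutions, and a zero inside would be a
  double one; so the zero sits at \<open>b\<close>.\<close>

lemma shooting:
 fixes p :: "real \<times> real => real"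
 assumes ab: "a < b" and c01: "c0 \<le> c1" and p: "continuous_on ({c0..c1} \<times> {a..b}) p"
  and p0: "!!y. y \<in> {a<..<b} ==> p (c0, y) > 0"
  and p1: "!!h h'. sol2 a b (%y. p (c1, y)) (%_. 0) h h' ==> h a = 0 ==> h' a = 1 ==> \<exists>y\<in>{a<..<b}. h y \<le> 0"
 obtains c ph ph' where "c \<in> {c0..c1}" "sol2 a b (%y. p (c, y)) (%_. 0) ph ph'"
  "ph a = 0" "ph' a = 1" "ph b = 0" "!!y. y \<in> {a<..<b} ==> ph y > 0"
proof -
 obtain h h' where hc: "continuous_on ({c0..c1} \<times> {a..b}) h" "continuous_on ({c0..c1} \<times> {a..b}) h'"
  and hd: "!!c y. c \<in> {c0..c1} ==> y \<in> {a..b} ==> ((%y. h (c, y)) has_real_derivative h' (c, y)) (at y within {a..b})"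
  "!!c y. c \<in> {c0..c1} ==> y \<in> {a..b} ==> ((%y. h' (c, y)) has_real_derivative p (c, y) * h (c, y)) (at y within {a..b})"
  and hi: "!!c. c \<in> {c0..c1} ==> h (c, a) = 0" "!!c. c \<in> {c0..c1} ==> h' (c, a) = 1"
  using linear_ode_solution[OF less_imp_le[OF ab] compact_Icc p, of 0 1] by metis
 have s: "sol2 a b (%y. p (c, y)) (%_. 0) (%y. h (c, y)) (%y. h' (c, y))" if "c \<in> {c0..c1}" for c
  using hd[OF that] by (simp add: sol2_def)
 have pc: "continuous_on {a..b} (%y. p (c, y))" if "c \<in> {c0..c1}" for c
  using continuous_on_slice[OF p, where g="Pair c" and A="{a..b}"] that by (simp add: continuous_on_Pair)
 have "uniformly_continuous_on ({c0..c1} \<times> {a..b}) h'"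
  by (rule compact_uniformly_continuous[OF hc(2) compact_Times[OF compact_Icc compact_Icc]])
 then obtain r0 where r0: "r0 > 0" "!!q q'. q \<in> {c0..c1} \<times> {a..b} ==> q' \<in> {c0..c1} \<times> {a..b} ==> dist q' q < r0 ==> dist (h' q') (h' q) < 1"
  unfolding uniformly_continuous_on_def by (meson zero_less_one)
 define r where "r = min (r0/2) (b - a)"
 have r: "0 < r" "r < r0" "a + r \<le> b" using r0(1) ab by (auto simp: r_def min_def)
 \<comment> \<open>All solutions vanish at \<open>a\<close>, so their zeros there must be kept away:
   the slope is 1 at \<open>a\<close>, and uniform continuity of \<open>h'\<close> gives a
   neighbourhood of \<open>a\<close> common to all parameters.\<close>
 have near: "h (c, y) > 0" if c: "c \<in> {c0..c1}" and y: "y \<in> {a<..a+r}" for c y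
 proof -
  obtain xi where xi: "xi \<in> {a<..<y}" "h (c, y) - h (c, a) = h' (c, xi) * (y - a)"
   by (rule Icc_derivative_attains[OF hd(1)[OF c], of a y]) (use y r in auto)
  have "dist (h' (c, xi)) (h' (c, a)) < 1"
   by (rule r0(2)) (use c xi y r ab in \<open>auto simp: dist_Pair_Pair dist_real_def\<close>)
  then have "h' (c, xi) > 0" using hi[OF c] by (auto simp: dist_real_def)
  then show ?thesis using xi hi[OF c] y by simp
 qed
 define Z where "Z = {q \<in> {c0..c1} \<times> {a+r..b}. h q \<in> {..0}}"
 have hcZ: "continuous_on ({c0..c1} \<times> {a+r..b}) h" by (rule continuous_on_subset[OF hc(1)]) (use r in auto)
 have "closed Z" unfolding Z_def
  using continuous_closed_preimage[OF hcZ closed_Times[OF closed_atLeastAtMost closed_atLeastAtMost] closed_atMost, of 0]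
  by (simp add: vimage_def Int_def)
 then have cZ: "compact Z" unfolding compact_eq_bounded_closed
  by (auto intro: bounded_subset[OF compact_imp_bounded[OF compact_Times[OF compact_Icc compact_Icc]], of _ c0 c1 "a+r" b] simp: Z_def)
 have inZ: "(c, y) \<in> Z" if "c \<in> {c0..c1}" "y \<in> {a<..b}" "h (c, y) \<le> 0" for c y
  using near[OF that(1), of y] that by (force simp: Z_def)
 obtain y1 where y1: "y1 \<in> {a<..<b}" "h (c1, y1) \<le> 0" using p1[OF s[of c1]] hi[of c1] c01 by auto
 then have "(c1, y1) \<in> Z" using inZ[of c1 y1] c01 by auto
 then have "fst ` Z \<noteq> {}" by blast
 moreover have "compact (fst ` Z)" by (rule compact_continuous_image[OF continuous_on_fst[OF continuous_on_id] cZ])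
 ultimately obtain c where c: "c \<in> fst ` Z" "!!c'. c' \<in> fst ` Z ==> c \<le> c'"
  using compact_attains_inf[of "fst ` Z"] by blast
 then obtain y0 where y0: "(c, y0) \<in> Z" by auto
 then have cI: "c \<in> {c0..c1}" and y0I: "y0 \<in> {a+r..b}" "h (c, y0) \<le> 0" by (auto simp: Z_def)
 \<comment> \<open>Comparison with y - a, the solution for the zero potential.\<close>
 have c0: "h (c0, y) > 0" if "y \<in> {a<..b}" for y
 proof (rule sturm_positive[OF ab _ s[of c0], of "%_. 0" "%y. y - a" "%_. 1"])
  show "sol2 a b (%_. 0) (%_. 0) (%y. y - a) (%_. 1)" by (auto simp: sol2_def intro!: derivative_eq_intros)
 qed (use that hi[of c0] c01 p0 ab in auto)
 have "c \<noteq> c0" using c0[of y0] y0I r by auto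
 then have cgt: "c0 < c" using cI by auto
 have nonneg: "h (c, y) \<ge> 0" if y: "y \<in> {a<..b}" for y
 proof (rule tendsto_lowerbound)
  have cc: "continuous_on {c0..c1} (%c. h (c, y))"
   using continuous_on_slice[OF hc(1), where g="%c. (c, y)" and A="{c0..c1}"] y by (simp add: continuous_on_Pair)
  have "((%c. h (c, y)) \<longlongrightarrow> h (c, y)) (at c within {c0..c1})" using cc cI by (simp add: continuous_on_def)
  then show "((%c. h (c, y)) \<longlongrightarrow> h (c, y)) (at c within {c0..<c})" by (rule tendsto_within_subset) (use cI in auto)
  show "\<forall>\<^sub>F c' in at c within {c0..<c}. 0 \<le> h (c', y)" unfolding eventually_at_filter
  proof (rule always_eventually, intro allI impI)
   fix c' assume "c' \<noteq> c" "c' \<in> {c0..<c}"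
   then have "(c', y) \<notin> Z" using c(2)[of c'] by (force simp: image_iff)
   then have "\<not> h (c', y) \<le> 0" using inZ[of c' y] y cI \<open>c' \<in> {c0..<c}\<close> by auto
   then show "0 \<le> h (c', y)" by simp
  qed
  show "at c within {c0..<c} \<noteq> bot" unfolding trivial_limit_within islimpt_approachable not_not
  proof (intro allI impI)
   fix e :: real assume "e > 0"
   then show "\<exists>x'\<in>{c0..<c}. x' \<noteq> c \<and> dist x' c < e"
    using cgt by (intro bexI[of _ "max c0 (c - e/2)"]) (auto simp: dist_real_def)
  qed
 qed
 have interior: "h (c, y) \<noteq> 0" if y: "y \<in> {a<..<b}" for y
 proof
  assume z: "h (c, y) = 0"
  have "((%y. h (c, y)) has_real_derivative h' (c, y)) (at y)"
   using hd(1)[OF cI, of y] y at_within_interior[of y "{a..b}"] by (simp add: interior_atLeastAtMost_real)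
  moreover define e where "e = min (y - a) (b - y)"
  moreover have "e > 0" using y by (auto simp: e_def)
  moreover have "\<forall>x. \<bar>y - x\<bar> < e --> h (c, y) \<le> h (c, x)"
  proof (intro allI impI)
   fix x assume "\<bar>y - x\<bar> < e"
   then have "x \<in> {a<..b}" by (auto simp: e_def)
   then show "h (c, y) \<le> h (c, x)" using nonneg z by simp
  qed
  ultimately have "h' (c, y) = 0" using DERIV_local_min by blast
  moreover have "h' (c, y) \<noteq> 0"
   by (rule simple_zero[OF less_imp_le[OF ab] pc[OF cI] s[OF cI]]) (use hi[OF cI] z y in auto)
  ultimately show False by simp
 qed
 have pos: "h (c, y) > 0" if "y \<in> {a<..<b}" for y using nonneg[of y] interior[OF that] that by force
 have "y0 = b" using pos[of y0] y0I r by force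
 then have "h (c, b) = 0" using nonneg[of b] y0I ab by auto
 with pos hi cI s show thesis by (intro that[of c "%y. h (c, y)" "%y. h' (c, y)"]) auto
qed

text \<open>\<open>ph\<close> vanishes at both ends and cannot serve as a weight. Raising the
  potential by \<open>ka\<close> makes the solution from (0, 1) positive up to and including
  \<open>b\<close> by Sturm; a small multiple of the solution from (1, 0) makes it positive at
  \<open>a\<close> as well, without destroying positivity elsewhere.\<close>

lemma positive_supersolution:
 assumes ab: "a < b" and pc: "continuous_on {a..b} p" and ph: "sol2 a b p (%_. 0) ph ph'"
  and i: "ph a = 0" "ph b = 0" "!!y. y \<in> {a<..<b} ==> ph y > 0" and ka: "ka > 0"
 obtains ro ro' where "sol2 a b (%y. p y + ka) (%_. 0) ro ro'" "!!y. y \<in> {a..b} ==> ro y > 0"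
proof -
 have pc': "continuous_on {a..b} (%y. p y + ka)" by (intro continuous_intros pc)
 obtain g g' where g: "sol2 a b (%y. p y + ka) (%_. 0) g g'" "g a = 1" "g' a = 0"
  by (rule ode_exists[OF less_imp_le[OF ab] pc', of 1 0]) blast
 obtain h h' where h: "sol2 a b (%y. p y + ka) (%_. 0) h h'" "h a = 0" "h' a = 1"
  by (rule ode_exists[OF less_imp_le[OF ab] pc', of 0 1]) blast
 have hpos: "h y > 0" if "y \<in> {a<..b}" for y by (rule sturm_positive[OF ab ph h(1)]) (use i h ka that in auto)
 have gc: "continuous_on {a..b} g" and hc: "continuous_on {a..b} h" using sol2_continuous g h by blast+
 obtain r0 where r0: "r0 > 0" "!!y. y \<in> {a..b} ==> dist y a < r0 ==> dist (g y) (g a) < 1"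
  using gc ab unfolding continuous_on_iff by (metis atLeastAtMost_iff less_imp_le order_refl zero_less_one)
 define r where "r = min (r0/2) (b - a)"
 have r: "0 < r" "r < r0" "a + r \<le> b" using r0(1) ab by (auto simp: r_def min_def)
 have gpos: "g y > 0" if "y \<in> {a..a+r}" for y using r0(2)[of y] that r g(2) by (auto simp: dist_real_def)
 obtain m where m: "m \<in> {a+r..b}" "!!y. y \<in> {a+r..b} ==> h m \<le> h y"
  using continuous_attains_inf[OF compact_Icc _ continuous_on_subset[OF hc], of "a+r" b] r by fastforce
 have hm: "h m > 0" using hpos[of m] m r by auto
 obtain M where M: "M > 0" "!!y. y \<in> {a..b} ==> \<bar>g y\<bar> \<le> M"
  using compact_imp_bounded[OF compact_continuous_image[OF gc compact_Icc]] unfolding bounded_pos by auto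
 define e where "e = h m / (2 * M)"
 have e: "e > 0" "e * M < h m" using hm M by (auto simp: e_def)
 have "h y + e * g y > 0" if y: "y \<in> {a..b}" for y
 proof (cases "y \<le> a + r")
  case True
  then have "e * g y > 0" using gpos[of y] e y by simp
  moreover have "h y \<ge> 0" using hpos[of y] y h(2) by (cases "y = a") (auto simp: less_imp_le)
  ultimately show ?thesis by simp
 next
  case False
  have "- (e * g y) \<le> e * M" using M(2)[OF y] e(1) by (metis abs_le_iff minus_le_iff mult_left_mono mult_minus_right less_imp_le)
  moreover have "h m \<le> h y" using m(2)[of y] False y by auto
  ultimately show ?thesis using e by linarith
 qed
 moreover have "sol2 a b (%y. p y + ka) (%_. 0) (%y. h y + e * g y) (%y. h' y + e * g' y)"
  using sol2_linear[OF h(1) g(1), of e] by simp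
 ultimately show thesis by (rule that[rotated])
qed

text \<open>The potential \<open>p\<close> may be negative, so w is compared with multiples of the
  positive solution \<open>ro\<close>. At a maximum of w / ro with value M > G / ka, the function M
  ro - w has a zero minimum, yet its second derivative there is at most (G - M ka) ro < 0.\<close>

lemma max_principle_upper:
 assumes ab: "a < b" and ro: "sol2 a b r (%_. 0) ro ro'" "!!y. y \<in> {a..b} ==> ro y > 0"
  and w: "sol2 a b p g w w'" "w a = 0" "w b = 0"
  and ka: "ka > 0" "!!y. y \<in> {a..b} ==> p y \<ge> r y + ka"
  and G: "G \<ge> 0" "!!y. y \<in> {a..b} ==> \<bar>g y\<bar> \<le> G * ro y" and y: "y \<in> {a..b}"
 shows "w y \<le> G / ka * ro y"
proof (rule ccontr)
 assume contra: "\<not> w y \<le> G / ka * ro y"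
 have c: "continuous_on {a..b} (%y. w y / ro y)"
  using ro(2) by (intro continuous_intros sol2_continuous(1)[OF w(1)] sol2_continuous(1)[OF ro(1)]) force
 obtain y0 where y0: "y0 \<in> {a..b}" "!!y. y \<in> {a..b} ==> w y / ro y \<le> w y0 / ro y0"
  using continuous_attains_sup[OF compact_Icc _ c] ab by auto
 define M where "M = w y0 / ro y0"
 have M: "G / ka < M"
 proof -
  have "G / ka < w y / ro y" using contra ro(2)[OF y] by (simp add: pos_less_divide_eq)
  then show ?thesis using y0(2)[OF y] by (simp add: M_def)
 qed
 then have M0: "M > 0" using G(1) ka(1) by (meson divide_nonneg_pos le_less_trans)
 have wM: "w y0 = M * ro y0" using ro(2)[OF y0(1)] by (simp add: M_def)
 have y0i: "y0 \<in> {a<..<b}"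
  using y0(1) w(2,3) M0 ro(2)[OF y0(1)] wM by (metis atLeastAtMost_iff greaterThanLessThan_iff less_eq_real_def mult_pos_pos order_less_irrefl)
 define k k' where "k y = M * ro y - w y" and "k' y = M * ro' y - w' y" for y
 have k: "(k has_real_derivative k' y) (at y within {a..b})" if "y \<in> {a..b}" for y
  unfolding k_def[abs_def] k'_def by (intro DERIV_diff DERIV_cmult sol2D(1)[OF ro(1) that] sol2D(1)[OF w(1) that])
 have dk': "(k' has_real_derivative (M * (r y0 * ro y0) - (p y0 * w y0 + g y0))) (at y0 within {a..b})"
  unfolding k'_def[abs_def] using DERIV_diff[OF DERIV_cmult[OF sol2D(2)[OF ro(1) y0(1)], of M] sol2D(2)[OF w(1) y0(1)]] by simp
 have kpos: "k y \<ge> 0" if "y \<in> {a..b}" for y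
  using y0(2)[OF that] ro(2)[OF that] by (simp add: k_def M_def[symmetric] field_simps)
 have k0: "k y0 = 0" by (simp add: k_def wM)
 have "(k has_real_derivative k' y0) (at y0)"
  using k[OF y0(1)] y0i at_within_interior[of y0 "{a..b}"] by (simp add: interior_atLeastAtMost_real)
 moreover have "\<forall>x. \<bar>y0 - x\<bar> < min (y0 - a) (b - y0) --> k y0 \<le> k x"
 proof (intro allI impI)
  fix x assume "\<bar>y0 - x\<bar> < min (y0 - a) (b - y0)"
  then have "x \<in> {a..b}" by (auto simp: abs_less_iff)
  then show "k y0 \<le> k x" using kpos k0 by simp
 qed
 ultimately have k'0: "k' y0 = 0" using DERIV_local_min[of k "k' y0" y0 "min (y0 - a) (b - y0)"] y0i by auto
 have "M * (r y0 * ro y0) - (p y0 * w y0 + g y0) = - (M * ro y0 * (p y0 - r y0)) - g y0"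
  by (simp add: wM algebra_simps)
 also have "... \<le> - (M * ro y0 * ka) + G * ro y0"
 proof -
  have "M * ro y0 * ka \<le> M * ro y0 * (p y0 - r y0)"
   using ka(2)[OF y0(1)] M0 ro(2)[OF y0(1)] by (intro mult_left_mono) auto
  moreover have "- g y0 \<le> G * ro y0" using G(2)[OF y0(1)] by auto
  ultimately show ?thesis by linarith
 qed
 also have "... = (G - M * ka) * ro y0" by (simp add: algebra_simps)
 also have "... < 0" using M ka(1) ro(2)[OF y0(1)] by (intro mult_neg_pos) (auto simp: field_simps)
 finally have "M * (r y0 * ro y0) - (p y0 * w y0 + g y0) < 0" .
 \<comment> \<open>The second derivative is used at \<open>y0\<close> only: \<open>k'\<close> is 0
   there and falls, so it is negative just to the right, and \<open>k\<close> becomes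
   negative.\<close>
 from has_real_derivative_neg_dec_right[OF dk' this]
 obtain e where e: "e > 0" "!!s. s > 0 ==> y0 + s \<in> {a..b} ==> s < e ==> k' (y0 + s) < 0" unfolding k'0 by blast
 define s where "s = min (e/2) (b - y0)"
 have s: "s > 0" "s < e" "y0 + s \<le> b" using e(1) y0i by (auto simp: s_def min_def)
 obtain xi where xi: "xi \<in> {y0<..<y0+s}" "k (y0+s) - k y0 = k' xi * (y0 + s - y0)"
  by (rule Icc_derivative_attains[OF k, of y0 "y0+s"]) (use y0i s in auto)
 have "k' xi < 0" using e(2)[of "xi - y0"] xi(1) s y0i by auto
 then have "k (y0 + s) < 0" using xi(2) s k0 by (simp add: mult_neg_pos)
 with kpos[of "y0+s"] s y0i show False by auto
qed

lemma max_principle: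
 assumes ab: "a < b" and ro: "sol2 a b r (%_. 0) ro ro'" "!!y. y \<in> {a..b} ==> ro y > 0"
  and w: "sol2 a b p g w w'" "w a = 0" "w b = 0"
  and ka: "ka > 0" "!!y. y \<in> {a..b} ==> p y \<ge> r y + ka"
  and G: "G \<ge> 0" "!!y. y \<in> {a..b} ==> \<bar>g y\<bar> \<le> G * ro y" and y: "y \<in> {a..b}"
 shows "\<bar>w y\<bar> \<le> G / ka * ro y"
proof -
 have "sol2 a b p (%y. - g y) (%y. - w y) (%y. - w' y)" unfolding sol2_def
 proof (intro ballI conjI)
  fix y assume y: "y \<in> {a..b}"
  show "((%y. - w y) has_real_derivative - w' y) (at y within {a..b})" by (intro DERIV_minus sol2D(1)[OF w(1) y])
  show "((%y. - w' y) has_real_derivative p y * - w y + - g y) (at y within {a..b})"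
   using DERIV_minus[OF sol2D(2)[OF w(1) y]] by simp
 qed
 from max_principle_upper[OF ab ro this _ _ ka G(1) _ y] max_principle_upper[OF ab ro w ka G y] w G(2)
 show ?thesis by (auto simp: abs_le_iff)
qed

section \<open>Inversion of a single Fourier mode\<close>

lemma variation_of_constants:
 assumes ab: "a \<le> b" and h1: "sol2 a b p (%_. 0) h1 h1'" "h1 a = 1" "h1' a = 0"
  and h2: "sol2 a b p (%_. 0) h2 h2'" "h2 a = 0" "h2' a = 1" and g: "continuous_on {a..b} g"
 shows "sol2 a b p g
   (%y. h2 y * integral {a..y} (%s. h1 s * g s) - h1 y * integral {a..y} (%s. h2 s * g s))
   (%y. h2' y * integral {a..y} (%s. h1 s * g s) - h1' y * integral {a..y} (%s. h2 s * g s))" unfolding sol2_def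
proof (intro ballI conjI)
 fix y assume y: "y \<in> {a..b}"
 have d1: "((%y. integral {a..y} (%s. h1 s * g s)) has_real_derivative h1 y * g y) (at y within {a..b})"
  by (rule integral_has_real_derivative[OF _ y]) (intro continuous_intros g sol2_continuous(1)[OF h1(1)])
 have d2: "((%y. integral {a..y} (%s. h2 s * g s)) has_real_derivative h2 y * g y) (at y within {a..b})"
  by (rule integral_has_real_derivative[OF _ y]) (intro continuous_intros g sol2_continuous(1)[OF h2(1)])
 have W: "h1 y * h2' y - h1' y * h2 y = 1" using wronskian_const[OF h2(1) h1(1) y] h1 h2 by (simp add: algebra_simps)
 show "((%y. h2 y * integral {a..y} (%s. h1 s * g s) - h1 y * integral {a..y} (%s. h2 s * g s)) has_real_derivative
   h2' y * integral {a..y} (%s. h1 s * g s) - h1' y * integral {a..y} (%s. h2 s * g s)) (at y within {a..b})"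
  by (rule DERIV_cong[OF DERIV_diff[OF DERIV_mult[OF sol2D(1)[OF h2(1) y] d1] DERIV_mult[OF sol2D(1)[OF h1(1) y] d2]]])
    (simp add: algebra_simps)
 have "(h1 y * h2' y - h1' y * h2 y) * g y = g y" using W by simp
 then show "((%y. h2' y * integral {a..y} (%s. h1 s * g s) - h1' y * integral {a..y} (%s. h2 s * g s)) has_real_derivative
   p y * (h2 y * integral {a..y} (%s. h1 s * g s) - h1 y * integral {a..y} (%s. h2 s * g s)) + g y) (at y within {a..b})"
  by (intro DERIV_cong[OF DERIV_diff[OF DERIV_mult[OF sol2D(2)[OF h2(1) y] d1] DERIV_mult[OF sol2D(2)[OF h1(1) y] d2]]])
    (simp add: algebra_simps)
qed

text \<open>A right inverse of w'' = p w + g with w(a) = 0. The constant \<open>C\<close> is meant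
  to be independent of the mode number; the gain (n + 1)^(-2) on w is what will make the cosine
  series summable in the strip, while for w' boundedness is enough.\<close>

definition mode_operator_spec ::
  "real => real => (real => real) => nat => real => ((real => real) => real => real) => ((real => real) => real => real) => bool" where
 "mode_operator_spec a b p n C W W' \<longleftrightarrow>
   (\<forall>g. continuous_on {a..b} g --> sol2 a b p g (W g) (W' g) \<and> W g a = 0) \<and>
   (\<forall>g G y. continuous_on {a..b} g --> (\<forall>y\<in>{a..b}. \<bar>g y\<bar> \<le> G) --> y \<in> {a..b} -->
    \<bar>W g y\<bar> \<le> C * G / (real n + 1)\<^sup>2 \<and> \<bar>W' g y\<bar> \<le> C * G) \<and>
   (\<forall>g h y. continuous_on {a..b} g --> continuous_on {a..b} h --> y \<in> {a..b} -->
    W (%y. g y - h y) y = W g y - W h y)"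

text \<open>Zero initial data are always admissible, also where the Dirichlet problem is singular.
  The price is that the value at \<open>b\<close> is not controlled and that there is no gain, as
  the index 0 in the specification expresses.\<close>

lemma initial_value_operator:
 assumes ab: "a < b" and pc: "continuous_on {a..b} p"
 obtains C W W' where "C \<ge> 0" "mode_operator_spec a b p 0 C W W'" "!!g. W' g a = 0"
proof -
 obtain h1 h1' where h1: "sol2 a b p (%_. 0) h1 h1'" "h1 a = 1" "h1' a = 0"
  by (rule ode_exists[OF less_imp_le[OF ab] pc, of 1 0]) blast
 obtain h2 h2' where h2: "sol2 a b p (%_. 0) h2 h2'" "h2 a = 0" "h2' a = 1"
  by (rule ode_exists[OF less_imp_le[OF ab] pc, of 0 1]) blast
 note c = sol2_continuous[OF h1(1)] sol2_continuous[OF h2(1)]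
 have bd: "\<exists>M. \<forall>y\<in>{a..b}. \<bar>f y\<bar> \<le> M" if "continuous_on {a..b} f" for f :: "real => real"
  using compact_imp_bounded[OF compact_continuous_image[OF that compact_Icc]] unfolding bounded_iff by auto
 from bd[OF c(1)] bd[OF c(2)] bd[OF c(3)] bd[OF c(4)] obtain M1 M2 M3 M4 where M:
  "!!y. y \<in> {a..b} ==> \<bar>h1 y\<bar> \<le> M1" "!!y. y \<in> {a..b} ==> \<bar>h1' y\<bar> \<le> M2"
  "!!y. y \<in> {a..b} ==> \<bar>h2 y\<bar> \<le> M3" "!!y. y \<in> {a..b} ==> \<bar>h2' y\<bar> \<le> M4" by metis
 define M where "M = \<bar>M1\<bar> + \<bar>M2\<bar> + \<bar>M3\<bar> + \<bar>M4\<bar>"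
 have M': "\<bar>h1 y\<bar> \<le> M" "\<bar>h1' y\<bar> \<le> M" "\<bar>h2 y\<bar> \<le> M" "\<bar>h2' y\<bar> \<le> M" if "y \<in> {a..b}" for y
  using M[OF that] by (auto simp: M_def)
 have M0: "M \<ge> 0" by (simp add: M_def)
 define W where "W g y = h2 y * integral {a..y} (%s. h1 s * g s) - h1 y * integral {a..y} (%s. h2 s * g s)" for g y
 define W' where "W' g y = h2' y * integral {a..y} (%s. h1 s * g s) - h1' y * integral {a..y} (%s. h2 s * g s)" for g y
 define C where "C = 2 * M\<^sup>2 * (b - a)"
 have C: "C \<ge> 0" using ab by (simp add: C_def)
 have sol: "sol2 a b p g (W g) (W' g) \<and> W g a = 0" if "continuous_on {a..b} g" for g :: "real => real"
  using variation_of_constants[OF less_imp_le[OF ab] h1 h2 that] by (simp add: W_def[abs_def] W'_def[abs_def])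
 have int: "(%s. h s * g s) integrable_on {a..y}" if "continuous_on {a..b} g" "y \<in> {a..b}" "continuous_on {a..b} h" for g h :: "real => real" and y
  by (rule integrable_continuous_interval, rule continuous_on_subset[of "{a..b}"])
    (use that in \<open>auto intro!: continuous_intros\<close>)
 have ib: "\<bar>integral {a..y} (%s. h s * g s)\<bar> \<le> (b - a) * (M * G)"
  if g: "continuous_on {a..b} g" "!!y. y \<in> {a..b} ==> \<bar>g y\<bar> \<le> G" and h: "continuous_on {a..b} h"
   "!!y. y \<in> {a..b} ==> \<bar>h y\<bar> \<le> M" and y: "y \<in> {a..b}" for g h :: "real => real" and y G
 proof -
  have "norm (integral {a..y} (%s. h s * g s)) \<le> integral {a..y} (%s. M * G)"
  proof (rule integral_norm_bound_integral[OF int[OF g(1) y h(1)]])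
   fix x assume "x \<in> {a..y}"
   with y have x: "x \<in> {a..b}" by auto
   show "norm (h x * g x) \<le> M * G"
    unfolding real_norm_def abs_mult by (rule mult_mono[OF h(2)[OF x] g(2)[OF x] M0]) simp
  qed (rule integrable_const_ivl)
  also have "... = (y - a) * (M * G)" using y by simp
  also have "... \<le> (b - a) * (M * G)"
  proof (rule mult_right_mono)
   have "0 \<le> G" using g(2)[OF y] by (meson abs_ge_zero order_trans)
   then show "0 \<le> M * G" using M0 by simp
  qed (use y in auto)
  finally show ?thesis by simp
 qed
 have Cb: "\<bar>u * I1 - v * I2\<bar> \<le> C * G"
  if "\<bar>u\<bar> \<le> M" "\<bar>v\<bar> \<le> M" "\<bar>I1\<bar> \<le> (b - a) * (M * G)" "\<bar>I2\<bar> \<le> (b - a) * (M * G)" for u v I1 I2 G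
 proof -
  have "\<bar>u * I1 - v * I2\<bar> \<le> \<bar>u\<bar> * \<bar>I1\<bar> + \<bar>v\<bar> * \<bar>I2\<bar>" by (metis abs_mult abs_triangle_ineq4)
  also have "... \<le> M * ((b - a) * (M * G)) + M * ((b - a) * (M * G))" by (intro add_mono mult_mono that M0) auto
  also have "... = C * G" by (simp add: C_def power2_eq_square algebra_simps)
  finally show ?thesis .
 qed
 have "mode_operator_spec a b p 0 C W W'" unfolding mode_operator_spec_def
 proof (intro conjI allI impI)
  fix g :: "real => real" and G y assume g: "continuous_on {a..b} g" "\<forall>y\<in>{a..b}. \<bar>g y\<bar> \<le> G" and y: "y \<in> {a..b}"
  have "\<bar>W g y\<bar> \<le> C * G" unfolding W_def by (rule Cb; (rule M' ib)?) (use g y c M' in auto)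
  then show "\<bar>W g y\<bar> \<le> C * G / (real 0 + 1)\<^sup>2" by simp
  show "\<bar>W' g y\<bar> \<le> C * G" unfolding W'_def by (rule Cb; (rule M' ib)?) (use g y c M' in auto)
 next
  fix g k :: "real => real" and y assume gk: "continuous_on {a..b} g" "continuous_on {a..b} k" and y: "y \<in> {a..b}"
  have I: "integral {a..y} (%s. h s * (g s - k s)) = integral {a..y} (%s. h s * g s) - integral {a..y} (%s. h s * k s)"
   if "continuous_on {a..b} h" for h
   using integral_diff[OF int[OF gk(1) y that] int[OF gk(2) y that]] by (simp add: right_diff_distrib)
  then show "W (%y. g y - k y) y = W g y - W k y" unfolding W_def I[OF c(1)] I[OF c(3)] by (simp add: algebra_simps)
 qed (use sol in auto)
 with C show thesis by (rule that) (simp add: W'_def)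
qed

text \<open>For n \<ge> 2 the potential exceeds that of \<open>ro\<close> by at least (n^2 - 2) k^2,
  so the maximum principle yields uniqueness and the bound at once, uniformly in n.\<close>

lemma dirichlet_operator:
 assumes ab: "a < b" and qc: "continuous_on {a..b} q" and k: "k > 0"
  and ro: "sol2 a b (%y. 2 * k\<^sup>2 - q y) (%_. 0) ro ro'" "!!y. y \<in> {a..b} ==> ro y > 0"
 shows "\<exists>C\<ge>0. \<forall>n\<ge>2. \<exists>W W'. mode_operator_spec a b (%y. (real n * k)\<^sup>2 - q y) n C W W' \<and>
   (\<forall>g. continuous_on {a..b} g --> W g b = 0)"
proof -
 have rc: "continuous_on {a..b} ro" using sol2_continuous ro by blast
 obtain m where m: "m \<in> {a..b}" "!!y. y \<in> {a..b} ==> ro m \<le> ro y"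
  using continuous_attains_inf[OF compact_Icc _ rc] ab by fastforce
 obtain M where M: "M \<in> {a..b}" "!!y. y \<in> {a..b} ==> ro y \<le> ro M"
  using continuous_attains_sup[OF compact_Icc _ rc] ab by fastforce
 obtain Q where Q: "Q > 0" "!!y. y \<in> {a..b} ==> \<bar>q y\<bar> \<le> Q"
  using compact_imp_bounded[OF compact_continuous_image[OF qc compact_Icc]] unfolding bounded_pos by auto
 have rm: "ro m > 0" using ro(2) m by blast
 define C1 where "C1 = ro M / ro m * (9 / (2 * k\<^sup>2))"
 define C2 where "C2 = (b - a) * ((k\<^sup>2 + Q) * C1 + 1)"
 define C where "C = C1 + C2"
 have C1: "C1 > 0" using rm ro(2)[OF M(1)] k by (simp add: C1_def)
 then have C2: "C2 > 0" using ab Q k by (simp add: C2_def add_nonneg_pos)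
 have "\<exists>W W'. mode_operator_spec a b (%y. (real n * k)\<^sup>2 - q y) n C W W' \<and>
   (\<forall>g. continuous_on {a..b} g --> W g b = 0)" if n: "n \<ge> 2" for n
 proof -
  define p where "p y = (real n * k)\<^sup>2 - q y" for y
  have pc: "continuous_on {a..b} p" unfolding p_def by (intro continuous_intros qc)
  define ka where "ka = ((real n)\<^sup>2 - 2) * k\<^sup>2"
  have n4: "(real n)\<^sup>2 \<ge> 4" using power_mono[of 2 "real n" 2] n by simp
  have ka: "ka > 0" "p y \<ge> 2 * k\<^sup>2 - q y + ka" for y
   using k n4 by (auto simp: ka_def p_def power_mult_distrib algebra_simps)
  \<comment> \<open>The ratio (n + 1)^2 / (n^2 - 2) is largest at n = 2, where it equals
    9/2.\<close>
  have nk: "(real n + 1)\<^sup>2 / ka \<le> 9 / (2 * k\<^sup>2)"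
  proof -
   have "real n \<ge> 2" using n by simp
   then have "0 \<le> (7 * real n + 10) * (real n - 2)" by simp
   then have "2 * (real n + 1)\<^sup>2 \<le> 9 * ((real n)\<^sup>2 - 2)" by (simp add: power2_eq_square algebra_simps)
   then have "(real n + 1)\<^sup>2 / ka \<le> (9/2 * ((real n)\<^sup>2 - 2)) / ka" using ka(1) by (intro divide_right_mono) auto
   also have "... = 9 / (2 * k\<^sup>2)"
   proof -
    have "(9/2 * X) / (X * k\<^sup>2) = 9 / (2 * k\<^sup>2)" if "X \<noteq> 0" for X :: real using that by simp
    from this[of "(real n)\<^sup>2 - 2"] show ?thesis using n4 unfolding ka_def by simp
   qed
   finally show ?thesis .
  qed
  have bound: "\<bar>w y\<bar> \<le> C1 * G / (real n + 1)\<^sup>2"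
   if w: "sol2 a b p g w w'" "w a = 0" "w b = 0" and G: "!!y. y \<in> {a..b} ==> \<bar>g y\<bar> \<le> G" and y: "y \<in> {a..b}"
   for g w w' G y
  proof -
   have G0: "G \<ge> 0" using G[OF y] by (meson abs_ge_zero order_trans)
   have "\<bar>w y\<bar> \<le> (G / ro m) / ka * ro y"
   proof (rule max_principle[OF ab ro w ka(1) ka(2) _ _ y])
    fix y assume y: "y \<in> {a..b}"
    have "\<bar>g y\<bar> \<le> G / ro m * ro m" using G[OF y] rm by simp
    also have "... \<le> G / ro m * ro y" using m(2)[OF y] G0 rm by (intro mult_left_mono) auto
    finally show "\<bar>g y\<bar> \<le> G / ro m * ro y" .
   qed (use G0 rm in auto)
   also have "... \<le> (G / ro m) / ka * ro M" using M(2)[OF y] G0 rm ka by (intro mult_left_mono) auto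
   also have "... = ro M / ro m * G / (real n + 1)\<^sup>2 * ((real n + 1)\<^sup>2 / ka)" by (simp add: add_eq_0_iff)
   also have "... \<le> ro M / ro m * G / (real n + 1)\<^sup>2 * (9 / (2 * k\<^sup>2))"
    using nk G0 rm ro(2)[OF M(1)] by (intro mult_left_mono) auto
   also have "... = C1 * G / (real n + 1)\<^sup>2" by (simp add: C1_def mult_ac)
   finally show ?thesis .
  qed
  obtain h h' where h: "sol2 a b p (%_. 0) h h'" "h a = 0" "h' a = 1"
   by (rule ode_exists[OF less_imp_le[OF ab] pc, of 0 1]) blast
  \<comment> \<open>Otherwise \<open>h\<close> would solve the homogeneous Dirichlet problem and
    vanish by the bound. Subtracting a multiple of \<open>h\<close> can therefore enforce the
    condition at \<open>b\<close>.\<close>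
  have hb: "h b \<noteq> 0"
  proof
   assume hb: "h b = 0"
   have "h y = 0" if "y \<in> {a..b}" for y using bound[OF h(1,2) hb, of 0 y] that by simp
   then have "((%_. 0) has_real_derivative h' a) (at a within {a..b})"
    by (intro DERIV_transform_on[OF sol2D(1)[OF h(1), of a]]) (use ab in auto)
   moreover have "((%_. 0) has_real_derivative 0) (at a within {a..b})" by simp
   ultimately have "h' a = 0" using DERIV_unique_thick[OF thick_Icc[OF ab]] ab by (meson atLeastAtMost_iff less_imp_le order_refl)
   with h show False by simp
  qed
  obtain V V' C0 where V: "mode_operator_spec a b p 0 C0 V V'" by (rule initial_value_operator[OF ab pc]) blast
  define W where "W g y = V g y + (- V g b / h b) * h y" for g y
  define W' where "W' g y = V' g y + (- V g b / h b) * h' y" for g y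
  have sol: "sol2 a b p g (W g) (W' g)" "W g a = 0" "W g b = 0" if "continuous_on {a..b} g" for g
  proof -
   have s: "sol2 a b p g (V g) (V' g)" "V g a = 0" using V that by (auto simp: mode_operator_spec_def)
   show "sol2 a b p g (W g) (W' g)" "W g a = 0" "W g b = 0"
    using sol2_linear[OF s(1) h(1), of "- V g b / h b"] s h hb by (simp_all add: W_def[abs_def] W'_def[abs_def])
  qed
  have "mode_operator_spec a b p n C W W'" unfolding mode_operator_spec_def
  proof (intro conjI allI impI)
   fix g :: "real => real" and G y assume g: "continuous_on {a..b} g" "\<forall>y\<in>{a..b}. \<bar>g y\<bar> \<le> G" and y: "y \<in> {a..b}"
   have G0: "G \<ge> 0" using g(2) y by (meson abs_ge_zero order_trans)
   have b1: "\<bar>W g y\<bar> \<le> C1 * G / (real n + 1)\<^sup>2" if "y \<in> {a..b}" for y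
    by (rule bound[OF sol[OF g(1)] _ that]) (use g in auto)
   also have "C1 * G / (real n + 1)\<^sup>2 \<le> C * G / (real n + 1)\<^sup>2"
    using C2 G0 by (intro divide_right_mono mult_right_mono) (auto simp: C_def)
   finally show "\<bar>W g y\<bar> \<le> C * G / (real n + 1)\<^sup>2" using y by blast
   \<comment> \<open>Rolle's theorem gives a zero of w', from which w' is recovered by integrating
     w''. In w'' the growth n^2 of the potential is cancelled by the decay of w, so the bound is
     uniform in n.\<close>
   have "\<exists>z\<in>{a<..<b}. W g b - W g a = W' g z * (b - a)"
    by (rule Icc_derivative_attains[OF sol2D(1)[OF sol(1)[OF g(1)]], of a b]) (use ab in auto)
   then obtain z where z: "z \<in> {a<..<b}" "W' g z = 0" using sol[OF g(1)] ab by auto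
   have d2: "\<bar>p y * W g y + g y\<bar> \<le> (k\<^sup>2 + Q) * C1 * G + G" if y: "y \<in> {a..b}" for y
   proof -
    have "\<bar>p y\<bar> \<le> (real n * k)\<^sup>2 + Q" using Q(2)[OF y] zero_le_power2[of "real n * k"] unfolding p_def by linarith
    also have "... \<le> (real n + 1)\<^sup>2 * (k\<^sup>2 + Q)"
    proof -
     have "(real n)\<^sup>2 \<le> (real n + 1)\<^sup>2" "1 \<le> (real n + 1)\<^sup>2" by (auto simp: power2_eq_square algebra_simps)
     then have "(real n)\<^sup>2 * k\<^sup>2 \<le> (real n + 1)\<^sup>2 * k\<^sup>2" "1 * Q \<le> (real n + 1)\<^sup>2 * Q"
      using Q by (auto intro!: mult_right_mono)
     then show ?thesis by (simp add: power_mult_distrib distrib_left)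
    qed
    finally have pb: "\<bar>p y\<bar> \<le> (real n + 1)\<^sup>2 * (k\<^sup>2 + Q)" .
    have "\<bar>p y * W g y\<bar> \<le> ((real n + 1)\<^sup>2 * (k\<^sup>2 + Q)) * (C1 * G / (real n + 1)\<^sup>2)"
     unfolding abs_mult by (rule mult_mono[OF pb b1[OF y]]) (use Q in auto)
    also have "... = (k\<^sup>2 + Q) * C1 * G" by (simp add: add_eq_0_iff)
    finally show ?thesis using g(2) y by force
   qed
   have "\<bar>W' g y - W' g z\<bar> \<le> ((k\<^sup>2 + Q) * C1 * G + G) * \<bar>y - z\<bar>"
   proof -
    have "norm (W' g y - W' g z) \<le> ((k\<^sup>2 + Q) * C1 * G + G) * norm (y - z)"
     by (rule field_differentiable_bound[of "{a..b}" "W' g" "%y. p y * W g y + g y"])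
       (use sol2D(2)[OF sol(1)[OF g(1)]] d2 y z in auto)
    then show ?thesis by simp
   qed
   also have "... \<le> ((k\<^sup>2 + Q) * C1 * G + G) * (b - a)" using y z G0 Q C1 by (intro mult_left_mono) auto
   also have "... = C2 * G" by (simp add: C2_def algebra_simps)
   also have "... \<le> C * G" using C1 G0 by (intro mult_right_mono) (auto simp: C_def)
   finally show "\<bar>W' g y\<bar> \<le> C * G" using z by simp
  next
   fix g u :: "real => real" and y assume gu: "continuous_on {a..b} g" "continuous_on {a..b} u" and y: "y \<in> {a..b}"
   have d: "V (%y. g y - u y) y = V g y - V u y" if "y \<in> {a..b}" for y
    using V gu that by (auto simp: mode_operator_spec_def)
   have b: "b \<in> {a..b}" using ab by simp
   show "W (%y. g y - u y) y = W g y - W u y"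
    unfolding W_def d[OF y] d[OF b] by (simp add: diff_divide_distrib algebra_simps)
  qed (use sol in auto)
  then show ?thesis using sol(3) unfolding p_def by blast
 qed
 then show ?thesis using C1 C2 by (intro exI[of _ C]) (auto simp: C_def)
qed

text \<open>Dirichlet inverses are used from mode 2 on. Mode 1 is resonant because \<open>ph\<close>
  is in its kernel, so it gets zero initial data and a solvability condition; mode 0 also gets
  initial data, since the mean flow need not satisfy any condition at the second wall.\<close>

lemma mode_operators:
 assumes ab: "a < b" and qc: "continuous_on {a..b} q" and k: "k > 0"
  and ph: "sol2 a b (%y. k\<^sup>2 - q y) (%_. 0) ph ph'" "ph a = 0" "ph' a = 1" "ph b = 0" "!!y. y \<in> {a<..<b} ==> ph y > 0"
 obtains C W W' where "C \<ge> 0" "!!n. mode_operator_spec a b (%y. (real n * k)\<^sup>2 - q y) n C (W n) (W' n)"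
  "!!n g. n \<ge> 2 ==> continuous_on {a..b} g ==> W n g b = 0"
  "!!g. continuous_on {a..b} g ==> integral {a..b} (%y. g y * ph y) = 0 ==> W 1 g b = 0"
  "!!g. W' 1 g a = 0"
proof -
 have pc: "continuous_on {a..b} (%y. (real n * k)\<^sup>2 - q y)" for n by (intro continuous_intros qc)
 have pc1: "continuous_on {a..b} (%y. k\<^sup>2 - q y)" using pc[of 1] by simp
 obtain ro ro' where ro: "sol2 a b (%y. k\<^sup>2 - q y + k\<^sup>2) (%_. 0) ro ro'" "!!y. y \<in> {a..b} ==> ro y > 0"
  by (rule positive_supersolution[OF ab pc1 ph(1,2,4,5), of "k\<^sup>2"]) (use k in auto)
 have ro': "sol2 a b (%y. 2 * k\<^sup>2 - q y) (%_. 0) ro ro'" by (rule sol2_cong[OF ro(1)]) (simp add: algebra_simps)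
 obtain CD where CD: "CD \<ge> 0" "!!n. n \<ge> 2 ==> \<exists>W W'. mode_operator_spec a b (%y. (real n * k)\<^sup>2 - q y) n CD W W' \<and>
   (\<forall>g. continuous_on {a..b} g --> W g b = 0)" using dirichlet_operator[OF ab qc k ro' ro(2)] by metis
 obtain C0 W0 W0' where W0: "C0 \<ge> 0" "mode_operator_spec a b (%y. (real 0 * k)\<^sup>2 - q y) 0 C0 W0 W0'"
  by (rule initial_value_operator[OF ab pc[of 0]]) blast
 obtain C1 W1 W1' where W1: "C1 \<ge> 0" "mode_operator_spec a b (%y. (real 1 * k)\<^sup>2 - q y) 0 C1 W1 W1'" "!!g. W1' g a = 0"
  by (rule initial_value_operator[OF ab pc[of 1]]) blast
 \<comment> \<open>The mode 1 operator was built without gain; the factor 4 = (1 + 1)^2 restates its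
   bound with index 1.\<close>
 define C where "C = CD + C0 + 4 * C1"
 have mono: "mode_operator_spec a b p n C W W'"
  if s: "mode_operator_spec a b p m C' W W'" and C': "C' * (real n + 1)\<^sup>2 \<le> C * (real m + 1)\<^sup>2" "C' \<le> C" for p n m C' W W'
  unfolding mode_operator_spec_def
 proof (intro conjI allI impI)
  fix g :: "real => real" and G y assume g: "continuous_on {a..b} g" "\<forall>y\<in>{a..b}. \<bar>g y\<bar> \<le> G" and y: "y \<in> {a..b}"
  have G0: "G \<ge> 0" using g(2) y by (meson abs_ge_zero order_trans)
  have "C' / (real m + 1)\<^sup>2 \<le> C / (real n + 1)\<^sup>2" using C'(1) by (simp add: frac_le_eq divide_simps)
  then have "C' / (real m + 1)\<^sup>2 * G \<le> C / (real n + 1)\<^sup>2 * G" using G0 by (rule mult_right_mono)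
  then have "C' * G / (real m + 1)\<^sup>2 \<le> C * G / (real n + 1)\<^sup>2" by simp
  moreover have "C' * G \<le> C * G" using C'(2) G0 by (rule mult_right_mono)
  moreover have "\<bar>W g y\<bar> \<le> C' * G / (real m + 1)\<^sup>2 \<and> \<bar>W' g y\<bar> \<le> C' * G"
   using s g y unfolding mode_operator_spec_def by blast
  ultimately show "\<bar>W g y\<bar> \<le> C * G / (real n + 1)\<^sup>2" "\<bar>W' g y\<bar> \<le> C * G" by linarith+
 qed (use s in \<open>unfold mode_operator_spec_def, blast+\<close>)
 define OK where "OK n WW \<longleftrightarrow> mode_operator_spec a b (%y. (real n * k)\<^sup>2 - q y) n C (fst WW) (snd WW) \<and>
   (n \<ge> 2 --> (\<forall>g. continuous_on {a..b} g --> fst WW g b = 0)) \<and>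
   (n = 1 --> (\<forall>g. snd WW g a = 0))" for n WW
 have "\<exists>WW. OK n WW" for n
 proof -
  consider "n = 0" | "n = 1" | "n \<ge> 2" by linarith
  then show ?thesis
  proof cases
   case 1
   have "mode_operator_spec a b (%y. (real 0 * k)\<^sup>2 - q y) 0 C W0 W0'"
    by (rule mono[OF W0(2)]) (use CD W0 W1 in \<open>auto simp: C_def\<close>)
   then show ?thesis using 1 by (intro exI[of _ "(W0, W0')"]) (simp add: OK_def)
  next
   case 2
   have "mode_operator_spec a b (%y. (real 1 * k)\<^sup>2 - q y) 1 C W1 W1'"
    by (rule mono[OF W1(2)]) (use CD W0 W1 in \<open>auto simp: C_def\<close>)
   then show ?thesis using 2 W1 by (intro exI[of _ "(W1, W1')"]) (simp add: OK_def)
  next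
   case 3
   with CD(2) obtain W W' where W: "mode_operator_spec a b (%y. (real n * k)\<^sup>2 - q y) n CD W W'"
    "\<forall>g. continuous_on {a..b} g --> W g b = 0" by blast
   have "mode_operator_spec a b (%y. (real n * k)\<^sup>2 - q y) n C W W'"
    by (rule mono[OF W(1)]) (use CD W0 W1 in \<open>auto simp: C_def intro!: mult_right_mono\<close>)
   then show ?thesis using 3 W by (intro exI[of _ "(W, W')"]) (simp add: OK_def)
  qed
 qed
 then obtain WW where WW: "!!n. OK n (WW n)" by metis
 show thesis
 proof (rule that[of C "%n. fst (WW n)" "%n. snd (WW n)"])
  show "C \<ge> 0" using CD W0 W1 by (simp add: C_def)
  show "mode_operator_spec a b (%y. (real n * k)\<^sup>2 - q y) n C (fst (WW n)) (snd (WW n))" for n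
   using WW[of n] by (simp add: OK_def)
  show "snd (WW 1) g a = 0" for g using WW[of 1] by (simp add: OK_def)
  show "fst (WW n) g b = 0" if "n \<ge> 2" "continuous_on {a..b} g" for n g using WW[of n] that by (simp add: OK_def)
  fix g :: "real => real" assume g: "continuous_on {a..b} g" "integral {a..b} (%y. g y * ph y) = 0"
  define w w' where "w = fst (WW 1) g" and "w' = snd (WW 1) g"
  have "mode_operator_spec a b (%y. k\<^sup>2 - q y) 1 C (fst (WW 1)) (snd (WW 1))" using WW[of 1] by (simp add: OK_def)
  then have w: "sol2 a b (%y. k\<^sup>2 - q y) g w w'" "w a = 0"
   using g(1) by (auto simp: mode_operator_spec_def w_def w'_def)
  \<comment> \<open>Fredholm alternative: integrating the derivative of the Wronskian with
    \<open>ph\<close>, only the term w(b) ph'(b) survives at the ends, and ph'(b) is nonzero because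
    zeros are simple.\<close>
  have "((%y. g y * ph y) has_integral ((w' b * ph b - w b * ph' b) - (w' a * ph a - w a * ph' a))) {a..b}"
  proof (rule fundamental_theorem_of_calculus[OF less_imp_le[OF ab]])
   show "((%y. w' y * ph y - w y * ph' y) has_vector_derivative g y * ph y) (at y within {a..b})" if "y \<in> {a..b}" for y
    using wronskian_derivative[OF w(1) ph(1) that] by (simp add: has_real_derivative_iff_has_vector_derivative)
  qed
  from integral_unique[OF this] have "w b * ph' b = 0" using g(2) ph(2,4) w(2) by simp
  moreover have "ph' b \<noteq> 0" by (rule simple_zero[OF less_imp_le[OF ab] pc1 ph(1-3)]) (use ab ph in auto)
  ultimately show "fst (WW 1) g b = 0" by (simp add: w_def)
 qed
qed

section \<open>Even periodic functions holomorphic in a strip\<close>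

definition Sg :: "complex set" where "Sg = {z. \<bar>Im z\<bar> < 1}"

text \<open>Periodicity, evenness and reality on the real axis together amount to a cosine series
  with real coefficients. Boundedness is kept apart and quantified by
  \<open>strip_le\<close>.\<close>

definition strip_fun :: "real => (complex => real => complex) => bool" where
 "strip_fun d f \<longleftrightarrow> continuous_on (Sg \<times> {-d..d}) (%(z, y). f z y) \<and>
   (\<forall>y\<in>{-d..d}. (%z. f z y) holomorphic_on Sg \<and>
    (\<forall>z\<in>Sg. f (z + 2 * of_real pi) y = f z y \<and> f (- z) y = f z y \<and> f (cnj z) y = cnj (f z y)))"

definition fcoef :: "nat => (complex => real => complex) => real => real" where
 "fcoef n f y = (if n = 0 then 1 / (2 * pi) else 1 / pi) *
   integral {0..2*pi} (%th. Re (f (of_real th) y) * cos (real n * th))"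

lemma open_Sg: "open Sg"
proof -
 have "Sg = Im -` {-1<..<1}" by (auto simp: Sg_def)
 moreover have "open (Im -` {-1<..<1})" by (intro open_vimage continuous_intros open_greaterThanLessThan)
 ultimately show ?thesis by simp
qed

lemma of_real_in_Sg [simp]: "of_real th \<in> Sg" by (simp add: Sg_def)

lemma strip_fun_real:
 assumes "strip_fun d f" "y \<in> {-d..d}"
 shows "f (of_real th) y = of_real (Re (f (of_real th) y))"
proof -
 have "f (cnj (of_real th)) y = cnj (f (of_real th) y)" using assms of_real_in_Sg unfolding strip_fun_def by blast
 then have "cnj (f (of_real th) y) = f (of_real th) y" by simp
 then show ?thesis by (metis Reals_cnj_iff of_real_Re)
qed

lemma strip_fun_continuous_real:
 assumes "strip_fun d f"
 shows "continuous_on (UNIV \<times> {-d..d}) (%(th, y). Re (f (of_real th) y))"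
proof -
 have "continuous_on (UNIV \<times> {-d..d}) (%p. (%(z, y). f z y) (of_real (fst p), snd p))"
  by (rule continuous_on_slice[of "Sg \<times> {-d..d}"])
    (use assms in \<open>auto simp: strip_fun_def intro!: continuous_intros\<close>)
 then have "continuous_on (UNIV \<times> {-d..d}) (%p. Re (f (of_real (fst p)) (snd p)))" by (simp add: continuous_on_Re)
 then show ?thesis by (simp add: split_beta)
qed

lemma fcoef_continuous:
 assumes "strip_fun d f"
 shows "continuous_on {-d..d} (fcoef n f)"
proof -
 have "continuous_on ({-d..d} \<times> {0..2*pi}) (%p. (%(th, y). Re (f (of_real th) y)) (snd p, fst p))"
  by (rule continuous_on_slice[OF strip_fun_continuous_real[OF assms]]) (auto intro!: continuous_intros)
 then have "continuous_on ({-d..d} \<times> cbox 0 (2*pi)) (%(y, th). Re (f (of_real th) y) * cos (real n * th))"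
  unfolding split_beta by (auto intro!: continuous_intros)
 then have "continuous_on {-d..d} (%y. integral (cbox 0 (2*pi)) (%th. Re (f (of_real th) y) * cos (real n * th)))"
  by (rule integral_continuous_on_param)
 then show ?thesis unfolding fcoef_def[abs_def] by (auto intro!: continuous_intros)
qed

lemma fcoef_integrable:
 assumes "strip_fun d f" "y \<in> {-d..d}"
 shows "(%th. Re (f (of_real th) y) * cos (real n * th)) integrable_on {0..2*pi}"
proof (rule integrable_continuous_interval)
 have "continuous_on {0..2*pi} (%th. (%(th, y). Re (f (of_real th) y)) (th, y))"
  by (rule continuous_on_slice[OF strip_fun_continuous_real[OF assms(1)]]) (use assms(2) in \<open>auto intro!: continuous_intros\<close>)
 then show "continuous_on {0..2*pi} (%th. Re (f (of_real th) y) * cos (real n * th))"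
  by (auto intro!: continuous_intros)
qed

lemma fcoef_diff:
 assumes "strip_fun d f" "strip_fun d g" "y \<in> {-d..d}"
 shows "fcoef n (%z y. f z y - g z y) y = fcoef n f y - fcoef n g y"
proof -
 have "integral {0..2*pi} (%th. Re (f (of_real th) y - g (of_real th) y) * cos (real n * th)) =
  integral {0..2*pi} (%th. Re (f (of_real th) y) * cos (real n * th)) - integral {0..2*pi} (%th. Re (g (of_real th) y) * cos (real n * th))"
  by (subst integral_diff[symmetric]) (use fcoef_integrable assms in \<open>auto simp: left_diff_distrib\<close>)
 then show ?thesis unfolding fcoef_def by (simp only: right_diff_distrib)
qed

text \<open>Cauchy's theorem for a period rectangle: the derivative of the integral with respect to
  the height s is i times the integral of a derivative over a full period.\<close>

lemma periodic_integral_shift: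
 assumes hol: "g holomorphic_on Sg" and per: "!!z. z \<in> Sg ==> g (z + 2 * of_real pi) = g z" and s: "\<bar>s\<bar> < 1"
 shows "integral {0..2*pi} (%th. g (of_real th + \<i> * of_real s)) = integral {0..2*pi} (%th. g (of_real th))"
proof -
 define I where "I s = integral {0..2*pi} (%th. g (of_real th + \<i> * of_real s))" for s
 define U where "U = {-1<..<1::real}"
 have inS: "of_real th + \<i> * of_real s \<in> Sg" if "s \<in> U" for th s using that by (auto simp: Sg_def U_def)
 have dg: "(g has_field_derivative deriv g z) (at z)" if "z \<in> Sg" for z
  by (rule holomorphic_derivI[OF hol open_Sg that])
 have cg: "continuous_on Sg g" using hol holomorphic_on_imp_continuous_on by blast
 have cdg: "continuous_on Sg (deriv g)"
  using holomorphic_deriv[OF hol open_Sg] holomorphic_on_imp_continuous_on by blast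
 have comp: "continuous_on (U \<times> cbox 0 (2*pi)) (%p. deriv g (of_real (snd p) + \<i> * of_real (fst p)))"
  by (rule continuous_on_compose2[OF cdg]) (use inS in \<open>auto intro!: continuous_intros\<close>)
 have dI: "(I has_vector_derivative 0) (at s within U)" if s: "s \<in> U" for s
 proof -
  have "(I has_vector_derivative integral (cbox 0 (2*pi)) (%th. \<i> * deriv g (of_real th + \<i> * of_real s))) (at s within U)"
   unfolding I_def[abs_def] cbox_interval[symmetric]
  proof (rule leibniz_rule_vector_derivative)
   fix s th assume "s \<in> U"
   have "((%x. of_real th + \<i> * of_real x) has_vector_derivative \<i>) (at s within U)"
    by (auto intro!: derivative_eq_intros)
   from field_vector_diff_chain_within[OF this has_field_derivative_at_within[OF dg[OF inS[OF \<open>s \<in> U\<close>]]]]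
   show "((%s. g (of_real th + \<i> * of_real s)) has_vector_derivative \<i> * deriv g (of_real th + \<i> * of_real s)) (at s within U)"
    by (simp add: o_def)
  next
   fix s assume "s \<in> U"
   show "(%th. g (of_real th + \<i> * of_real s)) integrable_on cbox 0 (2*pi)"
    by (rule integrable_continuous, rule continuous_on_compose2[OF cg]) (use inS[OF \<open>s \<in> U\<close>] in \<open>auto intro!: continuous_intros\<close>)
  qed (use comp s in \<open>auto simp: split_beta U_def intro!: continuous_intros\<close>)
  also have "integral (cbox 0 (2*pi)) (%th. \<i> * deriv g (of_real th + \<i> * of_real s)) = 0"
  proof -
   have "((%th. deriv g (of_real th + \<i> * of_real s)) has_integral
     (g (of_real (2*pi) + \<i> * of_real s) - g (of_real 0 + \<i> * of_real s))) {0..2*pi}"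
   proof (rule fundamental_theorem_of_calculus)
    fix th :: real
    have "((%x. of_real x + \<i> * of_real s) has_vector_derivative 1) (at th within {0..2*pi})"
     by (auto intro!: derivative_eq_intros)
    from field_vector_diff_chain_within[OF this has_field_derivative_at_within[OF dg[OF inS[OF s]]]]
    show "((%th. g (of_real th + \<i> * of_real s)) has_vector_derivative deriv g (of_real th + \<i> * of_real s)) (at th within {0..2*pi})"
     by (simp add: o_def)
   qed simp
   moreover have "g (of_real (2*pi) + \<i> * of_real s) = g (of_real 0 + \<i> * of_real s)"
    using per[OF inS[OF s, of 0]] by (simp add: add.commute)
   ultimately have "integral {0..2*pi} (%th. deriv g (of_real th + \<i> * of_real s)) = 0"
    by (simp add: integral_unique)
   then show ?thesis by simp
  qed
  finally show ?thesis .
 qed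
 have "\<exists>c. \<forall>s\<in>U. I s = c" by (rule has_vector_derivative_zero_constant[OF _ dI]) (auto simp: U_def)
 then obtain c where c: "\<forall>s\<in>U. I s = c" by blast
 have "I s = I 0" using bspec[OF c, of s] bspec[OF c, of 0] s by (auto simp: U_def abs_less_iff)
 then show ?thesis by (simp add: I_def)
qed

text \<open>The line of integration is moved up for the frequency +n and down for -n, so that the
  exponential factor has modulus exp(-n s).\<close>

lemma fourier_exp_decay:
 assumes f: "strip_fun d f" and y: "y \<in> {-d..d}" and M: "!!z. z \<in> Sg ==> norm (f z y) \<le> M"
  and s: "0 \<le> s" "s < 1" and ep: "ep \<in> {1, -1::real}"
 shows "norm (integral {0..2*pi} (%th. f (of_real th) y * exp (\<i> * of_real (ep * real n * th)))) \<le> 2 * pi * M * exp (- (real n * s))"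
proof -
 define g where "g z = f z y * exp (\<i> * of_real (ep * real n) * z)" for z
 have hol: "g holomorphic_on Sg" unfolding g_def using f y by (auto simp: strip_fun_def intro!: holomorphic_intros)
 have per: "g (z + 2 * of_real pi) = g z" if "z \<in> Sg" for z
 proof -
  have "exp (\<i> * of_real (ep * real n) * (2 * of_real pi)) = 1"
  proof -
   have "\<i> * of_real (ep * real n) * (2 * of_real pi) = complex_of_real (2 * of_int (if ep = 1 then int n else - int n) * pi) * \<i>"
    using ep by auto
   also have "exp ... = 1" by (rule exp_integer_2pi[OF Ints_of_int])
   finally show ?thesis .
  qed
  then have "exp (\<i> * of_real (ep * real n) * (z + 2 * of_real pi)) = exp (\<i> * of_real (ep * real n) * z)"
   by (simp add: distrib_left exp_add)
  moreover have "f (z + 2 * of_real pi) y = f z y" using f y that by (auto simp: strip_fun_def)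
  ultimately show ?thesis by (simp add: g_def)
 qed
 have s': "\<bar>ep * s\<bar> < 1" using s ep by auto
 have bd: "norm (g (of_real th + \<i> * of_real (ep * s))) \<le> M * exp (- (real n * s))" for th
 proof -
  have "\<i> * of_real (ep * real n) * (of_real th + \<i> * of_real (ep * s)) = \<i> * of_real (ep * real n * th) - of_real (real n * s)"
   using ep by (auto simp: algebra_simps)
  then have ne: "norm (exp (\<i> * of_real (ep * real n) * (of_real th + \<i> * of_real (ep * s)))) = exp (- (real n * s))"
   by (simp add: norm_exp_eq_Re)
  have "norm (f (of_real th + \<i> * of_real (ep * s)) y) \<le> M" by (rule M) (use s' in \<open>simp add: Sg_def\<close>)
  then show ?thesis unfolding g_def norm_mult ne by (rule mult_right_mono) simp
 qed
 have "norm (integral {0..2*pi} (%th. g (of_real th + \<i> * of_real (ep * s)))) \<le> M * exp (- (real n * s)) * (2 * pi - 0)"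
 proof (rule integral_bound)
  show "continuous_on {0..2*pi} (%th. g (of_real th + \<i> * of_real (ep * s)))"
   by (rule continuous_on_compose2[OF holomorphic_on_imp_continuous_on[OF hol]])
     (use s' in \<open>auto simp: Sg_def intro!: continuous_intros\<close>)
 qed (use bd in auto)
 also have "integral {0..2*pi} (%th. g (of_real th + \<i> * of_real (ep * s))) = integral {0..2*pi} (%th. g (of_real th))"
  by (rule periodic_integral_shift[OF hol per s'])
 finally show ?thesis by (simp add: g_def mult_ac)
qed

lemma fcoef_bound:
 assumes f: "strip_fun d f" and y: "y \<in> {-d..d}" and M: "!!z. z \<in> Sg ==> norm (f z y) \<le> M"
 shows "\<bar>fcoef n f y\<bar> \<le> 2 * M * exp (- real n)"
proof -
 have b: "\<bar>fcoef n f y\<bar> \<le> 2 * M * exp (- (real n * s))" if s: "0 \<le> s" "s < 1" for s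
 proof -
  define E where "E ep = integral {0..2*pi} (%th. f (of_real th) y * exp (\<i> * of_real (ep * real n * th)))" for ep :: real
  have cf: "continuous_on {0..2*pi} (%th. f (of_real th) y)"
  proof -
   have "continuous_on {0..2*pi} (%th. (%(z, y). f z y) (of_real th, y))"
    by (rule continuous_on_slice[of "Sg \<times> {-d..d}"]) (use f y in \<open>auto simp: strip_fun_def intro!: continuous_intros\<close>)
   then show ?thesis by simp
  qed
  have int: "(%th. f (of_real th) y * exp (\<i> * of_real (ep * real n * th))) integrable_on {0..2*pi}" for ep :: real
   by (rule integrable_continuous_interval) (intro continuous_intros cf)
  have "(%th. of_real (Re (f (of_real th) y) * cos (real n * th))) =
    (%th. (f (of_real th) y * exp (\<i> * of_real (1 * real n * th)) + f (of_real th) y * exp (\<i> * of_real (- 1 * real n * th))) / 2)"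
   (is "?A = ?B")
  proof
   fix th :: real
   have "complex_of_real (cos (real n * th)) = (exp (\<i> * of_real (real n * th)) + exp (- (\<i> * of_real (real n * th)))) / 2"
    by (simp add: cos_of_real[symmetric] cos_exp_eq)
   moreover have "?A th = f (of_real th) y * complex_of_real (cos (real n * th))"
    using strip_fun_real[OF f y, of th] by (metis of_real_mult)
   ultimately show "?A th = ?B th" by (simp add: distrib_left add_divide_distrib)
  qed
  then have "integral {0..2*pi} (%th. complex_of_real (Re (f (of_real th) y) * cos (real n * th))) = (E 1 + E (-1)) / 2"
   using integral_add[OF int[of 1] int[of "-1"]] by (simp add: E_def)
  moreover have "integral {0..2*pi} (%th. complex_of_real (Re (f (of_real th) y) * cos (real n * th))) =
    of_real (integral {0..2*pi} (%th. Re (f (of_real th) y) * cos (real n * th)))"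
   using integral_linear[OF fcoef_integrable[OF f y] bounded_linear_of_real[where 'a=complex], of n] by (simp add: o_def)
  ultimately have "norm (complex_of_real (integral {0..2*pi} (%th. Re (f (of_real th) y) * cos (real n * th)))) \<le> (norm (E 1) + norm (E (-1))) / 2"
   by (metis norm_triangle_ineq norm_divide norm_numeral divide_right_mono zero_le_numeral)
  also have "... \<le> 2 * pi * M * exp (- (real n * s))"
   using fourier_exp_decay[OF f y M s, of 1 n] fourier_exp_decay[OF f y M s, of "-1" n] by (simp add: E_def)
  finally have I: "\<bar>integral {0..2*pi} (%th. Re (f (of_real th) y) * cos (real n * th))\<bar> \<le> 2 * pi * M * exp (- (real n * s))" by simp
  have "\<bar>fcoef n f y\<bar> \<le> 1 / pi * (2 * pi * M * exp (- (real n * s)))"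
   unfolding fcoef_def abs_mult by (rule mult_mono[OF _ I]) (auto simp: field_simps)
  then show ?thesis by simp
 qed
 \<comment> \<open>Letting the height tend to 1 gives the full rate exp(-n); any smaller rate would
   cost a piece of the strip in each application.\<close>
 have "((%s. 2 * M * exp (- (real n * s))) \<longlongrightarrow> 2 * M * exp (- (real n * 1))) (at_left 1)" by (intro tendsto_intros)
 moreover have "\<forall>\<^sub>F s in at_left (1::real). \<bar>fcoef n f y\<bar> \<le> 2 * M * exp (- (real n * s))"
  unfolding eventually_at_left_field by (rule exI[of _ 0]) (use b in auto)
 ultimately have "\<bar>fcoef n f y\<bar> \<le> 2 * M * exp (- (real n * 1))" by (rule tendsto_lowerbound) simp
 then show ?thesis by simp
qed

section \<open>Completeness of the cosines\<close>

lemma integral_cos_multiple: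
 "integral {0..2*pi} (%th. cos (real_of_int k * th)) = (if k = 0 then 2 * pi else 0)"
proof (cases "k = 0")
 case False
 have "((%th. cos (real_of_int k * th)) has_integral (sin (real_of_int k * (2*pi)) / k - sin (real_of_int k * 0) / k)) {0..2*pi}"
 proof (rule fundamental_theorem_of_calculus)
  fix th :: real
  have "((%th. sin (real_of_int k * th) / k) has_real_derivative cos (real_of_int k * th)) (at th within {0..2*pi})"
   using False by (auto intro!: derivative_eq_intros)
  then show "((%th. sin (real_of_int k * th) / k) has_vector_derivative cos (real_of_int k * th)) (at th within {0..2*pi})"
   by (simp add: has_real_derivative_iff_has_vector_derivative)
 qed simp
 moreover have "sin (real_of_int k * (2*pi)) = 0" using sin_integer_2pi[OF Ints_of_int[of k]] by (simp add: mult_ac)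
 ultimately show ?thesis using False by (simp add: integral_unique)
qed simp

lemma integral_cos_cos:
 "integral {0..2*pi} (%th. cos (real m * th) * cos (real n * th)) =
   (if m = n then if n = 0 then 2 * pi else pi else 0)"
proof -
 have int: "(%th. cos (real_of_int k * th) / 2) integrable_on {0..2*pi}" for k
  by (intro integrable_continuous_interval continuous_intros) simp
 have "(%th. cos (real m * th) * cos (real n * th)) =
   (%th. cos (real_of_int (int m - int n) * th) / 2 + cos (real_of_int (int m + int n) * th) / 2)"
  by (simp add: cos_times_cos left_diff_distrib distrib_right add_divide_distrib)
 then have "integral {0..2*pi} (%th. cos (real m * th) * cos (real n * th)) =
   integral {0..2*pi} (%th. cos (real_of_int (int m - int n) * th) / 2) + integral {0..2*pi} (%th. cos (real_of_int (int m + int n) * th) / 2)"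
  using integral_add[OF int[of "int m - int n"] int[of "int m + int n"]] by simp
 also have "... = (if m = n then if n = 0 then 2 * pi else pi else 0)"
  using integral_cos_multiple[of "int m - int n"] integral_cos_multiple[of "int m + int n"] by simp
 finally show ?thesis .
qed

text \<open>An even periodic function is a continuous function of \<open>cos th\<close>, so that Weierstrass'
 theorem makes the cosines complete.\<close>

lemma cosine_coefficients_zero:
 fixes h :: "real => real"
 assumes c: "continuous_on UNIV h" and even: "!!th. h (- th) = h th" and per: "!!th. h (th + 2 * pi) = h th"
  and z: "!!n. integral {0..2*pi} (%th. h th * cos (real n * th)) = 0" and th: "th \<in> {0..2*pi}"
 shows "h th = 0"
proof -
 have ch: "continuous_on S h" for S using c continuous_on_subset by blast
 have pw: "integral {0..2*pi} (%th. h th * cos th ^ i * cos (real n * th)) = 0" for i n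
 proof (induction i arbitrary: n)
  case 0 then show ?case using z by simp
 next
  case (Suc i)
  \<comment> \<open>The absolute value covers n = 0, where the product formula produces the
    frequency -1, and cosine is even.\<close>
  define m where "m = nat \<bar>int n - 1\<bar>"
  have m: "cos (real m * th) = cos (real n * th - th)" for th
  proof (cases "n = 0")
   case True then show ?thesis by (simp add: m_def)
  next
   case False
   then have "real m = real n - 1" by (simp add: m_def)
   then show ?thesis by (simp add: left_diff_distrib)
  qed
  have int: "(%th. h th * cos th ^ i * cos (real k * th) / 2) integrable_on {0..2*pi}" for k
   by (intro integrable_continuous_interval continuous_intros ch) simp
  have "(%th. h th * cos th ^ Suc i * cos (real n * th)) =
    (%th. h th * cos th ^ i * cos (real (Suc n) * th) / 2 + h th * cos th ^ i * cos (real m * th) / 2)"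
  proof
   fix th
   have "cos (real n * th) * cos th = (cos (real n * th - th) + cos (real n * th + th)) / 2"
    by (rule cos_times_cos)
   moreover have "cos (real (Suc n) * th) = cos (real n * th + th)" by (simp add: algebra_simps)
   ultimately have "cos (real n * th) * cos th = cos (real (Suc n) * th) / 2 + cos (real m * th) / 2"
    unfolding m by simp
   then have "h th * cos th ^ i * (cos (real n * th) * cos th) = h th * cos th ^ i * (cos (real (Suc n) * th) / 2 + cos (real m * th) / 2)"
    by simp
   then show "h th * cos th ^ Suc i * cos (real n * th) =
    h th * cos th ^ i * cos (real (Suc n) * th) / 2 + h th * cos th ^ i * cos (real m * th) / 2"
    unfolding distrib_left power_Suc by (simp only: mult_ac times_divide_eq_right times_divide_eq_left)
  qed
  then have "integral {0..2*pi} (%th. h th * cos th ^ Suc i * cos (real n * th)) =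
    integral {0..2*pi} (%th. h th * cos th ^ i * cos (real (Suc n) * th) / 2) + integral {0..2*pi} (%th. h th * cos th ^ i * cos (real m * th) / 2)"
   using integral_add[OF int[of "Suc n"] int[of m]] by simp
  also have "... = 0" using Suc.IH[of "Suc n"] Suc.IH[of m] by simp
  finally show ?case .
 qed
 define H where "H x = h (arccos x)" for x
 have cH: "continuous_on {-1..1} H"
  unfolding H_def by (rule continuous_on_compose2[OF c]) (auto intro: continuous_on_arccos')
 have hH: "h th = H (cos th)" if "th \<in> {0..2*pi}" for th
 proof (cases "th \<le> pi")
  case True
  then show ?thesis using that by (simp add: H_def arccos_cos)
 next
  case False
  have "cos th = cos (2 * pi - th)" by (simp add: cos_diff)
  moreover have "arccos (cos (2 * pi - th)) = 2 * pi - th" by (rule arccos_cos) (use False that in auto)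
  ultimately have "arccos (cos th) = 2 * pi - th" by metis
  moreover have "h (2 * pi - th) = h th" using per[of "- th"] even[of th] by (simp add: add.commute)
  ultimately show ?thesis by (simp add: H_def)
 qed
 have ip: "(%th. h th * P (cos th)) integrable_on {0..2*pi}" if "continuous_on UNIV P" for P :: "real => real"
  by (intro integrable_continuous_interval continuous_intros ch continuous_on_compose2[OF that]) auto
 define B where "B = integral {0..2*pi} (%th. \<bar>h th\<bar>)"
 have B0: "B \<ge> 0" unfolding B_def by (rule integral_nonneg) (auto intro!: integrable_continuous_interval continuous_intros ch)
 \<comment> \<open>\<open>h\<close> is orthogonal to every polynomial in the cosine, hence the
   integral of h^2 equals that of h (h - P(cos)), which is at most e times the integral of
   |h|.\<close>
 have small: "integral {0..2*pi} (%th. h th * h th) \<le> e * B" if e: "e > 0" for e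
 proof -
  obtain P where P: "real_polynomial_function P" "!!x. x \<in> {-1..1} ==> \<bar>H x - P x\<bar> < e"
   by (rule Stone_Weierstrass_real_polynomial_function[OF compact_Icc cH e]) blast
  obtain a N where aN: "P = (%x. \<Sum>i\<le>N. a i * x ^ i)" using P(1) by (auto simp: real_polynomial_function_iff_sum)
  have cP: "continuous_on UNIV P" unfolding aN by (intro continuous_intros)
  have "integral {0..2*pi} (%th. h th * P (cos th)) = integral {0..2*pi} (%th. \<Sum>i\<le>N. a i * (h th * cos th ^ i))"
   by (simp add: aN sum_distrib_left mult_ac)
  also have "... = (\<Sum>i\<le>N. integral {0..2*pi} (%th. a i * (h th * cos th ^ i)))"
   by (rule integral_sum) (auto intro!: integrable_continuous_interval continuous_intros ch)
  also have "... = 0" using pw[of _ 0] by simp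
  finally have P0: "integral {0..2*pi} (%th. h th * P (cos th)) = 0" .
  have "integral {0..2*pi} (%th. h th * h th) = integral {0..2*pi} (%th. h th * h th - h th * P (cos th))"
   by (subst integral_diff) (use P0 ip[OF cP] in \<open>auto intro!: integrable_continuous_interval continuous_intros ch\<close>)
  also have "... \<le> integral {0..2*pi} (%th. e * \<bar>h th\<bar>)"
  proof (rule integral_le)
   show "(%th. h th * h th - h th * P (cos th)) integrable_on {0..2*pi}"
    by (rule integrable_diff[OF _ ip[OF cP]]) (intro integrable_continuous_interval continuous_intros ch)
   show "(%th. e * \<bar>h th\<bar>) integrable_on {0..2*pi}" by (intro integrable_continuous_interval continuous_intros ch)
   fix th assume t: "th \<in> {0..2*pi}"
   have "h th * h th - h th * P (cos th) = h th * (H (cos th) - P (cos th))"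
    using hH[OF t] by (simp add: right_diff_distrib)
   also have "... \<le> \<bar>h th\<bar> * \<bar>H (cos th) - P (cos th)\<bar>" by (metis abs_ge_self abs_mult)
   also have "... \<le> \<bar>h th\<bar> * e" using P(2)[of "cos th"] by (intro mult_left_mono) auto
   finally show "h th * h th - h th * P (cos th) \<le> e * \<bar>h th\<bar>" by (simp add: mult.commute)
  qed
  also have "... = e * B" by (simp add: B_def)
  finally show ?thesis .
 qed
 have "integral {0..2*pi} (%th. h th * h th) \<le> 0"
 proof (rule field_le_epsilon)
  fix e :: real assume e: "e > 0"
  have "integral {0..2*pi} (%th. h th * h th) \<le> e / (B + 1) * B" by (rule small) (use e B0 in auto)
  also have "... \<le> e" using e B0 by (simp add: field_simps)
  finally show "integral {0..2*pi} (%th. h th * h th) \<le> 0 + e" by simp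
 qed
 moreover have "integral {0..2*pi} (%th. h th * h th) \<ge> 0"
  by (rule integral_nonneg) (auto intro!: integrable_continuous_interval continuous_intros ch)
 ultimately have "integral {0..2*pi} (%th. h th * h th) = 0" by simp
 moreover have "continuous_on {0..2*pi} (%th. h th * h th)" by (intro continuous_intros ch)
 ultimately show ?thesis using integral_eq_0_iff[of 0 "2*pi" "%th. h th * h th"] th by simp
qed

lemma cos_series:
 fixes a :: "nat => real"
 assumes A: "summable A" and a: "!!n. \<bar>a n\<bar> \<le> A n"
 shows "continuous_on UNIV (%th. \<Sum>n. a n * cos (real n * th))"
  and "integral {0..2*pi} (%th. (\<Sum>n. a n * cos (real n * th)) * cos (real m * th)) = (if m = 0 then 2 * pi else pi) * a m"
proof -
 have b: "norm (a n * cos (real n * th)) \<le> A n" for n th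
  using mult_mono[OF a[of n], of "\<bar>cos (real n * th)\<bar>" 1] a[of n] abs_ge_zero order_trans by (fastforce simp: abs_mult)
 have ul: "uniform_limit S (%N th. \<Sum>n<N. a n * cos (real n * th)) (%th. \<Sum>n. a n * cos (real n * th)) sequentially" for S
  by (rule Weierstrass_m_test[OF b A])
 show "continuous_on UNIV (%th. \<Sum>n. a n * cos (real n * th))"
  by (rule uniform_limit_theorem[OF _ ul]) (auto intro!: always_eventually continuous_intros)
 have "uniform_limit {0..2*pi} (%N th. (\<Sum>n<N. a n * cos (real n * th)) * cos (real m * th))
   (%th. (\<Sum>n. a n * cos (real n * th)) * cos (real m * th)) sequentially"
 proof (rule uniform_lim_mult[OF ul uniform_limit_const])
  have "bounded ((%th. \<Sum>n. a n * cos (real n * th)) ` {0..2*pi})"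
   by (intro compact_imp_bounded compact_continuous_image compact_Icc continuous_on_subset[OF
      \<open>continuous_on UNIV (%th. \<Sum>n. a n * cos (real n * th))\<close>]) auto
  then show "bounded ((%th. \<Sum>n. a n * cos (real n * th)) ` {0..2*pi})" .
  show "bounded ((%th. cos (real m * th)) ` {0..2*pi})"
   by (intro compact_imp_bounded compact_continuous_image compact_Icc continuous_intros)
 qed
 then obtain I J where I: "!!N. ((%th. (\<Sum>n<N. a n * cos (real n * th)) * cos (real m * th)) has_integral I N) {0..2*pi}"
  and J: "((%th. (\<Sum>n. a n * cos (real n * th)) * cos (real m * th)) has_integral J) {0..2*pi}"
  and IJ: "I \<longlonglongrightarrow> J" by (rule uniform_limit_integral) (auto intro!: continuous_intros)
 have "I N = (if m = 0 then 2 * pi else pi) * a m" if N: "N > m" for N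
 proof -
  have int: "(%th. a n * (cos (real n * th) * cos (real m * th))) integrable_on {0..2*pi}" for n
   by (intro integrable_continuous_interval continuous_intros)
  have "I N = integral {0..2*pi} (%th. \<Sum>n<N. a n * (cos (real n * th) * cos (real m * th)))"
   using integral_unique[OF I[of N]] by (simp add: sum_distrib_right mult.assoc)
  also have "... = (\<Sum>n<N. integral {0..2*pi} (%th. a n * (cos (real n * th) * cos (real m * th))))"
   by (rule integral_sum) (use int in auto)
  also have "... = (\<Sum>n<N. if n = m then a n * (if n = 0 then 2 * pi else pi) else 0)"
   by (intro sum.cong refl) (simp add: integral_cos_cos)
  also have "... = (if m = 0 then 2 * pi else pi) * a m" using N by (simp add: sum.delta)
  finally show ?thesis .
 qed
 then have "\<forall>\<^sub>F N in sequentially. I N = (if m = 0 then 2 * pi else pi) * a m"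
  using eventually_gt_at_top[of m] by (rule eventually_mono[rotated])
 then have "I \<longlonglongrightarrow> (if m = 0 then 2 * pi else pi) * a m" by (rule tendsto_eventually)
 with IJ have "J = (if m = 0 then 2 * pi else pi) * a m" using LIMSEQ_unique by blast
 then show "integral {0..2*pi} (%th. (\<Sum>n. a n * cos (real n * th)) * cos (real m * th)) = (if m = 0 then 2 * pi else pi) * a m"
  using integral_unique[OF J] by simp
qed

lemma summable_exp_neg_nat: "summable (%n. B * exp (- real n))"
proof -
 have "(%n. exp (- real n)) = (%n. exp (-1) ^ n)" by (simp add: exp_of_nat_mult[symmetric])
 then show ?thesis by (intro summable_mult) (simp add: summable_geometric)
qed

text \<open>The exponentially decaying coefficients define a continuous function with the same
  coefficients; the difference has none left and vanishes by completeness.\<close>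

lemma strip_fun_expansion:
 assumes f: "strip_fun d f" and M: "!!z. z \<in> Sg ==> norm (f z y) \<le> M" and y: "y \<in> {-d..d}"
 shows "Re (f (of_real th) y) = (\<Sum>n. fcoef n f y * cos (real n * th))"
proof -
 define h where "h th = Re (f (of_real th) y) - (\<Sum>n. fcoef n f y * cos (real n * th))" for th
 note bd = fcoef_bound[OF f y M]
 note cs = cos_series[OF summable_exp_neg_nat bd]
 have cf: "continuous_on UNIV (%th. Re (f (of_real th) y))"
  using continuous_on_slice[OF strip_fun_continuous_real[OF f], where g="%th. (th, y)" and A=UNIV] y
  by (simp add: continuous_on_Pair)
 have ch: "continuous_on UNIV h" unfolding h_def by (intro continuous_on_diff cf cs(1))
 have even: "h (- th) = h th" for th using f y of_real_in_Sg[of th] by (simp add: h_def strip_fun_def)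
 have per: "h (th + 2 * pi) = h th" for th
 proof -
  have "cos (real n * (th + 2 * pi)) = cos (real n * th)" for n
  proof -
   have "cos (real n * (th + 2 * pi)) = cos (real n * th + 2 * real n * pi)" by (simp add: distrib_left mult_ac)
   also have "... = cos (real n * th)" unfolding cos_add cos_2npi sin_2npi by simp
   finally show ?thesis .
  qed
  then show ?thesis using f y of_real_in_Sg[of th] by (simp add: h_def strip_fun_def)
 qed
 have z: "integral {0..2*pi} (%th. h th * cos (real m * th)) = 0" for m
 proof -
  have "integral {0..2*pi} (%th. h th * cos (real m * th)) =
   integral {0..2*pi} (%th. Re (f (of_real th) y) * cos (real m * th)) -
   integral {0..2*pi} (%th. (\<Sum>n. fcoef n f y * cos (real n * th)) * cos (real m * th))"
   unfolding h_def left_diff_distrib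
   by (rule integral_diff; intro integrable_continuous_interval continuous_on_mult continuous_on_subset[OF cf]
     continuous_on_subset[OF cs(1)] continuous_intros) auto
  also have "integral {0..2*pi} (%th. Re (f (of_real th) y) * cos (real m * th)) = (if m = 0 then 2 * pi else pi) * fcoef m f y"
   by (simp add: fcoef_def)
  also have "integral {0..2*pi} (%th. (\<Sum>n. fcoef n f y * cos (real n * th)) * cos (real m * th)) =
   (if m = 0 then 2 * pi else pi) * fcoef m f y" by (rule cs(2))
  finally show ?thesis by simp
 qed
 have h0: "h th = 0" if "th \<in> {0..2*pi}" for th by (rule cosine_coefficients_zero[OF ch even per z that])
 have "h th = 0"
 proof -
  define k where "k = \<lfloor>th / (2*pi)\<rfloor>"
  have pern: "h (th + real n * (2*pi)) = h th" for n th
  proof (induction n)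
   case (Suc n)
   have "h (th + real (Suc n) * (2*pi)) = h ((th + real n * (2*pi)) + 2 * pi)" by (simp add: algebra_simps)
   then show ?case using Suc per by simp
  qed simp
  have perk: "h (th - of_int k * (2*pi)) = h th"
  proof (cases "k \<ge> 0")
   case True
   then show ?thesis using pern[of "th - of_int k * (2*pi)" "nat k"] by simp
  next
   case False
   then show ?thesis using pern[of th "nat (- k)"] by simp
  qed
  have "of_int k \<le> th / (2*pi)" "th / (2*pi) \<le> of_int k + 1" unfolding k_def by linarith+
  then have "th - of_int k * (2*pi) \<in> {0..2*pi}" by (auto simp: field_simps)
  then show ?thesis using h0 perk by metis
 qed
 then show ?thesis by (simp add: h_def)
qed

section \<open>Cosine series in the strip\<close>

lemma norm_cos_strip: "z \<in> Sg ==> norm (cos (of_nat n * z)) \<le> exp (real n)"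
proof -
 assume z: "z \<in> Sg"
 have b: "norm (exp (\<i> * w)) \<le> exp (real n)" if "\<bar>Im w\<bar> \<le> real n" for w using that by (simp add: norm_exp_eq_Re)
 have "\<bar>Im (of_nat n * z)\<bar> \<le> real n" using z mult_left_mono[of "\<bar>Im z\<bar>" 1 "real n"] by (simp add: Sg_def abs_mult)
 then have "norm (exp (\<i> * (of_nat n * z))) \<le> exp (real n)" "norm (exp (\<i> * (- (of_nat n * z)))) \<le> exp (real n)"
  by (intro b; simp)+
 then have "norm (exp (\<i> * (of_nat n * z)) + exp (- (\<i> * (of_nat n * z)))) \<le> exp (real n) + exp (real n)"
  by (intro norm_triangle_mono) simp_all
 then show ?thesis by (simp add: cos_exp_eq norm_divide)
qed

definition sq_sum :: real where "sq_sum = (\<Sum>n. 1 / (real n + 1)\<^sup>2)"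

lemma summable_sq: "summable (%n. 1 / (real n + 1)\<^sup>2)"
 using inverse_power_summable[of 2, where 'a=real] summable_Suc_iff[of "%n. inverse (real n ^ 2)"]
 by (simp add: inverse_eq_divide add.commute)

text \<open>The factor exp(-n) exactly compensates the growth of cos(n z) throughout the open strip,
  and (n + 1)^(-2) is left for the Weierstrass test. A gain of two powers of n is thus enough to
  return to the same strip.\<close>

lemma strip_series:
 fixes a :: "nat => real => real"
 assumes c: "!!n. continuous_on {-d..d} (a n)" and B: "!!n y. y \<in> {-d..d} ==> \<bar>a n y\<bar> \<le> B * exp (- real n) / (real n + 1)\<^sup>2"
 defines "F \<equiv> %z y. \<Sum>n. of_real (a n y) * cos (of_nat n * z)"
 shows "strip_fun d F" "!!z y. z \<in> Sg ==> y \<in> {-d..d} ==> norm (F z y) \<le> B * sq_sum"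
  "!!z y. z \<in> Sg ==> y \<in> {-d..d} ==> summable (%n. of_real (a n y) * cos (of_nat n * z))"
  "!!th y. y \<in> {-d..d} ==> Re (F (of_real th) y) = (\<Sum>n. a n y * cos (real n * th))"
  "!!n y. y \<in> {-d..d} ==> fcoef n F y = a n y"
proof -
 define T where "T n z y = complex_of_real (a n y) * cos (of_nat n * z)" for n z y
 have Tb: "norm (T n z y) \<le> B * (1 / (real n + 1)\<^sup>2)" if "z \<in> Sg" "y \<in> {-d..d}" for n z y
 proof -
  have "norm (T n z y) \<le> (B * exp (- real n) / (real n + 1)\<^sup>2) * exp (real n)"
   unfolding T_def norm_mult norm_of_real using B[OF that(2)] norm_cos_strip[OF that(1)]
   by (intro mult_mono) (auto intro: order_trans[OF abs_ge_zero])
  also have "... = B * (1 / (real n + 1)\<^sup>2)" by (simp add: exp_minus field_simps)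
  finally show ?thesis .
 qed
 have sB: "summable (%n. B * (1 / (real n + 1)\<^sup>2))" by (intro summable_mult summable_sq)
 have sT: "summable (%n. T n z y)" if "z \<in> Sg" "y \<in> {-d..d}" for z y
  by (rule summable_comparison_test'[OF sB, of 0]) (use Tb that in auto)
 then show "summable (%n. of_real (a n y) * cos (of_nat n * z))" if "z \<in> Sg" "y \<in> {-d..d}" for z y
  using that by (simp add: T_def)
 have F: "F z y = (\<Sum>n. T n z y)" for z y by (simp add: F_def T_def)
 have ul: "uniform_limit (Sg \<times> {-d..d}) (%N p. \<Sum>n<N. T n (fst p) (snd p)) (%p. F (fst p) (snd p)) sequentially"
  unfolding F by (rule Weierstrass_m_test[OF _ sB]) (use Tb in auto)
 show nF: "norm (F z y) \<le> B * sq_sum" if "z \<in> Sg" "y \<in> {-d..d}" for z y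
 proof -
  have sn: "summable (%n. norm (T n z y))" by (rule summable_comparison_test'[OF sB, of 0]) (use Tb that in auto)
  have "norm (F z y) \<le> (\<Sum>n. norm (T n z y))" unfolding F by (rule summable_norm[OF sn])
  also have "... \<le> (\<Sum>n. B * (1 / (real n + 1)\<^sup>2))" by (rule suminf_le[OF Tb[OF that] sn sB])
  also have "... = B * sq_sum" unfolding sq_sum_def by (rule suminf_mult[OF summable_sq])
  finally show ?thesis .
 qed
 have cT: "continuous_on (Sg \<times> {-d..d}) (%p. T n (fst p) (snd p))" for n
  unfolding T_def by (intro continuous_intros continuous_on_compose2[OF c]) auto
 have cF: "continuous_on (Sg \<times> {-d..d}) (%(z, y). F z y)"
  unfolding split_beta by (rule uniform_limit_theorem[OF _ ul]) (auto intro!: always_eventually continuous_on_sum cT)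
 have holF: "(%z. F z y) holomorphic_on Sg" if y: "y \<in> {-d..d}" for y
 proof (rule holomorphic_uniform_sequence[OF open_Sg, of "%N z. \<Sum>n<N. T n z y"])
  show "(%z. \<Sum>n<N. T n z y) holomorphic_on Sg" for N unfolding T_def by (intro holomorphic_intros)
  fix z assume "z \<in> Sg"
  then obtain r where r: "r > 0" "cball z r \<subseteq> Sg" using open_Sg open_contains_cball by blast
  have "uniform_limit (cball z r) (%N z. \<Sum>n<N. T n z y) (%z. F z y) sequentially"
   unfolding F by (rule Weierstrass_m_test[OF _ sB]) (use Tb r y in auto)
  with r show "\<exists>r>0. cball z r \<subseteq> Sg \<and> uniform_limit (cball z r) (%N z. \<Sum>n<N. T n z y) (%z. F z y) sequentially" by blast
 qed
 have sym: "F (z + 2 * of_real pi) y = F z y" "F (- z) y = F z y" "F (cnj z) y = cnj (F z y)"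
  if z: "z \<in> Sg" and y: "y \<in> {-d..d}" for z y
 proof -
  have "cos (of_nat n * (z + 2 * of_real pi)) = cos (of_nat n * z)" for n
  proof -
   have "of_nat n * (2 * of_real pi) = complex_of_real (2 * real n * pi)" by simp
   then have "cos (of_nat n * (2 * of_real pi) :: complex) = 1" "sin (of_nat n * (2 * of_real pi) :: complex) = 0"
    by (simp_all only: cos_of_real sin_of_real cos_2npi sin_2npi of_real_1 of_real_0)
   then show ?thesis by (simp add: distrib_left cos_add)
  qed
  then show "F (z + 2 * of_real pi) y = F z y" by (simp add: F_def)
  show "F (- z) y = F z y" by (simp add: F_def)
  have "cnj (T n z y) = T n (cnj z) y" for n by (simp add: T_def cnj_cos)
  then show "F (cnj z) y = cnj (F z y)"
   unfolding F using bounded_linear.suminf[OF bounded_linear_cnj sT[OF z y]] by simp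
 qed
 show sF: "strip_fun d F" unfolding strip_fun_def using cF holF sym by blast
 have a_bd: "\<bar>a n y\<bar> \<le> \<bar>B\<bar> * exp (- real n)" if "y \<in> {-d..d}" for n y
 proof -
  have "\<bar>a n y\<bar> \<le> B * exp (- real n) / (real n + 1)\<^sup>2" by (rule B[OF that])
  also have "... \<le> \<bar>B\<bar> * exp (- real n) / (real n + 1)\<^sup>2" by (intro divide_right_mono mult_right_mono) auto
  also have "... \<le> \<bar>B\<bar> * exp (- real n) / 1" by (intro divide_left_mono) (auto intro!: one_le_power)
  finally show ?thesis by simp
 qed
 show re: "Re (F (of_real th) y) = (\<Sum>n. a n y * cos (real n * th))" if y: "y \<in> {-d..d}" for th y
 proof -
  have "Re (F (of_real th) y) = (\<Sum>n. Re (T n (of_real th) y))"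
   unfolding F by (rule bounded_linear.suminf[OF bounded_linear_Re sT[OF of_real_in_Sg y]])
  moreover have "Re (T n (of_real th) y) = a n y * cos (real n * th)" for n
  proof -
   have "T n (of_real th) y = of_real (a n y * cos (real n * th))" by (simp add: T_def flip: cos_of_real)
   then show ?thesis by simp
  qed
  ultimately show ?thesis by simp
 qed
 show "fcoef n F y = a n y" if y: "y \<in> {-d..d}" for n y unfolding fcoef_def re[OF y]
  using cos_series(2)[OF summable_exp_neg_nat a_bd[OF y], of n] by simp
qed

section \<open>Operations on strip functions\<close>

lemma strip_fun_combine:
 assumes "strip_fun d f" "strip_fun d g"
 shows "strip_fun d (%z y. f z y + g z y)" "strip_fun d (%z y. f z y - g z y)" "strip_fun d (%z y. f z y * g z y)"
 using assms unfolding strip_fun_def split_beta by (auto intro!: continuous_intros holomorphic_intros)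

lemma strip_fun_const:
 assumes "continuous_on {-d..d} p"
 shows "strip_fun d (%z y. of_real (p y))" unfolding strip_fun_def split_beta
 by (auto intro!: continuous_intros continuous_on_compose2[OF assms])

lemma strip_fun_cos: "strip_fun d (%z y. cos z)" unfolding strip_fun_def split_beta
proof (intro conjI ballI)
 fix z :: complex
 have "cos (2 * of_real pi :: complex) = 1" "sin (2 * of_real pi :: complex) = 0"
  using cos_of_real[of "2 * pi", where 'a=complex] sin_of_real[of "2 * pi", where 'a=complex] by simp_all
 then show "cos (z + 2 * of_real pi) = cos z" by (simp add: cos_add)
 show "cos (cnj z) = cnj (cos z)" by (simp add: cnj_cos)
qed (auto intro!: continuous_intros holomorphic_intros)

definition cpoly :: "real poly => complex => complex" where
 "cpoly p z = poly (map_poly of_real p) z"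

lemma cpoly_of_real: "cpoly p (of_real x) = of_real (poly p x)"
 by (simp add: cpoly_def poly_altdef coeff_map_poly degree_map_poly)

lemma cpoly_cnj: "cpoly p (cnj z) = cnj (cpoly p z)"
 by (simp add: cpoly_def poly_altdef coeff_map_poly degree_map_poly)

lemma cpoly_deriv: "(cpoly p has_field_derivative cpoly (pderiv p) z) (at z within S)"
proof -
 have "map_poly complex_of_real (pderiv p) = pderiv (map_poly of_real p)"
  by (rule poly_eqI) (simp add: coeff_map_poly coeff_pderiv)
 then show ?thesis unfolding cpoly_def[abs_def] by (auto intro!: DERIV_subset[OF poly_DERIV])
qed

lemma continuous_on_cpoly [continuous_intros]: "continuous_on S f ==> continuous_on S (%x. cpoly p (f x))"
 unfolding cpoly_def by (intro continuous_intros)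

lemma strip_fun_cpoly:
 assumes "strip_fun d f"
 shows "strip_fun d (%z y. cpoly p (of_real y + f z y))"
proof -
 have hol: "(%z. cpoly p (of_real y + f z y)) holomorphic_on Sg" if "y \<in> {-d..d}" for y
 proof -
  have "cpoly p holomorphic_on UNIV" unfolding holomorphic_on_def using cpoly_deriv field_differentiable_def by blast
  moreover have "(%z. f z y) holomorphic_on Sg" using assms that by (simp add: strip_fun_def)
  then have "(%z. of_real y + f z y) holomorphic_on Sg" by (intro holomorphic_intros)
  ultimately show ?thesis
   using holomorphic_on_compose_gen[of "%z. of_real y + f z y" Sg "cpoly p" UNIV] by (simp add: o_def)
 qed
 moreover have "cpoly p (of_real y + cnj w) = cnj (cpoly p (of_real y + w))" for y w
  using cpoly_cnj[of p "of_real y + w"] by simp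
 ultimately show ?thesis using assms unfolding strip_fun_def split_beta by (auto intro!: continuous_intros)
qed

text \<open>The linearization error of a polynomial is Lipschitz with constant A r on the disc of
  radius r, which is where the contraction factor comes from. \<open>A\<close> bounds the second
  derivative on the disc of radius |d| + 1, which contains y + et whenever r \<le> 1.\<close>

lemma cpoly_remainder:
 obtains A where "A \<ge> 0" "!!y et et' r. y \<in> {-d..d} ==> norm et \<le> r ==> norm et' \<le> r ==> r \<le> 1 ==>
   norm ((cpoly p (of_real y + et) - of_real (poly (pderiv p) y) * et) -
      (cpoly p (of_real y + et') - of_real (poly (pderiv p) y) * et')) \<le> A * r * norm (et - et')"
proof -
 define K where "K = cball (0::complex) (\<bar>d\<bar> + 1)"
 have "bounded (cpoly (pderiv (pderiv p)) ` K)"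
  unfolding K_def by (intro compact_imp_bounded compact_continuous_image continuous_intros compact_cball)
 then obtain A where A: "A > 0" "!!z. z \<in> K ==> norm (cpoly (pderiv (pderiv p)) z) \<le> A" unfolding bounded_pos by auto
 show thesis
 proof (rule that[of A])
  fix y r :: real and et et' :: complex
  assume y: "y \<in> {-d..d}" and r: "norm et \<le> r" "norm et' \<le> r" "r \<le> 1"
  have inK: "of_real y + w \<in> K" if "norm w \<le> r" for w
  proof -
   have "norm (of_real y + w) \<le> \<bar>y\<bar> + norm w" using norm_triangle_ineq[of "of_real y" w] by simp
   then show ?thesis using that r y by (auto simp: K_def)
  qed
  have r0: "0 \<le> r" using r(1) norm_ge_zero order_trans by blast
  have d1: "norm (cpoly (pderiv p) (of_real y + w) - of_real (poly (pderiv p) y)) \<le> A * r" if w: "norm w \<le> r" for w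
  proof -
   have "norm (cpoly (pderiv p) (of_real y + w) - cpoly (pderiv p) (of_real y + 0)) \<le> A * norm ((of_real y + w) - (of_real y + 0))"
   proof (rule field_differentiable_bound[of K "cpoly (pderiv p)" "cpoly (pderiv (pderiv p))"])
    show "convex K" by (simp add: K_def)
   qed (use A inK[OF w] inK[of 0] r0 cpoly_deriv in auto)
   also have "... \<le> A * r" using w A by simp
   finally show ?thesis by (simp add: cpoly_of_real)
  qed
  define S where "S = cball (0::complex) r"
  define h where "h w = cpoly p (of_real y + w) - of_real (poly (pderiv p) y) * w" for w
  have "norm (h et - h et') \<le> A * r * norm (et - et')"
  proof (rule field_differentiable_bound[of S h "%w. cpoly (pderiv p) (of_real y + w) - of_real (poly (pderiv p) y)"])
   show "convex S" by (simp add: S_def)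
   show "(h has_field_derivative cpoly (pderiv p) (of_real y + w) - of_real (poly (pderiv p) y)) (at w within S)" for w
   proof -
    have s: "((%w. of_real y + w) has_field_derivative 1) (at w within S)" by (auto intro!: derivative_eq_intros)
    have "((%w. cpoly p (of_real y + w)) has_field_derivative cpoly (pderiv p) (of_real y + w) * 1) (at w within S)"
     by (rule DERIV_chain2[OF cpoly_deriv[of _ _ UNIV, simplified] s])
    then show ?thesis unfolding h_def[abs_def] by (auto intro!: derivative_eq_intros)
   qed
  qed (use d1 r in \<open>auto simp: S_def\<close>)
  then show "norm ((cpoly p (of_real y + et) - of_real (poly (pderiv p) y) * et) -
      (cpoly p (of_real y + et') - of_real (poly (pderiv p) y) * et')) \<le> A * r * norm (et - et')"
   by (simp add: h_def)
 qed (use A in simp)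
qed

lemma strip_fun_limit:
 assumes f: "!!m. strip_fun d (f m)"
  and ul: "uniform_limit (Sg \<times> {-d..d}) (%m p. f m (fst p) (snd p)) (%p. g (fst p) (snd p)) sequentially"
 shows "strip_fun d g"
proof -
 have lim: "(%m. f m z y) \<longlonglongrightarrow> g z y" if "z \<in> Sg" "y \<in> {-d..d}" for z y
  using tendsto_uniform_limitI[OF ul, of "(z, y)"] that by simp
 have c: "continuous_on (Sg \<times> {-d..d}) (%(z, y). g z y)" unfolding split_beta
  by (rule uniform_limit_theorem[OF _ ul]) (use f in \<open>auto simp: strip_fun_def split_beta\<close>)
 have hol: "(%z. g z y) holomorphic_on Sg" if y: "y \<in> {-d..d}" for y
 proof (rule holomorphic_uniform_sequence[OF open_Sg, of "%m z. f m z y"])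
  show "(%z. f m z y) holomorphic_on Sg" for m using f y by (auto simp: strip_fun_def)
  fix z assume "z \<in> Sg"
  then obtain r where r: "r > 0" "cball z r \<subseteq> Sg" using open_Sg open_contains_cball by blast
  have "uniform_limit (cball z r) (%m z. f m z y) (%z. g z y) sequentially"
  proof (rule uniform_limitI)
   fix e :: real assume "e > 0"
   from uniform_limitD[OF ul this]
   show "\<forall>\<^sub>F m in sequentially. \<forall>x\<in>cball z r. dist (f m x y) (g x y) < e"
    by eventually_elim (use r(2) y in fastforce)
  qed
  with r show "\<exists>r>0. cball z r \<subseteq> Sg \<and> uniform_limit (cball z r) (%m z. f m z y) (%z. g z y) sequentially" by blast
 qed
 have inS: "z + 2 * of_real pi \<in> Sg" "- z \<in> Sg" "cnj z \<in> Sg" if "z \<in> Sg" for z using that by (auto simp: Sg_def)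
 have sym: "g (z + 2 * of_real pi) y = g z y" "g (- z) y = g z y" "g (cnj z) y = cnj (g z y)"
  if z: "z \<in> Sg" and y: "y \<in> {-d..d}" for z y
 proof -
  have fs: "f m (z + 2 * of_real pi) y = f m z y" "f m (- z) y = f m z y" "f m (cnj z) y = cnj (f m z y)" for m
   using f[of m] z y by (auto simp: strip_fun_def)
  show "g (z + 2 * of_real pi) y = g z y"
   using lim[OF inS(1)[OF z] y] lim[OF z y] LIMSEQ_unique unfolding fs by blast
  show "g (- z) y = g z y" using lim[OF inS(2)[OF z] y] lim[OF z y] LIMSEQ_unique unfolding fs by blast
  have "(%m. cnj (f m z y)) \<longlonglongrightarrow> cnj (g z y)" by (intro tendsto_intros lim z y)
  then show "g (cnj z) y = cnj (g z y)" using lim[OF inS(3)[OF z] y] LIMSEQ_unique unfolding fs by blast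
 qed
 show ?thesis unfolding strip_fun_def using c hol sym by blast
qed

definition strip_le :: "real => (complex => real => complex) => real => bool" where
 "strip_le d f M \<longleftrightarrow> (\<forall>z\<in>Sg. \<forall>y\<in>{-d..d}. norm (f z y) \<le> M)"

text \<open>Banach's theorem on a ball for the supremum over the strip. The contraction hypothesis
  speaks of an arbitrary bound \<open>de\<close> in place of a norm, so no function space has to be
  introduced.\<close>

lemma strip_contraction:
 assumes T: "!!f. strip_fun d f ==> strip_le d f r ==> strip_fun d (T f) \<and> strip_le d (T f) r"
  and contr: "!!f g de. strip_fun d f ==> strip_le d f r ==> strip_fun d g ==> strip_le d g r ==>
    strip_le d (%z y. f z y - g z y) de ==> strip_le d (%z y. T f z y - T g z y) (de / 2)"
  and r: "r \<ge> 0"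
 obtains f where "strip_fun d f" "strip_le d f r" "!!z y. z \<in> Sg ==> y \<in> {-d..d} ==> T f z y = f z y"
proof -
 define F where "F m = (T ^^ m) (%z y. 0)" for m
 have F0: "F 0 = (%z y. 0)" and FS: "F (Suc m) = T (F m)" for m by (simp_all add: F_def)
 have FF: "strip_fun d (F m) \<and> strip_le d (F m) r" for m
 proof (induction m)
  case 0
  have "strip_fun d (%z y. of_real 0)" by (rule strip_fun_const) (intro continuous_intros)
  then show ?case using r by (simp add: F0 strip_le_def)
 next
  case (Suc m) then show ?case unfolding FS using T by blast
 qed
 have inc: "strip_le d (%z y. F (Suc m) z y - F m z y) (r * (1/2)^m)" for m
 proof (induction m)
  case 0 then show ?case using FF[of "Suc 0"] by (simp add: F0)
 next
  case (Suc m)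
  from contr[OF FF[of "Suc m", THEN conjunct1] FF[of "Suc m", THEN conjunct2] FF[of m, THEN conjunct1] FF[of m, THEN conjunct2] Suc]
  show ?case by (simp add: FS)
 qed
 have inc': "norm (F (Suc m) (fst p) (snd p) - F m (fst p) (snd p)) \<le> r * (1/2)^m" if "p \<in> Sg \<times> {-d..d}" for m p
  using inc[of m] that by (auto simp: strip_le_def)
 obtain g where g: "uniform_limit (Sg \<times> {-d..d}) (%m p. F m (fst p) (snd p)) g sequentially"
  by (rule geometric_uniform_limit[of "Sg \<times> {-d..d}" "%m p. F m (fst p) (snd p)"]) (rule inc')
 define f where "f z y = g (z, y)" for z y
 have ul: "uniform_limit (Sg \<times> {-d..d}) (%m p. F m (fst p) (snd p)) (%p. f (fst p) (snd p)) sequentially"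
  using g by (simp add: f_def)
 have sf: "strip_fun d f" by (rule strip_fun_limit[OF _ ul]) (use FF in auto)
 have lim: "(%m. F m z y) \<longlonglongrightarrow> f z y" if "z \<in> Sg" "y \<in> {-d..d}" for z y
  using tendsto_uniform_limitI[OF ul, of "(z, y)"] that by simp
 have le: "strip_le d f r" unfolding strip_le_def
 proof (intro ballI)
  fix z y assume zy: "z \<in> Sg" "y \<in> {-d..d}"
  show "norm (f z y) \<le> r"
   by (rule Lim_bounded[OF tendsto_norm[OF lim[OF zy]], of 0]) (use FF zy in \<open>auto simp: strip_le_def\<close>)
 qed
 have "T f z y = f z y" if zy: "z \<in> Sg" "y \<in> {-d..d}" for z y
 proof -
  have "(%m. T (F m) z y) \<longlonglongrightarrow> T f z y"
  proof (rule tendstoI)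
   fix e :: real assume e: "e > 0"
   from uniform_limitD[OF ul e] show "\<forall>\<^sub>F m in sequentially. dist (T (F m) z y) (T f z y) < e"
   proof eventually_elim
    case (elim m)
    then have "strip_le d (%z y. F m z y - f z y) e" by (force simp: strip_le_def dist_norm)
    from contr[OF FF[of m, THEN conjunct1] FF[of m, THEN conjunct2] sf le this] zy e
    show ?case by (force simp: strip_le_def dist_norm)
   qed
  qed
  then have "(%m. F (Suc m) z y) \<longlonglongrightarrow> T f z y" by (simp add: FS)
  then show ?thesis using LIMSEQ_Suc[OF lim[OF zy]] LIMSEQ_unique by blast
 qed
 with sf le show thesis by (rule that)
qed

section \<open>Construction of travelling waves\<close>

text \<open>\<open>E\<close> is the stream function of the profile in the moving frame, \<open>- G\<close> its absolute vorticity,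
 and \<open>q = - G' / E'\<close>.\<close>

locale wave_setup =
 fixes d k :: real and E G :: "real poly" and q ph ph' :: "real => real"
 assumes d: "d > 0" and k: "k > 0"
  and Us: "!!y. y \<in> {-d..d} ==> poly (pderiv E) y > 0"
  and qc: "continuous_on {-d..d} q"
  and q_eq: "!!y. y \<in> {-d..d} ==> q y * poly (pderiv E) y + poly (pderiv G) y = 0"
  and q_pos: "!!y. y \<in> {-d..d} ==> q y > 0"
  and ph: "sol2 (-d) d (%y. k\<^sup>2 - q y) (%_. 0) ph ph'" "ph (-d) = 0" "ph' (-d) = 1" "ph d = 0"
   "!!y. y \<in> {-d<..<d} ==> ph y > 0"

text \<open>All constants are fixed before an amplitude is chosen, so that the radius of the
  contraction and the admissible amplitudes can be defined from them.\<close>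

locale wave_operators = wave_setup +
 fixes C :: real and W W' :: "nat => (real => real) => real => real"
  and m Qb AG AF Ph :: real
 assumes C: "C \<ge> 0" and W: "!!n. mode_operator_spec (-d) d (%y. (real n * k)\<^sup>2 - q y) n C (W n) (W' n)"
  and W_end: "!!n g. n \<ge> 2 ==> continuous_on {-d..d} g ==> W n g d = 0"
   "!!g. continuous_on {-d..d} g ==> integral {-d..d} (%y. g y * ph y) = 0 ==> W 1 g d = 0"
   "!!g. W' 1 g (-d) = 0"
  and m: "m > 0" "!!y. y \<in> {-d..d} ==> m \<le> poly (pderiv E) y"
  and Qb: "!!y. y \<in> {-d..d} ==> q y \<le> Qb"
  and AG: "AG \<ge> 0" "!!y et et' r. y \<in> {-d..d} ==> norm et \<le> r ==> norm et' \<le> r ==> r \<le> 1 ==>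
   norm ((cpoly G (of_real y + et) - of_real (poly (pderiv G) y) * et) -
      (cpoly G (of_real y + et') - of_real (poly (pderiv G) y) * et')) \<le> AG * r * norm (et - et')"
  and AF: "AF \<ge> 0" "!!y et et' r. y \<in> {-d..d} ==> norm et \<le> r ==> norm et' \<le> r ==> r \<le> 1 ==>
   norm ((cpoly E (of_real y + et) - of_real (poly (pderiv E) y) * et) -
      (cpoly E (of_real y + et') - of_real (poly (pderiv E) y) * et')) \<le> AF * r * norm (et - et')"
  and Ph: "!!y. y \<in> {-d..d} ==> \<bar>ph y\<bar> \<le> Ph"

lemma (in wave_setup) wave_operators_exist:
 "\<exists>C W W' m Qb AG AF Ph. wave_operators d k E G q ph ph' C W W' m Qb AG AF Ph"
proof -
 have ab: "-d < d" using d by simp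
 have ne: "{-d..d} \<noteq> {}" using d by simp
 have cE: "continuous_on {-d..d} (poly (pderiv E))" by (intro continuous_intros)
 obtain ym where ym: "ym \<in> {-d..d}" "!!y. y \<in> {-d..d} ==> poly (pderiv E) ym \<le> poly (pderiv E) y"
  using continuous_attains_inf[OF compact_Icc ne cE] by blast
 obtain yq where yq: "yq \<in> {-d..d}" "!!y. y \<in> {-d..d} ==> q y \<le> q yq"
  using continuous_attains_sup[OF compact_Icc ne qc] by blast
 have cph: "continuous_on {-d..d} (%y. \<bar>ph y\<bar>)" by (intro continuous_intros sol2_continuous(1)[OF ph(1)])
 obtain yp where yp: "yp \<in> {-d..d}" "!!y. y \<in> {-d..d} ==> \<bar>ph y\<bar> \<le> \<bar>ph yp\<bar>"
  using continuous_attains_sup[OF compact_Icc ne cph] by blast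
 show ?thesis
 proof (rule mode_operators[OF ab qc k ph])
  fix C :: real and W W' :: "nat => (real => real) => real => real"
  assume 1: "C \<ge> 0" "!!n. mode_operator_spec (-d) d (%y. (real n * k)\<^sup>2 - q y) n C (W n) (W' n)"
   "!!n g. n \<ge> 2 ==> continuous_on {-d..d} g ==> W n g d = 0"
   "!!g. continuous_on {-d..d} g ==> integral {-d..d} (%y. g y * ph y) = 0 ==> W 1 g d = 0"
   "!!g. W' 1 g (-d) = 0"
  show ?thesis
  proof (rule cpoly_remainder[of d G])
   fix AG assume AG: "AG \<ge> 0" "!!y et et' r. y \<in> {-d..d} ==> norm et \<le> r ==> norm et' \<le> r ==> r \<le> 1 ==>
     norm ((cpoly G (of_real y + et) - of_real (poly (pderiv G) y) * et) -
      (cpoly G (of_real y + et') - of_real (poly (pderiv G) y) * et')) \<le> AG * r * norm (et - et')"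
   show ?thesis
   proof (rule cpoly_remainder[of d E])
    fix AF assume AF: "AF \<ge> 0" "!!y et et' r. y \<in> {-d..d} ==> norm et \<le> r ==> norm et' \<le> r ==> r \<le> 1 ==>
     norm ((cpoly E (of_real y + et) - of_real (poly (pderiv E) y) * et) -
      (cpoly E (of_real y + et') - of_real (poly (pderiv E) y) * et')) \<le> AF * r * norm (et - et')"
    have "wave_operators d k E G q ph ph' C W W' (poly (pderiv E) ym) (q yq) AG AF \<bar>ph yp\<bar>"
     by (intro wave_operators.intro wave_operators_axioms.intro wave_setup_axioms)
       (rule 1 AG AF Us[OF ym(1)] ym(2) yq(2) yp(2); assumption)+
    then show ?thesis by blast
   qed
  qed
 qed
qed

section \<open>Estimates for the fixed-point map\<close>

context wave_operators begin

lemma Qb0: "Qb \<ge> 0" using Qb[of 0] q_pos[of 0] d by simp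

lemma Ph0: "Ph \<ge> 0" using Ph[of 0] d by simp

lemma cph: "continuous_on {-d..d} ph" by (rule sol2_continuous(1)[OF ph(1)])

lemma W_sol: "continuous_on {-d..d} g ==> sol2 (-d) d (%y. (real n * k)\<^sup>2 - q y) g (W n g) (W' n g)"
 using W[of n] by (simp add: mode_operator_spec_def)

lemma W_start: "continuous_on {-d..d} g ==> W n g (-d) = 0" using W[of n] by (simp add: mode_operator_spec_def)

lemma W_bound:
 assumes "continuous_on {-d..d} g" "!!y. y \<in> {-d..d} ==> \<bar>g y\<bar> \<le> B" "y \<in> {-d..d}"
 shows "\<bar>W n g y\<bar> \<le> C * B / (real n + 1)\<^sup>2" "\<bar>W' n g y\<bar> \<le> C * B"
 using W[of n] assms unfolding mode_operator_spec_def by blast+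

lemma W_diff:
 assumes "continuous_on {-d..d} g" "continuous_on {-d..d} h" "y \<in> {-d..d}"
 shows "W n g y - W n h y = W n (%y. g y - h y) y" using W[of n] assms unfolding mode_operator_spec_def by metis

text \<open>A right inverse of k^2 d_zz + d_yy + q, that is, of the Laplacian plus q with z = k
  x.\<close>

definition K :: "(complex => real => complex) => complex => real => complex" where
 "K f = (%z y. \<Sum>n. of_real (W n (fcoef n f) y) * cos (of_nat n * z))"

definition CK :: real where "CK = 2 * C * sq_sum"

lemma CK0: "CK \<ge> 0"
proof -
 have "sq_sum \<ge> 0" unfolding sq_sum_def by (rule suminf_nonneg[OF summable_sq]) simp
 then show ?thesis using C by (simp add: CK_def)
qed

lemma fcoef_le:
 assumes "strip_fun d f" "strip_le d f M" "y \<in> {-d..d}"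
 shows "\<bar>fcoef n f y\<bar> \<le> 2 * M * exp (- real n)"
 by (rule fcoef_bound[OF assms(1,3)]) (use assms in \<open>auto simp: strip_le_def\<close>)

lemma K_coef:
 assumes f: "strip_fun d f" "strip_le d f M"
 shows "continuous_on {-d..d} (W n (fcoef n f))"
  "y \<in> {-d..d} ==> \<bar>W n (fcoef n f) y\<bar> \<le> (2 * C * M) * exp (- real n) / (real n + 1)\<^sup>2"
proof -
 show "continuous_on {-d..d} (W n (fcoef n f))" using sol2_continuous(1)[OF W_sol[OF fcoef_continuous[OF f(1)]]] .
 show "\<bar>W n (fcoef n f) y\<bar> \<le> (2 * C * M) * exp (- real n) / (real n + 1)\<^sup>2" if "y \<in> {-d..d}"
  using W_bound(1)[OF fcoef_continuous[OF f(1)] fcoef_le[OF f] that, of n n] by (simp add: mult_ac)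
qed

lemma K_props:
 assumes f: "strip_fun d f" "strip_le d f M"
 shows "strip_fun d (K f)" "strip_le d (K f) (CK * M)"
  "y \<in> {-d..d} ==> fcoef n (K f) y = W n (fcoef n f) y"
  "z \<in> Sg ==> y \<in> {-d..d} ==> summable (%n. of_real (W n (fcoef n f) y) * cos (of_nat n * z))"
proof -
 show "strip_fun d (K f)" unfolding K_def
  by (rule strip_series(1)[where B="2 * C * M"]) (rule K_coef[OF f]; assumption?)+
 have "norm (K f z y) \<le> (2 * C * M) * sq_sum" if "z \<in> Sg" "y \<in> {-d..d}" for z y unfolding K_def
  by (rule strip_series(2)[OF _ _ that]) (rule K_coef[OF f]; assumption?)+
 then show "strip_le d (K f) (CK * M)" unfolding strip_le_def CK_def by (simp add: mult_ac)
 show "fcoef n (K f) y = W n (fcoef n f) y" if "y \<in> {-d..d}" unfolding K_def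
  by (rule strip_series(5)[where B="2 * C * M", OF _ _ that]) (rule K_coef[OF f]; assumption?)+
 show "summable (%n. of_real (W n (fcoef n f) y) * cos (of_nat n * z))" if "z \<in> Sg" "y \<in> {-d..d}"
  by (rule strip_series(3)[where B="2 * C * M", OF _ _ that]) (rule K_coef[OF f]; assumption?)+
qed

lemma K_diff:
 assumes f: "strip_fun d f" "strip_le d f M" and g: "strip_fun d g" "strip_le d g M'"
  and fg: "strip_le d (%z y. f z y - g z y) de"
 shows "strip_le d (%z y. K f z y - K g z y) (CK * de)"
proof -
 define a where "a n y = W n (fcoef n f) y - W n (fcoef n g) y" for n y
 have sfg: "strip_fun d (%z y. f z y - g z y)" by (rule strip_fun_combine(2)[OF f(1) g(1)])
 have ca: "continuous_on {-d..d} (a n)" for n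
  unfolding a_def by (intro continuous_intros K_coef(1)[OF f] K_coef(1)[OF g])
 have ba: "\<bar>a n y\<bar> \<le> (2 * C * de) * exp (- real n) / (real n + 1)\<^sup>2" if y: "y \<in> {-d..d}" for n y
 proof -
  note cf = fcoef_continuous[OF f(1), of n] and cg = fcoef_continuous[OF g(1), of n]
  have "a n y = W n (%y. fcoef n f y - fcoef n g y) y" unfolding a_def by (rule W_diff[OF cf cg y])
  also have "\<bar>...\<bar> \<le> C * (2 * de * exp (- real n)) / (real n + 1)\<^sup>2"
  proof (rule W_bound(1)[OF _ _ y])
   show "continuous_on {-d..d} (%y. fcoef n f y - fcoef n g y)" by (intro continuous_intros cf cg)
   show "\<bar>fcoef n f y - fcoef n g y\<bar> \<le> 2 * de * exp (- real n)" if "y \<in> {-d..d}" for y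
    using fcoef_le[OF sfg fg that, of n] fcoef_diff[OF f(1) g(1) that, of n] by simp
  qed
  finally show ?thesis by (simp add: mult_ac)
 qed
 show ?thesis unfolding strip_le_def
 proof (intro ballI)
  fix z y assume zy: "z \<in> Sg" "y \<in> {-d..d}"
  have "K f z y - K g z y = (\<Sum>n. of_real (a n y) * cos (of_nat n * z))" unfolding K_def a_def
   using suminf_diff[OF K_props(4)[OF f zy] K_props(4)[OF g zy]] by (simp add: left_diff_distrib)
  also have "norm ... \<le> (2 * C * de) * sq_sum" by (rule strip_series(2)[OF ca ba zy])
  finally show "norm (K f z y - K g z y) \<le> CK * de" by (simp add: CK_def mult_ac)
 qed
qed

text \<open>If w = E(y + f) - E(y) - mu f, then Laplacian w = G(y + f) - G(y) is the same as
  (Laplacian + q) w = \<open>T mu f\<close>. Since q E' + G' = 0, the only term of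
  \<open>T mu f\<close> linear in f is - mu q f.\<close>

definition T :: "real => (complex => real => complex) => complex => real => complex" where
 "T mu f = (%z y. (cpoly G (of_real y + f z y) - of_real (poly G y)) +
   of_real (q y) * (cpoly E (of_real y + f z y) - of_real (poly E y)) - of_real (mu * q y) * f z y)"

definition R :: "(complex => real => complex) => complex => real => complex" where
 "R f = (%z y. cpoly E (of_real y + f z y) - of_real (poly E y) - of_real (poly (pderiv E) y) * f z y)"

text \<open>The displacement \<open>f\<close> of the level lines is a fixed point of \<open>step a mu\<close>. Dividing by \<open>E'\<close> isolates the
 linear part of \<open>E (y + f) - E y - mu f = a ph cos z + K (T mu f)\<close>, where \<open>K\<close> inverts the linearized
 vorticity equation mode by mode, with zero initial data at \<open>-d\<close> for the modes 0 and 1.\<close>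

definition step :: "real => real => (complex => real => complex) => complex => real => complex" where
 "step a mu f = (%z y. of_real (1 / poly (pderiv E) y) *
   (of_real (a * ph y) * cos z + K (T mu f) z y - R f z y + of_real mu * f z y))"

definition AT :: real where "AT = AG + Qb * AF + Qb"

lemma AT0: "AT \<ge> 0" using AG(1) AF(1) Qb0 by (simp add: AT_def)

lemma T_strip_fun: "strip_fun d f ==> strip_fun d (T mu f)" unfolding T_def
 by (intro strip_fun_combine strip_fun_cpoly strip_fun_const continuous_intros qc)

lemma R_strip_fun: "strip_fun d f ==> strip_fun d (R f)" unfolding R_def
 by (intro strip_fun_combine strip_fun_cpoly strip_fun_const continuous_intros)

lemma T_diff:
 assumes f: "strip_le d f r" and g: "strip_le d g r" and r: "r \<le> 1" and fg: "strip_le d (%z y. f z y - g z y) de"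
 shows "strip_le d (%z y. T mu f z y - T mu g z y) (AT * (r + \<bar>mu\<bar>) * de)" unfolding strip_le_def
proof (intro ballI)
 fix z y assume zy: "z \<in> Sg" "y \<in> {-d..d}"
 define u v where "u = f z y" and "v = g z y"
 have uv: "norm u \<le> r" "norm v \<le> r" "norm (u - v) \<le> de" using f g fg zy by (auto simp: strip_le_def u_def v_def)
 have r0: "r \<ge> 0" using uv(1) norm_ge_zero order_trans by blast
 have de0: "de \<ge> 0" using uv(3) norm_ge_zero order_trans by blast
 define hG where "hG w = cpoly G (of_real y + w) - of_real (poly (pderiv G) y) * w" for w
 define hE where "hE w = cpoly E (of_real y + w) - of_real (poly (pderiv E) y) * w" for w
 have "complex_of_real (poly (pderiv G) y) = - of_real (q y) * of_real (poly (pderiv E) y)"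
  using q_eq[OF zy(2)] by (metis add_eq_0_iff mult_minus_left of_real_minus of_real_mult)
 then have eq: "T mu f z y - T mu g z y = (hG u - hG v) + of_real (q y) * (hE u - hE v) - of_real (mu * q y) * (u - v)"
  by (simp add: T_def hG_def hE_def u_def v_def algebra_simps)
 have "norm (T mu f z y - T mu g z y) \<le> norm (hG u - hG v) + norm (of_real (q y) * (hE u - hE v)) + norm (of_real (mu * q y) * (u - v))"
  unfolding eq by (rule order_trans[OF norm_triangle_ineq4 add_right_mono[OF norm_triangle_ineq]])
 also have "... \<le> AG * r * de + Qb * (AF * r * de) + (\<bar>mu\<bar> * Qb) * de"
 proof (intro add_mono)
  have "norm (hG u - hG v) \<le> AG * r * norm (u - v)" unfolding hG_def by (rule AG(2)[OF zy(2) uv(1,2) r])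
  also have "... \<le> AG * r * de" using AG(1) r0 uv(3) by (intro mult_left_mono) auto
  finally show "norm (hG u - hG v) \<le> AG * r * de" .
  have "norm (hE u - hE v) \<le> AF * r * norm (u - v)" unfolding hE_def by (rule AF(2)[OF zy(2) uv(1,2) r])
  also have "... \<le> AF * r * de" using AF(1) r0 uv(3) by (intro mult_left_mono) auto
  finally have "norm (hE u - hE v) \<le> AF * r * de" .
  then show "norm (of_real (q y) * (hE u - hE v)) \<le> Qb * (AF * r * de)"
   unfolding norm_mult using Qb[OF zy(2)] q_pos[OF zy(2)] Qb0 by (intro mult_mono) auto
  show "norm (of_real (mu * q y) * (u - v)) \<le> (\<bar>mu\<bar> * Qb) * de"
   unfolding norm_mult norm_of_real abs_mult using Qb[OF zy(2)] q_pos[OF zy(2)] Qb0 uv(3)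
   by (intro mult_mono) (auto intro: mult_left_mono)
 qed
 also have "... \<le> AT * (r + \<bar>mu\<bar>) * de"
 proof -
  have "(AG + Qb * AF) * r + Qb * \<bar>mu\<bar> \<le> AT * r + AT * \<bar>mu\<bar>"
   using r0 AG(1) AF(1) Qb0 by (intro add_mono mult_right_mono) (auto simp: AT_def)
  from mult_right_mono[OF this de0] show ?thesis by (simp add: algebra_simps)
 qed
 finally show "norm (T mu f z y - T mu g z y) \<le> AT * (r + \<bar>mu\<bar>) * de" .
qed

lemma strip_zero: "strip_fun d (%z y. 0)" "r \<ge> 0 ==> strip_le d (%z y. 0) r"
 using strip_fun_const[of d "%_. 0"] by (auto simp: strip_le_def)

lemma T_zero: "T mu (%z y. 0) = (%z y. 0)" by (simp add: T_def cpoly_of_real)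

lemma R_zero: "R (%z y. 0) = (%z y. 0)" by (simp add: R_def cpoly_of_real)

lemma T_le:
 assumes f: "strip_le d f r" and r: "0 \<le> r" "r \<le> 1"
 shows "strip_le d (T mu f) (AT * (r + \<bar>mu\<bar>) * r)"
 using T_diff[OF f strip_zero(2)[OF r(1)] r(2), of r mu] f by (simp add: T_zero)

lemma R_diff:
 assumes f: "strip_le d f r" and g: "strip_le d g r" and r: "r \<le> 1" and fg: "strip_le d (%z y. f z y - g z y) de"
 shows "strip_le d (%z y. R f z y - R g z y) (AF * r * de)" unfolding strip_le_def
proof (intro ballI)
 fix z y assume zy: "z \<in> Sg" "y \<in> {-d..d}"
 have uv: "norm (f z y) \<le> r" "norm (g z y) \<le> r" "norm (f z y - g z y) \<le> de" using f g fg zy by (auto simp: strip_le_def)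
 have r0: "r \<ge> 0" using uv(1) norm_ge_zero order_trans by blast
 have "norm (R f z y - R g z y) \<le> AF * r * norm (f z y - g z y)"
  using AF(2)[OF zy(2) uv(1,2) r] by (simp add: R_def algebra_simps)
 also have "... \<le> AF * r * de" using AF(1) r0 uv(3) by (intro mult_left_mono) auto
 finally show "norm (R f z y - R g z y) \<le> AF * r * de" .
qed

definition B1 :: real where "B1 = (CK * AT + AF + 1) / m"

lemma B1_pos: "B1 > 0" using CK0 AT0 AF(1) m by (simp add: B1_def add_nonneg_pos)

lemma step_strip_fun:
 assumes f: "strip_fun d f" "strip_le d f r" "0 \<le> r" "r \<le> 1"
 shows "strip_fun d (step a mu f)"
proof -
 have cu: "continuous_on {-d..d} (%y. 1 / poly (pderiv E) y)" by (intro continuous_intros) (use Us in force)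
 show ?thesis unfolding step_def
  by (intro strip_fun_combine strip_fun_const[OF cu] strip_fun_const strip_fun_cos continuous_intros cph R_strip_fun
    K_props(1)[OF T_strip_fun[OF f(1)] T_le[OF f(2-4)]] f)
qed

lemma step_diff:
 assumes f: "strip_fun d f" "strip_le d f r" and g: "strip_fun d g" "strip_le d g r" and r: "0 \<le> r" "r \<le> 1"
  and fg: "strip_le d (%z y. f z y - g z y) de"
 shows "strip_le d (%z y. step a mu f z y - step a mu g z y) (B1 * (r + \<bar>mu\<bar>) * de)" unfolding strip_le_def
proof (intro ballI)
 fix z y assume zy: "z \<in> Sg" "y \<in> {-d..d}"
 define s where "s = AT * (r + \<bar>mu\<bar>) * de"
 have "norm (f z y - g z y) \<le> de" using fg zy by (auto simp: strip_le_def)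
 then have de0: "de \<ge> 0" using norm_ge_zero order_trans by blast
 have k1: "norm (K (T mu f) z y - K (T mu g) z y) \<le> CK * s"
  using K_diff[OF T_strip_fun[OF f(1)] T_le[OF f(2) r] T_strip_fun[OF g(1)] T_le[OF g(2) r] T_diff[OF f(2) g(2) r(2) fg]] zy
  by (auto simp: strip_le_def s_def)
 have k2: "norm (R f z y - R g z y) \<le> AF * r * de" using R_diff[OF f(2) g(2) r(2) fg] zy by (auto simp: strip_le_def)
 have k3: "norm (of_real mu * (f z y - g z y)) \<le> \<bar>mu\<bar> * de"
  using fg zy by (auto simp: norm_mult strip_le_def intro: mult_left_mono)
 have "step a mu f z y - step a mu g z y = of_real (1 / poly (pderiv E) y) *
   ((K (T mu f) z y - K (T mu g) z y) - (R f z y - R g z y) + of_real mu * (f z y - g z y))"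
  by (simp add: step_def algebra_simps)
 also have "norm ... \<le> (1 / m) * (CK * s + AF * r * de + \<bar>mu\<bar> * de)" unfolding norm_mult
 proof (rule mult_mono)
  show "norm (complex_of_real (1 / poly (pderiv E) y)) \<le> 1 / m"
   using m m(2)[OF zy(2)] by (auto simp: norm_divide intro!: frac_le)
  show "norm ((K (T mu f) z y - K (T mu g) z y) - (R f z y - R g z y) + of_real mu * (f z y - g z y)) \<le> CK * s + AF * r * de + \<bar>mu\<bar> * de"
   by (rule order_trans[OF norm_triangle_ineq add_mono[OF order_trans[OF norm_triangle_ineq4 add_mono[OF k1 k2]] k3]])
 qed (use m in auto)
 also have "... \<le> B1 * (r + \<bar>mu\<bar>) * de"
 proof -
  have "AF * r + \<bar>mu\<bar> \<le> (AF + 1) * (r + \<bar>mu\<bar>)" using AF(1) r by (simp add: algebra_simps)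
  then have "(AF * r + \<bar>mu\<bar>) * de \<le> (AF + 1) * (r + \<bar>mu\<bar>) * de" using de0 by (rule mult_right_mono)
  then have "CK * s + AF * r * de + \<bar>mu\<bar> * de \<le> (CK * AT + AF + 1) * (r + \<bar>mu\<bar>) * de"
   by (simp add: s_def algebra_simps)
  from divide_right_mono[OF this, of m] show ?thesis using m by (simp add: B1_def)
 qed
 finally show "norm (step a mu f z y - step a mu g z y) \<le> B1 * (r + \<bar>mu\<bar>) * de" .
qed

text \<open>The 3 bounds |cos z| in the strip, because e < 3.\<close>

definition B2 :: real where "B2 = 3 * Ph / m + 1"

lemma B2_ge1: "B2 \<ge> 1" using Ph0 m by (simp add: B2_def)

lemma step_zero: "a \<ge> 0 ==> strip_le d (step a mu (%z y. 0)) (a * B2)" unfolding strip_le_def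
proof (intro ballI)
 fix z y assume a: "a \<ge> 0" and zy: "z \<in> Sg" "y \<in> {-d..d}"
 have K0: "K (%z y. 0) z y = 0"
  using K_props(2)[OF strip_zero(1) strip_zero(2)[OF order_refl]] zy by (auto simp: strip_le_def)
 have "norm (cos z) \<le> 3" using norm_cos_strip[OF zy(1), of 1] exp_le by simp
 then have "norm (step a mu (%z y. 0) z y) \<le> (1 / m) * ((a * Ph) * 3)" unfolding step_def T_zero R_zero K0
  using m m(2)[OF zy(2)] Ph[OF zy(2)] a Ph0
  by (auto simp: norm_mult norm_divide abs_mult intro!: mult_mono frac_le mult_nonneg_nonneg)
 also have "... \<le> a * B2" using a m by (simp add: B2_def distrib_left mult_ac)
 finally show "norm (step a mu (%z y. 0) z y) \<le> a * B2" .
qed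

text \<open>Chosen so that the Lipschitz constant B1 (r + |mu|) of \<open>step\<close> is at most
  1/2 when both r and |mu| are at most \<open>r0\<close>.\<close>

definition r0 :: real where "r0 = min 1 (1 / (4 * B1))"

lemma r0: "r0 > 0" "r0 \<le> 1" "B1 * (r + s) \<le> 1/2" if "0 \<le> r" "r \<le> r0" "s \<le> r0" for r s
proof -
 show "r0 > 0" "r0 \<le> 1" using B1_pos by (auto simp: r0_def)
 have "B1 * (r + s) \<le> B1 * (2 * (1 / (4 * B1)))" using that B1_pos by (intro mult_left_mono) (auto simp: r0_def)
 then show "B1 * (r + s) \<le> 1/2" using B1_pos by simp
qed

lemma strip_le_mono: "strip_le d f M ==> M \<le> N ==> strip_le d f N" by (force simp: strip_le_def)

lemma step_fixed_point:
 assumes a: "a \<ge> 0" "2 * a * B2 \<le> r0" and mu: "\<bar>mu\<bar> \<le> r0"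
 obtains f where "strip_fun d f" "strip_le d f (2 * a * B2)" "!!z y. z \<in> Sg ==> y \<in> {-d..d} ==> step a mu f z y = f z y"
proof -
 \<comment> \<open>\<open>step\<close> maps 0 to size at most a B2 = r / 2, and the contraction adds
   at most another r / 2, so the ball of radius r is invariant.\<close>
 define r where "r = 2 * a * B2"
 have r: "0 \<le> r" "r \<le> r0" using a B2_ge1 by (auto simp: r_def)
 have r1: "r \<le> 1" using r r0(2)[OF order_refl, of 0] by (meson order_trans r0(2))
 have Bh: "B1 * (r + \<bar>mu\<bar>) \<le> 1/2" by (rule r0(3)[OF r mu])
 have contr: "strip_le d (%z y. step a mu f z y - step a mu g z y) (de / 2)"
  if "strip_fun d f" "strip_le d f r" "strip_fun d g" "strip_le d g r" and fg: "strip_le d (%z y. f z y - g z y) de" for f g de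
 proof (rule strip_le_mono[OF step_diff[OF that(1-4) r(1) r1 fg]])
  have "norm (f 0 0 - g 0 0) \<le> de" using fg d by (auto simp: strip_le_def Sg_def)
  then have "de \<ge> 0" using norm_ge_zero order_trans by blast
  then show "B1 * (r + \<bar>mu\<bar>) * de \<le> de / 2" using mult_right_mono[OF Bh] by fastforce
 qed
 have self: "strip_fun d (step a mu f) \<and> strip_le d (step a mu f) r" if f: "strip_fun d f" "strip_le d f r" for f
 proof
  show "strip_fun d (step a mu f)" by (rule step_strip_fun[OF f r(1) r1])
  have "strip_le d (%z y. step a mu f z y - step a mu (%z y. 0) z y) (r / 2)"
   by (rule contr[OF f strip_zero(1) strip_zero(2)[OF r(1)]]) (use f in simp)
  then show "strip_le d (step a mu f) r" using step_zero[OF a(1), of mu] unfolding strip_le_def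
  proof (intro ballI)
   fix z y assume h: "\<forall>z\<in>Sg. \<forall>y\<in>{- d..d}. cmod (step a mu f z y - step a mu (%z y. 0) z y) \<le> r / 2"
    "\<forall>z\<in>Sg. \<forall>y\<in>{- d..d}. cmod (step a mu (%z y. 0) z y) \<le> a * B2" and zy: "z \<in> Sg" "y \<in> {-d..d}"
   have "norm (step a mu f z y) \<le> norm (step a mu f z y - step a mu (%z y. 0) z y) + norm (step a mu (%z y. 0) z y)"
    by (metis norm_triangle_ineq diff_add_cancel)
   also have "... \<le> r / 2 + a * B2" using h zy by (intro add_mono) auto
   finally show "norm (step a mu f z y) \<le> r" by (simp add: r_def)
  qed
 qed
 show thesis
 proof (rule strip_contraction[of d r "step a mu", OF self contr r(1)])
  fix f assume "strip_fun d f" "strip_le d f r" "!!z y. z \<in> Sg ==> y \<in> {-d..d} ==> step a mu f z y = f z y"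
  then show thesis using that[of f] unfolding r_def by blast
 qed
qed

lemma fixed_point_identity:
 assumes "step a mu f z y = f z y" "y \<in> {-d..d}"
 shows "cpoly E (of_real y + f z y) - of_real (poly E y) - of_real mu * f z y = of_real (a * ph y) * cos z + K (T mu f) z y"
proof -
 have "complex_of_real (poly (pderiv E) y) \<noteq> 0" using Us[OF assms(2)] by simp
 then have "of_real (poly (pderiv E) y) * step a mu f z y = of_real (a * ph y) * cos z + K (T mu f) z y - R f z y + of_real mu * f z y"
  by (simp add: step_def)
 then show ?thesis unfolding assms(1) by (simp add: R_def algebra_simps)
qed

lemma step_parameter_diff:
 assumes g: "strip_fun d g" "strip_le d g r" and r: "0 \<le> r" "r \<le> 1"
 shows "strip_le d (%z y. step a mu g z y - step a nu g z y) ((CK * Qb + 1) / m * r * \<bar>mu - nu\<bar>)"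
  and "strip_le d (%z y. T mu g z y - T nu g z y) (Qb * r * \<bar>mu - nu\<bar>)"
proof -
 show TT: "strip_le d (%z y. T mu g z y - T nu g z y) (Qb * r * \<bar>mu - nu\<bar>)" unfolding strip_le_def
 proof (intro ballI)
  fix z y assume zy: "z \<in> Sg" "y \<in> {-d..d}"
  have "T mu g z y - T nu g z y = of_real (q y) * (g z y * of_real (nu - mu))" by (simp add: T_def algebra_simps)
  also have "norm ... \<le> Qb * (r * \<bar>mu - nu\<bar>)" unfolding norm_mult norm_of_real
  proof (rule mult_mono)
   show "\<bar>q y\<bar> \<le> Qb" using Qb[OF zy(2)] q_pos[OF zy(2)] by simp
   have "norm (g z y) \<le> r" using g zy by (auto simp: strip_le_def)
   then show "norm (g z y) * \<bar>nu - mu\<bar> \<le> r * \<bar>mu - nu\<bar>" by (simp add: abs_minus_commute mult_right_mono)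
  qed (use Qb0 in auto)
  finally show "norm (T mu g z y - T nu g z y) \<le> Qb * r * \<bar>mu - nu\<bar>" by (simp add: mult_ac)
 qed
 show "strip_le d (%z y. step a mu g z y - step a nu g z y) ((CK * Qb + 1) / m * r * \<bar>mu - nu\<bar>)"
  unfolding strip_le_def
 proof (intro ballI)
  fix z y assume zy: "z \<in> Sg" "y \<in> {-d..d}"
  have k1: "norm (K (T mu g) z y - K (T nu g) z y) \<le> CK * (Qb * r * \<bar>mu - nu\<bar>)"
   using K_diff[OF T_strip_fun[OF g(1)] T_le[OF g(2) r] T_strip_fun[OF g(1)] T_le[OF g(2) r] TT] zy by (auto simp: strip_le_def)
  have k2: "norm (of_real (mu - nu) * g z y) \<le> \<bar>mu - nu\<bar> * r"
   unfolding norm_mult norm_of_real using g zy by (auto simp: strip_le_def intro: mult_left_mono)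
  have "step a mu g z y - step a nu g z y = of_real (1 / poly (pderiv E) y) *
    ((K (T mu g) z y - K (T nu g) z y) + of_real (mu - nu) * g z y)" by (simp add: step_def algebra_simps)
  also have "norm ... \<le> (1 / m) * (CK * (Qb * r * \<bar>mu - nu\<bar>) + \<bar>mu - nu\<bar> * r)" unfolding norm_mult
  proof (rule mult_mono)
   show "norm (complex_of_real (1 / poly (pderiv E) y)) \<le> 1 / m"
    using m m(2)[OF zy(2)] by (auto simp: norm_divide intro!: frac_le)
   show "norm ((K (T mu g) z y - K (T nu g) z y) + of_real (mu - nu) * g z y) \<le> CK * (Qb * r * \<bar>mu - nu\<bar>) + \<bar>mu - nu\<bar> * r"
    by (rule order_trans[OF norm_triangle_ineq add_mono[OF k1 k2]])
  qed (use m in auto)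
  also have "... = (CK * Qb + 1) / m * r * \<bar>mu - nu\<bar>" by (simp add: field_simps)
  finally show "norm (step a mu g z y - step a nu g z y) \<le> (CK * Qb + 1) / m * r * \<bar>mu - nu\<bar>" .
 qed
qed

text \<open>Changing mu changes \<open>step\<close> by at most e, and the contraction halves what
  was there before. Iterating the map sending a bound x to x/2 + e, starting from the trivial bound
  2r, leads to 2e in the limit.\<close>

lemma fixed_point_lipschitz:
 assumes f: "strip_fun d f" "strip_le d f r" "!!z y. z \<in> Sg ==> y \<in> {-d..d} ==> step a mu f z y = f z y"
  and g: "strip_fun d g" "strip_le d g r" "!!z y. z \<in> Sg ==> y \<in> {-d..d} ==> step a nu g z y = g z y"
  and r: "0 \<le> r" "r \<le> r0" and mu: "\<bar>mu\<bar> \<le> r0"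
 shows "strip_le d (%z y. f z y - g z y) (2 * ((CK * Qb + 1) / m) * \<bar>mu - nu\<bar>)"
proof -
 have r1: "r \<le> 1" using r r0(2) order_trans by blast
 define e where "e = (CK * Qb + 1) / m * r * \<bar>mu - nu\<bar>"
 have b: "strip_le d (%z y. f z y - g z y) (2 * e + 2 * r * (1/2)^n)" for n
 proof (induction n)
  case 0
  show ?case unfolding strip_le_def
  proof (intro ballI)
   fix z y assume zy: "z \<in> Sg" "y \<in> {-d..d}"
   have "norm (f z y - g z y) \<le> norm (f z y) + norm (g z y)" by (rule norm_triangle_ineq4)
   also have "... \<le> r + r" using f(2) g(2) zy by (intro add_mono) (auto simp: strip_le_def)
   also have "... \<le> 2 * e + 2 * r * (1/2)^0" using r m Qb0 CK0 by (simp add: e_def)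
   finally show "norm (f z y - g z y) \<le> 2 * e + 2 * r * (1/2)^0" .
  qed
 next
  case (Suc n)
  define de where "de = 2 * e + 2 * r * (1/2)^n"
  have de0: "de \<ge> 0" using r m Qb0 CK0 by (simp add: de_def e_def)
  have h: "B1 * (r + \<bar>mu\<bar>) * de \<le> de / 2" using mult_right_mono[OF r0(3)[OF r mu] de0] by simp
  show ?case unfolding strip_le_def
  proof (intro ballI)
   fix z y assume zy: "z \<in> Sg" "y \<in> {-d..d}"
   have "norm (f z y - g z y) = norm ((step a mu f z y - step a mu g z y) + (step a mu g z y - step a nu g z y))"
    using f(3)[OF zy] g(3)[OF zy] by simp
   also have "... \<le> norm (step a mu f z y - step a mu g z y) + norm (step a mu g z y - step a nu g z y)"
    by (rule norm_triangle_ineq)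
   also have "... \<le> de / 2 + e"
   proof (rule add_mono)
    show "norm (step a mu f z y - step a mu g z y) \<le> de / 2"
    proof -
     have "norm (step a mu f z y - step a mu g z y) \<le> B1 * (r + \<bar>mu\<bar>) * de"
      using step_diff[OF f(1,2) g(1,2) r(1) r1 Suc[folded de_def], of a mu] zy by (auto simp: strip_le_def)
     with h show ?thesis by linarith
    qed
    show "norm (step a mu g z y - step a nu g z y) \<le> e"
     using step_parameter_diff(1)[OF g(1,2) r(1) r1, of a mu nu] zy by (auto simp: strip_le_def e_def)
   qed
   also have "... = 2 * e + 2 * r * (1/2)^Suc n" by (simp add: de_def)
   finally show "norm (f z y - g z y) \<le> 2 * e + 2 * r * (1/2)^Suc n" .
  qed
 qed
 have "strip_le d (%z y. f z y - g z y) (2 * e)" unfolding strip_le_def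
 proof (intro ballI)
  fix z y assume zy: "z \<in> Sg" "y \<in> {-d..d}"
  have "(%n. 2 * e + 2 * r * (1/2)^n) \<longlonglongrightarrow> 2 * e + 2 * r * 0" by (intro tendsto_intros LIMSEQ_realpow_zero) auto
  then show "norm (f z y - g z y) \<le> 2 * e"
   by (intro LIMSEQ_le_const[of "%n. 2 * e + 2 * r * (1/2)^n"]) (use b zy in \<open>auto simp: strip_le_def\<close>)
 qed
 moreover have "2 * e \<le> 2 * ((CK * Qb + 1) / m) * \<bar>mu - nu\<bar>"
 proof -
  have "(CK * Qb + 1) / m * r \<le> (CK * Qb + 1) / m * 1" using r1 m CK0 Qb0 by (intro mult_left_mono) auto
  then have "2 * e \<le> 2 * ((CK * Qb + 1) / m * 1 * \<bar>mu - nu\<bar>)"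
   unfolding e_def by (rule mult_left_mono[OF mult_right_mono]) auto
  then show ?thesis by (simp only: mult_1_right mult.assoc)
 qed
 ultimately show ?thesis by (rule strip_le_mono)
qed

section \<open>The bifurcation equation for the first mode\<close>

lemma fcoef_const_mult: "fcoef n (%z y. of_real (p y) * f z y) y = p y * fcoef n f y"
proof -
 have "integral {0..2*pi} (%th. Re (of_real (p y) * f (of_real th) y) * cos (real n * th)) =
   integral {0..2*pi} (%th. p y * (Re (f (of_real th) y) * cos (real n * th)))" by (simp add: mult.assoc)
 also have "... = p y * integral {0..2*pi} (%th. Re (f (of_real th) y) * cos (real n * th))" by simp
 finally show ?thesis by (simp add: fcoef_def)
qed

text \<open>By \<open>W_end\<close> the first mode vanishes at \<open>d\<close> as soon as \<open>Bif\<close> does; its sign change in the speed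
 correction \<open>mu\<close> comes from the term \<open>- mu a I0\<close>.\<close>

definition Bif :: "real => (complex => real => complex) => real" where
 "Bif mu f = integral {-d..d} (%y. fcoef 1 (T mu f) y * ph y)"

definition I0 :: real where "I0 = integral {-d..d} (%y. q y * (ph y)\<^sup>2 / poly (pderiv E) y)"

lemma cI0: "continuous_on {-d..d} (%y. q y * (ph y)\<^sup>2 / poly (pderiv E) y)"
 by (intro continuous_intros qc cph) (use Us in force)

text \<open>The transversality condition. It rests on q > 0, that is, on the sign of \<beta> -
  U''.\<close>

lemma I0_pos: "I0 > 0"
proof -
 have nn: "q y * (ph y)\<^sup>2 / poly (pderiv E) y \<ge> 0" if "y \<in> {-d..d}" for y using q_pos[OF that] Us[OF that] by simp
 have "I0 \<ge> 0" unfolding I0_def by (rule integral_nonneg[OF integrable_continuous_interval[OF cI0] nn])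
 moreover have "I0 \<noteq> 0"
 proof
  assume "I0 = 0"
  then have "\<forall>y\<in>{-d..d}. q y * (ph y)\<^sup>2 / poly (pderiv E) y = 0"
   using integral_eq_0_iff[OF cI0 _ nn] d by (simp add: I0_def)
  from bspec[OF this, of 0] show False using q_pos[of 0] Us[of 0] ph(5)[of 0] d by simp
 qed
 ultimately show ?thesis by simp
qed

text \<open>To leading order f equals \<open>step a mu\<close> applied to 0, which is a ph cos z /
  E'; the contraction estimate bounds the difference.\<close>

lemma fixed_point_first_mode:
 assumes f: "strip_fun d f" "strip_le d f r" "!!z y. z \<in> Sg ==> y \<in> {-d..d} ==> step a mu f z y = f z y"
  and r: "0 \<le> r" "r \<le> 1" and y: "y \<in> {-d..d}"
 shows "\<bar>fcoef 1 f y - a * ph y / poly (pderiv E) y\<bar> \<le> 2 * B1 * (r + \<bar>mu\<bar>) * r"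
proof -
 have cu: "continuous_on {-d..d} (%y. a * ph y / poly (pderiv E) y)"
  by (intro continuous_intros cph) (use Us in force)
 define c where "c = (%(z::complex) y. complex_of_real (a * ph y / poly (pderiv E) y) * cos z)"
 have sc: "strip_fun d c" unfolding c_def by (intro strip_fun_combine strip_fun_const[OF cu] strip_fun_cos)
 have fc: "fcoef 1 c y = a * ph y / poly (pderiv E) y"
 proof -
  have "fcoef 1 (%z y. cos z) y = 1" using integral_cos_cos[of 1 1] by (simp add: fcoef_def cos_of_real)
  then show ?thesis unfolding c_def by (subst fcoef_const_mult) simp
 qed
 have sfc: "strip_fun d (%z y. f z y - c z y)" by (rule strip_fun_combine(2)[OF f(1) sc])
 have "strip_le d (%z y. f z y - c z y) (B1 * (r + \<bar>mu\<bar>) * r)" unfolding strip_le_def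
 proof (intro ballI)
  fix z y assume zy: "z \<in> Sg" "y \<in> {-d..d}"
  have K0: "K (%z y. 0) z y = 0"
   using K_props(2)[OF strip_zero(1) strip_zero(2)[OF order_refl]] zy by (auto simp: strip_le_def)
  have "c z y = step a mu (%z y. 0) z y" by (simp add: c_def step_def T_zero R_zero K0)
  then have "f z y - c z y = step a mu f z y - step a mu (%z y. 0) z y" using f(3)[OF zy] by simp
  moreover have "strip_le d (%z y. step a mu f z y - step a mu (%z y. 0) z y) (B1 * (r + \<bar>mu\<bar>) * r)"
   by (rule step_diff[OF f(1,2) strip_zero(1) strip_zero(2)[OF r(1)] r]) (use f(2) in simp)
  ultimately show "norm (f z y - c z y) \<le> B1 * (r + \<bar>mu\<bar>) * r" using zy by (auto simp: strip_le_def)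
 qed
 then have "\<bar>fcoef 1 (%z y. f z y - c z y) y\<bar> \<le> 2 * (B1 * (r + \<bar>mu\<bar>) * r) * exp (- real 1)"
  by (rule fcoef_le[OF sfc _ y])
 also have "... \<le> 2 * (B1 * (r + \<bar>mu\<bar>) * r) * 1" using B1_pos r by (intro mult_left_mono) auto
 finally show ?thesis using fcoef_diff[OF f(1) sc y, of 1] fc by simp
qed

definition H :: real where "H = 2 * d * Ph * (2 * AT + 2 * Qb * B1)"

lemma H0: "H \<ge> 0" using d Ph0 AT0 Qb0 B1_pos by (simp add: H_def)

text \<open>\<open>T mu f\<close> splits into \<open>T 0 f\<close>, which is quadratic in f, and -
  mu q f, whose first mode is known to leading order. Pairing the latter with \<open>ph\<close>
  produces - mu a I0.\<close>

lemma Bif_expansion: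
 assumes f: "strip_fun d f" "strip_le d f r" "!!z y. z \<in> Sg ==> y \<in> {-d..d} ==> step a mu f z y = f z y"
  and r: "0 \<le> r" "r \<le> 1"
 shows "\<bar>Bif mu f + mu * a * I0\<bar> \<le> H * (r * r + \<bar>mu\<bar> * ((r + \<bar>mu\<bar>) * r))"
proof -
 define h where "h y = fcoef 1 (T mu f) y * ph y + mu * a * (q y * (ph y)\<^sup>2 / poly (pderiv E) y)" for y
 define bd where "bd = r * r + \<bar>mu\<bar> * ((r + \<bar>mu\<bar>) * r)"
 have c1: "continuous_on {-d..d} (%y. fcoef 1 (T mu f) y * ph y)"
  by (intro continuous_intros fcoef_continuous T_strip_fun f cph)
 have c2: "continuous_on {-d..d} (%y. mu * a * (q y * (ph y)\<^sup>2 / poly (pderiv E) y))"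
  by (intro continuous_on_mult continuous_on_const cI0)
 have "integral {-d..d} (%y. mu * a * (q y * (ph y)\<^sup>2 / poly (pderiv E) y)) = mu * a * I0"
  unfolding I0_def by (rule integral_mult_right)
 then have "Bif mu f + mu * a * I0 = integral {-d..d} h" unfolding h_def Bif_def
  using integral_add[OF integrable_continuous_interval[OF c1] integrable_continuous_interval[OF c2]] by simp
 also have "norm ... \<le> integral {-d..d} (%y. Ph * (2 * AT + 2 * Qb * B1) * bd)"
 proof (rule integral_norm_bound_integral)
  show "h integrable_on {-d..d}" unfolding h_def by (intro integrable_continuous_interval continuous_on_add c1 continuous_on_mult cI0 continuous_on_const)
  show "(%y. Ph * (2 * AT + 2 * Qb * B1) * bd) integrable_on {-d..d}" by (rule integrable_const_ivl)
  fix y assume y: "y \<in> {-d..d}"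
  have T0: "strip_fun d (T 0 f)" by (rule T_strip_fun[OF f(1)])
  have sq: "strip_fun d (%z y. of_real (mu * q y) * f z y)"
   by (intro strip_fun_combine strip_fun_const continuous_intros qc f(1))
  have "T mu f = (%z y. T 0 f z y - of_real (mu * q y) * f z y)" by (simp add: T_def)
  then have e: "fcoef 1 (T mu f) y = fcoef 1 (T 0 f) y - mu * q y * fcoef 1 f y"
   using fcoef_diff[OF T0 sq y, of 1] fcoef_const_mult[of 1 "%y. mu * q y" f y] by simp
  have hy: "h y = ph y * (fcoef 1 (T 0 f) y - mu * q y * (fcoef 1 f y - a * ph y / poly (pderiv E) y))"
   unfolding h_def e by (simp add: algebra_simps power2_eq_square)
  have t1: "\<bar>fcoef 1 (T 0 f) y\<bar> \<le> 2 * AT * (r * r)"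
  proof -
   have "\<bar>fcoef 1 (T 0 f) y\<bar> \<le> 2 * (AT * (r + \<bar>0\<bar>) * r) * exp (- real 1)"
    by (rule fcoef_le[OF T0 T_le[OF f(2) r] y])
   also have "... \<le> 2 * (AT * (r + \<bar>0\<bar>) * r) * 1" using AT0 r by (intro mult_left_mono) auto
   finally show ?thesis by (simp add: mult_ac)
  qed
  have t2: "\<bar>mu * q y * (fcoef 1 f y - a * ph y / poly (pderiv E) y)\<bar> \<le> (\<bar>mu\<bar> * Qb) * (2 * B1 * (r + \<bar>mu\<bar>) * r)"
   unfolding abs_mult by (intro mult_mono fixed_point_first_mode[OF f r y]) (use Qb[OF y] q_pos[OF y] Qb0 in auto)
  have "\<bar>h y\<bar> \<le> Ph * (2 * AT * (r * r) + (\<bar>mu\<bar> * Qb) * (2 * B1 * (r + \<bar>mu\<bar>) * r))" unfolding hy abs_mult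
   by (intro mult_mono Ph[OF y] order_trans[OF abs_triangle_ineq4 add_mono[OF t1 t2]]) (use Ph0 in auto)
  also have "... \<le> Ph * ((2 * AT + 2 * Qb * B1) * bd)"
  proof (rule mult_left_mono[OF _ Ph0])
   have "2 * AT * (r * r) \<le> 2 * AT * bd" using AT0 r by (intro mult_left_mono) (auto simp: bd_def)
   moreover have "(2 * Qb * B1) * (\<bar>mu\<bar> * ((r + \<bar>mu\<bar>) * r)) \<le> (2 * Qb * B1) * bd"
    using Qb0 B1_pos r by (intro mult_left_mono) (auto simp: bd_def)
   moreover have "(\<bar>mu\<bar> * Qb) * (2 * B1 * (r + \<bar>mu\<bar>) * r) = (2 * Qb * B1) * (\<bar>mu\<bar> * ((r + \<bar>mu\<bar>) * r))"
    by (simp only: mult_ac)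
   ultimately show "2 * AT * (r * r) + (\<bar>mu\<bar> * Qb) * (2 * B1 * (r + \<bar>mu\<bar>) * r) \<le> (2 * AT + 2 * Qb * B1) * bd"
    unfolding distrib_right[of "2 * AT"] by linarith
  qed
  finally show "norm (h y) \<le> Ph * (2 * AT + 2 * Qb * B1) * bd" by (simp add: mult.assoc)
 qed
 also have "... = H * bd" using d by (simp add: H_def)
 finally show ?thesis by (simp add: bd_def)
qed

text \<open>Supplies the continuity in mu that the intermediate value theorem needs, for fixed
  points chosen separately at each mu.\<close>

lemma Bif_lipschitz:
 assumes f: "strip_fun d f" "strip_le d f r" "!!z y. z \<in> Sg ==> y \<in> {-d..d} ==> step a mu f z y = f z y"
  and g: "strip_fun d g" "strip_le d g r" "!!z y. z \<in> Sg ==> y \<in> {-d..d} ==> step a nu g z y = g z y"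
  and r: "0 \<le> r" "r \<le> r0" and mu: "\<bar>mu\<bar> \<le> r0"
 shows "\<bar>Bif mu f - Bif nu g\<bar> \<le> 4 * d * Ph * (4 * AT * ((CK * Qb + 1) / m) + Qb) * \<bar>mu - nu\<bar>"
proof -
 have r1: "r \<le> 1" using r r0(2) order_trans by blast
 have mu1: "\<bar>mu\<bar> \<le> 1" using mu r0(2)[of 0 0] r0(1)[of 0 0] order_trans[OF mu] r0_def by auto
 define e where "e = 2 * ((CK * Qb + 1) / m) * \<bar>mu - nu\<bar>"
 have e0: "e \<ge> 0" using m CK0 Qb0 by (simp add: e_def)
 define M where "M = (4 * AT * ((CK * Qb + 1) / m) + Qb) * \<bar>mu - nu\<bar>"
 have fg: "strip_le d (%z y. f z y - g z y) e" unfolding e_def by (rule fixed_point_lipschitz[OF f g r mu])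
 have TT: "strip_le d (%z y. T mu f z y - T nu g z y) M" unfolding strip_le_def
 proof (intro ballI)
  fix z y assume zy: "z \<in> Sg" "y \<in> {-d..d}"
  have "norm (T mu f z y - T nu g z y) \<le> norm (T mu f z y - T mu g z y) + norm (T mu g z y - T nu g z y)"
   by (metis norm_triangle_ineq diff_add_cancel add_diff_eq)
  also have "... \<le> AT * (r + \<bar>mu\<bar>) * e + Qb * r * \<bar>mu - nu\<bar>"
   using T_diff[OF f(2) g(2) r1 fg, of mu] step_parameter_diff(2)[OF g(1,2) r(1) r1, of mu nu] zy
   by (intro add_mono) (auto simp: strip_le_def)
  also have "... \<le> AT * 2 * e + Qb * 1 * \<bar>mu - nu\<bar>"
   using r r1 mu1 AT0 Qb0 e0 by (intro add_mono mult_right_mono mult_left_mono) auto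
  also have "... = M" by (simp add: M_def e_def algebra_simps)
  finally show "norm (T mu f z y - T nu g z y) \<le> M" .
 qed
 have sT: "strip_fun d (T mu f)" "strip_fun d (T nu g)" by (intro T_strip_fun f g)+
 have M0: "M \<ge> 0" using AT0 Qb0 CK0 m by (simp add: M_def)
 have c: "continuous_on {-d..d} (%y. fcoef 1 (T mu f) y * ph y)" "continuous_on {-d..d} (%y. fcoef 1 (T nu g) y * ph y)"
  by (intro continuous_intros fcoef_continuous sT cph)+
 have "Bif mu f - Bif nu g = integral {-d..d} (%y. fcoef 1 (T mu f) y * ph y - fcoef 1 (T nu g) y * ph y)"
  unfolding Bif_def by (rule integral_diff[symmetric]; rule integrable_continuous_interval, rule c)
 also have "norm ... \<le> integral {-d..d} (%y. 2 * M * Ph)"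
 proof (rule integral_norm_bound_integral)
  show "(%y. fcoef 1 (T mu f) y * ph y - fcoef 1 (T nu g) y * ph y) integrable_on {-d..d}"
   by (rule integrable_continuous_interval[OF continuous_on_diff[OF c]])
  fix y assume y: "y \<in> {-d..d}"
  have "\<bar>fcoef 1 (%z y. T mu f z y - T nu g z y) y\<bar> \<le> 2 * M * exp (- real 1)"
   by (rule fcoef_le[OF strip_fun_combine(2)[OF sT] TT y])
  also have "... \<le> 2 * M * 1" using M0 by (intro mult_left_mono) auto
  finally have "\<bar>fcoef 1 (T mu f) y - fcoef 1 (T nu g) y\<bar> \<le> 2 * M" using fcoef_diff[OF sT y, of 1] by simp
  then show "norm (fcoef 1 (T mu f) y * ph y - fcoef 1 (T nu g) y * ph y) \<le> 2 * M * Ph"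
   unfolding left_diff_distrib[symmetric] real_norm_def abs_mult using Ph[OF y] M0 by (intro mult_mono) auto
 qed (rule integrable_const_ivl)
 also have "... = 4 * d * Ph * (4 * AT * ((CK * Qb + 1) / m) + Qb) * \<bar>mu - nu\<bar>" using d by (simp add: M_def)
 finally show ?thesis by simp
qed

definition mode_amplitude :: real where
 "mode_amplitude = 4 * AT * B2"

lemma bifurcation_parameter:
 assumes mub: "mub > 0"
 obtains a1 where "a1 > 0" "2 * a1 * B2 \<le> r0" "!!a. 0 < a ==> a \<le> a1 ==> \<exists>mu f. \<bar>mu\<bar> \<le> mub \<and> \<bar>mu\<bar> \<le> r0 \<and> strip_fun d f \<and>
   strip_le d f (2 * a * B2) \<and> (\<forall>z\<in>Sg. \<forall>y\<in>{-d..d}. step a mu f z y = f z y) \<and> Bif mu f = 0"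
proof -
 have rr: "r0 > 0" "r0 \<le> 1" using B1_pos by (auto simp: r0_def)
 define b where "b = 2 * B2"
 have b: "b > 0" using B2_ge1 by (simp add: b_def)
 \<comment> \<open>At |mu| = mu0 the error in \<open>Bif_expansion\<close> is at most H (2 r^2 +
   mu0^2 r) with r = b a. The choice of \<open>mu0\<close> keeps the second term below a quarter of
   the main term mu0 a I0, and \<open>a1\<close> does the same for the first.\<close>
 define mu0 where "mu0 = min (min mub r0) (I0 / (4 * (H * b + 1)))"
 have mu0: "mu0 > 0" "mu0 \<le> mub" "mu0 \<le> r0" "mu0 \<le> 1" using mub rr I0_pos H0 b by (auto simp: mu0_def add_nonneg_pos)
 have Hmu: "H * b * mu0 \<le> I0 / 4"
 proof -
  have hb: "H * b + 1 > 0" using H0 b by (simp add: add_nonneg_pos)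
  have "(H * b + 1) * mu0 \<le> (H * b + 1) * (I0 / (4 * (H * b + 1)))"
   using hb by (intro mult_left_mono) (auto simp: mu0_def)
  also have "... = I0 / 4"
  proof -
   have "X * (I0 / (4 * X)) = I0 / 4" if "X > 0" for X using that by simp
   from this[OF hb] show ?thesis .
  qed
  finally show ?thesis using mu0(1) by (simp add: distrib_right)
 qed
 define a1 where "a1 = min (r0 / b) (mu0 * I0 / (8 * (H * b * b + 1)))"
 have hbb: "H * b * b + 1 > 0" using H0 b by (simp add: add_nonneg_pos)
 have a1: "a1 > 0" "a1 * b \<le> r0"
 proof -
  show "a1 > 0" using rr b mu0 I0_pos hbb by (simp add: a1_def)
  have "a1 * b \<le> r0 / b * b" using b by (intro mult_right_mono) (auto simp: a1_def)
  then show "a1 * b \<le> r0" using b by simp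
 qed
 have Ha: "H * b * b * (2 * a) \<le> mu0 * I0 / 4" if "0 < a" "a \<le> a1" for a
 proof -
  have "H * b * b * (2 * a) \<le> (H * b * b + 1) * (2 * (mu0 * I0 / (8 * (H * b * b + 1))))"
   using that hbb H0 b by (intro mult_mono) (auto simp: a1_def)
  also have "... = mu0 * I0 / 4"
  proof -
   have "X * (2 * (Y / (8 * X))) = Y / 4" if "X > 0" for X Y :: real using that by simp
   from this[OF hbb] show ?thesis .
  qed
  finally show ?thesis .
 qed
 have "\<exists>mu f. \<bar>mu\<bar> \<le> mub \<and> \<bar>mu\<bar> \<le> r0 \<and> strip_fun d f \<and> strip_le d f (2 * a * B2) \<and>
   (\<forall>z\<in>Sg. \<forall>y\<in>{-d..d}. step a mu f z y = f z y) \<and> Bif mu f = 0" if a: "0 < a" "a \<le> a1" for a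
 proof -
  define r where "r = 2 * a * B2"
  have rb: "r = b * a" by (simp add: r_def b_def)
  have "r \<le> b * a1" unfolding rb using a b by (intro mult_left_mono) auto
  also have "... \<le> r0" using a1(2) by (simp only: mult.commute)
  finally have r: "0 \<le> r" "r \<le> r0" "r \<le> 1" using a b rr by (auto simp: rb)
  have "\<exists>f. strip_fun d f \<and> strip_le d f r \<and> (\<forall>z\<in>Sg. \<forall>y\<in>{-d..d}. step a mu f z y = f z y)" if "\<bar>mu\<bar> \<le> r0" for mu
  proof (rule step_fixed_point[of a mu])
   show "2 * a * B2 \<le> r0" using r(2) by (simp add: r_def)
   fix f assume "strip_fun d f" "strip_le d f (2 * a * B2)" "!!z y. z \<in> Sg ==> y \<in> {-d..d} ==> step a mu f z y = f z y"
   then show ?thesis unfolding r_def by blast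
  qed (use a that in auto)
  then obtain F where F: "!!mu. \<bar>mu\<bar> \<le> r0 ==> strip_fun d (F mu)" "!!mu. \<bar>mu\<bar> \<le> r0 ==> strip_le d (F mu) r"
   "!!mu z y. \<bar>mu\<bar> \<le> r0 ==> z \<in> Sg ==> y \<in> {-d..d} ==> step a mu (F mu) z y = F mu z y" by metis
  define Lc where "Lc = 4 * d * Ph * (4 * AT * ((CK * Qb + 1) / m) + Qb)"
  have Lc0: "Lc \<ge> 0" using d Ph0 AT0 CK0 Qb0 m by (simp add: Lc_def)
  have lip: "\<bar>Bif mu (F mu) - Bif nu (F nu)\<bar> \<le> Lc * \<bar>mu - nu\<bar>" if "mu \<in> {-mu0..mu0}" "nu \<in> {-mu0..mu0}" for mu nu
  proof -
   have "\<bar>mu\<bar> \<le> r0" "\<bar>nu\<bar> \<le> r0" using that mu0 by auto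
   from Bif_lipschitz[OF F[OF this(1)] F[OF this(2)] r(1,2) this(1)] show ?thesis by (simp add: Lc_def)
  qed
  have cont: "continuous_on {-mu0..mu0} (%mu. Bif mu (F mu))"
   by (rule lipschitz_on_continuous_on[of Lc], rule lipschitz_onI) (use lip Lc0 in \<open>auto simp: dist_real_def\<close>)
  \<comment> \<open>The main term - mu a I0 therefore decides the sign of \<open>Bif\<close> at mu =
    mu0 and mu = -mu0.\<close>
  have sgn: "\<bar>Bif mu (F mu) + mu * a * I0\<bar> < mu0 * a * I0" if "\<bar>mu\<bar> = mu0" for mu
  proof -
   have mur: "\<bar>mu\<bar> \<le> r0" using that mu0 by simp
   have "\<bar>Bif mu (F mu) + mu * a * I0\<bar> \<le> H * (r * r + mu0 * ((r + mu0) * r))"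
    using Bif_expansion[OF F[OF mur] r(1,3)] that by simp
   also have "... \<le> H * (r * r + (1 * r + mu0 * mu0) * r)"
   proof -
    have "mu0 * (r * r) \<le> 1 * (r * r)" using mu0 r by (intro mult_right_mono) auto
    then show ?thesis using H0 by (intro mult_left_mono) (auto simp: algebra_simps)
   qed
   also have "... = a * (H * b * b * (2 * a) + (H * b * mu0) * mu0)" by (simp add: rb algebra_simps)
   also have "... \<le> a * (mu0 * I0 / 4 + I0 / 4 * mu0)"
    using Ha[OF a] Hmu a mu0 by (intro mult_left_mono add_mono mult_right_mono) auto
   also have "... < mu0 * a * I0" using a mu0 I0_pos by simp
   finally show ?thesis .
  qed
  have "Bif mu0 (F mu0) \<le> 0" "0 \<le> Bif (-mu0) (F (-mu0))" using sgn[of mu0] sgn[of "-mu0"] mu0 by auto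
  then obtain mu where mu: "-mu0 \<le> mu" "mu \<le> mu0" "Bif mu (F mu) = 0"
   using IVT2'[of "%mu. Bif mu (F mu)" mu0 0 "-mu0"] cont mu0 by auto
  then have mur: "\<bar>mu\<bar> \<le> r0" "\<bar>mu\<bar> \<le> mub" using mu0 by auto
  show ?thesis by (rule exI[of _ mu], rule exI[of _ "F mu"]) (use F[OF mur(1)] mur mu(3) in \<open>simp add: r_def\<close>)
 qed
 with a1 show thesis by (intro that[of a1]) (auto simp: b_def mult_ac)
qed

end

text \<open>The outcome of the complex construction in real terms: \<open>w n\<close> and
  \<open>g n\<close> are the cosine coefficients of the perturbation stream function and of the
  source T, and \<open>e\<close> is the displacement. The clause \<open>w' 1 (-d) = a\<close>
  records that the wave is nontrivial.\<close>

definition wave_modes ::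
  "real => real => real poly => real poly => (real => real) => real => real => real =>
   (nat => real => real) => (nat => real => real) => (nat => real => real) => (real => real => real) => bool" where
 "wave_modes d k E G q Cw a mu w w' g e \<longleftrightarrow>
   (\<forall>n. continuous_on {-d..d} (g n) \<and> sol2 (-d) d (%y. (real n * k)\<^sup>2 - q y) (g n) (w n) (w' n)) \<and>
   (\<forall>n. \<forall>y\<in>{-d..d}. \<bar>w n y\<bar> \<le> Cw * a * exp (- real n) \<and> \<bar>w' n y\<bar> \<le> Cw * a * exp (- real n) \<and>
    \<bar>g n y\<bar> \<le> Cw * a * exp (- real n)) \<and>
   (\<forall>n\<ge>1. w n (-d) = 0 \<and> w n d = 0) \<and> w' 1 (-d) = a \<and>
   (\<forall>th. \<forall>y\<in>{-d..d}. \<bar>e th y\<bar> \<le> Cw * a \<and>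
    (\<Sum>n. w n y * cos (real n * th)) = poly E (y + e th y) - poly E y - mu * e th y \<and>
    (\<Sum>n. g n y * cos (real n * th)) = poly G (y + e th y) - poly G y + q y * (\<Sum>n. w n y * cos (real n * th)))"

lemma (in wave_operators) wave_modes_exist_aux:
 assumes mub: "mub > 0"
 shows "\<exists>Cw>0. \<exists>a1>0. \<forall>a. 0 < a \<and> a \<le> a1 --> (\<exists>mu w w' g e. \<bar>mu\<bar> \<le> mub \<and> wave_modes d k E G q Cw a mu w w' g e)"
proof (rule bifurcation_parameter[OF mub])
 fix a1 assume a1: "a1 > 0" "2 * a1 * B2 \<le> r0" and ex: "!!a. 0 < a ==> a \<le> a1 ==> \<exists>mu f. \<bar>mu\<bar> \<le> mub \<and> \<bar>mu\<bar> \<le> r0 \<and> strip_fun d f \<and>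
   strip_le d f (2 * a * B2) \<and> (\<forall>z\<in>Sg. \<forall>y\<in>{-d..d}. step a mu f z y = f z y) \<and> Bif mu f = 0"
 have rr: "r0 > 0" "r0 \<le> 1" using B1_pos by (auto simp: r0_def)
 have ne: "{-d..d} \<noteq> {}" using d by simp
 have cph': "continuous_on {-d..d} (%y. \<bar>ph' y\<bar>)" by (intro continuous_intros sol2_continuous(2)[OF ph(1)])
 obtain yp where yp: "yp \<in> {-d..d}" "!!y. y \<in> {-d..d} ==> \<bar>ph' y\<bar> \<le> \<bar>ph' yp\<bar>"
  using continuous_attains_sup[OF compact_Icc ne cph'] by blast
 define Phm where "Phm = Ph + \<bar>ph' yp\<bar>"
 have Phm: "Phm \<ge> 0" "y \<in> {-d..d} ==> \<bar>ph y\<bar> \<le> Phm" "y \<in> {-d..d} ==> \<bar>ph' y\<bar> \<le> Phm" for y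
  using Ph[of y] yp(2)[of y] Ph0 by (auto simp: Phm_def)
 define M where "M = 4 * AT * B2"
 have M0: "M \<ge> 0" using AT0 B2_ge1 by (simp add: M_def)
 define Cw where "Cw = 2 * C * M + 2 * M + 3 * Phm + 2 * B2"
 have Cw: "Cw > 0" using C M0 Phm B2_ge1 by (simp add: Cw_def add_nonneg_pos)
 have "\<exists>mu w w' g e. \<bar>mu\<bar> \<le> mub \<and> wave_modes d k E G q Cw a mu w w' g e" if a: "0 < a" "a \<le> a1" for a
 proof -
  obtain mu f where mu: "\<bar>mu\<bar> \<le> mub" "\<bar>mu\<bar> \<le> r0" and f: "strip_fun d f" "strip_le d f (2 * a * B2)"
   and fp: "!!z y. z \<in> Sg ==> y \<in> {-d..d} ==> step a mu f z y = f z y" and B0: "Bif mu f = 0"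
   using ex[OF a] by blast
  define r where "r = 2 * a * B2"
  have "2 * a * B2 \<le> 2 * a1 * B2" using a B2_ge1 by (intro mult_right_mono) auto
  with a1(2) rr(2) have "r \<le> 1" unfolding r_def by linarith
  moreover have "0 \<le> r" using a B2_ge1 by (simp add: r_def)
  ultimately have r: "0 \<le> r" "r \<le> 1" by blast+
  define F where "F = T mu f"
  have F: "strip_fun d F" unfolding F_def by (rule T_strip_fun[OF f(1)])
  have FM: "strip_le d F (M * a)"
  proof (rule strip_le_mono)
   show "strip_le d F (AT * (r + \<bar>mu\<bar>) * r)" unfolding F_def by (rule T_le) (use f r in \<open>auto simp: r_def\<close>)
   have "AT * (r + \<bar>mu\<bar>) * r \<le> AT * 2 * r" using AT0 r mu rr by (intro mult_right_mono mult_left_mono) auto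
   then show "AT * (r + \<bar>mu\<bar>) * r \<le> M * a" by (simp add: M_def r_def mult_ac)
  qed
  define g where "g n = fcoef n F" for n
  have cg: "continuous_on {-d..d} (g n)" for n unfolding g_def by (rule fcoef_continuous[OF F])
  have gb: "\<bar>g n y\<bar> \<le> 2 * (M * a) * exp (- real n)" if "y \<in> {-d..d}" for n y
   unfolding g_def by (rule fcoef_le[OF F FM that])
  define w where "w n y = W n (g n) y + (if n = 1 then a else 0) * ph y" for n y
  define w' where "w' n y = W' n (g n) y + (if n = 1 then a else 0) * ph' y" for n y
  define e where "e th y = Re (f (of_real th) y)" for th y
  have sol: "sol2 (-d) d (%y. (real n * k)\<^sup>2 - q y) (g n) (w n) (w' n)" for n
  proof (cases "n = 1")
   case True
   have "sol2 (-d) d (%y. (real n * k)\<^sup>2 - q y) (%_. 0) ph ph'" using ph(1) True by simp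
   from sol2_linear[OF W_sol[OF cg] this, where c=a] show ?thesis using True by (simp add: w_def[abs_def] w'_def[abs_def])
  next
   case False
   then show ?thesis using W_sol[OF cg, of n n] by (simp add: w_def[abs_def] w'_def[abs_def])
  qed
  \<comment> \<open>Lets the extra term a ph in mode 1 be absorbed into a bound of the common form
    constant times exp(-n).\<close>
  have e1: "exp (- real 1) * 3 \<ge> (1::real)" using exp_le by (simp add: exp_minus field_simps)
  have exn: "exp (- real n) > 0" for n by simp
  have Wb: "\<bar>W n (g n) y\<bar> \<le> 2 * C * M * a * exp (- real n)" "\<bar>W' n (g n) y\<bar> \<le> 2 * C * M * a * exp (- real n)"
   if y: "y \<in> {-d..d}" for n y
  proof -
   have "\<bar>W n (g n) y\<bar> \<le> C * (2 * (M * a) * exp (- real n)) / (real n + 1)\<^sup>2" by (rule W_bound(1)[OF cg gb y])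
   also have "... \<le> C * (2 * (M * a) * exp (- real n)) / 1"
    using C M0 a by (intro divide_left_mono) (auto intro!: one_le_power mult_nonneg_nonneg)
   finally show "\<bar>W n (g n) y\<bar> \<le> 2 * C * M * a * exp (- real n)" by (simp add: mult_ac)
   show "\<bar>W' n (g n) y\<bar> \<le> 2 * C * M * a * exp (- real n)"
    using W_bound(2)[OF cg gb y, of n n] by (simp add: mult_ac)
  qed
  have pb: "\<bar>(if n = 1 then a else 0) * p\<bar> \<le> 3 * Phm * a * exp (- real n)" if "\<bar>p\<bar> \<le> Phm" for n p
  proof (cases "n = 1")
   case True
   have "a * \<bar>p\<bar> \<le> a * Phm" using that a by (intro mult_left_mono) auto
   also have "... \<le> a * Phm * (exp (- real 1) * 3)" using mult_left_mono[OF e1, of "a * Phm"] a Phm(1) by simp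
   finally show ?thesis using True a by (simp add: abs_mult mult_ac)
  next
   case False then show ?thesis using Phm(1) a by simp
  qed
  have le: "x * a * exp (- real n) \<le> Cw * a * exp (- real n)" if "x \<le> Cw" for x n
   using that a by (intro mult_right_mono) auto
  have wb: "\<bar>w n y\<bar> \<le> Cw * a * exp (- real n)" "\<bar>w' n y\<bar> \<le> Cw * a * exp (- real n)" "\<bar>g n y\<bar> \<le> Cw * a * exp (- real n)"
   if y: "y \<in> {-d..d}" for n y
  proof -
   have "\<bar>w n y\<bar> \<le> 2 * C * M * a * exp (- real n) + 3 * Phm * a * exp (- real n)"
    unfolding w_def by (rule order_trans[OF abs_triangle_ineq add_mono[OF Wb(1)[OF y] pb[OF Phm(2)[OF y]]]])
   also have "... = (2 * C * M + 3 * Phm) * a * exp (- real n)" by (simp add: algebra_simps)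
   also have "... \<le> Cw * a * exp (- real n)" using M0 B2_ge1 by (intro le) (simp add: Cw_def)
   finally show "\<bar>w n y\<bar> \<le> Cw * a * exp (- real n)" .
   have "\<bar>w' n y\<bar> \<le> 2 * C * M * a * exp (- real n) + 3 * Phm * a * exp (- real n)"
    unfolding w'_def by (rule order_trans[OF abs_triangle_ineq add_mono[OF Wb(2)[OF y] pb[OF Phm(3)[OF y]]]])
   also have "... = (2 * C * M + 3 * Phm) * a * exp (- real n)" by (simp add: algebra_simps)
   also have "... \<le> Cw * a * exp (- real n)" using M0 B2_ge1 by (intro le) (simp add: Cw_def)
   finally show "\<bar>w' n y\<bar> \<le> Cw * a * exp (- real n)" .
   have "\<bar>g n y\<bar> \<le> (2 * M) * a * exp (- real n)" using gb[OF y, of n] by simp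
   also have "... \<le> Cw * a * exp (- real n)" using C M0 Phm(1) B2_ge1 by (intro le) (simp add: Cw_def)
   finally show "\<bar>g n y\<bar> \<le> Cw * a * exp (- real n)" .
  qed
  \<comment> \<open>Mode 1 vanishes at \<open>d\<close> by the bifurcation equation, the higher
    modes by construction; mode 0 is not constrained there.\<close>
  have ends: "w n (-d) = 0 \<and> w n d = 0" if n: "n \<ge> 1" for n
  proof
   show "w n (-d) = 0" using W_start[OF cg, of n n] ph(2) by (simp add: w_def)
   have "W n (g n) d = 0"
   proof (cases "n = 1")
    case True
    have "integral {-d..d} (%y. g 1 y * ph y) = 0" using B0 by (simp add: Bif_def g_def F_def)
    from W_end(2)[OF cg this] show ?thesis using True by simp
   next
    case False
    then show ?thesis using W_end(1)[OF _ cg, of n] n by simp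
   qed
   then show "w n d = 0" using ph(4) by (simp add: w_def)
  qed
  have start: "w' 1 (-d) = a" using W_end(3) ph(3) by (simp add: w'_def)
  have expand: "\<bar>e th y\<bar> \<le> Cw * a \<and>
    (\<Sum>n. w n y * cos (real n * th)) = poly E (y + e th y) - poly E y - mu * e th y \<and>
    (\<Sum>n. g n y * cos (real n * th)) = poly G (y + e th y) - poly G y + q y * (\<Sum>n. w n y * cos (real n * th))"
   if y: "y \<in> {-d..d}" for th y
  proof -
   have fe: "f (of_real th) y = of_real (e th y)" unfolding e_def by (rule strip_fun_real[OF f(1) y])
   have "norm (f (of_real th) y) \<le> 2 * a * B2" using f(2) y by (simp add: strip_le_def)
   then have eb: "\<bar>e th y\<bar> \<le> 2 * B2 * a" unfolding fe by (simp add: mult_ac)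
   have "2 * B2 * a \<le> Cw * a" using a C M0 Phm(1) by (intro mult_right_mono) (auto simp: Cw_def)
   with eb have e1: "\<bar>e th y\<bar> \<le> Cw * a" by simp
   have ce: "cpoly p (of_real y + f (of_real th) y) = of_real (poly p (y + e th y))" for p
    unfolding fe by (metis cpoly_of_real of_real_add)
   have "of_real (poly E (y + e th y)) - of_real (poly E y) - of_real mu * of_real (e th y) = of_real (a * ph y) * cos (of_real th) + K F (of_real th) y"
    using fixed_point_identity[OF fp[OF of_real_in_Sg[of th] y] y] unfolding ce unfolding fe F_def .
   from arg_cong[OF this, of Re]
   have i1: "poly E (y + e th y) - poly E y - mu * e th y = a * ph y * cos th + Re (K F (of_real th) y)"
    by (simp add: cos_of_real)
   have KF: "Re (K F (of_real th) y) = (\<Sum>n. W n (g n) y * cos (real n * th))" unfolding K_def g_def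
    by (rule strip_series(4)[where B="2 * C * (M * a)", OF _ _ y]) (rule K_coef[OF F FM]; assumption?)+
   have sW: "summable (%n. W n (g n) y * cos (real n * th))"
   proof (rule summable_comparison_test'[OF summable_exp_neg_nat[of "2 * C * M * a"], of 0])
    fix n :: nat
    have "\<bar>W n (g n) y\<bar> * \<bar>cos (real n * th)\<bar> \<le> \<bar>W n (g n) y\<bar> * 1" by (intro mult_left_mono) auto
    then show "norm (W n (g n) y * cos (real n * th)) \<le> 2 * C * M * a * exp (- real n)"
     using Wb(1)[OF y, of n] by (simp add: abs_mult)
   qed
   have "(%n. (if n = 1 then a * ph y * cos th else 0)) sums (a * ph y * cos th)"
    using sums_single[of 1 "%_. a * ph y * cos th"] by simp
   from sums_add[OF summable_sums[OF sW] this]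
   have "(%n. w n y * cos (real n * th)) sums (Re (K F (of_real th) y) + a * ph y * cos th)"
    unfolding KF by (rule sums_cong[THEN iffD1, rotated]) (auto simp: w_def distrib_right)
   then have sw: "(\<Sum>n. w n y * cos (real n * th)) = poly E (y + e th y) - poly E y - mu * e th y"
    using i1 sums_unique by (metis add.commute)
   have "Re (F (of_real th) y) = (\<Sum>n. g n y * cos (real n * th))"
    unfolding g_def by (rule strip_fun_expansion[OF F _ y, where M="M * a"]) (use FM y in \<open>auto simp: strip_le_def\<close>)
   moreover have "F (of_real th) y = of_real (poly G (y + e th y) - poly G y + q y * (poly E (y + e th y) - poly E y) - mu * q y * e th y)"
    by (simp add: F_def T_def fe ce[unfolded fe])
   ultimately have "(\<Sum>n. g n y * cos (real n * th)) = poly G (y + e th y) - poly G y + q y * (\<Sum>n. w n y * cos (real n * th))"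
    unfolding sw by (simp add: algebra_simps)
   with e1 sw show ?thesis by blast
  qed
  have "wave_modes d k E G q Cw a mu w w' g e" unfolding wave_modes_def using cg sol wb ends start expand by blast
  with mu(1) show ?thesis by blast
 qed
 with Cw a1(1) show ?thesis by blast
qed

theorem (in wave_setup) wave_modes_exist:
 assumes "mub > 0"
 shows "\<exists>Cw>0. \<exists>a1>0. \<forall>a. 0 < a \<and> a \<le> a1 --> (\<exists>mu w w' g e. \<bar>mu\<bar> \<le> mub \<and> wave_modes d k E G q Cw a mu w w' g e)"
proof -
 obtain C W W' m Qb AG AF Ph where "wave_operators d k E G q ph ph' C W W' m Qb AG AF Ph"
  using wave_operators_exist by blast
 from wave_operators.wave_modes_exist_aux[OF this assms] show ?thesis .
qed

section \<open>Sums of modes\<close>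

lemma summable_poly_exp: "summable (%n. (real n + 1) ^ p * exp (- real n))"
proof (rule summable_comparison_test'[where N=0])
 define B where "B = fact p * 2 ^ p * exp (1/2::real)"
 have "(%n. exp (- real n / 2)) = (%n. exp (-1/2) ^ n)" by (simp add: exp_of_nat_mult[symmetric])
 then show "summable (%n. B * exp (- real n / 2))" by (intro summable_mult) (simp add: summable_geometric)
 fix n :: nat
 have "((real n + 1) / 2) ^ p / fact p \<le> exp ((real n + 1) / 2)"
 proof -
  define x where "x = (real n + 1) / 2"
  have "(\<Sum>i\<in>{p}. x ^ i /\<^sub>R fact i) \<le> (\<Sum>i. x ^ i /\<^sub>R fact i)"
   by (rule sum_le_suminf[OF summable_exp_generic]) (auto simp: x_def)
  then have "x ^ p / fact p \<le> exp x" by (simp add: exp_def divide_inverse mult.commute)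
  then show ?thesis by (simp only: x_def)
 qed
 then have "(real n + 1) ^ p \<le> fact p * 2 ^ p * exp ((real n + 1) / 2)" by (simp add: field_simps power_divide)
 then have "(real n + 1) ^ p * exp (- real n) \<le> fact p * 2 ^ p * exp ((real n + 1) / 2) * exp (- real n)"
  by (rule mult_right_mono) simp
 also have "... = B * (exp (real n / 2) * exp (- real n))" by (simp add: B_def add_divide_distrib exp_add)
 also have "exp (real n / 2) * exp (- real n) = exp (- real n / 2)"
  unfolding exp_add[symmetric] by (rule arg_cong[of _ _ exp]) simp
 finally show "norm ((real n + 1) ^ p * exp (- real n)) \<le> B * exp (- real n / 2)" by simp
qed

text \<open>The weight (n + 1)^2 leaves room for second derivatives in \<open>y\<close>, which the
  mode equation makes larger than the mode itself by that factor.\<close>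

definition modes_le :: "real => (nat => real => real) => real => bool" where
 "modes_le d w B \<longleftrightarrow> (\<forall>n. continuous_on {-d..d} (w n)) \<and>
   (\<forall>n. \<forall>y\<in>{-d..d}. \<bar>w n y\<bar> \<le> B * ((real n + 1)\<^sup>2 * exp (- real n)))"

text \<open>The phase shift by \<open>j \<pi> / 2\<close> makes \<open>mode_sum k w j\<close> the \<open>j\<close>-th derivative in the first variable.\<close>

definition mode_sum :: "real => (nat => real => real) => nat => real \<times> real => real" where
 "mode_sum k w j = (%(x, y). \<Sum>n. w n y * (real n * k) ^ j * cos (real n * k * x + real j * (pi / 2)))"

definition mode_const :: "real => nat => real" where
 "mode_const k j = (\<Sum>n. k ^ j * ((real n + 1) ^ (2 + j) * exp (- real n)))"

lemma mode_term_bound: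
 assumes k: "k > 0" and w: "modes_le d w B" and y: "y \<in> {-d..d}"
 shows "\<bar>w n y * (real n * k) ^ j * cos t\<bar> \<le> B * (k ^ j * ((real n + 1) ^ (2 + j) * exp (- real n)))"
proof -
 have b: "\<bar>w n y\<bar> \<le> B * ((real n + 1)\<^sup>2 * exp (- real n))" using w y by (auto simp: modes_le_def)
 have "(real n * k) ^ j \<le> ((real n + 1) * k) ^ j" using k by (intro power_mono mult_right_mono) auto
 then have "\<bar>w n y\<bar> * (real n * k) ^ j * \<bar>cos t\<bar> \<le> (B * ((real n + 1)\<^sup>2 * exp (- real n))) * (((real n + 1) * k) ^ j) * 1"
  using b k by (intro mult_mono) (auto intro: order_trans[OF abs_ge_zero] mult_nonneg_nonneg)
 also have "... = B * (k ^ j * ((real n + 1) ^ (2 + j) * exp (- real n)))"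
  by (simp add: power_mult_distrib power_add mult_ac power2_eq_square)
 finally show ?thesis using k by (simp add: abs_mult)
qed

lemma mode_majorant_summable: "summable (%n. B * (k ^ j * ((real n + 1) ^ (2 + j) * exp (- real n))))"
 by (intro summable_mult summable_poly_exp)

lemma mode_sum_summable:
 assumes k: "k > 0" and w: "modes_le d w B" and y: "y \<in> {-d..d}"
 shows "summable (%n. w n y * (real n * k) ^ j * cos (t n))"
 by (rule summable_comparison_test'[OF mode_majorant_summable[of B k j], of 0])
   (use mode_term_bound[OF k w y] in auto)

lemma mode_sum_bound:
 assumes k: "k > 0" and w: "modes_le d w B" and p: "p \<in> strip d"
 shows "\<bar>mode_sum k w j p\<bar> \<le> B * mode_const k j"
proof -
 obtain x y where xy: "p = (x, y)" "y \<in> {-d..d}" using p by (auto simp: strip_def)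
 have sn: "summable (%n. \<bar>w n y * (real n * k) ^ j * cos (real n * k * x + real j * (pi / 2))\<bar>)"
  by (rule summable_comparison_test'[OF mode_majorant_summable[of B k j], of 0])
    (use mode_term_bound[OF k w xy(2)] in auto)
 have "\<bar>mode_sum k w j p\<bar> \<le> (\<Sum>n. \<bar>w n y * (real n * k) ^ j * cos (real n * k * x + real j * (pi / 2))\<bar>)"
  using summable_rabs[OF sn] by (simp add: mode_sum_def xy)
 also have "... \<le> (\<Sum>n. B * (k ^ j * ((real n + 1) ^ (2 + j) * exp (- real n))))"
  by (rule suminf_le[OF mode_term_bound[OF k w xy(2)] sn mode_majorant_summable])
 also have "... = B * mode_const k j"
  unfolding mode_const_def by (rule suminf_mult) (intro summable_mult summable_poly_exp)
 finally show ?thesis .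
qed

lemma mode_const_nonneg: "k > 0 ==> mode_const k j \<ge> 0"
 unfolding mode_const_def by (intro suminf_nonneg summable_mult summable_poly_exp) auto

lemma mode_sum_continuous:
 assumes k: "k > 0" and w: "modes_le d w B"
 shows "continuous_on (strip d) (mode_sum k w j)"
proof -
 have "uniform_limit (strip d) (%N p. \<Sum>n<N. w n (snd p) * (real n * k) ^ j * cos (real n * k * fst p + real j * (pi / 2)))
   (%p. \<Sum>n. w n (snd p) * (real n * k) ^ j * cos (real n * k * fst p + real j * (pi / 2))) sequentially"
  by (rule Weierstrass_m_test[OF _ mode_majorant_summable[of B k j]])
    (use mode_term_bound[OF k w] in \<open>auto simp: strip_def\<close>)
 then have "continuous_on (strip d) (%p. \<Sum>n. w n (snd p) * (real n * k) ^ j * cos (real n * k * fst p + real j * (pi / 2)))"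
 proof (rule uniform_limit_theorem[rotated])
  have "continuous_on (strip d) (%p. w n (snd p))" for n
   by (rule continuous_on_compose2[of "{-d..d}" "w n"]) (use w in \<open>auto simp: modes_le_def strip_def intro!: continuous_intros\<close>)
  then show "\<forall>\<^sub>F N in sequentially. continuous_on (strip d) (%p. \<Sum>n<N. w n (snd p) * (real n * k) ^ j * cos (real n * k * fst p + real j * (pi / 2)))"
   by (intro always_eventually allI continuous_intros)
 qed simp
 then show ?thesis by (simp add: mode_sum_def split_beta)
qed

lemma mode_sum_deriv_x:
 assumes k: "k > 0" and w: "modes_le d w B" and y: "y \<in> {-d..d}"
 shows "((%x. mode_sum k w j (x, y)) has_real_derivative mode_sum k w (Suc j) (x, y)) (at x)"
proof -
 have ul: "uniformly_convergent_on UNIV (%N x. \<Sum>n<N. w n y * (real n * k) ^ Suc j * cos (real n * k * x + real (Suc j) * (pi / 2)))"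
  by (rule Weierstrass_m_test'[OF _ mode_majorant_summable[of B k "Suc j"]])
    (use mode_term_bound[OF k w y, of _ "Suc j"] in auto)
 have d: "((%x. w n y * (real n * k) ^ j * cos (real n * k * x + real j * (pi / 2))) has_real_derivative
   w n y * (real n * k) ^ Suc j * cos (real n * k * x + real (Suc j) * (pi / 2))) (at x within UNIV)" for n x
 proof -
  have "((%x. w n y * (real n * k) ^ j * cos (real n * k * x + real j * (pi / 2))) has_real_derivative
   w n y * (real n * k) ^ j * (- sin (real n * k * x + real j * (pi / 2)) * (real n * k))) (at x within UNIV)"
   by (auto intro!: derivative_eq_intros)
  moreover have "real n * k * x + real (Suc j) * (pi / 2) = (real n * k * x + real j * (pi / 2)) + pi / 2"
   by (simp add: algebra_simps)
  ultimately show ?thesis by (simp only: cos_add cos_pi_half sin_pi_half power_Suc) (simp add: mult_ac)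
 qed
 have "((%x. \<Sum>n. w n y * (real n * k) ^ j * cos (real n * k * x + real j * (pi / 2))) has_real_derivative
   (\<Sum>n. w n y * (real n * k) ^ Suc j * cos (real n * k * x + real (Suc j) * (pi / 2)))) (at x)"
  by (rule has_field_derivative_series'(2)[OF convex_UNIV d ul UNIV_I mode_sum_summable[OF k w y]]) simp
 then show ?thesis by (simp add: mode_sum_def)
qed

lemma mode_sum_deriv_y:
 assumes k: "k > 0" and d: "d > 0" and w: "modes_le d w B" and w': "modes_le d w' B'" and y: "y \<in> {-d..d}"
  and der: "!!n y. y \<in> {-d..d} ==> (w n has_real_derivative w' n y) (at y within {-d..d})"
 shows "((%y. mode_sum k w j (x, y)) has_real_derivative mode_sum k w' j (x, y)) (at y within {-d..d})"
proof -
 have ul: "uniform_limit {-d..d} (%N y. \<Sum>n<N. w' n y * (real n * k) ^ j * cos (real n * k * x + real j * (pi / 2)))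
   (%y. \<Sum>n. w' n y * (real n * k) ^ j * cos (real n * k * x + real j * (pi / 2))) sequentially"
  by (rule Weierstrass_m_test[OF _ mode_majorant_summable[of B' k j]])
    (use mode_term_bound[OF k w'] in auto)
 have dd: "((%y. w n y * (real n * k) ^ j * cos (real n * k * x + real j * (pi / 2))) has_real_derivative
   w' n y * (real n * k) ^ j * cos (real n * k * x + real j * (pi / 2))) (at y within {-d..d})" if "y \<in> {-d..d}" for n y
  by (intro DERIV_cmult_right der that)
 obtain g where g: "!!y. y \<in> {-d..d} ==> (%n. w n y * (real n * k) ^ j * cos (real n * k * x + real j * (pi / 2))) sums g y"
  "!!y. y \<in> {-d..d} ==> (g has_real_derivative (\<Sum>n. w' n y * (real n * k) ^ j * cos (real n * k * x + real j * (pi / 2)))) (at y within {-d..d})"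
  using has_field_derivative_series[OF _ dd ul y mode_sum_summable[OF k w y]] by blast
 show ?thesis by (rule DERIV_transform_on[of g]) (use g y in \<open>auto simp: mode_sum_def sums_iff\<close>)
qed

lemma mode_sum_periodic:
 assumes "k * L = 2 * pi"
 shows "mode_sum k w j (x + L, y) = mode_sum k w j (x, y)"
proof -
 have "cos (real n * k * (x + L) + real j * (pi / 2)) = cos (real n * k * x + real j * (pi / 2))" for n
 proof -
  have "real n * k * (x + L) + real j * (pi / 2) = (real n * k * x + real j * (pi / 2)) + 2 * real n * pi"
   using assms by (simp add: algebra_simps)
  then show ?thesis by (simp only: cos_add cos_2npi sin_2npi) simp
 qed
 then show ?thesis by (simp add: mode_sum_def)
qed

section \<open>Functions of class $C^1$ and $C^2$ on the strip\<close>

lemma C1_strip: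
 fixes f fx fy :: "real \<times> real => real"
 assumes d: "d > 0"
  and fx: "!!x y. (x, y) \<in> strip d ==> ((%x. f (x, y)) has_real_derivative fx (x, y)) (at x)"
  and fy: "!!x y. (x, y) \<in> strip d ==> ((%y. f (x, y)) has_real_derivative fy (x, y)) (at y within {-d..d})"
  and cx: "continuous_on (strip d) fx" and cy: "continuous_on (strip d) fy"
 shows "Ck_on 1 (strip d) f"
  and "p \<in> strip d ==> (f has_derivative (%(h, k). fx p * h + fy p * k)) (at p within strip d)"
  and "p \<in> strip d ==> partial_within (strip d) (1, 0) f p = fx p"
  and "p \<in> strip d ==> partial_within (strip d) (0, 1) f p = fy p"
proof -
 have D: "(f has_derivative (%(h, k). fx p * h + fy p * k)) (at p within strip d)" if p: "p \<in> strip d" for p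
 proof -
  obtain x y where xy: "p = (x, y)" by (cases p)
  show ?thesis unfolding xy by (rule has_derivative_strip[OF d _ _ _ cy]) (use p fx fy xy in \<open>auto simp: strip_def\<close>)
 qed
 then show "p \<in> strip d ==> (f has_derivative (%(h, k). fx p * h + fy p * k)) (at p within strip d)" .
 show "p \<in> strip d ==> partial_within (strip d) (1, 0) f p = fx p"
  "p \<in> strip d ==> partial_within (strip d) (0, 1) f p = fy p"
  using partial_within_eq[OF thick_strip[OF d] _ D, of p] by auto
 show "Ck_on 1 (strip d) f" unfolding One_nat_def
  by (rule Ck_on_SucI[OF thick_strip[OF d] D]) (use cx cy in \<open>auto simp: Basis_real2\<close>)
qed

lemma Ck_norm_cong: "(!!p. p \<in> S ==> f p = g p) ==> Ck_norm n S f = Ck_norm n S g"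
proof (induction n arbitrary: f g)
 case 0
 then show ?case by simp
next
 case (Suc n)
 have "Ck_norm n S (partial_within S b f) = Ck_norm n S (partial_within S b g)" for b
  by (rule Suc.IH) (use Suc.prems partial_within_cong in blast)
 then show ?case using Suc.prems by simp
qed

lemma C2_strip:
 fixes f fx fy :: "real \<times> real => real"
 assumes d: "d > 0"
  and fx: "!!x y. (x, y) \<in> strip d ==> ((%x. f (x, y)) has_real_derivative fx (x, y)) (at x)"
  and fy: "!!x y. (x, y) \<in> strip d ==> ((%y. f (x, y)) has_real_derivative fy (x, y)) (at y within {-d..d})"
  and fxx: "!!x y. (x, y) \<in> strip d ==> ((%x. fx (x, y)) has_real_derivative fxx (x, y)) (at x)"
  and fxy: "!!x y. (x, y) \<in> strip d ==> ((%y. fx (x, y)) has_real_derivative fxy (x, y)) (at y within {-d..d})"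
  and fyx: "!!x y. (x, y) \<in> strip d ==> ((%x. fy (x, y)) has_real_derivative fyx (x, y)) (at x)"
  and fyy: "!!x y. (x, y) \<in> strip d ==> ((%y. fy (x, y)) has_real_derivative fyy (x, y)) (at y within {-d..d})"
  and c: "continuous_on (strip d) fx" "continuous_on (strip d) fy"
   "continuous_on (strip d) fxx" "continuous_on (strip d) fxy" "continuous_on (strip d) fyx" "continuous_on (strip d) fyy"
 shows "Ck_on 2 (strip d) f"
  and "(!!p. p \<in> strip d ==> \<bar>f p\<bar> \<le> B \<and> \<bar>fx p\<bar> \<le> B \<and> \<bar>fy p\<bar> \<le> B \<and> \<bar>fxx p\<bar> \<le> B \<and> \<bar>fxy p\<bar> \<le> B \<and> \<bar>fyx p\<bar> \<le> B \<and> \<bar>fyy p\<bar> \<le> B)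
    ==> Ck_norm 2 (strip d) f \<le> B"
proof -
 note F = C1_strip[OF d fx fy c(1,2)]
 have X: "Ck_on 1 (strip d) fx" "p \<in> strip d ==> partial_within (strip d) (1, 0) fx p = fxx p"
  "p \<in> strip d ==> partial_within (strip d) (0, 1) fx p = fxy p" for p using C1_strip[OF d fxx fxy c(3,4)] by blast+
 have Y: "Ck_on 1 (strip d) fy" "p \<in> strip d ==> partial_within (strip d) (1, 0) fy p = fyx p"
  "p \<in> strip d ==> partial_within (strip d) (0, 1) fy p = fyy p" for p using C1_strip[OF d fyx fyy c(5,6)] by blast+
 have "Ck_on (Suc 1) (strip d) f"
  by (rule Ck_on_SucI[OF thick_strip[OF d] F(2)]) (use X(1) Y(1) in \<open>auto simp: Basis_real2\<close>)
 then show "Ck_on 2 (strip d) f" by (simp add: numeral_2_eq_2)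
 assume B: "!!p. p \<in> strip d ==> \<bar>f p\<bar> \<le> B \<and> \<bar>fx p\<bar> \<le> B \<and> \<bar>fy p\<bar> \<le> B \<and> \<bar>fxx p\<bar> \<le> B \<and> \<bar>fxy p\<bar> \<le> B \<and> \<bar>fyx p\<bar> \<le> B \<and> \<bar>fyy p\<bar> \<le> B"
 have ne: "strip d \<noteq> {}" using d by (auto simp: strip_def)
 have sup: "(SUP p\<in>strip d. \<bar>h p\<bar>) \<le> B" if "!!p. p \<in> strip d ==> \<bar>h p\<bar> \<le> B" for h :: "real \<times> real => real"
  by (rule cSUP_least[OF ne that])
 have n1: "Ck_norm (Suc 0) (strip d) h \<le> B"
  if "!!p. p \<in> strip d ==> \<bar>h p\<bar> \<le> B \<and> \<bar>partial_within (strip d) (1, 0) h p\<bar> \<le> B \<and> \<bar>partial_within (strip d) (0, 1) h p\<bar> \<le> B" for h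
  unfolding Ck_norm.simps using that by (auto simp: Basis_real2 intro!: sup)
 have nx: "Ck_norm (Suc 0) (strip d) (partial_within (strip d) (1, 0) f) \<le> B"
  using Ck_norm_cong[of "strip d" "partial_within (strip d) (1, 0) f" fx "Suc 0"] F(3) n1[of fx] X B by auto
 have ny: "Ck_norm (Suc 0) (strip d) (partial_within (strip d) (0, 1) f) \<le> B"
  using Ck_norm_cong[of "strip d" "partial_within (strip d) (0, 1) f" fy "Suc 0"] F(4) n1[of fy] Y B by auto
 have "Ck_norm (Suc (Suc 0)) (strip d) f \<le> B"
  unfolding Ck_norm.simps(2)[of "Suc 0"] using nx ny sup[of f] B by (auto simp: Basis_real2)
 then show "Ck_norm 2 (strip d) f \<le> B" by (simp add: numeral_2_eq_2)
qed

lemma travelling_C1: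
 fixes f fx fy :: "real \<times> real => real"
 assumes d: "d > 0"
  and fx: "!!x y. (x, y) \<in> strip d ==> ((%x. f (x, y)) has_real_derivative fx (x, y)) (at x)"
  and fy: "!!x y. (x, y) \<in> strip d ==> ((%y. f (x, y)) has_real_derivative fy (x, y)) (at y within {-d..d})"
  and cx: "continuous_on (strip d) fx" and cy: "continuous_on (strip d) fy"
 shows "Ck_on 1 (slab d) (%(t, x, y). f (x - c * t, y))"
  and "(t, x, y) \<in> slab d ==> Dt d (%(t, x, y). f (x - c * t, y)) (t, x, y) = - c * fx (x - c * t, y)"
  and "(t, x, y) \<in> slab d ==> Dx d (%(t, x, y). f (x - c * t, y)) (t, x, y) = fx (x - c * t, y)"
  and "(t, x, y) \<in> slab d ==> Dy d (%(t, x, y). f (x - c * t, y)) (t, x, y) = fy (x - c * t, y)"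
proof -
 define \<pi> where "\<pi> = (%(t, x, y). (x - c * t, y :: real))"
 define F where "F p = (%(h, k, l). fx (\<pi> p) * (k - c * h) + fy (\<pi> p) * l)" for p
 have \<pi>: "\<pi> p \<in> strip d" if "p \<in> slab d" for p using that by (auto simp: \<pi>_def slab_def strip_def)
 have D: "((%(t, x, y). f (x - c * t, y)) has_derivative F p) (at p within slab d)" if p: "p \<in> slab d" for p
 proof -
  have dp: "(\<pi> has_derivative (%(h, k, l). (k - c * h, l))) (at p within slab d)"
   unfolding \<pi>_def split_beta by (auto intro!: derivative_eq_intros simp: fun_eq_iff)
  have "(f has_derivative (%(h, k). fx (\<pi> p) * h + fy (\<pi> p) * k)) (at (\<pi> p) within strip d)"
   by (rule C1_strip(2)[OF d fx fy cx cy \<pi>[OF p]])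
  then have "(f has_derivative (%(h, k). fx (\<pi> p) * h + fy (\<pi> p) * k)) (at (\<pi> p) within \<pi> ` slab d)"
   by (rule has_derivative_subset) (use \<pi> in auto)
  from has_derivative_in_compose[OF dp this] show ?thesis by (simp add: \<pi>_def F_def case_prod_unfold)
 qed
 show "(t, x, y) \<in> slab d ==> Dt d (%(t, x, y). f (x - c * t, y)) (t, x, y) = - c * fx (x - c * t, y)"
  "(t, x, y) \<in> slab d ==> Dx d (%(t, x, y). f (x - c * t, y)) (t, x, y) = fx (x - c * t, y)"
  "(t, x, y) \<in> slab d ==> Dy d (%(t, x, y). f (x - c * t, y)) (t, x, y) = fy (x - c * t, y)"
  using partial_within_eq[OF thick_slab[OF d] _ D, of "(t, x, y)"] by (auto simp: F_def \<pi>_def)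
 have c\<pi>: "continuous_on (slab d) (%p. h (\<pi> p))" if "continuous_on (strip d) h" for h :: "real \<times> real => real"
  by (rule continuous_on_compose2[OF that]) (use \<pi> in \<open>auto simp: \<pi>_def split_beta intro!: continuous_intros\<close>)
 show "Ck_on 1 (slab d) (%(t, x, y). f (x - c * t, y))" unfolding One_nat_def
 proof (rule Ck_on_SucI[OF thick_slab[OF d] D])
  fix b :: "real \<times> real \<times> real" assume "b \<in> Basis"
  then show "Ck_on 0 (slab d) (%p. F p b)"
   using c\<pi>[OF cx] c\<pi>[OF cy] by (auto simp: Basis_real3 F_def intro!: continuous_intros)
 qed
qed

section \<open>The travelling wave as a solution\<close>

lemma antiderivative_poly: "\<exists>P. pderiv P = (p :: real poly)"
proof
 have "pderiv (\<Sum>i\<le>degree p. monom (coeff p i / (1 + real i)) (Suc i)) = (\<Sum>i\<le>degree p. monom (coeff p i) i)"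
  unfolding higher_pderiv_sum[of 1, simplified] pderiv_monom by (intro sum.cong refl arg_cong2[of _ _ _ _ monom]) (simp_all add: field_simps add_pos_nonneg)
 then show "pderiv (\<Sum>i\<le>degree p. monom (coeff p i / (1 + real i)) (Suc i)) = p" by (simp add: poly_as_sum_of_monoms)
qed

text \<open>The displaced point y + e may leave [-d, d], since mode 0 is free at the upper wall. The
  gap between profile and speed is therefore required on an interval longer by \<open>ro\<close> on
  each side, where the polynomial \<open>U\<close> is still defined.\<close>

locale wave_flow =
 fixes d L \<beta> k cs mu c :: real and U E G :: "real poly" and q :: "real => real"
  and w w' g :: "nat => real => real" and e :: "real => real => real" and Cw a Qb ro mub :: real
 assumes d: "d > 0" and L: "L > 0" and k: "k > 0" "k * L = 2 * pi"
  and c: "c = cs + mu" and E: "pderiv E = U - [:cs:]" and G: "G = pderiv U - [:0, \<beta>:]"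
  and modes: "wave_modes d k E G q Cw a mu w w' g e"
  and a: "a > 0" and Cw: "Cw > 0" "Cw * a < ro"
  and qc: "continuous_on {-d..d} q" and Qb: "!!y. y \<in> {-d..d} ==> \<bar>q y\<bar> \<le> Qb"
  and mub: "mub > 0" and gap: "!!s. s \<in> {-d-ro..d+ro} ==> mub \<le> poly U s - c"
begin

definition w'' :: "nat => real => real" where
 "w'' n y = ((real n * k)\<^sup>2 - q y) * w n y + g n y"

definition Bq :: real where "Bq = (k\<^sup>2 + Qb + 1) * Cw"

lemma Qb0: "Qb \<ge> 0" using Qb[of 0] d by simp

lemma Cwa: "Cw * a > 0" using Cw a by simp

lemma sol: "sol2 (-d) d (%y. (real n * k)\<^sup>2 - q y) (g n) (w n) (w' n)"
 and gcont: "continuous_on {-d..d} (g n)" using modes by (auto simp: wave_modes_def)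

lemma bounds:
 assumes "y \<in> {-d..d}"
 shows "\<bar>w n y\<bar> \<le> Cw * a * exp (- real n)" "\<bar>w' n y\<bar> \<le> Cw * a * exp (- real n)" "\<bar>g n y\<bar> \<le> Cw * a * exp (- real n)"
 using modes assms by (auto simp: wave_modes_def)

lemma der_w: "y \<in> {-d..d} ==> (w n has_real_derivative w' n y) (at y within {-d..d})"
 "y \<in> {-d..d} ==> (w' n has_real_derivative w'' n y) (at y within {-d..d})"
 using sol2D[OF sol] by (auto simp: w''_def)

lemma modes_w: "modes_le d w (Bq * a)" "modes_le d w' (Bq * a)" "modes_le d w'' (Bq * a)"
proof -
 have n1: "1 \<le> (real n + 1)\<^sup>2" for n by (simp add: one_le_power)
 have CB: "Cw * a \<le> Bq * a" using k Qb0 Cw(1) a by (intro mult_right_mono) (auto simp: Bq_def)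
 have up: "Cw * a * exp (- real n) \<le> Bq * a * ((real n + 1)\<^sup>2 * exp (- real n))" for n
 proof -
  have "0 \<le> Bq * a" using CB Cwa by linarith
  then have "(Cw * a) * (1 * exp (- real n)) \<le> (Bq * a) * ((real n + 1)\<^sup>2 * exp (- real n))"
   using mult_mono[OF CB, of "1 * exp (- real n)" "(real n + 1)\<^sup>2 * exp (- real n)"] n1[of n] by simp
  then show ?thesis by simp
 qed
 note cw = sol2_continuous[OF sol]
 show "modes_le d w (Bq * a)" "modes_le d w' (Bq * a)"
  unfolding modes_le_def using cw bounds order_trans[OF _ up] by blast+
 show "modes_le d w'' (Bq * a)" unfolding modes_le_def
 proof (intro conjI allI ballI)
  show "continuous_on {-d..d} (w'' n)" for n unfolding w''_def by (intro continuous_intros cw qc gcont)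
  fix n y assume y: "y \<in> {-d..d}"
  have "\<bar>(real n * k)\<^sup>2 - q y\<bar> \<le> (real n * k)\<^sup>2 + Qb" using Qb[OF y] zero_le_power2[of "real n * k"] by linarith
  then have "\<bar>w'' n y\<bar> \<le> ((real n * k)\<^sup>2 + Qb) * (Cw * a * exp (- real n)) + Cw * a * exp (- real n)"
   unfolding w''_def using bounds[OF y, of n]
   by (intro order_trans[OF abs_triangle_ineq] add_mono) (auto simp: abs_mult intro!: mult_mono add_nonneg_nonneg Qb0)
  also have "... = ((real n * k)\<^sup>2 + Qb + 1) * (Cw * a * exp (- real n))" by (simp add: algebra_simps)
  also have "... \<le> ((k\<^sup>2 + Qb + 1) * (real n + 1)\<^sup>2) * (Cw * a * exp (- real n))"
  proof (rule mult_right_mono)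
   have "(real n)\<^sup>2 \<le> (real n + 1)\<^sup>2" by (intro power_mono) auto
   then have "(real n)\<^sup>2 * k\<^sup>2 \<le> (real n + 1)\<^sup>2 * k\<^sup>2" by (rule mult_right_mono) simp
   moreover have "1 * (Qb + 1) \<le> (real n + 1)\<^sup>2 * (Qb + 1)" using n1 Qb0 by (intro mult_right_mono) auto
   ultimately show "(real n * k)\<^sup>2 + Qb + 1 \<le> (k\<^sup>2 + Qb + 1) * (real n + 1)\<^sup>2"
    by (simp add: power_mult_distrib algebra_simps)
  qed (use Cwa in simp)
  also have "... = Bq * a * ((real n + 1)\<^sup>2 * exp (- real n))" by (simp add: Bq_def mult_ac)
  finally show "\<bar>w'' n y\<bar> \<le> Bq * a * ((real n + 1)\<^sup>2 * exp (- real n))" .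
 qed
qed

abbreviation "S0 \<equiv> mode_sum k w"
abbreviation "S1 \<equiv> mode_sum k w'"
abbreviation "S2 \<equiv> mode_sum k w''"

lemmas S_cont = mode_sum_continuous[OF k(1) modes_w(1)] mode_sum_continuous[OF k(1) modes_w(2)] mode_sum_continuous[OF k(1) modes_w(3)]

lemma S_der_x:
 assumes "(x, y) \<in> strip d"
 shows "((%x. S0 j (x, y)) has_real_derivative S0 (Suc j) (x, y)) (at x)"
  "((%x. S1 j (x, y)) has_real_derivative S1 (Suc j) (x, y)) (at x)"
  "((%x. S2 j (x, y)) has_real_derivative S2 (Suc j) (x, y)) (at x)"
 using assms by (auto simp: strip_def intro!: mode_sum_deriv_x[OF k(1)] modes_w)

lemma S_der_y:
 assumes "(x, y) \<in> strip d"
 shows "((%y. S0 j (x, y)) has_real_derivative S1 j (x, y)) (at y within {-d..d})"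
  "((%y. S1 j (x, y)) has_real_derivative S2 j (x, y)) (at y within {-d..d})"
proof -
 have y: "y \<in> {-d..d}" using assms by (simp add: strip_def)
 show "((%y. S0 j (x, y)) has_real_derivative S1 j (x, y)) (at y within {-d..d})"
  by (rule mode_sum_deriv_y[OF k(1) d modes_w(1,2) y der_w(1)])
 show "((%y. S1 j (x, y)) has_real_derivative S2 j (x, y)) (at y within {-d..d})"
  by (rule mode_sum_deriv_y[OF k(1) d modes_w(2,3) y der_w(2)])
qed

text \<open>The stream function in the moving frame is \<open>Hp (Y (x, y))\<close>, so the flow is steady there with
 absolute vorticity a function of \<open>Y\<close>.\<close>

definition Y :: "real \<times> real => real" where "Y = (%(x, y). y + e (k * x) y)"

definition Hp :: "real => real" where "Hp s = poly E s - mu * s"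

lemma Hp_der: "(Hp has_real_derivative poly U s - c) (at s)"
proof -
 have "(Hp has_real_derivative poly (pderiv E) s - mu * 1) (at s)"
  unfolding Hp_def[abs_def] by (intro DERIV_diff poly_DERIV DERIV_cmult DERIV_ident)
 then show ?thesis by (simp add: E c diff_diff_eq)
qed

text \<open>The last claim is Laplacian w = G(Y) - G(y): summing the mode equations, the terms with
  q cancel against the q in the source.\<close>

lemma expand:
 assumes "(x, y) \<in> strip d"
 shows "\<bar>Y (x, y) - y\<bar> \<le> Cw * a" "S0 0 (x, y) = Hp (Y (x, y)) - Hp y"
  "S2 0 (x, y) = poly G (Y (x, y)) - poly G y - S0 2 (x, y)"
proof -
 have y: "y \<in> {-d..d}" using assms by (simp add: strip_def)
 have m: "\<bar>e (k * x) y\<bar> \<le> Cw * a"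
  "(\<Sum>n. w n y * cos (real n * (k * x))) = poly E (y + e (k * x) y) - poly E y - mu * e (k * x) y"
  "(\<Sum>n. g n y * cos (real n * (k * x))) = poly G (y + e (k * x) y) - poly G y + q y * (\<Sum>n. w n y * cos (real n * (k * x)))"
  using modes y unfolding wave_modes_def by blast+
 show "\<bar>Y (x, y) - y\<bar> \<le> Cw * a" using m(1) by (simp add: Y_def)
 show S0: "S0 0 (x, y) = Hp (Y (x, y)) - Hp y" using m(2) by (simp add: mode_sum_def Hp_def Y_def algebra_simps)
 have sw: "summable (%n. w n y * (real n * k)\<^sup>2 * cos (real n * k * x))"
  by (rule mode_sum_summable[OF k(1) modes_w(1) y])
 have sw0: "summable (%n. w n y * cos (real n * k * x))"
  using mode_sum_summable[OF k(1) modes_w(1) y, of 0 "%n. real n * k * x"] by simp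
 have sg: "summable (%n. g n y * cos (real n * k * x))"
 proof (rule summable_comparison_test'[OF summable_exp_neg_nat[of "Cw * a"], of 0])
  fix n :: nat
  have "\<bar>g n y\<bar> * \<bar>cos (real n * k * x)\<bar> \<le> \<bar>g n y\<bar> * 1" by (intro mult_left_mono) auto
  then show "norm (g n y * cos (real n * k * x)) \<le> Cw * a * exp (- real n)"
   using bounds(3)[OF y, of n] by (simp add: abs_mult)
 qed
 have "S2 0 (x, y) = (\<Sum>n. w n y * (real n * k)\<^sup>2 * cos (real n * k * x) - q y * (w n y * cos (real n * k * x)) + g n y * cos (real n * k * x))"
  unfolding mode_sum_def by (simp add: w''_def algebra_simps)
 also have "... = (\<Sum>n. w n y * (real n * k)\<^sup>2 * cos (real n * k * x)) - q y * (\<Sum>n. w n y * cos (real n * k * x)) + (\<Sum>n. g n y * cos (real n * k * x))"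
  by (intro sums_unique[symmetric] sums_add sums_diff sums_mult summable_sums sw sw0 sg)
 also have "(\<Sum>n. w n y * (real n * k)\<^sup>2 * cos (real n * k * x)) = - S0 2 (x, y)"
 proof -
  have "cos (t + real 2 * (pi / 2)) = - cos t" for t by simp
  then have "S0 2 (x, y) = (\<Sum>n. - (w n y * (real n * k)\<^sup>2 * cos (real n * k * x)))" by (simp add: mode_sum_def)
  also have "... = - (\<Sum>n. w n y * (real n * k)\<^sup>2 * cos (real n * k * x))" by (rule suminf_minus[OF sw])
  finally show ?thesis by simp
 qed
 finally show "S2 0 (x, y) = poly G (Y (x, y)) - poly G y - S0 2 (x, y)" using m(3) by (simp add: Y_def mult.assoc)
qed

lemma ro0: "ro > 0" using Cw Cwa by simp

lemma Y_range:
 assumes "(x, y) \<in> strip d"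
 shows "Y (x, y) \<in> {-d-ro<..<d+ro}" "mub \<le> poly U (Y (x, y)) - c"
proof -
 show "Y (x, y) \<in> {-d-ro<..<d+ro}" using expand(1)[OF assms] Cw(2) assms by (auto simp: strip_def)
 then show "mub \<le> poly U (Y (x, y)) - c" by (intro gap) auto
qed

section \<open>Regularity of the level-line function\<close>

lemma Hp_strict_mono: "s \<in> {-d-ro..d+ro} ==> t \<in> {-d-ro..d+ro} ==> s < t ==> Hp s < Hp t"
proof (rule DERIV_pos_imp_increasing[of s t])
 fix r assume "s \<in> {-d-ro..d+ro}" "t \<in> {-d-ro..d+ro}" "s \<le> r" "r \<le> t"
 then have "0 < poly U r - c" using gap[of r] mub by simp
 then show "\<exists>y. (Hp has_real_derivative y) (at r) \<and> 0 < y" using Hp_der by blast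
qed

definition Hinv :: "real => real" where "Hinv = the_inv_into {-d-ro..d+ro} Hp"

lemma Hinv: "s \<in> {-d-ro..d+ro} ==> Hinv (Hp s) = s" unfolding Hinv_def
proof (rule the_inv_into_f_f)
 show "inj_on Hp {-d-ro..d+ro}"
 proof (rule inj_onI)
  fix r t assume r: "r \<in> {-d-ro..d+ro}" and t: "t \<in> {-d-ro..d+ro}" and eq: "Hp r = Hp t"
  show "r = t"
  proof (rule ccontr)
   assume "r \<noteq> t"
   then consider "r < t" | "t < r" by linarith
   then show False using Hp_strict_mono[OF r t] Hp_strict_mono[OF t r] eq by cases auto
  qed
 qed
qed

lemma Hinv_der:
 assumes s: "s \<in> {-d-ro<..<d+ro}"
 shows "(Hinv has_real_derivative 1 / (poly U s - c)) (at (Hp s))"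
proof -
 have Hcont: "isCont Hp s" for s using Hp_der DERIV_isCont by blast
 have "(Hinv has_real_derivative inverse (poly U s - c)) (at (Hp s))"
 proof (rule DERIV_inverse_function[where f=Hp and a="Hp (-d-ro)" and b="Hp (d+ro)"])
  show "(Hp has_real_derivative poly U s - c) (at (Hinv (Hp s)))" using Hinv[of s] s Hp_der by simp
  show "poly U s - c \<noteq> 0" using gap[of s] s mub by auto
  show "Hp (-d-ro) < Hp s" "Hp s < Hp (d+ro)" using s Hp_strict_mono[of "-d-ro" s] Hp_strict_mono[of s "d+ro"] by simp_all
  show "Hp (Hinv t) = t" if t: "Hp (-d-ro) < t" "t < Hp (d+ro)" for t
  proof -
   obtain r where "-d-ro \<le> r" "r \<le> d+ro" "Hp r = t"
    using IVT[of Hp "-d-ro" t "d+ro"] t Hcont d ro0 by (auto simp: less_imp_le)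
   then show ?thesis using Hinv[of r] by auto
  qed
  show "isCont Hinv (Hp s)" by (rule isCont_inverse_function2[of "-d-ro" s "d+ro"]) (use s Hinv Hcont in auto)
 qed
 then show ?thesis by (simp add: inverse_eq_divide)
qed

text \<open>The displacement \<open>e\<close> comes without any regularity. Solving the stream
  function relation for \<open>Y\<close> by the inverse of \<open>Hp\<close> transfers the
  smoothness of the mode sum to it.\<close>

lemma Y_Hinv: "(x, y) \<in> strip d ==> Hinv (Hp y + S0 0 (x, y)) = Y (x, y)"
 using expand(2) Hinv[of "Y (x, y)"] Y_range(1)[of x y] by auto

definition Yx :: "real \<times> real => real" where "Yx p = S0 1 p / (poly U (Y p) - c)"
definition Yy :: "real \<times> real => real" where "Yy p = (poly U (snd p) - c + S1 0 p) / (poly U (Y p) - c)"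

lemma Y_der:
 assumes p: "(x, y) \<in> strip d"
 shows "((%x. Y (x, y)) has_real_derivative Yx (x, y)) (at x)"
  "((%y. Y (x, y)) has_real_derivative Yy (x, y)) (at y within {-d..d})"
proof -
 have y: "y \<in> {-d..d}" using p by (simp add: strip_def)
 have eq: "Hp y + S0 0 (x, y) = Hp (Y (x, y))" using expand(2)[OF p] by simp
 note dH = Hinv_der[OF Y_range(1)[OF p], folded eq]
 have "((%x. Hinv (Hp y + S0 0 (x, y))) has_real_derivative 1 / (poly U (Y (x, y)) - c) * (0 + S0 (Suc 0) (x, y))) (at x)"
  by (rule DERIV_chain2[where f=Hinv and g="%x. Hp y + S0 0 (x, y)", OF dH]) (intro DERIV_add DERIV_const S_der_x p)
 moreover have "(%x. Hinv (Hp y + S0 0 (x, y))) = (%x. Y (x, y))" using Y_Hinv y by (auto simp: strip_def)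
 ultimately show "((%x. Y (x, y)) has_real_derivative Yx (x, y)) (at x)" by (simp add: Yx_def)
 have "((%y. Hinv (Hp y + S0 0 (x, y))) has_real_derivative 1 / (poly U (Y (x, y)) - c) * ((poly U y - c) + S1 0 (x, y))) (at y within {-d..d})"
  by (rule DERIV_chain2[where f=Hinv and g="%y. Hp y + S0 0 (x, y)", OF dH]) (intro DERIV_add S_der_y p has_field_derivative_at_within[OF Hp_der])
 then have "((%y. Y (x, y)) has_real_derivative 1 / (poly U (Y (x, y)) - c) * ((poly U y - c) + S1 0 (x, y))) (at y within {-d..d})"
  by (rule DERIV_transform_on[OF _ y]) (rule Y_Hinv, simp add: strip_def)
 then show "((%y. Y (x, y)) has_real_derivative Yy (x, y)) (at y within {-d..d})" by (simp add: Yy_def)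
qed

lemma snd_cont: "continuous_on (strip d) (%p. poly P (snd p))" by (intro continuous_intros)

lemma Hp_cont: "continuous_on S Hp"
 using DERIV_continuous_on[of S Hp "%s. poly U s - c"] Hp_der has_field_derivative_at_within by blast

lemma Y_cont: "continuous_on (strip d) Y"
proof -
 have 1: "continuous_on (Hp ` {-d-ro<..<d+ro}) Hinv"
 proof (rule continuous_at_imp_continuous_on, clarify)
  fix s assume "s \<in> {-d-ro<..<d+ro}"
  then show "isCont Hinv (Hp s)" by (rule DERIV_isCont[OF Hinv_der])
 qed
 have 2: "continuous_on (strip d) (%p. Hp (snd p) + S0 0 p)"
  by (intro continuous_on_add S_cont continuous_on_compose2[OF Hp_cont[of UNIV]] continuous_intros) auto
 have im: "Hp (snd p) + S0 0 p = Hp (Y p)" if "p \<in> strip d" for p using expand(2)[of "fst p" "snd p"] that by simp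
 have "continuous_on (strip d) (%p. Hinv (Hp (snd p) + S0 0 p))"
  by (rule continuous_on_compose2[OF 1 2]) (use im Y_range(1)[of "fst _" "snd _"] in auto)
 then show ?thesis by (rule continuous_on_eq) (use Y_Hinv[of "fst _" "snd _"] in auto)
qed

lemma denom: "p \<in> strip d ==> poly U (Y p) - c \<noteq> 0" using Y_range(2)[of "fst p" "snd p"] mub by simp

lemma polyY_cont: "continuous_on (strip d) (%p. poly P (Y p))" by (intro continuous_intros Y_cont)

lemma Yxy_cont: "continuous_on (strip d) Yx" "continuous_on (strip d) Yy"
 unfolding Yx_def Yy_def by (intro continuous_intros S_cont polyY_cont snd_cont; use denom in blast)+

lemma polyY_der:
 assumes p: "(x, y) \<in> strip d"
 shows "((%x. poly P (Y (x, y))) has_real_derivative poly (pderiv P) (Y (x, y)) * Yx (x, y)) (at x)"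
  "((%y. poly P (Y (x, y))) has_real_derivative poly (pderiv P) (Y (x, y)) * Yy (x, y)) (at y within {-d..d})"
 by (rule DERIV_chain2[OF poly_DERIV] Y_der p)+

definition fy :: "real \<times> real => real" where
 "fy p = poly (pderiv G) (Y p) * Yy p - poly (pderiv G) (snd p)"

lemma fy_cont: "continuous_on (strip d) fy" unfolding fy_def by (intro continuous_intros polyY_cont Yxy_cont snd_cont)

text \<open>A third \<open>y\<close>-derivative of the perturbation is needed, but q and the sources
  \<open>g n\<close> are only known to be continuous, so the series for w'' is not differentiated
  termwise. The derivative is read off the nonlinear equation instead.\<close>

lemma S2_der_y:
 assumes p: "(x, y) \<in> strip d"
 shows "((%y. S2 0 (x, y)) has_real_derivative fy (x, y) - S1 2 (x, y)) (at y within {-d..d})"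
proof -
 have y: "y \<in> {-d..d}" using p by (simp add: strip_def)
 have "((%y. poly G (Y (x, y)) - poly G y - S0 2 (x, y)) has_real_derivative fy (x, y) - S1 2 (x, y)) (at y within {-d..d})"
  unfolding fy_def snd_conv by (intro DERIV_diff polyY_der S_der_y p has_field_derivative_at_within[OF poly_DERIV])
 then show ?thesis by (rule DERIV_transform_on[OF _ y]) (rule expand(3)[symmetric], simp add: strip_def)
qed

text \<open>The mode sum w acts as a perturbation stream function: the velocity is (U + w_y, -
  w_x).\<close>

definition u1 :: "real \<times> real => real" where "u1 p = poly U (snd p) + S1 0 p"
definition v1 :: "real \<times> real => real" where "v1 p = - S0 1 p"
definition u1y :: "real \<times> real => real" where "u1y p = poly (pderiv U) (snd p) + S2 0 p"
definition om :: "real \<times> real => real" where "om p = - poly G (Y p) - \<beta> * snd p"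

lemma u1_der:
 assumes p: "(x, y) \<in> strip d"
 shows "((%x. u1 (x, y)) has_real_derivative S1 1 (x, y)) (at x)"
  "((%y. u1 (x, y)) has_real_derivative u1y (x, y)) (at y within {-d..d})"
  "((%x. u1y (x, y)) has_real_derivative S2 1 (x, y)) (at x)"
  "((%y. u1y (x, y)) has_real_derivative poly (pderiv (pderiv U)) y + (fy (x, y) - S1 2 (x, y))) (at y within {-d..d})"
 unfolding u1_def u1y_def snd_conv
   apply (rule DERIV_cong[OF DERIV_add[OF DERIV_const S_der_x(2)[OF p]]], simp)
  apply (intro DERIV_add S_der_y p has_field_derivative_at_within[OF poly_DERIV])
  apply (rule DERIV_cong[OF DERIV_add[OF DERIV_const S_der_x(3)[OF p]]], simp)
 apply (intro DERIV_add S2_der_y p has_field_derivative_at_within[OF poly_DERIV])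
 done

lemma v1_der:
 assumes p: "(x, y) \<in> strip d"
 shows "((%x. v1 (x, y)) has_real_derivative - S0 2 (x, y)) (at x)"
  "((%y. v1 (x, y)) has_real_derivative - S1 1 (x, y)) (at y within {-d..d})"
  "((%x. - S0 2 (x, y)) has_real_derivative - S0 3 (x, y)) (at x)"
  "((%y. - S0 2 (x, y)) has_real_derivative - S1 2 (x, y)) (at y within {-d..d})"
  "((%x. - S1 1 (x, y)) has_real_derivative - S1 2 (x, y)) (at x)"
  "((%y. - S1 1 (x, y)) has_real_derivative - S2 1 (x, y)) (at y within {-d..d})" unfolding v1_def
 using DERIV_minus[OF S_der_x(1)[OF p, of 1]] DERIV_minus[OF S_der_x(1)[OF p, of 2]] DERIV_minus[OF S_der_x(2)[OF p, of 1]]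
  DERIV_minus[OF S_der_y(1)[OF p, of 1]] DERIV_minus[OF S_der_y(1)[OF p, of 2]] DERIV_minus[OF S_der_y(2)[OF p, of 1]]
 by (simp_all add: numeral_2_eq_2 numeral_3_eq_3)

lemma polyG: "poly G y = poly (pderiv U) y - \<beta> * y" by (simp add: G)

lemma om_eq: "p \<in> strip d ==> - S0 2 p - u1y p = om p"
 using expand(3)[of "fst p" "snd p"] polyG[of "snd p"] by (simp add: om_def u1y_def)

lemma om_der:
 assumes p: "(x, y) \<in> strip d"
 shows "((%x. om (x, y)) has_real_derivative - (poly (pderiv G) (Y (x, y)) * Yx (x, y))) (at x)"
  "((%y. om (x, y)) has_real_derivative - (poly (pderiv G) (Y (x, y)) * Yy (x, y)) - \<beta> * 1) (at y within {-d..d})"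
 unfolding om_def snd_conv
  apply (rule DERIV_cong[OF DERIV_diff[OF DERIV_minus[OF polyY_der(1)[OF p]] DERIV_const]], simp)
 apply (intro DERIV_diff DERIV_minus polyY_der(2)[OF p] DERIV_cmult DERIV_ident)
 done

lemma u1y_cont: "continuous_on (strip d) u1y" unfolding u1y_def by (intro continuous_intros S_cont snd_cont)

section \<open>The travelling velocity field and its pressure\<close>

definition uu :: "real \<times> real \<times> real => real" where "uu = (%(t, x, y). u1 (x - c * t, y))"
definition vv :: "real \<times> real \<times> real => real" where "vv = (%(t, x, y). v1 (x - c * t, y))"

lemma cv1: "continuous_on (strip d) (%p. - S0 j p)" "continuous_on (strip d) (%p. - S1 j p)" "continuous_on (strip d) (%p. - S2 j p)"
 by (intro continuous_intros S_cont)+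

lemma uu_C1:
 "Ck_on 1 (slab d) uu"
 "(t, x, y) \<in> slab d ==> Dt d uu (t, x, y) = - c * S1 1 (x - c * t, y)"
 "(t, x, y) \<in> slab d ==> Dx d uu (t, x, y) = S1 1 (x - c * t, y)"
 "(t, x, y) \<in> slab d ==> Dy d uu (t, x, y) = u1y (x - c * t, y)"
 using travelling_C1[OF d u1_der(1,2) S_cont(2) u1y_cont, where c=c] by (simp_all add: uu_def)

lemma vv_C1:
 "Ck_on 1 (slab d) vv"
 "(t, x, y) \<in> slab d ==> Dt d vv (t, x, y) = - c * - S0 2 (x - c * t, y)"
 "(t, x, y) \<in> slab d ==> Dx d vv (t, x, y) = - S0 2 (x - c * t, y)"
 "(t, x, y) \<in> slab d ==> Dy d vv (t, x, y) = - S1 1 (x - c * t, y)"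
 using travelling_C1[OF d v1_der(1,2) cv1(1,2), where c=c] by (simp_all add: vv_def)

lemma vorticity_eq: "p \<in> slab d ==> vorticity d uu vv p = (%(t, x, y). om (x - c * t, y)) p"
proof -
 assume p: "p \<in> slab d"
 obtain t x y where pt: "p = (t, x, y)" by (cases p) auto
 have s: "(x - c * t, y) \<in> strip d" using p by (auto simp: pt slab_def strip_def)
 show ?thesis
  using uu_C1(4)[OF p[unfolded pt]] vv_C1(3)[OF p[unfolded pt]] om_eq[OF s] by (simp add: vorticity_def pt)
qed

lemma om_cont:
 "continuous_on (strip d) (%p. - (poly (pderiv G) (Y p) * Yx p))"
 "continuous_on (strip d) (%p. - (poly (pderiv G) (Y p) * Yy p) - \<beta> * 1)"
 by (intro continuous_intros polyY_cont Yxy_cont)+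

lemma vorticity_C1: "Ck_on 1 (slab d) (vorticity d uu vv)"
 by (rule Ck_on_cong[THEN iffD2, OF vorticity_eq travelling_C1(1)[OF d om_der om_cont]])

lemma mode_sum_shift: "mode_sum k h j (x + L, y) = mode_sum k h j (x, y)" by (rule mode_sum_periodic[OF k(2)])

lemma u1_periodic: "u1 (x + L, y) = u1 (x, y)" and v1_periodic: "v1 (x + L, y) = v1 (x, y)"
 by (simp_all add: u1_def v1_def mode_sum_shift)

lemma Y_periodic: "(x, y) \<in> strip d ==> Y (x + L, y) = Y (x, y)"
 using Y_Hinv[of x y] Y_Hinv[of "x + L" y] by (simp add: mode_sum_shift strip_def)

text \<open>The \<open>x\<close>-derivative gives mode n the factor n k, so mode 0 drops out and the
  other modes vanish at both walls.\<close>

lemma v1_boundary: "v1 (x, -d) = 0" "v1 (x, d) = 0"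
proof -
 have z: "w n y * (real n * k) ^ 1 = 0" if "y = -d \<or> y = d" for n y
  using modes that by (cases "n = 0") (auto simp: wave_modes_def)
 show "v1 (x, -d) = 0" "v1 (x, d) = 0" unfolding v1_def mode_sum_def prod.case by (subst z, simp, simp)+
qed

text \<open>The pressure is found from Bernoulli's law in the moving frame. There the absolute
  vorticity is - G(Y) and the stream function is Hp(Y), so their product terms integrate to M(Y)
  with M' = G (U - c). Returning to the rest frame, the Coriolis force of the frame speed adds -
  \<beta> c y^2 / 2.\<close>

lemma momentum:
 "\<exists>P. x_periodic d L P \<and>
    (\<forall>t\<ge>0. Ck_on 1 (strip d) (%q. P (t, q))) \<and>
    (\<forall>(t, x, y) \<in> slab d.
      Dt d uu (t, x, y) + uu (t, x, y) * Dx d uu (t, x, y) + vv (t, x, y) * Dy d uu (t, x, y)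
       - \<beta> * y * vv (t, x, y)
       = - partial_within (strip d) (1, 0) (%q. P (t, q)) (x, y) \<and>
      Dt d vv (t, x, y) + uu (t, x, y) * Dx d vv (t, x, y) + vv (t, x, y) * Dy d vv (t, x, y)
       + \<beta> * y * uu (t, x, y)
       = - partial_within (strip d) (0, 1) (%q. P (t, q)) (x, y))"
proof -
 obtain M where M: "pderiv M = G * (U - [:c:])" using antiderivative_poly by blast
 define P1 where "P1 p = - ((u1 p - c)\<^sup>2 + (v1 p)\<^sup>2) / 2 + poly M (Y p) - \<beta> * c * (snd p)\<^sup>2 / 2" for p
 define Px where "Px p = - ((u1 p - c) * S1 1 p + v1 p * - S0 2 p) + poly G (Y p) * S0 1 p" for p
 define Py where "Py p = - ((u1 p - c) * u1y p + v1 p * - S1 1 p) + poly G (Y p) * (u1 p - c) - \<beta> * c * snd p" for p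
 have MYx: "poly (pderiv M) (Y (x, y)) * Yx (x, y) = poly G (Y (x, y)) * S0 1 (x, y)"
  and MYy: "poly (pderiv M) (Y (x, y)) * Yy (x, y) = poly G (Y (x, y)) * (u1 (x, y) - c)" if "(x, y) \<in> strip d" for x y
 proof -
  have canc: "D \<noteq> 0 ==> a * D * (b / D) = a * b" for a b D :: real by simp
  have M': "poly (pderiv M) s = poly G s * (poly U s - c)" for s by (simp add: M)
  show "poly (pderiv M) (Y (x, y)) * Yx (x, y) = poly G (Y (x, y)) * S0 1 (x, y)"
   "poly (pderiv M) (Y (x, y)) * Yy (x, y) = poly G (Y (x, y)) * (u1 (x, y) - c)"
   unfolding M' Yx_def Yy_def canc[OF denom[OF that]] by (simp_all add: u1_def)
 qed
 have dx: "((%x. P1 (x, y)) has_real_derivative Px (x, y)) (at x)" if p: "(x, y) \<in> strip d" for x y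
 proof -
  have "((%x. P1 (x, y)) has_real_derivative - ((u1 (x, y) - c) * S1 1 (x, y) + v1 (x, y) * - S0 2 (x, y)) + poly (pderiv M) (Y (x, y)) * Yx (x, y) - 0) (at x)"
   unfolding P1_def snd_conv
   by (rule DERIV_cong, (rule u1_der(1)[OF p] v1_der(1)[OF p] polyY_der(1)[OF p] DERIV_const DERIV_diff DERIV_add DERIV_minus DERIV_cdivide DERIV_power)+)
     (simp add: field_simps)
  then show ?thesis using MYx[OF p] by (simp add: Px_def)
 qed
 have dy: "((%y. P1 (x, y)) has_real_derivative Py (x, y)) (at y within {-d..d})" if p: "(x, y) \<in> strip d" for x y
 proof -
  have "((%y. P1 (x, y)) has_real_derivative - ((u1 (x, y) - c) * u1y (x, y) + v1 (x, y) * - S1 1 (x, y)) + poly (pderiv M) (Y (x, y)) * Yy (x, y) - \<beta> * c * y) (at y within {-d..d})"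
   unfolding P1_def snd_conv
   by (rule DERIV_cong, (rule u1_der(2)[OF p] v1_der(2)[OF p] polyY_der(2)[OF p] DERIV_const DERIV_ident DERIV_diff DERIV_add DERIV_minus DERIV_cdivide DERIV_cmult DERIV_power)+)
     (simp add: field_simps)
  then show ?thesis using MYy[OF p] by (simp add: Py_def)
 qed
 have u1c: "continuous_on (strip d) u1" and v1c: "continuous_on (strip d) v1"
  unfolding u1_def v1_def by (intro continuous_intros S_cont snd_cont)+
 have cPx: "continuous_on (strip d) Px" and cPy: "continuous_on (strip d) Py"
  unfolding Px_def Py_def by (intro continuous_intros S_cont u1c v1c u1y_cont polyY_cont)+
 define P where "P = (%(t, x, y). P1 (x - c * t, y))"
 have sh: "((%x. P (t, x, y)) has_real_derivative Px (x - c * t, y)) (at x)"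
  "((%y. P (t, x, y)) has_real_derivative Py (x - c * t, y)) (at y within {-d..d})" if p: "(x, y) \<in> strip d" for t x y
 proof -
  have p': "(x - c * t, y) \<in> strip d" using p by (simp add: strip_def)
  have "((%x. P1 (x - c * t, y)) has_real_derivative Px (x - c * t, y) * (1 - 0)) (at x)"
   by (rule DERIV_chain2[where f="%x. P1 (x, y)" and g="%x. x - c * t", OF dx[OF p']]) (intro DERIV_diff DERIV_ident DERIV_const)
  then show "((%x. P (t, x, y)) has_real_derivative Px (x - c * t, y)) (at x)" by (simp add: P_def)
  show "((%y. P (t, x, y)) has_real_derivative Py (x - c * t, y)) (at y within {-d..d})"
   using dy[OF p'] by (simp add: P_def)
 qed
 have csh: "continuous_on (strip d) (%p. h (fst p - c * t, snd p))" if "continuous_on (strip d) h" for h :: "real \<times> real => real" and t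
  by (rule continuous_on_compose2[OF that]) (auto simp: strip_def intro!: continuous_intros)
 have C1: "Ck_on 1 (strip d) (%q. P (t, q))"
  "p \<in> strip d ==> partial_within (strip d) (1, 0) (%q. P (t, q)) p = Px (fst p - c * t, snd p)"
  "p \<in> strip d ==> partial_within (strip d) (0, 1) (%q. P (t, q)) p = Py (fst p - c * t, snd p)" for t p
  using C1_strip[OF d, of "%q. P (t, q)" "%p. Px (fst p - c * t, snd p)" "%p. Py (fst p - c * t, snd p)"] sh csh[OF cPx] csh[OF cPy]
  by simp_all
 have per: "x_periodic d L P" unfolding x_periodic_def
 proof (clarify)
  fix t x y assume "(t, x, y) \<in> slab d"
  then have s: "(x - c * t, y) \<in> strip d" by (auto simp: slab_def strip_def)
  have e: "x + L - c * t = (x - c * t) + L" by simp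
  show "P (t, x + L, y) = P (t, x, y)" unfolding P_def P1_def prod.case e snd_conv
   by (simp only: u1_periodic v1_periodic Y_periodic[OF s])
 qed
 have eqs: "Dt d uu (t, x, y) + uu (t, x, y) * Dx d uu (t, x, y) + vv (t, x, y) * Dy d uu (t, x, y)
       - \<beta> * y * vv (t, x, y) = - Px (x - c * t, y) \<and>
      Dt d vv (t, x, y) + uu (t, x, y) * Dx d vv (t, x, y) + vv (t, x, y) * Dy d vv (t, x, y)
       + \<beta> * y * uu (t, x, y) = - Py (x - c * t, y)" if p: "(t, x, y) \<in> slab d" for t x y
 proof -
  define z where "z = (x - c * t, y)"
  have z: "z \<in> strip d" using p by (auto simp: z_def slab_def strip_def)
  have GY: "poly G (Y z) = S0 2 z + u1y z - \<beta> * y" using om_eq[OF z] by (simp add: om_def z_def)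
  have vz: "v1 z = - S0 1 z" by (simp add: v1_def)
  show ?thesis using uu_C1(2-4)[OF p] vv_C1(2-4)[OF p] unfolding Px_def Py_def z_def[symmetric] GY vz
   by (simp add: uu_def vv_def z_def[symmetric] vz, simp add: z_def algebra_simps)
 qed
 show ?thesis by (rule exI[of _ P]) (use per C1 eqs in \<open>auto simp: slab_def\<close>)
qed

lemma solution: "global_solution d L \<beta> uu vv"
proof -
 have "x_periodic d L uu" "x_periodic d L vv" unfolding x_periodic_def uu_def vv_def
  using u1_periodic[of "_ - c * _"] v1_periodic[of "_ - c * _"] by (auto simp: diff_add_eq)
 moreover have "Dx d uu p + Dy d vv p = 0" if "p \<in> slab d" for p
 proof -
  obtain t x y where pt: "p = (t, x, y)" by (cases p) auto
  show ?thesis using uu_C1(3)[OF that[unfolded pt]] vv_C1(4)[OF that[unfolded pt]] by (simp add: pt)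
 qed
 moreover have "vv (t, x, -d) = 0 \<and> vv (t, x, d) = 0" for t x using v1_boundary by (simp add: vv_def)
 ultimately show ?thesis unfolding global_solution_def using uu_C1(1) vv_C1(1) vorticity_C1 momentum by blast
qed

end

text \<open>A Bochner integral defaults to 0 when the integrand is not integrable, so monotonicity
  has to be earned: the square of f - U is shown integrable over the cell, by Fubini from the
  one-dimensional hypothesis on \<open>U\<close>.\<close>

lemma L2_norm_pair_ge:
 fixes f g :: "real \<times> real => real" and U :: "real => real"
 assumes d: "d > 0" and L: "L > 0" and f: "continuous_on UNIV f" and g: "continuous_on UNIV g" and U: "in_L2 {-d..d} U"
 shows "L2_norm (cell d L) g \<le> L2_norm (cell d L) (%p. (f p - U (snd p), g p))"
proof -
 define C where "C = cell d L"
 define iy where "iy y = indicat_real {-d..d} y * U y" for y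
 have iC: "indicat_real C (x, y) = indicat_real {0..L} x * indicat_real {-d..d} y" for x y
  by (auto simp: C_def cell_def indicator_def)
 have Cc: "compact C" unfolding C_def cell_def by (intro compact_Times) auto
 have Cm: "C \<in> sets lborel" using Cc by (simp add: borel_compact)
 have int_cont: "set_integrable lborel C h" if "continuous_on UNIV h" for h :: "real \<times> real => real"
  using borel_integrable_compact[OF Cc continuous_on_subset[OF that subset_UNIV]] unfolding set_integrable_def by simp
 have iym: "iy \<in> borel_measurable borel" using U by (simp add: in_L2_def set_borel_measurable_def iy_def[abs_def])
 have iyi: "integrable lborel (%y. (iy y)\<^sup>2)"
 proof -
  have "(iy y)\<^sup>2 = indicat_real {-d..d} y *\<^sub>R (norm (U y))\<^sup>2" for y by (auto simp: iy_def indicator_def)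
  then show ?thesis using U by (simp add: in_L2_def set_integrable_def)
 qed
 have F: "integrable lborel (%p. indicat_real C p *\<^sub>R (U (snd p))\<^sup>2)"
 proof -
  have eq: "indicat_real C p *\<^sub>R (U (snd p))\<^sup>2 = (case p of (x, y) => indicat_real {0..L} x * (iy y)\<^sup>2)" for p
   by (cases p, simp only: iC) (auto simp: iy_def indicator_def)
  have "integrable (lborel \<Otimes>\<^sub>M lborel) (%(x, y). indicat_real {0..L} x * (iy y)\<^sup>2)"
  proof (rule lborel_pair.Fubini_integrable)
   show "(%(x, y). indicat_real {0..L} x * (iy y)\<^sup>2) \<in> borel_measurable (lborel \<Otimes>\<^sub>M lborel)"
    using iym by measurable
   show "AE x in lborel. integrable lborel (%y. case (x, y) of (x, y) => indicat_real {0..L} x * (iy y)\<^sup>2)"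
    using iyi by simp
   have "integrable lborel (%x. indicat_real {0..L} x * (LINT y|lborel. (iy y)\<^sup>2))"
    by (intro integrable_mult_left integrable_real_indicator) (auto simp: emeasure_lborel_Icc_eq)
   then show "integrable lborel (%x. LINT y|lborel. norm (case (x, y) of (x, y) => indicat_real {0..L} x * (iy y)\<^sup>2))"
    by (simp add: abs_mult)
  qed
  then show ?thesis unfolding eq by (simp add: lborel_prod)
 qed
 have S: "integrable lborel (%p. indicat_real C p *\<^sub>R (f p - U (snd p))\<^sup>2)"
 proof (rule Bochner_Integration.integrable_bound)
  show "integrable lborel (%p. 2 * (indicat_real C p *\<^sub>R (f p)\<^sup>2) + 2 * (indicat_real C p *\<^sub>R (U (snd p))\<^sup>2))"
   using int_cont[of "%p. (f p)\<^sup>2"] F f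
   by (intro Bochner_Integration.integrable_add integrable_mult_right) (auto simp: set_integrable_def intro!: continuous_intros)
  have "(%p. indicat_real C p *\<^sub>R (f p - U (snd p))\<^sup>2) = (%p. indicat_real C p * (f p - iy (snd p))\<^sup>2)"
  proof (rule ext)
   fix p show "indicat_real C p *\<^sub>R (f p - U (snd p))\<^sup>2 = indicat_real C p * (f p - iy (snd p))\<^sup>2"
   by (cases p, simp only: iC) (auto simp: iy_def indicator_def)
  qed
  moreover have "(%p. indicat_real C p * (f p - iy (snd p))\<^sup>2) \<in> borel_measurable borel"
  proof -
   have "f \<in> borel_measurable borel" using f by (rule borel_measurable_continuous_onI)
   moreover have "(%p :: real \<times> real. iy (snd p)) \<in> borel_measurable borel"
    by (rule measurable_compose[OF borel_measurable_continuous_onI iym]) (intro continuous_intros)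
   ultimately show ?thesis using Cm by simp
  qed
  ultimately show "(%p. indicat_real C p *\<^sub>R (f p - U (snd p))\<^sup>2) \<in> borel_measurable lborel" by (simp only: measurable_lborel2)
  have "(s - t)\<^sup>2 \<le> 2 * s\<^sup>2 + 2 * t\<^sup>2" for s t :: real
   using zero_le_power2[of "s + t"] by (simp add: power2_eq_square algebra_simps)
  then show "AE p in lborel. norm (indicat_real C p *\<^sub>R (f p - U (snd p))\<^sup>2) \<le> norm (2 * (indicat_real C p *\<^sub>R (f p)\<^sup>2) + 2 * (indicat_real C p *\<^sub>R (U (snd p))\<^sup>2))"
   by (intro AE_I2) (auto simp: indicator_def)
 qed
 have G: "integrable lborel (%p. indicat_real C p *\<^sub>R (g p)\<^sup>2)"
  using int_cont[of "%p. (g p)\<^sup>2"] g by (auto simp: set_integrable_def intro!: continuous_intros)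
 have "(LINT p|lborel. indicat_real C p *\<^sub>R (g p)\<^sup>2) \<le> (LINT p|lborel. indicat_real C p *\<^sub>R (f p - U (snd p))\<^sup>2 + indicat_real C p *\<^sub>R (g p)\<^sup>2)"
  by (rule integral_mono[OF G Bochner_Integration.integrable_add[OF S G]]) simp
 then show ?thesis unfolding L2_norm_def set_lebesgue_integral_def C_def[symmetric]
  by (intro real_sqrt_le_mono) (simp add: norm_Pair algebra_simps)
qed

lemma poly_lipschitz_on_interval:
 fixes P :: "real poly"
 assumes "!!s. s \<in> {lo..hi} ==> \<bar>poly (pderiv P) s\<bar> \<le> B" and "s \<in> {lo..hi}" "t \<in> {lo..hi}"
 shows "\<bar>poly P s - poly P t\<bar> \<le> B * \<bar>s - t\<bar>"
 using field_differentiable_bound[of "{lo..hi}" "poly P" "poly (pderiv P)" B s t] assms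
  has_field_derivative_at_within[OF poly_DERIV] by (auto simp: abs_minus_commute)

section \<open>Persistence of the wave and the size of its initial perturbation\<close>

context wave_flow
begin

lemma v1_shift: "v1 (x + real n * L, y) = v1 (x, y)" and u1_shift: "u1 (x + real n * L, y) = u1 (x, y)"
proof -
 have "v1 (x + real n * L, y) = v1 (x, y) \<and> u1 (x + real n * L, y) = u1 (x, y)"
 proof (induction n)
  case (Suc n)
  have "x + real (Suc n) * L = (x + real n * L) + L" by (simp add: algebra_simps)
  then show ?case using Suc by (simp only: v1_periodic u1_periodic)
 qed simp
 then show "v1 (x + real n * L, y) = v1 (x, y)" "u1 (x + real n * L, y) = u1 (x, y)" by blast+
qed

text \<open>If v vanished, the mode sum would not depend on x, so its coefficient \<open>w 1\<close>
  would be 0, contradicting the slope a > 0 of that mode at the wall.\<close>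

lemma v1_nonzero: "\<exists>x\<in>{0..L}. \<exists>y\<in>{-d..d}. v1 (x, y) \<noteq> 0"
proof (rule ccontr)
 assume "\<not> ?thesis"
 then have z: "S0 1 (x, y) = 0" if "x \<in> {0..L}" "y \<in> {-d..d}" for x y using that by (auto simp: v1_def)
 have w1: "w 1 y = 0" if y: "y \<in> {-d..d}" for y
 proof -
  have "((%x. S0 0 (x, y)) has_real_derivative 0) (at x within {0..L})" if x: "x \<in> {0..L}" for x
   using S_der_x(1)[of x y 0] z[OF x y] y by (auto simp: strip_def intro: has_field_derivative_at_within)
  then have const: "\<exists>C. \<forall>x\<in>{0..L}. S0 0 (x, y) = C"
   using has_field_derivative_zero_constant[of "{0..L}" "%x. S0 0 (x, y)"] by auto
  then obtain C where C: "!!x. x \<in> {0..L} ==> S0 0 (x, y) = C" by blast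
  have eq: "(\<Sum>n. w n y * cos (real n * th)) = C" if "th \<in> {0..2*pi}" for th
  proof -
   have "th / k \<in> {0..L}" using that k L by (auto simp: field_simps)
   from C[OF this] show ?thesis using k(1) by (simp add: mode_sum_def)
  qed
  have "integral {0..2*pi} (%th. (\<Sum>n. w n y * cos (real n * th)) * cos (real 1 * th)) = (if (1::nat) = 0 then 2 * pi else pi) * w 1 y"
   by (rule cos_series(2)[OF summable_exp_neg_nat[of "Cw * a"]]) (rule bounds(1)[OF y])
  moreover have "integral {0..2*pi} (%th. (\<Sum>n. w n y * cos (real n * th)) * cos (real 1 * th)) = integral {0..2*pi} (%th. C * cos th)"
   by (rule integral_cong) (simp add: eq)
  moreover have "((%th. C * cos th) has_integral (C * sin (2 * pi) - C * sin 0)) {0..2*pi}"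
   by (rule fundamental_theorem_of_calculus)
     (auto simp: has_real_derivative_iff_has_vector_derivative[symmetric] intro!: derivative_eq_intros)
  then have "integral {0..2*pi} (%th. C * cos th) = 0" by (simp add: integral_unique)
  ultimately show ?thesis by simp
 qed
 have "((%y. 0 :: real) has_real_derivative w' 1 (-d)) (at (-d) within {-d..d})"
  by (rule DERIV_transform_on[OF der_w(1)[of "-d" 1]]) (use d w1 in auto)
 moreover have "((%y. 0 :: real) has_real_derivative 0) (at (-d) within {-d..d})" by simp
 ultimately have "w' 1 (-d) = 0" by (rule DERIV_unique_thick[rotated 2]) (use d in \<open>auto intro: thick_Icc\<close>)
 then show False using modes a by (simp add: wave_modes_def)
qed

lemma u1_cont: "continuous_on (strip d) u1" and v1_cont: "continuous_on (strip d) v1"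
 unfolding u1_def v1_def by (intro continuous_intros S_cont snd_cont)+

text \<open>The wave reproduces its initial state at all multiples of L / |c|. Along these times the
  distance to a fixed shear flow is constant, so convergence would make it 0 and force v =
  0.\<close>

lemma no_convergence: "\<not> converges_to_shear d L uu vv"
proof
 assume "converges_to_shear d L uu vv"
 then obtain U' :: "real => real" where U': "in_L2 {-d..d} U'"
  and lim: "((%t. L2_norm (cell d L) (%(x, y). (uu (t, x, y) - U' y, vv (t, x, y)))) \<longlongrightarrow> 0) at_top"
  unfolding converges_to_shear_def by blast
 \<comment> \<open>For c = 0 the flow is steady, and any positive time serves as a period.\<close>
 define ta where "ta = (if c = 0 then 1 else L / \<bar>c\<bar>)"
 have ta: "ta > 0" using L by (simp add: ta_def)
 have shift: "uu (ta * real n, x, y) = u1 (x, y) \<and> vv (ta * real n, x, y) = v1 (x, y)" for n x y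
 proof -
  consider "c = 0" | "c > 0" | "c < 0" by linarith
  then show ?thesis
  proof cases
   case 2
   then have e: "x - c * (ta * real n) = x - real n * L" by (simp add: ta_def)
   show ?thesis using v1_shift[of "x - real n * L" n y] u1_shift[of "x - real n * L" n y] unfolding uu_def vv_def prod.case e by simp
  next
   case 3
   then have e: "x - c * (ta * real n) = x + real n * L" by (simp add: ta_def)
   show ?thesis using v1_shift[of "x" n y] u1_shift[of "x" n y] unfolding uu_def vv_def prod.case e by simp
  next
   case 1
   then have e: "x - c * (ta * real n) = x" by simp
   show ?thesis unfolding uu_def vv_def prod.case e by simp
  qed
 qed
 \<comment> \<open>\<open>u1\<close> and \<open>v1\<close> are only known to be continuous on the
   strip; clamping y extends them continuously to the plane without changing them on the
   cell.\<close>
 define clamp where "clamp p = (fst p, max (-d) (min d (snd p)))" for p :: "real \<times> real"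
 have cl: "clamp p \<in> strip d" for p using d by (auto simp: clamp_def strip_def)
 have clc: "continuous_on UNIV clamp" unfolding clamp_def by (intro continuous_intros)
 have cell_clamp: "p \<in> cell d L ==> clamp p = p" for p by (auto simp: cell_def clamp_def)
 have cu: "continuous_on UNIV (%p. u1 (clamp p))" and cv: "continuous_on UNIV (%p. v1 (clamp p))"
  using cl by (auto intro!: continuous_on_compose2[OF u1_cont clc] continuous_on_compose2[OF v1_cont clc])
 have L2c: "L2_norm (cell d L) F = L2_norm (cell d L) F'" if "!!p. p \<in> cell d L ==> F p = F' p"
  for F F' :: "real \<times> real => 'b::{banach, second_countable_topology}"
  unfolding L2_norm_def set_lebesgue_integral_def
  by (intro arg_cong[of _ _ sqrt] Bochner_Integration.integral_cong) (use that in \<open>auto simp: indicator_def\<close>)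
 have "filterlim (%n. ta * real n) at_top sequentially"
  by (rule filterlim_tendsto_pos_mult_at_top[OF tendsto_const ta filterlim_real_sequentially])
 from filterlim_compose[OF lim this]
 have "(%n. L2_norm (cell d L) (%(x, y). (u1 (x, y) - U' y, v1 (x, y)))) \<longlonglongrightarrow> 0" using shift by simp
 then have 0: "L2_norm (cell d L) (%(x, y). (u1 (x, y) - U' y, v1 (x, y))) = 0"
  using LIMSEQ_unique[OF tendsto_const] by blast
 have "L2_norm (cell d L) (%p. v1 (clamp p)) \<le> L2_norm (cell d L) (%p. (u1 (clamp p) - U' (snd p), v1 (clamp p)))"
  by (rule L2_norm_pair_ge[OF d L cu cv U'])
 also have "... = 0" unfolding 0[symmetric] by (rule L2c) (auto simp: cell_clamp)
 finally have le: "L2_norm (cell d L) (%p. v1 (clamp p)) \<le> 0" .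
 have v1sq: "continuous_on ({0..L} \<times> {-d..d}) (%p. (v1 (clamp p))\<^sup>2)"
  by (intro continuous_intros continuous_on_subset[OF cv]) auto
 have "L2_norm (cell d L) (%p. v1 (clamp p)) = sqrt (integral ({0..L} \<times> {-d..d}) (%p. (v1 (clamp p))\<^sup>2))"
  by (subst L2_norm_cell[OF continuous_on_subset[OF cv]], simp) (subst rect_int_prod[OF v1sq], simp)
 then have "integral ({0..L} \<times> {-d..d}) (%p. (v1 (clamp p))\<^sup>2) \<le> 0" using le by simp
 moreover have "integral ({0..L} \<times> {-d..d}) (%p. (v1 (clamp p))\<^sup>2) \<ge> 0"
  by (rule integral_nonneg) (use v1sq integrable_continuous[of "(0, -d)" "(L, d)"] in \<open>simp_all add: rect_cbox\<close>)
 ultimately have "integral (cbox (0, -d) (L, d)) (%p. (v1 (clamp p))\<^sup>2) = 0" by (simp add: rect_cbox)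
 then have "\<forall>p\<in>cbox (0, -d) (L, d). (v1 (clamp p))\<^sup>2 = 0"
  by (subst integral_cbox_eq_0_iff[symmetric]) (use v1sq d L in \<open>auto simp: rect_cbox box_ne_empty Basis_real2\<close>)
 then have "v1 (x, y) = 0" if "x \<in> {0..L}" "y \<in> {-d..d}" for x y
  using that cell_clamp[of "(x, y)"] by (auto simp: cell_def dest!: bspec[of _ _ "(x, y)"])
 then show False using v1_nonzero by blast
qed

lemma mode_bounds:
 assumes p: "p \<in> strip d"
 shows "\<bar>S0 j p\<bar> \<le> Bq * a * mode_const k j" "\<bar>S1 j p\<bar> \<le> Bq * a * mode_const k j" "\<bar>S2 j p\<bar> \<le> Bq * a * mode_const k j"
 by (rule mode_sum_bound[OF k(1) _ p] modes_w)+

text \<open>Order 3 occurs because v is already a first derivative of the stream function and is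
  differentiated twice more.\<close>

definition "Mk = (\<Sum>j\<le>3. mode_const k j)"

lemma Bq0: "Bq \<ge> 0" using k Qb0 Cw by (simp add: Bq_def)

lemma Mk_ge: "j \<le> 3 ==> Bq * a * mode_const k j \<le> Bq * a * Mk"
 unfolding Mk_def using Bq0 a by (intro mult_left_mono member_le_sum mode_const_nonneg k) auto

text \<open>Both Y - y and Y_y - 1 are of order a, so fy = G'(Y) Y_y - G'(y) is small with the
  amplitude; for the second of these the gap \<open>mub\<close> bounds the denominator away from
  0.\<close>

lemma fy_bound:
 assumes M: "!!s. s \<in> {-d-ro..d+ro} ==> \<bar>poly (pderiv U) s\<bar> \<le> M \<and> \<bar>poly (pderiv G) s\<bar> \<le> M \<and> \<bar>poly (pderiv (pderiv G)) s\<bar> \<le> M"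
  and p: "p \<in> strip d"
 shows "\<bar>fy p\<bar> \<le> a * (M * ((M * Cw + Bq * Mk) / mub + Cw))"
proof -
 obtain x y where xy: "p = (x, y)" by (cases p)
 have y: "y \<in> {-d-ro..d+ro}" using p ro0 by (auto simp: xy strip_def)
 have Y: "Y p \<in> {-d-ro..d+ro}" using Y_range(1)[of x y] p by (auto simp: xy)
 have M0: "M \<ge> 0" using M[OF y] by linarith
 have Yy: "\<bar>y - Y p\<bar> \<le> Cw * a" using expand(1)[of x y] p by (simp add: xy abs_minus_commute)
 have D: "poly U (Y p) - c \<ge> mub" using Y_range(2)[of x y] p by (simp add: xy)
 have lU: "\<bar>poly U y - poly U (Y p)\<bar> \<le> M * (Cw * a)"
  using poly_lipschitz_on_interval[of "-d-ro" "d+ro" U M y "Y p"] M y Y mult_left_mono[OF Yy M0] by fastforce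
 have lG: "\<bar>poly (pderiv G) (Y p) - poly (pderiv G) y\<bar> \<le> M * (Cw * a)"
  using poly_lipschitz_on_interval[of "-d-ro" "d+ro" "pderiv G" M y "Y p"] M y Y mult_left_mono[OF Yy M0] by (fastforce simp: abs_minus_commute)
 have num: "\<bar>poly U y - poly U (Y p) + S1 0 p\<bar> \<le> a * (M * Cw + Bq * Mk)"
  using lU mode_bounds(2)[OF p, of 0] Mk_ge[of 0] by (simp add: algebra_simps)
 have eq: "Yy p - 1 = (poly U y - poly U (Y p) + S1 0 p) / (poly U (Y p) - c)"
  using denom[OF p] by (simp add: Yy_def xy field_simps)
 have "\<bar>Yy p - 1\<bar> = \<bar>poly U y - poly U (Y p) + S1 0 p\<bar> / (poly U (Y p) - c)"
  unfolding eq using D mub by (simp add: abs_divide)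
 also have "... \<le> a * (M * Cw + Bq * Mk) / mub" using num D mub by (intro frac_le) auto
 finally have Yy1: "\<bar>Yy p - 1\<bar> \<le> a * ((M * Cw + Bq * Mk) / mub)" by simp
 have "fy p = poly (pderiv G) (Y p) * (Yy p - 1) + (poly (pderiv G) (Y p) - poly (pderiv G) y)"
  by (simp add: fy_def xy algebra_simps)
 then have "\<bar>fy p\<bar> \<le> \<bar>poly (pderiv G) (Y p)\<bar> * \<bar>Yy p - 1\<bar> + \<bar>poly (pderiv G) (Y p) - poly (pderiv G) y\<bar>"
  by (metis abs_triangle_ineq abs_mult)
 also have "... \<le> M * (a * ((M * Cw + Bq * Mk) / mub)) + M * (Cw * a)"
  using M[OF Y] M0 Yy1 lG by (intro add_mono mult_mono) auto
 finally show ?thesis by (simp add: algebra_simps)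
qed

text \<open>The bound separates the error e0 of the polynomial profile from the perturbation, which
  is proportional to the amplitude with a factor free of the amplitude.\<close>

lemma initial_C2:
 fixes u0 u0' u0'' :: "real => real"
 assumes M: "!!s. s \<in> {-d-ro..d+ro} ==> \<bar>poly (pderiv U) s\<bar> \<le> M \<and> \<bar>poly (pderiv G) s\<bar> \<le> M \<and> \<bar>poly (pderiv (pderiv G)) s\<bar> \<le> M"
  and u0: "!!y. y \<in> {-d..d} ==> (u0 has_real_derivative u0' y) (at y within {-d..d})"
   "!!y. y \<in> {-d..d} ==> (u0' has_real_derivative u0'' y) (at y within {-d..d})" "continuous_on {-d..d} u0''"
  and close: "!!y. y \<in> {-d..d} ==> \<bar>poly U y - u0 y\<bar> \<le> e0 \<and> \<bar>poly (pderiv U) y - u0' y\<bar> \<le> e0 \<and> \<bar>poly (pderiv (pderiv U)) y - u0'' y\<bar> \<le> e0"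
 shows "Ck_on 2 (strip d) u1" "Ck_on 2 (strip d) v1"
  "Ck_norm 2 (strip d) (%(x, y). u1 (x, y) - u0 y) \<le> e0 + a * (Bq * Mk + M * ((M * Cw + Bq * Mk) / mub + Cw))"
  "Ck_norm 2 (strip d) v1 \<le> e0 + a * (Bq * Mk + M * ((M * Cw + Bq * Mk) / mub + Cw))"
proof -
 define K where "K = M * ((M * Cw + Bq * Mk) / mub + Cw)"
 define B where "B = e0 + a * (Bq * Mk + K)"
 have M0: "M \<ge> 0" using M[of 0] d ro0 by auto
 have Mk0: "Mk \<ge> 0" unfolding Mk_def by (intro sum_nonneg mode_const_nonneg k)
 have K0: "a * K \<ge> 0" unfolding K_def using M0 Mk0 Bq0 Cw a mub by (intro mult_nonneg_nonneg add_nonneg_nonneg divide_nonneg_nonneg) auto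
 have e00: "e0 \<ge> 0" using close[of 0] d by auto
 have Bexp: "B = e0 + (Bq * a * Mk + a * K)" by (simp add: B_def algebra_simps)
 have S: "\<bar>S0 j p\<bar> \<le> Bq * a * Mk" "\<bar>S1 j p\<bar> \<le> Bq * a * Mk" "\<bar>S2 j p\<bar> \<le> Bq * a * Mk" if "p \<in> strip d" "j \<le> 3" for j p
  using mode_bounds[OF that(1), of j] Mk_ge[OF that(2)] by linarith+
 have SB: "\<bar>S0 j p\<bar> \<le> B" "\<bar>S1 j p\<bar> \<le> B" "\<bar>S2 j p\<bar> \<le> B" if "p \<in> strip d" "j \<le> 3" for j p
  using S[OF that] K0 e00 unfolding Bexp by linarith+
 have fyB: "\<bar>fy p\<bar> \<le> a * K" if "p \<in> strip d" for p unfolding K_def by (rule fy_bound[OF M that])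
 have cy: "continuous_on (strip d) (%p. h (snd p))" if "continuous_on {-d..d} h" for h :: "real => real"
  by (rule continuous_on_compose2[OF that]) (auto simp: strip_def intro!: continuous_intros)
 have u0c: "continuous_on {-d..d} u0'" by (rule DERIV_continuous_on[OF u0(2)])
 have cyy: "continuous_on (strip d) (%p. poly (pderiv (pderiv U)) (snd p) + (fy p - S1 2 p))"
  by (intro continuous_intros fy_cont S_cont snd_cont)
 note V = C2_strip[OF d v1_der(1) v1_der(2) v1_der(3) v1_der(4) v1_der(5) v1_der(6) cv1(1) cv1(2) cv1(1) cv1(2) cv1(2) cv1(3)]
 show "Ck_on 2 (strip d) v1" by (rule V(1))
 show "Ck_norm 2 (strip d) v1 \<le> e0 + a * (Bq * Mk + M * ((M * Cw + Bq * Mk) / mub + Cw))"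
  unfolding K_def[symmetric] B_def[symmetric] by (rule V(2)) (use SB in \<open>simp_all add: v1_def\<close>)
 define D where "D p = u1 p - u0 (snd p)" for p
 define Dy' where "Dy' p = u1y p - u0' (snd p)" for p
 have D1: "((%x. D (x, y)) has_real_derivative S1 1 (x, y)) (at x)"
  and D2: "((%y. D (x, y)) has_real_derivative Dy' (x, y)) (at y within {-d..d})"
  and D3: "((%x. Dy' (x, y)) has_real_derivative S2 1 (x, y)) (at x)"
  and D4: "((%y. Dy' (x, y)) has_real_derivative poly (pderiv (pderiv U)) y + (fy (x, y) - S1 2 (x, y)) - u0'' y) (at y within {-d..d})"
  and D5: "((%x. S1 1 (x, y)) has_real_derivative S1 2 (x, y)) (at x)"
  and D6: "((%y. S1 1 (x, y)) has_real_derivative S2 1 (x, y)) (at y within {-d..d})"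
  if p: "(x, y) \<in> strip d" for x y
 proof -
  have y: "y \<in> {-d..d}" using p by (simp add: strip_def)
  show "((%x. D (x, y)) has_real_derivative S1 1 (x, y)) (at x)"
   using DERIV_diff[OF u1_der(1)[OF p] DERIV_const[of "u0 y"]] by (simp add: D_def)
  show "((%y. D (x, y)) has_real_derivative Dy' (x, y)) (at y within {-d..d})"
   using DERIV_diff[OF u1_der(2)[OF p] u0(1)[OF y]] by (simp add: D_def Dy'_def)
  show "((%x. Dy' (x, y)) has_real_derivative S2 1 (x, y)) (at x)"
   using DERIV_diff[OF u1_der(3)[OF p] DERIV_const[of "u0' y"]] by (simp add: Dy'_def)
  show "((%y. Dy' (x, y)) has_real_derivative poly (pderiv (pderiv U)) y + (fy (x, y) - S1 2 (x, y)) - u0'' y) (at y within {-d..d})"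
   using DERIV_diff[OF u1_der(4)[OF p] u0(2)[OF y]] by (simp add: Dy'_def)
  show "((%x. S1 1 (x, y)) has_real_derivative S1 2 (x, y)) (at x)" using S_der_x(2)[OF p, of 1] by (simp add: numeral_2_eq_2)
  show "((%y. S1 1 (x, y)) has_real_derivative S2 1 (x, y)) (at y within {-d..d})" by (rule S_der_y(2)[OF p])
 qed
 have D4': "((%y. Dy' (x, y)) has_real_derivative (%p. poly (pderiv (pderiv U)) (snd p) + (fy p - S1 2 p) - u0'' (snd p)) (x, y)) (at y within {-d..d})"
  if p: "(x, y) \<in> strip d" for x y using D4[OF p] by simp
 show "Ck_on 2 (strip d) u1"
 proof (rule C2_strip(1)[OF d u1_der(1,2) D5 D6 u1_der(3)])
  show "((%y. u1y (x, y)) has_real_derivative (%p. poly (pderiv (pderiv U)) (snd p) + (fy p - S1 2 p)) (x, y)) (at y within {-d..d})"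
   if "(x, y) \<in> strip d" for x y using u1_der(4)[OF that] by simp
 qed (rule S_cont u1y_cont cyy | assumption)+
 have "Ck_norm 2 (strip d) D \<le> B"
 proof (rule C2_strip(2)[OF d D1 D2 D5 D6 D3 D4'])
  show "continuous_on (strip d) Dy'" unfolding Dy'_def by (intro continuous_intros u1y_cont cy u0c)
  show "continuous_on (strip d) (%p. poly (pderiv (pderiv U)) (snd p) + (fy p - S1 2 p) - u0'' (snd p))"
   by (intro continuous_intros cyy cy u0)
  fix p assume p: "p \<in> strip d"
  then have y: "snd p \<in> {-d..d}" by (auto simp: strip_def)
  have "\<bar>D p\<bar> \<le> B" "\<bar>Dy' p\<bar> \<le> B"
   using close[OF y] S(2)[OF p, of 0] S(3)[OF p, of 0] K0 unfolding Bexp D_def u1_def Dy'_def u1y_def by linarith+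
  moreover have "\<bar>poly (pderiv (pderiv U)) (snd p) + (fy p - S1 2 p) - u0'' (snd p)\<bar> \<le> B"
   using close[OF y] S(2)[OF p, of 2] fyB[OF p] unfolding Bexp by linarith
  ultimately show "\<bar>D p\<bar> \<le> B \<and> \<bar>S1 1 p\<bar> \<le> B \<and> \<bar>Dy' p\<bar> \<le> B \<and> \<bar>S1 2 p\<bar> \<le> B \<and> \<bar>S2 1 p\<bar> \<le> B \<and> \<bar>S2 1 p\<bar> \<le> B \<and>
   \<bar>poly (pderiv (pderiv U)) (snd p) + (fy p - S1 2 p) - u0'' (snd p)\<bar> \<le> B"
   using SB(2)[OF p, of 1] SB(2)[OF p, of 2] SB(3)[OF p, of 1] by simp
 qed (rule S_cont | assumption)+
 then show "Ck_norm 2 (strip d) (%(x, y). u1 (x, y) - u0 y) \<le> e0 + a * (Bq * Mk + M * ((M * Cw + Bq * Mk) / mub + Cw))"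
  unfolding K_def[symmetric] B_def[symmetric] by (simp add: D_def[abs_def] split_beta')
qed

end

section \<open>Test functions\<close>

lemma has_integral_derivative:
 fixes f f' :: "real => real"
 assumes "a \<le> b" "!!y. y \<in> {a..b} ==> (f has_real_derivative f' y) (at y within {a..b})"
 shows "(f' has_integral (f b - f a)) {a..b}" using fundamental_theorem_of_calculus[OF assms(1), of f f'] assms(2)
 by (simp add: has_real_derivative_iff_has_vector_derivative)

text \<open>Smoothness by closure: in a family stable under differentiation no higher derivative has
  to be computed.\<close>

lemma smooth_family_Ck_on:
 assumes der: "!!f. f \<in> F ==> \<exists>f'\<in>F. \<forall>y. (f has_real_derivative f' y) (at y)" and f: "f \<in> F"
 shows "Ck_on k (UNIV :: real set) f" using f
proof (induction k arbitrary: f)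
 case 0
 then obtain f' where "\<forall>y. (f has_real_derivative f' y) (at y)" using der by blast
 then show ?case by (auto intro!: DERIV_isCont continuous_at_imp_continuous_on)
next
 case (Suc k)
 then obtain f' where f': "f' \<in> F" "!!y. (f has_real_derivative f' y) (at y)" using der by blast
 show ?case by (rule Ck_on_SucI[where F="%y h. f' y * h"])
    (use f' Suc.IH thick_UNIV in \<open>auto simp: has_field_derivative_def\<close>)
qed

definition flat_fun :: "real poly => real => real" where
 "flat_fun P x = (if x > 0 then poly P (1 / x) * exp (- (1 / x)) else 0)"

lemma poly_exp_neg_tendsto_0: "((%t. poly P t * exp (- t)) \<longlongrightarrow> (0::real)) at_top"
proof -
 have "((%t. \<Sum>i\<le>degree P. coeff P i * (t ^ i / exp t)) \<longlongrightarrow> (\<Sum>i\<le>degree P. coeff P i * 0)) at_top"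
  by (intro tendsto_intros tendsto_power_div_exp_0)
 then show ?thesis by (simp add: poly_altdef sum_distrib_right exp_minus divide_inverse mult.assoc)
qed

text \<open>The polynomial \<open>[:0, 0, 1:]\<close> is t^2, from differentiating 1/x. At 0 the
  difference quotient is again a polynomial in 1/x times exp(-1/x), which tends to 0.\<close>

lemma flat_fun_derivative:
 "(flat_fun P has_real_derivative flat_fun ([:0, 0, 1:] * (P - pderiv P)) x) (at x)"
proof -
 consider "x > 0" | "x < 0" | "x = 0" by linarith
 then show ?thesis
 proof cases
  case 1
  have d1: "((%x. 1 / x) has_real_derivative - (1 / x\<^sup>2)) (at x)"
   using 1 by (auto intro!: derivative_eq_intros simp: power2_eq_square)
  have "((%x. poly P (1 / x) * exp (- (1 / x))) has_real_derivative
    poly (pderiv P) (1 / x) * (- (1 / x\<^sup>2)) * exp (- (1 / x)) + exp (- (1 / x)) * - (- (1 / x\<^sup>2)) * poly P (1 / x)) (at x)"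
   by (intro DERIV_mult DERIV_chain2[OF poly_DERIV d1] DERIV_chain2[OF DERIV_exp] DERIV_minus d1)
  then have "((%x. poly P (1 / x) * exp (- (1 / x))) has_real_derivative flat_fun ([:0, 0, 1:] * (P - pderiv P)) x) (at x)"
   by (rule DERIV_cong) (use 1 in \<open>simp add: flat_fun_def field_simps power2_eq_square\<close>)
  then show ?thesis by (rule DERIV_cong_ev[THEN iffD1, OF refl _ refl, rotated])
     (use 1 eventually_gt_at_top in \<open>auto simp: flat_fun_def eventually_at_filter intro!: eventually_nhds_in_open[of "{0<..}", THEN eventually_mono]\<close>)
 next
  case 2
  have "((%x. 0) has_real_derivative 0) (at x)" by simp
  then have "(flat_fun P has_real_derivative 0) (at x)" by (rule DERIV_cong_ev[THEN iffD1, OF refl _ refl, rotated])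
     (use 2 in \<open>auto simp: flat_fun_def intro!: eventually_nhds_in_open[of "{..<0}", THEN eventually_mono]\<close>)
  then show ?thesis using 2 by (simp add: flat_fun_def)
 next
  case 3
  have "((%h. flat_fun P h / h) \<longlongrightarrow> 0) (at_right 0)"
  proof -
   have "((%h. poly ([:0, 1:] * P) (inverse h) * exp (- (inverse h))) \<longlongrightarrow> 0) (at_right 0)"
    by (rule filterlim_compose[OF poly_exp_neg_tendsto_0 filterlim_inverse_at_top_right])
   then show ?thesis by (rule Lim_transform_eventually) (auto simp: flat_fun_def eventually_at_filter field_simps)
  qed
  moreover have "((%h. flat_fun P h / h) \<longlongrightarrow> 0) (at_left 0)"
   by (rule tendsto_eventually) (auto simp: flat_fun_def eventually_at_filter)
  ultimately have "((%h. flat_fun P h / h) \<longlongrightarrow> 0) (at 0)" by (simp add: filterlim_split_at)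
  then show ?thesis using 3 by (simp add: DERIV_def flat_fun_def)
 qed
qed

text \<open>Products of two flat functions supported in [-r, r]. Sums are included because the
  product rule produces them, so that the set is stable under differentiation.\<close>

inductive_set bump_span :: "real => (real => real) set" for r :: real where
 base: "(%y. flat_fun P (r + y) * flat_fun Q (r - y)) \<in> bump_span r"
| add: "f \<in> bump_span r ==> g \<in> bump_span r ==> (%y. f y + g y) \<in> bump_span r"

lemma bump_span_derivative:
 "f \<in> bump_span r ==> \<exists>f'\<in>bump_span r. \<forall>y. (f has_real_derivative f' y) (at y)"
proof (induction rule: bump_span.induct)
 case (base P Q)
 define P' Q' where "P' = [:0, 0, 1:] * (P - pderiv P)" and "Q' = [:0, 0, 1:] * (Q - pderiv Q)"
 have neg: "flat_fun (- Q') x = - flat_fun Q' x" for x by (simp add: flat_fun_def)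
 have 1: "((%y. flat_fun P (r + y)) has_real_derivative flat_fun P' (r + y) * 1) (at y)" for y
  unfolding P'_def by (rule DERIV_chain2[OF flat_fun_derivative]) (auto intro!: derivative_eq_intros)
 have 2: "((%y. flat_fun Q (r - y)) has_real_derivative flat_fun Q' (r - y) * - 1) (at y)" for y
  unfolding Q'_def by (rule DERIV_chain2[OF flat_fun_derivative]) (auto intro!: derivative_eq_intros)
 have "((%y. flat_fun P (r + y) * flat_fun Q (r - y)) has_real_derivative
   flat_fun P' (r + y) * flat_fun Q (r - y) + flat_fun P (r + y) * flat_fun (- Q') (r - y)) (at y)" for y
  by (rule DERIV_cong[OF DERIV_mult[OF 1 2]]) (simp add: neg)
 then show ?case by (intro bexI[OF _ bump_span.add[OF bump_span.base[of P' r Q] bump_span.base[of P r "- Q'"]]] allI)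
next
 case (add f g)
 then obtain f' g' where "f' \<in> bump_span r" "g' \<in> bump_span r"
  "!!y. (f has_real_derivative f' y) (at y)" "!!y. (g has_real_derivative g' y) (at y)" by blast
 then show ?case by (intro bexI[of _ "%y. f' y + g' y"] allI DERIV_add bump_span.add)
qed

lemma bump_exists:
 assumes d: "d > 0"
 shows "\<exists>ze. test_function d ze \<and> ze 0 > 0"
proof -
 define ze where "ze = (%y. flat_fun 1 (d / 2 + y) * flat_fun 1 (d / 2 - y))"
 have "Ck_on k UNIV ze" for k
  by (rule smooth_family_Ck_on[where F="bump_span (d / 2)"]) (auto simp: ze_def bump_span_derivative bump_span.base)
 moreover have "ze y = 0" if "y \<notin> {-d/2..d/2}" for y using that by (auto simp: ze_def flat_fun_def)
 moreover have "{-d/2..d/2} \<subseteq> {-d<..<d}" using d by auto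
 ultimately have "test_function d ze" unfolding test_function_def by (intro conjI allI exI[of _ "{-d/2..d/2}"]) auto
 moreover have "ze 0 > 0" using d by (simp add: ze_def flat_fun_def)
 ultimately show ?thesis by blast
qed

lemma test_function_C1:
 assumes "test_function d ze"
 shows "(ze has_real_derivative deriv ze y) (at y)" "continuous_on UNIV (deriv ze)" "continuous_on UNIV ze"
proof -
 have C: "Ck_on (Suc 0) UNIV ze" using assms by (auto simp: test_function_def)
 then have der: "(ze has_real_derivative deriv ze y) (at y)" for y
  by (auto simp: differentiable_on_def real_differentiable_def) (metis DERIV_imp_deriv)
 then show "(ze has_real_derivative deriv ze y) (at y)" .
 have "partial_within UNIV 1 ze y = deriv ze y" for y
  using partial_within_eq[OF thick_UNIV, of y ze "%h. deriv ze y * h" 1] der[of y] by (simp add: has_field_derivative_def)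
 then have "partial_within UNIV 1 ze = deriv ze" by (rule ext)
 then show "continuous_on UNIV (deriv ze)" using C by simp
 show "continuous_on UNIV ze" using der by (auto intro!: DERIV_isCont continuous_at_imp_continuous_on)
qed

lemma test_function_support:
 assumes "d > 0" "test_function d ze"
 shows "\<exists>r. 0 < r \<and> r < d \<and> (\<forall>y. r \<le> \<bar>y\<bar> --> ze y = 0 \<and> deriv ze y = 0)"
proof -
 obtain K where K: "compact K" "K \<subseteq> {-d<..<d}" "!!y. y \<notin> K ==> ze y = 0"
  using assms(2) by (auto simp: test_function_def)
 have "\<exists>r0. 0 < r0 \<and> r0 < d \<and> (\<forall>y\<in>K. \<bar>y\<bar> \<le> r0)"
 proof (cases "K = {}")
  case True
  then show ?thesis using assms(1) by (intro exI[of _ "d/2"]) auto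
 next
  case False
  have "continuous_on K (%y. \<bar>y\<bar>)" by (intro continuous_intros)
  then obtain z where z: "z \<in> K" "!!y. y \<in> K ==> \<bar>y\<bar> \<le> \<bar>z\<bar>" using continuous_attains_sup[OF K(1) False] by blast
  have "z \<in> {-d<..<d}" using z(1) K(2) by blast
  then have "\<bar>z\<bar> < d" by (auto simp: abs_less_iff)
  then show ?thesis using z(2) assms(1) by (intro exI[of _ "max (d/2) \<bar>z\<bar>"]) force
 qed
 then obtain r0 where r0: "0 < r0" "r0 < d" "!!y. y \<in> K ==> \<bar>y\<bar> \<le> r0" by blast
 have z: "ze y = 0" if "\<bar>y\<bar> > r0" for y using r0(3)[of y] K(3)[of y] that by fastforce
 have dz: "deriv ze y = 0" if "\<bar>y\<bar> > r0" for y
 proof -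
  have "open {y. r0 < \<bar>y\<bar>}" by (intro open_Collect_less continuous_intros)
  then have "\<forall>\<^sub>F x in nhds y. x \<in> {y. r0 < \<bar>y\<bar>}" by (rule eventually_nhds_in_open) (use that in simp)
  then have "\<forall>\<^sub>F x in nhds y. ze x = 0" by (rule eventually_mono) (simp add: z)
  then have "(ze has_real_derivative 0) (at y)" by (subst DERIV_cong_ev[OF refl _ refl, of _ "%_. 0"]) auto
  then show ?thesis by (rule DERIV_imp_deriv)
 qed
 show ?thesis by (rule exI[of _ "(r0 + d) / 2"]) (use r0 z dz in auto)
qed

lemma Ck_on_lincomb:
 "Ck_on k (UNIV :: real set) f ==> Ck_on k UNIV g ==> Ck_on k UNIV (%y. a * f y + b * g y)"
proof (induction k arbitrary: f g)
 case (Suc k)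
 show ?case
 proof (rule Ck_on_SucI[OF thick_UNIV])
  fix x :: real
  have fd: "(f has_derivative (%e. partial_within UNIV e f x)) (at x)" if f: "Ck_on (Suc k) UNIV f" for f :: "real => real"
  proof -
   obtain f' where f': "(f has_derivative f') (at x)" "!!e. f' e = partial_within UNIV e f x"
    using Ck_on_SucD[OF thick_UNIV f, of x] by auto
   have "f' = (%e. partial_within UNIV e f x)" using f'(2) by (rule ext)
   then show ?thesis using f'(1) by simp
  qed
  show "((%y. a * f y + b * g y) has_derivative (%e. a * partial_within UNIV e f x + b * partial_within UNIV e g x)) (at x)"
   by (intro has_derivative_add has_derivative_mult_right fd Suc.prems)
  fix e :: real assume "e \<in> Basis"
  then show "Ck_on k UNIV (%x. a * partial_within UNIV e f x + b * partial_within UNIV e g x)" using Suc by auto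
 qed
qed (auto intro!: continuous_intros)

lemma test_function_lincomb:
 assumes "test_function d ze" "test_function d ps"
 shows "test_function d (%y. a * ze y + b * ps y)" "deriv (%y. a * ze y + b * ps y) y = a * deriv ze y + b * deriv ps y"
proof -
 obtain K K' where K: "compact K" "K \<subseteq> {-d<..<d}" "!!y. y \<notin> K ==> ze y = 0"
  and K': "compact K'" "K' \<subseteq> {-d<..<d}" "!!y. y \<notin> K' ==> ps y = 0" using assms by (auto simp: test_function_def)
 have "compact (K \<union> K')" "K \<union> K' \<subseteq> {-d<..<d}" "\<forall>y. y \<notin> K \<union> K' --> a * ze y + b * ps y = 0"
  using K K' by (auto intro: compact_Un)
 then show "test_function d (%y. a * ze y + b * ps y)" using assms Ck_on_lincomb unfolding test_function_def by blast
 show "deriv (%y. a * ze y + b * ps y) y = a * deriv ze y + b * deriv ps y"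
  by (intro DERIV_imp_deriv DERIV_add DERIV_cmult test_function_C1(1)[OF assms(1)] test_function_C1(1)[OF assms(2)])
qed

lemma interior_integral:
 fixes f :: "real => real"
 assumes "r < d" "continuous_on {-r..r} f" "!!y. r \<le> \<bar>y\<bar> ==> f y = 0"
 shows "set_integrable lborel {-d<..<d} f"
  and "set_lebesgue_integral lborel {-d<..<d} f = integral {-r..r} f"
proof -
 have eq: "indicat_real {-d<..<d} y *\<^sub>R f y = indicat_real {-r..r} y *\<^sub>R f y" for y
  using assms(1) assms(3)[of y] by (cases "r \<le> \<bar>y\<bar>") (auto simp: indicator_def not_le abs_less_iff)
 have si: "set_integrable lborel {-r..r} f" by (rule borel_integrable_atLeastAtMost'[OF assms(2)])
 then show "set_integrable lborel {-d<..<d} f" unfolding set_integrable_def eq .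
 show "set_lebesgue_integral lborel {-d<..<d} f = integral {-r..r} f"
  using set_borel_integral_eq_integral(2)[OF si] unfolding set_lebesgue_integral_def eq by simp
qed

lemma in_L2_test:
 fixes f :: "real => real"
 assumes "r < d" "continuous_on UNIV f" "!!y. r \<le> \<bar>y\<bar> ==> f y = 0"
 shows "in_L2 {-d<..<d} f"
proof -
 have "set_integrable lborel {-d<..<d} (%y. (f y)\<^sup>2)"
  by (rule interior_integral(1)[OF assms(1)]) (use assms in \<open>auto intro!: continuous_intros continuous_on_subset[OF assms(2)]\<close>)
 moreover have "f \<in> borel_measurable borel" by (rule borel_measurable_continuous_onI[OF assms(2)])
 ultimately show ?thesis by (simp add: in_L2_def set_borel_measurable_def)
qed

lemma test_function_H10:
 assumes d: "d > 0" and ze: "test_function d ze"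
 shows "H10 d ze (deriv ze)"
proof -
 obtain r where r: "0 < r" "r < d" "!!y. r \<le> \<bar>y\<bar> ==> ze y = 0 \<and> deriv ze y = 0"
  using test_function_support[OF assms] by blast
 note C = test_function_C1[OF ze]
 have L2: "in_L2 {-d<..<d} ze" "in_L2 {-d<..<d} (deriv ze)" using r C by (auto intro!: in_L2_test)
 have "weak_derivative d ze (deriv ze)" unfolding weak_derivative_def
 proof (intro allI impI)
  fix ps assume ps: "test_function d ps"
  note P = test_function_C1[OF ps]
  have c: "continuous_on {-r..r} (%y. ze y * deriv ps y)" "continuous_on {-r..r} (%y. deriv ze y * ps y)"
   by (intro continuous_intros continuous_on_subset[OF C(2)] continuous_on_subset[OF C(3)] continuous_on_subset[OF P(2)] continuous_on_subset[OF P(3)] subset_UNIV)+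
  have "((%y. deriv ze y * ps y + deriv ps y * ze y) has_integral (ze r * ps r - ze (-r) * ps (-r))) {-r..r}"
   by (rule has_integral_derivative[of "-r" r "%y. ze y * ps y"])
     (use r in simp, rule DERIV_mult has_field_derivative_at_within[OF C(1)] has_field_derivative_at_within[OF P(1)])+
  moreover have "ze r = 0" "ze (-r) = 0" using r(1) r(3)[of r] r(3)[of "-r"] by auto
  ultimately have "integral {-r..r} (%y. deriv ze y * ps y + ze y * deriv ps y) = 0"
   by (simp add: integral_unique mult.commute)
  then have "integral {-r..r} (%y. deriv ze y * ps y) + integral {-r..r} (%y. ze y * deriv ps y) = 0"
   using c by (simp add: integral_add integrable_continuous_interval)
  then show "set_lebesgue_integral lborel {-d<..<d} (%y. ze y * deriv ps y) =
    - set_lebesgue_integral lborel {-d<..<d} (%y. deriv ze y * ps y)"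
   by (subst (1 2) interior_integral(2)[OF r(2)]) (use c r(3) in auto)
 qed
 then have "H1 d ze (deriv ze)" using L2 by (simp add: H1_def)
 moreover have "L2_norm {-d<..<d} (%y. 0 :: real) = 0" by (simp add: L2_norm_def)
 ultimately show ?thesis unfolding H10_def using ze by (intro conjI exI[of _ "%_. ze"]) auto
qed

section \<open>Hardy and Jacobi inequalities\<close>

text \<open>Cauchy-Schwarz in the form that the integral of (f' - m)^2 over [x, y] is nonnegative
  for the mean slope m.\<close>

lemma increment_square_le:
 fixes f f' :: "real => real"
 assumes f: "!!y. y \<in> {a..b} ==> (f has_real_derivative f' y) (at y within {a..b})"
  and c: "continuous_on {a..b} f'" and xy: "a \<le> x" "x \<le> y" "y \<le> b"
 shows "(f y - f x)\<^sup>2 \<le> (y - x) * integral {a..b} (%y. (f' y)\<^sup>2)"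
proof (cases "x = y")
 case False
 define m where "m = (f y - f x) / (y - x)"
 have sub: "{x..y} \<subseteq> {a..b}" using xy by auto
 have cx: "continuous_on {x..y} f'" using c sub continuous_on_subset by blast
 have i1: "(f' has_integral (f y - f x)) {x..y}"
  by (rule has_integral_derivative[OF xy(2)]) (rule DERIV_subset[OF f sub], use sub in blast)
 have i2: "((%y. (f' y)\<^sup>2) has_integral integral {x..y} (%y. (f' y)\<^sup>2)) {x..y}"
  by (intro integrable_integral integrable_continuous_interval continuous_intros cx)
 have "((%y. (f' y)\<^sup>2 - 2 * m * f' y + m\<^sup>2) has_integral (integral {x..y} (%y. (f' y)\<^sup>2) - 2 * m * (f y - f x) + m\<^sup>2 * (y - x))) {x..y}"
  using has_integral_const_real[of "m\<^sup>2" x y] xy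
  by (intro has_integral_add has_integral_diff i2 has_integral_mult_right i1) (simp add: mult.commute)
 then have "0 \<le> integral {x..y} (%y. (f' y)\<^sup>2) - 2 * m * (f y - f x) + m\<^sup>2 * (y - x)"
 proof (rule has_integral_nonneg)
  fix t show "0 \<le> (f' t)\<^sup>2 - 2 * m * f' t + m\<^sup>2"
   using zero_le_power2[of "f' t - m"] by (simp add: power2_diff algebra_simps)
 qed
 moreover have "2 * m * (f y - f x) - m\<^sup>2 * (y - x) = (f y - f x)\<^sup>2 / (y - x)"
 proof -
  have "2 * (D / h) * D - (D / h)\<^sup>2 * h = D\<^sup>2 / h" if "h \<noteq> 0" for D h :: real
   using that by (simp add: power2_eq_square)
  from this[of "y - x" "f y - f x"] show ?thesis using False unfolding m_def by simp
 qed
 ultimately have "(f y - f x)\<^sup>2 / (y - x) \<le> integral {x..y} (%y. (f' y)\<^sup>2)" by linarith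
 also have "... \<le> integral {a..b} (%y. (f' y)\<^sup>2)"
  by (rule integral_subset_le[OF sub]) (use c cx in \<open>auto intro!: integrable_continuous_interval continuous_intros\<close>)
 finally show ?thesis using False xy by (simp add: field_simps)
qed simp

text \<open>Jacobi's identity: (ze')^2 + p ze^2 minus the derivative of ze^2 w' / w is the square
  (ze' - ze w' / w)^2. The boundary terms vanish because \<open>ze\<close> has compact support, so w
  may degenerate at the ends.\<close>

lemma jacobi_inequality:
 fixes w w' p :: "real => real"
 assumes d: "d > 0" and ze: "test_function d ze" and p: "continuous_on {-d<..<d} p"
  and w: "!!y. y \<in> {-d<..<d} ==> (w has_real_derivative w' y) (at y)"
   "!!y. y \<in> {-d<..<d} ==> (w' has_real_derivative p y * w y) (at y)"
   "!!y. y \<in> {-d<..<d} ==> w y > 0"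
 shows "set_lebesgue_integral lborel {-d<..<d} (%y. (deriv ze y)\<^sup>2 + p y * (ze y)\<^sup>2) \<ge> 0"
proof -
 obtain r where r: "0 < r" "r < d" "!!y. r \<le> \<bar>y\<bar> ==> ze y = 0 \<and> deriv ze y = 0"
  using test_function_support[OF d ze] by blast
 note C = test_function_C1[OF ze]
 have sub: "{-r..r} \<subseteq> {-d<..<d}" using r by auto
 have c: "continuous_on {-r..r} (%y. (deriv ze y)\<^sup>2 + p y * (ze y)\<^sup>2)"
  by (intro continuous_intros continuous_on_subset[OF C(2)] continuous_on_subset[OF C(3)] continuous_on_subset[OF p sub] subset_UNIV)
 define F where "F y = (ze y)\<^sup>2 * (w' y / w y)" for y
 define F' where "F' y = 2 * ze y * deriv ze y * (w' y / w y) + (ze y)\<^sup>2 * (p y - (w' y / w y)\<^sup>2)" for y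
 have dF: "(F has_real_derivative F' y) (at y)" if y: "y \<in> {-d<..<d}" for y
 proof -
  have "(F has_real_derivative real 2 * (deriv ze y * ze y ^ (2 - Suc 0)) * (w' y / w y) + (p y * w y * w y - w' y * w' y) / (w y * w y) * (ze y)\<^sup>2) (at y)"
   unfolding F_def using w(3)[OF y] by (intro DERIV_mult DERIV_power C(1) DERIV_divide w(1,2) y) simp
  then show ?thesis
  proof (rule DERIV_cong)
   have "(p y * w y * w y - w' y * w' y) / (w y * w y) = p y - (w' y / w y)\<^sup>2"
    using w(3)[OF y] by (simp add: diff_divide_distrib power2_eq_square)
   then show "real 2 * (deriv ze y * ze y ^ (2 - Suc 0)) * (w' y / w y) + (p y * w y * w y - w' y * w' y) / (w y * w y) * (ze y)\<^sup>2 = F' y"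
    by (simp add: F'_def)
  qed
 qed
 have "(F' has_integral (F r - F (-r))) {-r..r}"
  by (rule has_integral_derivative) (use r in simp, rule has_field_derivative_at_within[OF dF], use sub in blast)
 moreover have "F r = 0" "F (-r) = 0" using r(1) r(3)[of r] r(3)[of "-r"] by (simp_all add: F_def)
 ultimately have F': "(F' has_integral 0) {-r..r}" by simp
 have "0 \<le> integral {-r..r} (%y. (deriv ze y)\<^sup>2 + p y * (ze y)\<^sup>2)"
 proof (rule has_integral_le[OF F' integrable_integral])
  show "(%y. (deriv ze y)\<^sup>2 + p y * (ze y)\<^sup>2) integrable_on {-r..r}" by (rule integrable_continuous_interval[OF c])
  fix y
  have "(deriv ze y)\<^sup>2 + p y * (ze y)\<^sup>2 - F' y = (deriv ze y - ze y * (w' y / w y))\<^sup>2"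
   unfolding F'_def by (simp only: power2_eq_square ring_distribs) (simp add: algebra_simps)
  then show "F' y \<le> (deriv ze y)\<^sup>2 + p y * (ze y)\<^sup>2" by (smt (verit) zero_le_power2)
 qed
 then show ?thesis by (subst interior_integral(2)[OF r(2) c]) (use r(3) in auto)
qed

text \<open>A pointwise substitute for Hardy's inequality: since the singular weight is only of
  order 1/s in the distance s to the endpoint, a bound ze^2 \<le> s times the Dirichlet integral
  makes the weighted integrand bounded. \<open>sg\<close> selects the endpoint.\<close>

lemma test_hardy:
 assumes d: "d > 0" and ze: "test_function d ze" and sg: "sg = 1 \<or> sg = -1" and y: "y \<in> {-d..d}"
 shows "(ze y)\<^sup>2 \<le> (d + sg * y) * set_lebesgue_integral lborel {-d<..<d} (%y. (deriv ze y)\<^sup>2)"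
proof -
 obtain r where r: "0 < r" "r < d" "!!y. r \<le> \<bar>y\<bar> ==> ze y = 0 \<and> deriv ze y = 0"
  using test_function_support[OF d ze] by blast
 note C = test_function_C1[OF ze]
 define J where "J = integral {-r..r} (%y. (deriv ze y)\<^sup>2)"
 have cc: "continuous_on S (%y. (deriv ze y)\<^sup>2)" for S
  by (intro continuous_intros continuous_on_subset[OF C(2)]) simp
 have J: "set_lebesgue_integral lborel {-d<..<d} (%y. (deriv ze y)\<^sup>2) = J"
  unfolding J_def by (rule interior_integral(2)[OF r(2) cc]) (use r(3) in simp)
 have J0: "J \<ge> 0" unfolding J_def by (intro integral_nonneg integrable_continuous_interval cc) simp
 show ?thesis
 proof (cases "r \<le> \<bar>y\<bar>")
  case True
  have "0 \<le> (d + sg * y) * J" using sg y J0 by (intro mult_nonneg_nonneg) auto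
  then show ?thesis unfolding J using r(3)[OF True] by simp
 next
  case False
  have inc: "a \<in> {-r..r} ==> b \<in> {-r..r} ==> a \<le> b ==> (ze b - ze a)\<^sup>2 \<le> (b - a) * J" for a b
   unfolding J_def by (rule increment_square_le[where f=ze and f'="deriv ze"])
    (auto intro!: has_field_derivative_at_within[OF C(1)] continuous_on_subset[OF C(2)])
  have e: "ze r = 0" "ze (-r) = 0" using r(1) r(3)[of r] r(3)[of "-r"] by auto
  from sg show ?thesis unfolding J
  proof
   assume "sg = 1"
   moreover have "(y + r) * J \<le> (d + y) * J" using r J0 by (intro mult_right_mono) auto
   ultimately show "(ze y)\<^sup>2 \<le> (d + sg * y) * J" using inc[of "-r" y] False e by (simp add: not_le abs_less_iff)
  next
   assume "sg = -1"
   moreover have "(r - y) * J \<le> (d - y) * J" using r J0 by (intro mult_right_mono) auto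
   ultimately show "(ze y)\<^sup>2 \<le> (d + sg * y) * J" using inc[of y r] False e by (simp add: not_le abs_less_iff)
  qed
 qed
qed

section \<open>Approximation of quadratic forms by test functions\<close>

text \<open>The weight may change sign, so convergence rests on |a^2 - b^2| \<le> (1 + 1/t) (a -
  b)^2 + t b^2, with t chosen small first and n large afterwards.\<close>

lemma weighted_square_limit:
 fixes W b :: "'a => real" and a :: "nat => 'a => real"
 assumes [measurable]: "W \<in> borel_measurable M" "b \<in> borel_measurable M" "!!n. a n \<in> borel_measurable M"
  and b: "integrable M (%x. \<bar>W x\<bar> * (b x)\<^sup>2)"
  and a: "!!n. integrable M (%x. \<bar>W x\<bar> * (a n x - b x)\<^sup>2)"
  and lim: "(%n. \<integral>x. \<bar>W x\<bar> * (a n x - b x)\<^sup>2 \<partial>M) \<longlonglongrightarrow> 0"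
 shows "integrable M (%x. W x * (b x)\<^sup>2)" "integrable M (%x. W x * (a n x)\<^sup>2)"
  "(%n. \<integral>x. W x * (a n x)\<^sup>2 \<partial>M) \<longlonglongrightarrow> (\<integral>x. W x * (b x)\<^sup>2 \<partial>M)"
proof -
 show ib: "integrable M (%x. W x * (b x)\<^sup>2)"
  by (rule Bochner_Integration.integrable_bound[OF b]) (auto simp: abs_mult)
 have p2: "s\<^sup>2 \<le> 2 * (s - t)\<^sup>2 + 2 * t\<^sup>2" for s t :: real
  using zero_le_power2[of "s - 2 * t"] by (simp add: power2_eq_square algebra_simps)
 have ia: "integrable M (%x. W x * (a n x)\<^sup>2)" for n
 proof (rule Bochner_Integration.integrable_bound)
  show "integrable M (%x. 2 * (\<bar>W x\<bar> * (a n x - b x)\<^sup>2) + 2 * (\<bar>W x\<bar> * (b x)\<^sup>2))"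
   by (intro Bochner_Integration.integrable_add integrable_mult_right a b)
  have "\<bar>W x\<bar> * (a n x)\<^sup>2 \<le> \<bar>W x\<bar> * (2 * (a n x - b x)\<^sup>2 + 2 * (b x)\<^sup>2)" for x by (intro mult_left_mono p2) simp
  then show "AE x in M. norm (W x * (a n x)\<^sup>2) \<le> norm (2 * (\<bar>W x\<bar> * (a n x - b x)\<^sup>2) + 2 * (\<bar>W x\<bar> * (b x)\<^sup>2))"
   by (intro AE_I2) (simp add: abs_mult algebra_simps)
 qed simp
 then show "integrable M (%x. W x * (a n x)\<^sup>2)" .
 define K where "K = (\<integral>x. \<bar>W x\<bar> * (b x)\<^sup>2 \<partial>M)"
 define e where "e n = (\<integral>x. \<bar>W x\<bar> * (a n x - b x)\<^sup>2 \<partial>M)" for n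
 have K0: "K \<ge> 0" unfolding K_def by (intro Bochner_Integration.integral_nonneg) simp
 have bound: "\<bar>(\<integral>x. W x * (a n x)\<^sup>2 \<partial>M) - (\<integral>x. W x * (b x)\<^sup>2 \<partial>M)\<bar> \<le> (1 + 1 / t) * e n + t * K" if t: "t > 0" for n t
 proof -
  have pt: "\<bar>W x * (a n x)\<^sup>2 - W x * (b x)\<^sup>2\<bar> \<le> (1 + 1 / t) * (\<bar>W x\<bar> * (a n x - b x)\<^sup>2) + t * (\<bar>W x\<bar> * (b x)\<^sup>2)" for x
  proof -
   define u v where "u = a n x - b x" and "v = b x"
   have "0 \<le> (t * \<bar>v\<bar> - \<bar>u\<bar>)\<^sup>2" by simp
   then have "2 * (\<bar>u\<bar> * \<bar>v\<bar>) \<le> t * v\<^sup>2 + u\<^sup>2 / t"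
    using t by (simp add: power2_diff power_mult_distrib field_simps power2_eq_square)
   moreover have "\<bar>(a n x)\<^sup>2 - (b x)\<^sup>2\<bar> \<le> u\<^sup>2 + 2 * (\<bar>u\<bar> * \<bar>v\<bar>)"
   proof -
    have "(a n x)\<^sup>2 - (b x)\<^sup>2 = u\<^sup>2 + 2 * (u * v)" by (simp add: u_def v_def power2_eq_square algebra_simps)
    moreover have "\<bar>u\<^sup>2 + 2 * (u * v)\<bar> \<le> \<bar>u\<^sup>2\<bar> + \<bar>2 * (u * v)\<bar>" by (rule abs_triangle_ineq)
    ultimately show ?thesis by (simp add: abs_mult)
   qed
   ultimately have "\<bar>(a n x)\<^sup>2 - (b x)\<^sup>2\<bar> \<le> (1 + 1 / t) * u\<^sup>2 + t * v\<^sup>2" by (simp add: algebra_simps)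
   then have "\<bar>W x\<bar> * \<bar>(a n x)\<^sup>2 - (b x)\<^sup>2\<bar> \<le> \<bar>W x\<bar> * ((1 + 1 / t) * u\<^sup>2 + t * v\<^sup>2)" by (rule mult_left_mono) simp
   moreover have "\<bar>W x * (a n x)\<^sup>2 - W x * (b x)\<^sup>2\<bar> = \<bar>W x\<bar> * \<bar>(a n x)\<^sup>2 - (b x)\<^sup>2\<bar>"
    by (simp add: abs_mult[symmetric] right_diff_distrib)
   moreover have "\<bar>W x\<bar> * ((1 + 1 / t) * u\<^sup>2 + t * v\<^sup>2) = (1 + 1 / t) * (\<bar>W x\<bar> * u\<^sup>2) + t * (\<bar>W x\<bar> * v\<^sup>2)"
    by (simp only: distrib_left mult_ac)
   ultimately show ?thesis by (simp only: u_def v_def)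
  qed
  have "\<bar>(\<integral>x. W x * (a n x)\<^sup>2 \<partial>M) - (\<integral>x. W x * (b x)\<^sup>2 \<partial>M)\<bar> = \<bar>\<integral>x. W x * (a n x)\<^sup>2 - W x * (b x)\<^sup>2 \<partial>M\<bar>"
   by (subst Bochner_Integration.integral_diff[OF ia ib]) simp
  also have "... \<le> (\<integral>x. \<bar>W x * (a n x)\<^sup>2 - W x * (b x)\<^sup>2\<bar> \<partial>M)" by (rule integral_abs_bound)
  also have "... \<le> (\<integral>x. (1 + 1 / t) * (\<bar>W x\<bar> * (a n x - b x)\<^sup>2) + t * (\<bar>W x\<bar> * (b x)\<^sup>2) \<partial>M)"
   by (intro integral_mono pt integrable_abs Bochner_Integration.integrable_diff Bochner_Integration.integrable_add integrable_mult_right ia ib a b)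
  also have "... = (1 + 1 / t) * e n + t * K"
   unfolding e_def K_def by (subst Bochner_Integration.integral_add) (auto intro!: integrable_mult_right a b)
  finally show ?thesis .
 qed
 show "(%n. \<integral>x. W x * (a n x)\<^sup>2 \<partial>M) \<longlonglongrightarrow> (\<integral>x. W x * (b x)\<^sup>2 \<partial>M)"
 proof (rule LIMSEQ_I)
  fix ep :: real assume ep: "ep > 0"
  define t where "t = ep / (2 * (K + 1))"
  have t: "t > 0" using ep K0 by (simp add: t_def)
  have tK: "t * K < ep / 2" using ep K0 by (simp add: t_def field_simps)
  have "(%n. (1 + 1 / t) * e n) \<longlonglongrightarrow> (1 + 1 / t) * 0" unfolding e_def by (intro tendsto_intros lim)
  then have "\<forall>\<^sub>F n in sequentially. (1 + 1 / t) * e n < ep / 2" using ep by (intro order_tendstoD(2)[of _ 0]) auto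
  then obtain N where "!!n. n \<ge> N ==> (1 + 1 / t) * e n < ep / 2" by (auto simp: eventually_sequentially)
  then have "norm ((\<integral>x. W x * (a n x)\<^sup>2 \<partial>M) - (\<integral>x. W x * (b x)\<^sup>2 \<partial>M)) < ep" if "n \<ge> N" for n
   using bound[OF t, of n] tK \<open>!!n. n \<ge> N ==> (1 + 1 / t) * e n < ep / 2\<close>[OF that] unfolding real_norm_def by linarith
  then show "\<exists>N. \<forall>n\<ge>N. norm ((\<integral>x. W x * (a n x)\<^sup>2 \<partial>M) - (\<integral>x. W x * (b x)\<^sup>2 \<partial>M)) < ep" by blast
 qed
qed

text \<open>Convergence in H^1 does not by itself control a weight with a pole. The Hardy bound for
  differences of test functions does, once it has been passed to the limit function.\<close>

lemma H10_density:
 fixes ph ph' q :: "real => real"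
 assumes d: "d > 0" and H: "H10 d ph ph'" and sg: "sg = 1 \<or> sg = -1" and C: "C \<ge> 0"
  and qc: "continuous_on {-d<..<d} q" and q: "!!y. y \<in> {-d<..<d} ==> \<bar>q y\<bar> \<le> C / (d + sg * y)"
 shows "\<exists>ze. (\<forall>n::nat. test_function d (ze n)) \<and>
  (%n. set_lebesgue_integral lborel {-d<..<d} (%y. (ze n y)\<^sup>2)) \<longlonglongrightarrow> set_lebesgue_integral lborel {-d<..<d} (%y. (ph y)\<^sup>2) \<and>
  (%n. set_lebesgue_integral lborel {-d<..<d} (%y. (deriv (ze n) y)\<^sup>2 - q y * (ze n y)\<^sup>2)) \<longlonglongrightarrow>
   set_lebesgue_integral lborel {-d<..<d} (%y. (ph' y)\<^sup>2 - q y * (ph y)\<^sup>2)"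
proof -
 define I where "I = {-d<..<d}"
 \<comment> \<open>Cutting off to the interval turns set integrals into integrals over the line;
   test functions and their derivatives are unaffected.\<close>
 define R where "R f = (%y. indicat_real I y * f y)" for f :: "real => real"
 have Im: "I \<in> sets lborel" by (simp add: I_def)
 have Rsq: "indicat_real I y *\<^sub>R (f y)\<^sup>2 = (R f y)\<^sup>2" for f y by (auto simp: R_def indicator_def)
 obtain ze where ze: "!!n::nat. test_function d (ze n)"
  and l0: "(%n. L2_norm {-d<..<d} (%y. ze n y - ph y)) \<longlonglongrightarrow> 0"
  and l1: "(%n. L2_norm {-d<..<d} (%y. deriv (ze n) y - ph' y)) \<longlonglongrightarrow> 0"
  and L2: "in_L2 {-d<..<d} ph" "in_L2 {-d<..<d} ph'" using H unfolding H10_def H1_def by blast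
 note C1 = test_function_C1[OF ze]
 have zero: "y \<notin> I ==> f y = 0 \<and> deriv f y = 0" if "test_function d f" for f y
  using test_function_support[OF d that] by (auto simp: I_def abs_if not_less)
 have Rze: "R (ze n) = ze n" "R (deriv (ze n)) = deriv (ze n)" for n
  using zero[OF ze] by (auto simp: R_def indicator_def fun_eq_iff)
 have m: "R ph \<in> borel_measurable lborel" "R ph' \<in> borel_measurable lborel"
  "integrable lborel (%y. (R ph y)\<^sup>2)" "integrable lborel (%y. (R ph' y)\<^sup>2)"
  using L2 unfolding in_L2_def set_borel_measurable_def set_integrable_def I_def[symmetric] Rsq[symmetric]
  by (simp_all only: real_norm_def power2_abs) (simp_all add: R_def)
 have mze: "ze n \<in> borel_measurable lborel" "deriv (ze n) \<in> borel_measurable lborel" for n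
  using borel_measurable_continuous_onI[OF C1(3)] borel_measurable_continuous_onI[OF C1(2)] by simp_all
 have ize: "integrable lborel (%y. (ze n y)\<^sup>2)" "integrable lborel (%y. (deriv (ze n) y)\<^sup>2)" for n
  using test_function_H10[OF d ze[of n]] unfolding H10_def H1_def in_L2_def set_integrable_def I_def[symmetric]
  by (simp_all add: Rsq[unfolded real_scaleR_def] Rze)
 have idiff: "integrable lborel (%y. (f y - g y)\<^sup>2)"
  if "f \<in> borel_measurable lborel" "g \<in> borel_measurable lborel" "integrable lborel (%y. (f y)\<^sup>2)" "integrable lborel (%y. (g y)\<^sup>2)"
  for f g :: "real => real"
 proof (rule Bochner_Integration.integrable_bound)
  show "integrable lborel (%y. 2 * (f y)\<^sup>2 + 2 * (g y)\<^sup>2)"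
   by (intro Bochner_Integration.integrable_add integrable_mult_right that)
  show "(%y. (f y - g y)\<^sup>2) \<in> borel_measurable lborel" using that(1,2) by measurable
  have "(s - t)\<^sup>2 \<le> 2 * s\<^sup>2 + 2 * t\<^sup>2" for s t :: real
   using zero_le_power2[of "s + t"] by (simp add: power2_eq_square algebra_simps)
  then show "AE y in lborel. norm ((f y - g y)\<^sup>2) \<le> norm (2 * (f y)\<^sup>2 + 2 * (g y)\<^sup>2)" by simp
 qed
 define E0 where "E0 n = (\<integral>y. (ze n y - R ph y)\<^sup>2 \<partial>lborel)" for n
 define E1 where "E1 n = (\<integral>y. (deriv (ze n) y - R ph' y)\<^sup>2 \<partial>lborel)" for n
 note i0 = idiff[OF mze(1) m(1) ize(1) m(3)] and i1 = idiff[OF mze(2) m(2) ize(2) m(4)]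
 have sq_lim: "(%n. \<integral>y. (f n y - R g y)\<^sup>2 \<partial>lborel) \<longlonglongrightarrow> 0"
  if "(%n. L2_norm {-d<..<d} (%y. f n y - g y)) \<longlonglongrightarrow> 0" "!!n. R (f n) = f n" for f :: "nat => real => real" and g
 proof -
  have "R (%y. f n y - g y) y = f n y - R g y" for n y
   using fun_cong[OF that(2)[of n], of y] by (simp add: R_def right_diff_distrib)
  then have "L2_norm {-d<..<d} (%y. f n y - g y) = sqrt (\<integral>y. (f n y - R g y)\<^sup>2 \<partial>lborel)" for n
   unfolding L2_norm_def set_lebesgue_integral_def I_def[symmetric] using Rsq[of _ "%y. f n y - g y"] by simp
  then have "(%n. (sqrt (\<integral>y. (f n y - R g y)\<^sup>2 \<partial>lborel))\<^sup>2) \<longlonglongrightarrow> 0\<^sup>2" using that(1) by (intro tendsto_power) simp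
  then show ?thesis by (simp add: Bochner_Integration.integral_nonneg)
 qed
 have E0: "E0 \<longlonglongrightarrow> 0" and E1: "E1 \<longlonglongrightarrow> 0"
  unfolding E0_def E1_def using sq_lim[of ze ph, OF l0 Rze(1)] sq_lim[of "%n. deriv (ze n)" ph', OF l1 Rze(2)] by auto
 \<comment> \<open>The limit is given only up to null sets. Along an almost everywhere convergent
   subsequence the bound for ze m - ze n carries over to ze m - ph.\<close>
 obtain r where r: "strict_mono r" "AE y in lborel. (%n. (ze (r n) y - R ph y)\<^sup>2) \<longlonglongrightarrow> 0"
  using tendsto_L1_AE_subseq[of lborel "%n y. (ze n y - R ph y)\<^sup>2"] i0 E0 unfolding E0_def by auto
 have cauchy: "(ze n y - ze m y)\<^sup>2 \<le> (d + sg * y) * (2 * E1 n + 2 * E1 m)" if y: "y \<in> I" for n m y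
 proof -
  have t: "test_function d (%y. 1 * ze n y + (-1) * ze m y)" by (rule test_function_lincomb(1)[OF ze ze])
  have dt: "deriv (%y. 1 * ze n y + (-1) * ze m y) y = deriv (ze n) y - deriv (ze m) y" for y
   using test_function_lincomb(2)[OF ze ze, of 1 n "-1" m y] by simp
  have y': "y \<in> {-d..d}" using y by (simp add: I_def)
  have nn: "0 \<le> d + sg * y" using sg y' by auto
  have eqi: "indicat_real I y *\<^sub>R (deriv (ze n) y - deriv (ze m) y)\<^sup>2 = (deriv (ze n) y - deriv (ze m) y)\<^sup>2" for y
   using zero[OF ze, of y n] zero[OF ze, of y m] by (cases "y \<in> I") auto
  have "(ze n y - ze m y)\<^sup>2 \<le> (d + sg * y) * (\<integral>y. (deriv (ze n) y - deriv (ze m) y)\<^sup>2 \<partial>lborel)"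
   using test_hardy[OF d t sg y'] unfolding dt set_lebesgue_integral_def I_def[symmetric] eqi by simp
  also have "(\<integral>y. (deriv (ze n) y - deriv (ze m) y)\<^sup>2 \<partial>lborel) \<le> (\<integral>y. 2 * (deriv (ze n) y - R ph' y)\<^sup>2 + 2 * (deriv (ze m) y - R ph' y)\<^sup>2 \<partial>lborel)"
  proof (rule integral_mono)
   show "integrable lborel (%y. (deriv (ze n) y - deriv (ze m) y)\<^sup>2)" by (rule idiff) (rule mze ize)+
   show "integrable lborel (%y. 2 * (deriv (ze n) y - R ph' y)\<^sup>2 + 2 * (deriv (ze m) y - R ph' y)\<^sup>2)"
    by (intro Bochner_Integration.integrable_add integrable_mult_right i1)
   have "(s - t)\<^sup>2 \<le> 2 * (s - p)\<^sup>2 + 2 * (t - p)\<^sup>2" for s t p :: real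
    using zero_le_power2[of "s + t - 2 * p"] by (simp add: power2_eq_square algebra_simps)
   then show "(deriv (ze n) y - deriv (ze m) y)\<^sup>2 \<le> 2 * (deriv (ze n) y - R ph' y)\<^sup>2 + 2 * (deriv (ze m) y - R ph' y)\<^sup>2" for y .
  qed
  also have "... = 2 * E1 n + 2 * E1 m"
   unfolding E1_def by (subst Bochner_Integration.integral_add) (auto intro!: integrable_mult_right i1)
  finally show ?thesis using nn by (simp add: mult_left_mono)
 qed
 have hardy: "AE y in lborel. y \<in> I --> (ze m y - R ph y)\<^sup>2 \<le> (d + sg * y) * (2 * E1 m)" for m using r(2)
 proof (rule AE_mp, intro AE_I2 impI)
  fix y assume l: "(%n. (ze (r n) y - R ph y)\<^sup>2) \<longlonglongrightarrow> 0" and y: "y \<in> I"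
  have "(%n. sqrt ((ze (r n) y - R ph y)\<^sup>2)) \<longlonglongrightarrow> sqrt 0" by (intro tendsto_real_sqrt l)
  then have "(%n. ze (r n) y - R ph y) \<longlonglongrightarrow> 0" by (simp add: tendsto_rabs_zero_iff)
  then have "(%n. ze (r n) y) \<longlonglongrightarrow> R ph y" by (simp add: LIM_zero_iff)
  then have "(%n. (ze m y - ze (r n) y)\<^sup>2) \<longlonglongrightarrow> (ze m y - R ph y)\<^sup>2" by (intro tendsto_intros)
  moreover have "(%n. (d + sg * y) * (2 * E1 m + 2 * E1 (r n))) \<longlonglongrightarrow> (d + sg * y) * (2 * E1 m + 2 * 0)"
   using LIMSEQ_subseq_LIMSEQ[OF E1 r(1)] by (intro tendsto_intros) (simp add: o_def)
  ultimately show "(ze m y - R ph y)\<^sup>2 \<le> (d + sg * y) * (2 * E1 m)"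
   using LIMSEQ_le[of _ _ _ "(d + sg * y) * (2 * E1 m)"] cauchy[OF y] by auto
 qed
 have Wm: "R q \<in> borel_measurable lborel"
  using borel_measurable_continuous_on_indicator[of I q] qc Im by (simp add: I_def R_def)
 have Iint: "integrable lborel (%y. K * indicat_real I y)" for K
  unfolding I_def by (intro integrable_mult_right integrable_real_indicator) (use d in auto)
 have Wle: "\<bar>R q y\<bar> * X \<le> C * B * indicat_real I y" if X: "X \<ge> 0" and that: "y \<in> I ==> X \<le> (d + sg * y) * B" for y X B
 proof (cases "y \<in> I")
  case True
  then have s: "d + sg * y > 0" using sg by (auto simp: I_def)
  have "\<bar>q y\<bar> * X \<le> \<bar>q y\<bar> * ((d + sg * y) * B)" using that[OF True] by (rule mult_left_mono) simp
  also have "... = (\<bar>q y\<bar> * (d + sg * y)) * B" by simp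
  also have "... \<le> C * B"
  proof (rule mult_right_mono)
   show "\<bar>q y\<bar> * (d + sg * y) \<le> C" using q[of y] True s by (simp add: I_def field_simps)
   have "0 \<le> (d + sg * y) * B" using that[OF True] X by linarith
   then show "0 \<le> B" using s by (simp add: zero_le_mult_iff)
  qed
  finally show ?thesis using True by (simp add: R_def)
 qed (simp add: R_def)
 have ibound: "integrable lborel f" if "f \<in> borel_measurable lborel" "AE y in lborel. \<bar>f y\<bar> \<le> K * indicat_real I y" for f :: "real => real" and K
  by (rule Bochner_Integration.integrable_bound[OF Iint[of K] that(1)]) (use that(2) in \<open>auto elim!: eventually_mono\<close>)
 have Rm [measurable]: "R q \<in> borel_measurable borel" "R ph \<in> borel_measurable borel" "R ph' \<in> borel_measurable borel"
  "ze n \<in> borel_measurable borel" "deriv (ze n) \<in> borel_measurable borel" for n using Wm m mze by simp_all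
 have Wdiff: "AE y in lborel. \<bar>\<bar>R q y\<bar> * (ze n y - R ph y)\<^sup>2\<bar> \<le> C * (2 * E1 n) * indicat_real I y" for n
  using hardy[of n] by (rule AE_mp) (intro AE_I2 impI, use Wle in \<open>auto simp: abs_mult\<close>)
 have a: "integrable lborel (%y. \<bar>R q y\<bar> * (ze n y - R ph y)\<^sup>2)" for n by (rule ibound[OF _ Wdiff]) measurable
 have "integrable lborel (%y. \<bar>R q y\<bar> * (ze 0 y)\<^sup>2)"
 proof (rule ibound)
  define J where "J = set_lebesgue_integral lborel {-d<..<d} (%y. (deriv (ze 0) y)\<^sup>2)"
  have "\<bar>\<bar>R q y\<bar> * (ze 0 y)\<^sup>2\<bar> \<le> C * J * indicat_real I y" for y
   using Wle[of "(ze 0 y)\<^sup>2" y J] test_hardy[OF d ze[of 0] sg, of y] by (simp add: abs_mult J_def I_def)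
  then show "AE y in lborel. \<bar>\<bar>R q y\<bar> * (ze 0 y)\<^sup>2\<bar> \<le> C * J * indicat_real I y" by simp
 qed measurable
 from Bochner_Integration.integrable_add[OF integrable_mult_right[OF a[of 0], of 2] integrable_mult_right[OF this, of 2]]
 have b: "integrable lborel (%y. \<bar>R q y\<bar> * (R ph y)\<^sup>2)"
 proof (rule Bochner_Integration.integrable_bound)
  have "t\<^sup>2 \<le> 2 * (s - t)\<^sup>2 + 2 * s\<^sup>2" for s t :: real
   using zero_le_power2[of "2 * s - t"] by (simp add: power2_eq_square algebra_simps)
  then have "\<bar>R q y\<bar> * (R ph y)\<^sup>2 \<le> \<bar>R q y\<bar> * (2 * (ze 0 y - R ph y)\<^sup>2 + 2 * (ze 0 y)\<^sup>2)" for y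
   by (intro mult_left_mono) auto
  then show "AE y in lborel. norm (\<bar>R q y\<bar> * (R ph y)\<^sup>2) \<le> norm (2 * (\<bar>R q y\<bar> * (ze 0 y - R ph y)\<^sup>2) + 2 * (\<bar>R q y\<bar> * (ze 0 y)\<^sup>2))"
   by (intro AE_I2) (simp add: abs_mult algebra_simps)
 qed measurable
 have lim: "(%n. \<integral>y. \<bar>R q y\<bar> * (ze n y - R ph y)\<^sup>2 \<partial>lborel) \<longlonglongrightarrow> 0"
 proof (rule tendsto_sandwich[of "%_. 0" _ _ "%n. C * (2 * E1 n) * (\<integral>y. indicat_real I y \<partial>lborel)"])
  show "\<forall>\<^sub>F n in sequentially. 0 \<le> (\<integral>y. \<bar>R q y\<bar> * (ze n y - R ph y)\<^sup>2 \<partial>lborel)"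
   by (intro always_eventually allI Bochner_Integration.integral_nonneg) simp
  have "(\<integral>y. \<bar>R q y\<bar> * (ze n y - R ph y)\<^sup>2 \<partial>lborel) \<le> (\<integral>y. C * (2 * E1 n) * indicat_real I y \<partial>lborel)" for n
   by (rule integral_mono_AE[OF a Iint]) (use Wdiff[of n] in \<open>simp add: abs_mult\<close>)
  then show "\<forall>\<^sub>F n in sequentially. (\<integral>y. \<bar>R q y\<bar> * (ze n y - R ph y)\<^sup>2 \<partial>lborel) \<le> C * (2 * E1 n) * (\<integral>y. indicat_real I y \<partial>lborel)"
   by simp
  have "(%n. C * (2 * E1 n) * (\<integral>y. indicat_real I y \<partial>lborel)) \<longlonglongrightarrow> C * (2 * 0) * (\<integral>y. indicat_real I y \<partial>lborel)"
   by (intro tendsto_intros E1)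
  then show "(%n. C * (2 * E1 n) * (\<integral>y. indicat_real I y \<partial>lborel)) \<longlonglongrightarrow> 0" by simp
 qed simp
 note WL = weighted_square_limit[OF Wm m(1) mze(1) b a lim]
 have L0: "(%n. \<integral>y. 1 * (ze n y)\<^sup>2 \<partial>lborel) \<longlonglongrightarrow> (\<integral>y. 1 * (R ph y)\<^sup>2 \<partial>lborel)"
  by (rule weighted_square_limit(3)[of "%_. 1"]) (use m mze i0 E0[unfolded E0_def[abs_def]] in simp_all)
 have L1: "(%n. \<integral>y. 1 * (deriv (ze n) y)\<^sup>2 \<partial>lborel) \<longlonglongrightarrow> (\<integral>y. 1 * (R ph' y)\<^sup>2 \<partial>lborel)"
  by (rule weighted_square_limit(3)[of "%_. 1"]) (use m mze i1 E1[unfolded E1_def[abs_def]] in simp_all)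
 have form: "set_lebesgue_integral lborel {-d<..<d} (%y. (f' y)\<^sup>2 - q y * (f y)\<^sup>2) = (\<integral>y. (R f' y)\<^sup>2 \<partial>lborel) - (\<integral>y. R q y * (R f y)\<^sup>2 \<partial>lborel)"
  if "integrable lborel (%y. (R f' y)\<^sup>2)" "integrable lborel (%y. R q y * (R f y)\<^sup>2)" for f f' :: "real => real"
 proof -
  have "indicat_real I y *\<^sub>R ((f' y)\<^sup>2 - q y * (f y)\<^sup>2) = (R f' y)\<^sup>2 - R q y * (R f y)\<^sup>2" for y
   by (auto simp: R_def indicator_def)
  then show ?thesis
   unfolding set_lebesgue_integral_def I_def[symmetric] by (simp add: Bochner_Integration.integral_diff[OF that])
 qed
 have sq: "set_lebesgue_integral lborel {-d<..<d} (%y. (f y)\<^sup>2) = (\<integral>y. (R f y)\<^sup>2 \<partial>lborel)" for f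
  unfolding set_lebesgue_integral_def I_def[symmetric] Rsq ..
 have "(%n. (\<integral>y. (deriv (ze n) y)\<^sup>2 \<partial>lborel) - (\<integral>y. R q y * (ze n y)\<^sup>2 \<partial>lborel)) \<longlonglongrightarrow> (\<integral>y. (R ph' y)\<^sup>2 \<partial>lborel) - (\<integral>y. R q y * (R ph y)\<^sup>2 \<partial>lborel)"
  using L1 WL(3) by (intro tendsto_diff) simp_all
 moreover have "set_lebesgue_integral lborel {-d<..<d} (%y. (deriv (ze n) y)\<^sup>2 - q y * (ze n y)\<^sup>2) = (\<integral>y. (deriv (ze n) y)\<^sup>2 \<partial>lborel) - (\<integral>y. R q y * (ze n y)\<^sup>2 \<partial>lborel)" for n
  using form[of "deriv (ze n)" "ze n"] ize(2) WL(2) by (simp add: Rze)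
 moreover note form[OF m(4) WL(1)]
 moreover have "set_lebesgue_integral lborel {-d<..<d} (%y. (ze n y)\<^sup>2) = (\<integral>y. (ze n y)\<^sup>2 \<partial>lborel)" for n
  using sq[of "ze n"] by (simp add: Rze)
 ultimately show ?thesis using ze L0 by (intro exI[of _ ze]) (simp add: sq)
qed

section \<open>The eigenvalue as a function of the Coriolis parameter\<close>

text \<open>An infimum of affine functions is concave, hence continuous, and slopes at most -m < 0
  make it decrease at least at rate m. This gives existence and uniqueness of the zero
  together.\<close>

lemma affine_infimum_zero:
 fixes X :: "(real \<times> real) set"
 assumes ne: "X \<noteq> {}" and m: "m > 0" "!!A N. (A, N) \<in> X ==> m \<le> N"
  and bdd: "!!b. bdd_below ((%(A, N). A - b * N) ` X)"
  and f: "!!b. f b = Inf ((%(A, N). A - b * N) ` X)" and b0: "f b0 \<ge> 0"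
 shows "\<exists>!b. b0 \<le> b \<and> f b = 0" and "f b1 = 0 ==> b1 < \<beta> ==> f \<beta> < 0"
proof -
 have le: "f b \<le> A - b * N" if "(A, N) \<in> X" for b A N unfolding f by (rule cInf_lower[OF _ bdd]) (use that in force)
 have ge: "z \<le> f b" if "!!A N. (A, N) \<in> X ==> z \<le> A - b * N" for z b
  unfolding f by (rule cInf_greatest) (use ne that in auto)
 have step: "f b' \<le> f b - m * (b' - b)" if "b \<le> b'" for b b'
 proof -
  have "f b' + m * (b' - b) \<le> f b"
  proof (rule ge)
   fix A N assume x: "(A, N) \<in> X"
   have "m * (b' - b) \<le> N * (b' - b)" using m(2)[OF x] that by (intro mult_right_mono) auto
   then show "f b' + m * (b' - b) \<le> A - b * N" using le[OF x, of b'] by (simp add: algebra_simps)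
  qed
  then show ?thesis by simp
 qed
 have "convex_on UNIV (%b. - f b)"
 proof (rule convex_onI)
  fix t x y :: real assume t: "0 < t" "t < 1"
  have "(1 - t) * f x + t * f y \<le> f ((1 - t) * x + t * y)"
  proof (rule ge)
   fix A N assume x: "(A, N) \<in> X"
   have "(1 - t) * f x + t * f y \<le> (1 - t) * (A - x * N) + t * (A - y * N)"
    using t le[OF x] by (intro add_mono mult_left_mono) auto
   also have "... = A - ((1 - t) * x + t * y) * N" by (simp add: algebra_simps)
   finally show "(1 - t) * f x + t * f y \<le> A - ((1 - t) * x + t * y) * N" .
  qed
  then show "- f ((1 - t) *\<^sub>R x + t *\<^sub>R y) \<le> (1 - t) * - f x + t * - f y" by simp
 qed simp
 then have "continuous_on UNIV (%b. - (- f b))" by (intro continuous_on_minus convex_on_continuous open_UNIV)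
 then have cont: "continuous_on S f" for S using continuous_on_subset[of UNIV f S] by simp
 \<comment> \<open>Decrease at rate m uses up the value f b0 within this distance.\<close>
 define b2 where "b2 = b0 + f b0 / m"
 have b2: "b0 \<le> b2" "f b2 \<le> 0" using b0 m(1) step[of b0 b2] by (auto simp: b2_def)
 obtain b where b: "b0 \<le> b" "f b = 0" using IVT2'[of f b2 0 b0] b2 b0 cont by auto
 have mono: "f \<beta> < 0" if "f b1 = 0" "b1 < \<beta>" for b1 \<beta>
 proof -
  have "m * (\<beta> - b1) > 0" using m(1) that by simp
  then show ?thesis using step[of b1 \<beta>] that by linarith
 qed
 then show "f b1 = 0 ==> b1 < \<beta> ==> f \<beta> < 0" .
 show "\<exists>!b. b0 \<le> b \<and> f b = 0"
 proof (rule ex1I[of _ b])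
  fix c assume "b0 \<le> c \<and> f c = 0"
  then show "c = b" using mono[of c b] mono[of b c] b by (cases c b rule: linorder_cases) auto
 qed (use b in simp)
qed

text \<open>Both monotonicity directions at once: the minimum of the profile is at the endpoint y =
  - sg d, and d + sg y is the distance to it. \<open>ka\<close> is a lower bound for the slope away
  from the minimum.\<close>

locale shear_profile =
 fixes d sg ka M :: real and u0 :: "real => real"
 assumes d: "d > 0" and sg: "sg = 1 \<or> sg = -1" and ka: "ka > 0" and M: "M > 0"
  and u0c: "continuous_on {-d..d} u0" and u2c: "continuous_on {-d..d} (D2 d u0)"
  and gap: "!!y. y \<in> {-d..d} ==> ka * (d + sg * y) \<le> u0 y - shear_min d u0"
  and upper: "!!y. y \<in> {-d..d} ==> u0 y - shear_min d u0 \<le> M"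
begin

abbreviation "I \<equiv> {-d<..<d}"
abbreviation "LI \<equiv> set_lebesgue_integral lborel I"

definition D :: "real => real" where "D y = u0 y - shear_min d u0"
definition q :: "real => real => real" where "q b y = (b - D2 d u0 y) / D y"
definition A :: "(real => real) => real" where "A ze = LI (%y. (deriv ze y)\<^sup>2 - q 0 y * (ze y)\<^sup>2)"
definition N :: "(real => real) => real" where "N ze = LI (%y. 1 / D y * (ze y)\<^sup>2)"
definition Z :: "(real => real) => real" where "Z ze = LI (%y. (ze y)\<^sup>2)"
definition Q :: "real => (real => real) => real" where "Q b ze = LI (%y. (deriv ze y)\<^sup>2 - q b y * (ze y)\<^sup>2)"

lemma s_pos: "y \<in> I ==> d + sg * y > 0" using sg by auto

lemma D_pos: assumes "y \<in> I" shows "D y > 0"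
proof -
 have "ka * (d + sg * y) > 0" using s_pos[OF assms] ka by simp
 then show ?thesis using gap[of y] assms by (simp add: D_def)
qed

lemma D_cont: "continuous_on I D" unfolding D_def by (intro continuous_intros continuous_on_subset[OF u0c]) auto

lemma q_cont: "continuous_on I (q b)"
 unfolding q_def by (intro continuous_intros D_cont continuous_on_subset[OF u2c]) (use D_pos in \<open>auto simp: less_imp_neq[symmetric]\<close>)

lemma q_bound: "\<exists>C\<ge>0. \<forall>y\<in>I. \<bar>q b y\<bar> \<le> C / (d + sg * y)"
proof -
 have "compact (D2 d u0 ` {-d..d})" by (rule compact_continuous_image[OF u2c compact_Icc])
 then obtain B where B: "!!y. y \<in> {-d..d} ==> \<bar>D2 d u0 y\<bar> \<le> B"
  using compact_imp_bounded bounded_iff by (metis imageI real_norm_def)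
 have B0: "B \<ge> 0" using B[of 0] d by auto
 have "\<bar>q b y\<bar> \<le> ((\<bar>b\<bar> + B) / ka) / (d + sg * y)" if y: "y \<in> I" for y
 proof -
  have "\<bar>b - D2 d u0 y\<bar> \<le> \<bar>b\<bar> + B" using B[of y] y by auto
  moreover have "0 < ka * (d + sg * y)" using s_pos[OF y] ka by simp
  moreover have "ka * (d + sg * y) \<le> D y" using gap[of y] y by (simp add: D_def)
  ultimately have "\<bar>b - D2 d u0 y\<bar> / D y \<le> (\<bar>b\<bar> + B) / (ka * (d + sg * y))" by (intro frac_le) auto
  then show ?thesis using D_pos[OF y] by (simp add: q_def abs_divide)
 qed
 then show ?thesis using B0 ka by (intro exI[of _ "(\<bar>b\<bar> + B) / ka"]) auto
qed

lemma test_integrable: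
 assumes ze: "test_function d ze" and p: "continuous_on I p"
 shows "set_integrable lborel I (%y. (deriv ze y)\<^sup>2)" "set_integrable lborel I (%y. p y * (ze y)\<^sup>2)"
proof -
 obtain r where r: "0 < r" "r < d" "!!y. r \<le> \<bar>y\<bar> ==> ze y = 0 \<and> deriv ze y = 0"
  using test_function_support[OF d ze] by blast
 note C = test_function_C1[OF ze]
 have sub: "{-r..r} \<subseteq> I" using r by auto
 show "set_integrable lborel I (%y. (deriv ze y)\<^sup>2)" "set_integrable lborel I (%y. p y * (ze y)\<^sup>2)"
  by (rule interior_integral(1)[OF r(2)], intro continuous_intros continuous_on_subset[OF C(2)] continuous_on_subset[OF C(3)] continuous_on_subset[OF p sub], use r(3) in auto)+
qed

lemma D_inv_cont: "continuous_on I (%y. 1 / D y)"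
 by (intro continuous_intros D_cont) (use D_pos in \<open>auto simp: less_imp_neq[symmetric]\<close>)

lemma Q_affine:
 assumes ze: "test_function d ze"
 shows "Q b ze = A ze - b * N ze"
proof -
 note i = test_integrable(1)[OF ze q_cont] test_integrable(2)[OF ze]
 have "Q b ze = LI (%y. ((deriv ze y)\<^sup>2 - q 0 y * (ze y)\<^sup>2) - b * (1 / D y * (ze y)\<^sup>2))"
  unfolding Q_def q_def by (simp add: diff_divide_distrib algebra_simps)
 also have "... = A ze - LI (%y. b * (1 / D y * (ze y)\<^sup>2))"
  unfolding A_def by (intro set_integral_diff(2) set_integral_diff(1) set_integrable_mult_right i(1) i(2)[OF q_cont] i(2)[OF D_inv_cont])
 finally show ?thesis by (simp only: set_integral_mult_right N_def)
qed

text \<open>N is minus the slope of the form in the Coriolis parameter; this bound makes the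
  decrease of the eigenvalue uniform over normalized test functions.\<close>

lemma N_ge:
 assumes ze: "test_function d ze"
 shows "1 / M * Z ze \<le> N ze"
proof -
 have "LI (%y. 1 / M * (ze y)\<^sup>2) \<le> LI (%y. 1 / D y * (ze y)\<^sup>2)"
 proof (rule set_integral_mono)
  show "set_integrable lborel I (%y. 1 / M * (ze y)\<^sup>2)" by (rule test_integrable(2)[OF ze]) simp
  show "set_integrable lborel I (%y. 1 / D y * (ze y)\<^sup>2)" by (rule test_integrable(2)[OF ze D_inv_cont])
  fix y assume y: "y \<in> I"
  have "1 / M \<le> 1 / D y" using D_pos[OF y] upper[of y] y by (intro divide_left_mono) (auto simp: D_def)
  then show "1 / M * (ze y)\<^sup>2 \<le> 1 / D y * (ze y)\<^sup>2" by (rule mult_right_mono) simp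
 qed
 moreover have "LI (%y. 1 / M * (ze y)\<^sup>2) = 1 / M * Z ze" unfolding Z_def by (rule set_integral_mult_right)
 ultimately show ?thesis by (simp only: N_def)
qed

text \<open>The positive function \<open>1 - exp (- al s)\<close> of the distance \<open>s\<close> to the singular endpoint
 turns the Jacobi inequality into a lower bound for the singular form.\<close>

lemma Q_lower: "\<exists>K. \<forall>ze. test_function d ze --> - K * Z ze \<le> Q b ze"
proof -
 obtain C where C: "C \<ge> 0" "!!y. y \<in> I ==> \<bar>q b y\<bar> \<le> C / (d + sg * y)" using q_bound by blast
 define al where "al = C + 1"
 have al: "al > 0" using C by (simp add: al_def)
 define E where "E y = exp (- (al * (d + sg * y)))" for y
 \<comment> \<open>This is w'' / w for w = 1 - E. Near the singular endpoint it behaves like - al /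
   s, and al > C lets it dominate the pole of - q up to a bounded term.\<close>
 define p where "p y = - (al\<^sup>2 * E y / (1 - E y))" for y
 have E1: "E y < 1" if "y \<in> I" for y using s_pos[OF that] al by (simp add: E_def)
 have dE: "(E has_real_derivative - (al * sg) * E y) (at y)" for y
  unfolding E_def by (auto intro!: derivative_eq_intros)
 have sg2: "sg * sg = 1" using sg by auto
 have pq: "q b y \<le> - p y + al\<^sup>2" if y: "y \<in> I" for y
 proof -
  define x where "x = al * (d + sg * y)"
  have x: "x > 0" using s_pos[OF y] al by (simp add: x_def)
  have e1: "1 - x \<le> exp (- x)" using exp_ge_add_one_self[of "- x"] by simp
  have "1 / x \<le> exp (- x) / (1 - exp (- x)) + 1"
  proof -
   have "exp (- x) / (1 - exp (- x)) + 1 = 1 / (1 - exp (- x))" using x by (simp add: field_simps)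
   moreover have "1 / x \<le> 1 / (1 - exp (- x))" using e1 x by (intro divide_left_mono) auto
   ultimately show ?thesis by simp
  qed
  then have "al\<^sup>2 * (1 / x) \<le> al\<^sup>2 * (exp (- x) / (1 - exp (- x)) + 1)" by (rule mult_left_mono) simp
  moreover have "al\<^sup>2 * (1 / x) = al / (d + sg * y)" using al by (simp add: x_def power2_eq_square)
  moreover have "C / (d + sg * y) \<le> al / (d + sg * y)" using s_pos[OF y] by (intro divide_right_mono) (auto simp: al_def)
  ultimately show ?thesis using C(2)[OF y] by (simp add: p_def E_def x_def algebra_simps)
 qed
 have pc: "continuous_on I p"
 proof -
  have "continuous_on I E" unfolding E_def by (intro continuous_intros)
  moreover have "1 - E y \<noteq> 0" if "y \<in> I" for y using E1[OF that] by simp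
  ultimately show ?thesis unfolding p_def by (intro continuous_intros) auto
 qed
 have "- al\<^sup>2 * Z ze \<le> Q b ze" if ze: "test_function d ze" for ze
 proof -
  note i = test_integrable(1)[OF ze q_cont] test_integrable(2)[OF ze]
  have "0 \<le> LI (%y. (deriv ze y)\<^sup>2 + p y * (ze y)\<^sup>2)"
  proof (rule jacobi_inequality[OF d ze pc, where w="%y. 1 - E y" and w'="%y. al * sg * E y"])
   fix y assume y: "y \<in> I"
   show "((%y. 1 - E y) has_real_derivative al * sg * E y) (at y)"
    by (rule DERIV_cong[OF DERIV_diff[OF DERIV_const dE]]) simp
   have "al * sg * (- (al * sg) * E y) = p y * (1 - E y)"
   proof -
    have "al * sg * (- (al * sg) * E y) = - (al\<^sup>2 * (sg * sg) * E y)" by (simp add: power2_eq_square)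
    then show ?thesis using E1[OF y] sg2 by (simp add: p_def)
   qed
   then show "((%y. al * sg * E y) has_real_derivative p y * (1 - E y)) (at y)"
    using DERIV_cmult[OF dE, of "al * sg" y] by simp
   show "1 - E y > 0" using E1[OF y] by simp
  qed
  also have "... \<le> LI (%y. ((deriv ze y)\<^sup>2 - q b y * (ze y)\<^sup>2) + al\<^sup>2 * (ze y)\<^sup>2)"
  proof (rule set_integral_mono)
   show "set_integrable lborel I (%y. (deriv ze y)\<^sup>2 + p y * (ze y)\<^sup>2)" by (intro set_integral_add(1) i pc)
   show "set_integrable lborel I (%y. ((deriv ze y)\<^sup>2 - q b y * (ze y)\<^sup>2) + al\<^sup>2 * (ze y)\<^sup>2)"
    by (intro set_integral_add(1) set_integral_diff(1) i q_cont continuous_intros)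
   fix y assume y: "y \<in> I"
   have "(p y + q b y) * (ze y)\<^sup>2 \<le> al\<^sup>2 * (ze y)\<^sup>2" using pq[OF y] by (intro mult_right_mono) auto
   then show "(deriv ze y)\<^sup>2 + p y * (ze y)\<^sup>2 \<le> ((deriv ze y)\<^sup>2 - q b y * (ze y)\<^sup>2) + al\<^sup>2 * (ze y)\<^sup>2"
    by (simp add: algebra_simps)
  qed
  also have "... = Q b ze + LI (%y. al\<^sup>2 * (ze y)\<^sup>2)"
   unfolding Q_def by (intro set_integral_add(2) set_integral_diff(1) i q_cont continuous_intros)
  also have "LI (%y. al\<^sup>2 * (ze y)\<^sup>2) = al\<^sup>2 * Z ze" by (simp add: Z_def)
  finally show ?thesis by simp
 qed
 then show ?thesis by blast
qed

text \<open>The pairs do not involve the Coriolis parameter, which exhibits the Rayleigh quotients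
  as a fixed family of affine functions of it.\<close>

definition X :: "(real \<times> real) set" where
 "X = {(A ze / Z ze, N ze / Z ze) | ze. test_function d ze \<and> Z ze > 0}"

lemma X_nonempty: "X \<noteq> {}"
proof -
 obtain ze where ze: "test_function d ze" "ze 0 > 0" using bump_exists[OF d] by blast
 obtain r where r: "0 < r" "r < d" "!!y. r \<le> \<bar>y\<bar> ==> ze y = 0 \<and> deriv ze y = 0"
  using test_function_support[OF d ze(1)] by blast
 have c: "continuous_on {-r..r} (%y. (ze y)\<^sup>2)"
  by (intro continuous_intros continuous_on_subset[OF test_function_C1(3)[OF ze(1)]]) simp
 have "Z ze = integral {-r..r} (%y. (ze y)\<^sup>2)"
  unfolding Z_def by (rule interior_integral(2)[OF r(2) c]) (use r(3) in simp)
 moreover have "integral {-r..r} (%y. (ze y)\<^sup>2) \<noteq> 0"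
  using integral_eq_0_iff[OF c] r(1) ze(2) by (auto intro!: bexI[of _ 0])
 moreover have "integral {-r..r} (%y. (ze y)\<^sup>2) \<ge> 0" by (intro integral_nonneg integrable_continuous_interval c) simp
 ultimately have "Z ze > 0" by simp
 then show ?thesis using ze by (auto simp: X_def)
qed

lemma X_bdd: "bdd_below ((%(A, N). A - b * N) ` X)"
proof -
 obtain K where K: "!!ze. test_function d ze ==> - K * Z ze \<le> Q b ze" using Q_lower by blast
 have "- K \<le> A ze / Z ze - b * (N ze / Z ze)" if "test_function d ze" "Z ze > 0" for ze
  using K[OF that(1)] Q_affine[OF that(1), of b] that(2) by (simp add: field_simps)
 then show ?thesis by (intro bdd_belowI[of _ "- K"]) (auto simp: X_def)
qed

lemma lambda1_set_near:
 assumes H: "H10 d ph ph'" and n: "L2_norm I ph = 1" and ep: "ep > 0"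
 shows "\<exists>ze. test_function d ze \<and> Z ze > 0 \<and> Q b ze / Z ze < LI (%y. \<bar>ph' y\<bar>\<^sup>2 - q b y * \<bar>ph y\<bar>\<^sup>2) + ep"
proof -
 obtain C where C: "C \<ge> 0" "!!y. y \<in> I ==> \<bar>q b y\<bar> \<le> C / (d + sg * y)" using q_bound by blast
 obtain ze where ze: "!!n::nat. test_function d (ze n)" "(%n. Z (ze n)) \<longlonglongrightarrow> LI (%y. (ph y)\<^sup>2)"
  "(%n. Q b (ze n)) \<longlonglongrightarrow> LI (%y. (ph' y)\<^sup>2 - q b y * (ph y)\<^sup>2)"
  using H10_density[OF d H sg C(1) q_cont C(2)] unfolding Z_def Q_def by blast
 have 1: "LI (%y. (ph y)\<^sup>2) = 1" using n by (simp add: L2_norm_def)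
 have "(%n. Q b (ze n) / Z (ze n)) \<longlonglongrightarrow> LI (%y. (ph' y)\<^sup>2 - q b y * (ph y)\<^sup>2) / 1"
  using ze(2,3) unfolding 1 by (intro tendsto_divide) auto
 then have "\<forall>\<^sub>F n in sequentially. Q b (ze n) / Z (ze n) < LI (%y. (ph' y)\<^sup>2 - q b y * (ph y)\<^sup>2) + ep"
  by (rule order_tendstoD(2)) (use ep in simp)
 moreover have "\<forall>\<^sub>F n in sequentially. Z (ze n) > 0" by (rule order_tendstoD(1)[OF ze(2)]) (simp add: 1)
 ultimately have "\<forall>\<^sub>F n in sequentially. Q b (ze n) / Z (ze n) < LI (%y. (ph' y)\<^sup>2 - q b y * (ph y)\<^sup>2) + ep \<and> Z (ze n) > 0"
  by (rule eventually_conj)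
 then obtain n where "Q b (ze n) / Z (ze n) < LI (%y. (ph' y)\<^sup>2 - q b y * (ph y)\<^sup>2) + ep" "Z (ze n) > 0"
  by (auto simp: eventually_sequentially)
 then show ?thesis using ze(1) by auto
qed

text \<open>Normalized test functions are admissible, and by density every admissible value is
  approached from the set of test function values. Boundedness below is transferred along the way,
  without which the real infimum would be meaningless.\<close>

lemma lambda1_eq: "lambda1 d u0 b (shear_min d u0) = Inf ((%(A, N). A - b * N) ` X)"
proof -
 define S where "S = {LI (%y. \<bar>ph' y\<bar>\<^sup>2 - q b y * \<bar>ph y\<bar>\<^sup>2) | ph ph'. H10 d ph ph' \<and> L2_norm I ph = 1}"
 define T where "T = (%(A, N). A - b * N) ` X"
 have "lambda1 d u0 b (shear_min d u0) = Inf S" by (simp add: lambda1_def S_def q_def D_def)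
 have T: "t \<in> T \<longleftrightarrow> (\<exists>ze. test_function d ze \<and> Z ze > 0 \<and> t = Q b ze / Z ze)" for t
 proof
  assume "t \<in> T"
  then show "\<exists>ze. test_function d ze \<and> Z ze > 0 \<and> t = Q b ze / Z ze"
   unfolding T_def X_def by (auto simp: Q_affine diff_divide_distrib)
 next
  assume "\<exists>ze. test_function d ze \<and> Z ze > 0 \<and> t = Q b ze / Z ze"
  then obtain ze where ze: "test_function d ze" "Z ze > 0" "t = Q b ze / Z ze" by blast
  then have "(A ze / Z ze, N ze / Z ze) \<in> X" by (auto simp: X_def)
  then show "t \<in> T" unfolding T_def by (rule rev_image_eqI) (use ze in \<open>simp add: Q_affine diff_divide_distrib\<close>)
 qed
 have TS: "T \<subseteq> S"
 proof
  fix t assume "t \<in> T"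
  then obtain ze where ze: "test_function d ze" "Z ze > 0" "t = Q b ze / Z ze" using T by blast
  define et where "et = (%y. 1 / sqrt (Z ze) * ze y + 0 * ze y)"
  have et: "test_function d et" unfolding et_def by (rule test_function_lincomb(1)[OF ze(1) ze(1)])
  have det: "deriv et y = 1 / sqrt (Z ze) * deriv ze y" for y
   unfolding et_def using test_function_lincomb(2)[OF ze(1) ze(1), of "1 / sqrt (Z ze)" 0 y] by simp
  have c2: "(1 / sqrt (Z ze))\<^sup>2 = 1 / Z ze" using ze(2) by (simp add: power_divide)
  have sq: "(et y)\<^sup>2 = 1 / Z ze * (ze y)\<^sup>2" "(deriv et y)\<^sup>2 = 1 / Z ze * (deriv ze y)\<^sup>2" for y
   unfolding det c2[symmetric] by (simp_all add: et_def power_mult_distrib power_divide)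
  have "LI (%y. \<bar>deriv et y\<bar>\<^sup>2 - q b y * \<bar>et y\<bar>\<^sup>2) = LI (%y. 1 / Z ze * ((deriv ze y)\<^sup>2 - q b y * (ze y)\<^sup>2))"
   unfolding power2_abs sq by (simp add: algebra_simps)
  also have "... = t" unfolding set_integral_mult_right ze(3) Q_def by simp
  finally have 1: "LI (%y. \<bar>deriv et y\<bar>\<^sup>2 - q b y * \<bar>et y\<bar>\<^sup>2) = t" .
  have "LI (%y. (et y)\<^sup>2) = 1 / Z ze * Z ze" unfolding sq set_integral_mult_right Z_def ..
  then have "L2_norm I et = 1" using ze(2) by (simp add: L2_norm_def)
  then show "t \<in> S" using 1 test_function_H10[OF d et] unfolding S_def by blast
 qed
 have near: "\<exists>t\<in>T. t < s + ep" if "s \<in> S" "ep > 0" for s ep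
 proof -
  obtain ph ph' where s: "s = LI (%y. \<bar>ph' y\<bar>\<^sup>2 - q b y * \<bar>ph y\<bar>\<^sup>2)" "H10 d ph ph'" "L2_norm I ph = 1"
   using \<open>s \<in> S\<close> unfolding S_def by blast
  then show ?thesis using lambda1_set_near[OF s(2,3) \<open>ep > 0\<close>, of b] T by blast
 qed
 have Tne: "T \<noteq> {}" using X_nonempty by (simp add: T_def)
 have lower: "Inf T \<le> s" if s: "s \<in> S" for s
 proof (rule field_le_epsilon)
  fix ep :: real assume "ep > 0"
  then obtain t where "t \<in> T" "t < s + ep" using near[OF s] by blast
  then show "Inf T \<le> s + ep" using cInf_lower[of t T] X_bdd[of b] by (simp add: T_def)
 qed
 have "Inf S = Inf T"
 proof (rule antisym)
  show "Inf S \<le> Inf T" by (rule cInf_superset_mono[OF Tne _ TS]) (rule bdd_belowI[of _ "Inf T"], rule lower)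
  show "Inf T \<le> Inf S" by (rule cInf_greatest) (use Tne TS lower in auto)
 qed
 then show ?thesis by (simp add: lambda1_def S_def q_def D_def T_def)
qed

text \<open>At the minimum of u0'' the potential term is nonnegative, so the eigenvalue is at least
  0 there. Existence and uniqueness of the later zero make the definite description in
  \<open>lambda1_inv0\<close> refer, and strict decrease does the rest.\<close>

theorem lambda1_negative:
 assumes "\<beta> > lambda1_inv0 d u0"
 shows "lambda1 d u0 \<beta> (shear_min d u0) < 0"
proof -
 define b0 where "b0 = (INF y\<in>{-d..d}. D2 d u0 y)"
 define f where "f b = lambda1 d u0 b (shear_min d u0)" for b
 have "f b0 \<ge> 0" unfolding f_def lambda1_eq
 proof (rule cInf_greatest)
  fix x assume "x \<in> (%(A, N). A - b0 * N) ` X"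
  then obtain ze where ze: "test_function d ze" "Z ze > 0" "x = Q b0 ze / Z ze"
   by (auto simp: X_def Q_affine diff_divide_distrib)
  have "Q b0 ze \<ge> 0" unfolding Q_def set_lebesgue_integral_def
  proof (rule Bochner_Integration.integral_nonneg)
   fix y
   have "q b0 y * (ze y)\<^sup>2 \<le> 0" if y: "y \<in> I"
   proof -
    have "bdd_below (D2 d u0 ` {-d..d})"
     by (intro bounded_imp_bdd_below compact_imp_bounded compact_continuous_image u2c compact_Icc)
    then have "b0 \<le> D2 d u0 y" unfolding b0_def by (rule cINF_lower) (use y in auto)
    then have "q b0 y \<le> 0" using D_pos[OF y] by (simp add: q_def divide_nonpos_pos)
    then show ?thesis by (rule mult_nonpos_nonneg) simp
   qed
   then show "0 \<le> indicat_real I y *\<^sub>R ((deriv ze y)\<^sup>2 - q b0 y * (ze y)\<^sup>2)"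
    using zero_le_power2[of "deriv ze y"] by (cases "y \<in> I") (auto simp: order_trans)
  qed
  then show "0 \<le> x" using ze by simp
 qed (use X_nonempty in simp)
 moreover have "1 / M \<le> N'" if "(A', N') \<in> X" for A' N' using that N_ge by (auto simp: X_def field_simps)
 ultimately have Z: "\<exists>!b. b0 \<le> b \<and> f b = 0" "f b1 = 0 ==> b1 < \<beta> ==> f \<beta> < 0" for b1 \<beta>
  using affine_infimum_zero[OF X_nonempty, of "1 / M" f b0] X_bdd M lambda1_eq unfolding f_def by auto
 have "f (lambda1_inv0 d u0) = 0" using theI'[OF Z(1)] unfolding lambda1_inv0_def b0_def f_def by blast
 then show ?thesis using Z(2)[OF _ assms] by (simp add: f_def)
qed

theorem lambda1_test_function:
 assumes "ep > 0"
 shows "\<exists>ze. test_function d ze \<and> Z ze > 0 \<and> Q \<beta> ze < (lambda1 d u0 \<beta> (shear_min d u0) + ep) * Z ze"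
proof -
 have "Inf ((%(A, N). A - \<beta> * N) ` X) < lambda1 d u0 \<beta> (shear_min d u0) + ep" using assms by (simp add: lambda1_eq)
 then obtain x where "x \<in> (%(A, N). A - \<beta> * N) ` X" "x < lambda1 d u0 \<beta> (shear_min d u0) + ep"
  using cInf_lessD[of "(%(A, N). A - \<beta> * N) ` X"] X_nonempty by blast
 then obtain ze where "test_function d ze" "Z ze > 0" "Q \<beta> ze / Z ze < lambda1 d u0 \<beta> (shear_min d u0) + ep"
  by (auto simp: X_def Q_affine diff_divide_distrib)
 then show ?thesis by (auto simp: field_simps)
qed

end

section \<open>Nearby polynomial profiles with a neutral mode\<close>

lemma poly_bounded_on: "\<exists>B\<ge>0. \<forall>s\<in>{lo..hi}. \<bar>poly P s\<bar> \<le> (B :: real)"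
proof -
 have "compact (poly P ` {lo..hi})" by (intro compact_continuous_image continuous_intros compact_Icc)
 then obtain B where "\<forall>s\<in>{lo..hi}. \<bar>poly P s\<bar> \<le> B"
  using compact_imp_bounded bounded_iff by (metis imageI real_norm_def)
 then show ?thesis by (intro exI[of _ "\<bar>B\<bar>"]) force
qed

lemma polynomial_antiderivative_approx:
 fixes f f' :: "real => real"
 assumes ab: "a \<le> b" and f: "!!y. y \<in> {a..b} ==> (f has_real_derivative f' y) (at y within {a..b})"
  and close: "!!y. y \<in> {a..b} ==> \<bar>poly p y - f' y\<bar> \<le> th"
 shows "\<exists>P. pderiv P = p \<and> (\<forall>y\<in>{a..b}. \<bar>poly P y - f y\<bar> \<le> (b - a) * th)"
proof -
 obtain P0 where P0: "pderiv P0 = p" using antiderivative_poly by blast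
 define P where "P = P0 + [:f a - poly P0 a:]"
 have dP: "pderiv P = p" and Pa: "poly P a = f a" by (simp_all add: P_def pderiv_add P0 pderiv_pCons)
 have "\<bar>poly P y - f y\<bar> \<le> (b - a) * th" if y: "y \<in> {a..b}" for y
 proof -
  have d: "((%y. poly P y - f y) has_real_derivative poly p y - f' y) (at y within {a..b})" if "y \<in> {a..b}" for y
   using DERIV_diff[OF has_field_derivative_at_within[OF poly_DERIV[of P]] f[OF that]] by (simp add: dP)
  have "norm ((poly P y - f y) - (poly P a - f a)) \<le> th * norm (y - a)"
   by (rule field_differentiable_bound[of "{a..b}" "%y. poly P y - f y" "%y. poly p y - f' y"]) (use d close y ab in auto)
  moreover have "th \<ge> 0" using close[OF y] by linarith
  then have "th * (y - a) \<le> th * (b - a)" using y by (intro mult_left_mono) auto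
  ultimately show ?thesis using y Pa by (simp add: mult.commute)
 qed
 then show ?thesis using dP by blast
qed

lemma polynomial_C2_approx:
 fixes f f' f'' :: "real => real"
 assumes ab: "a < b" and f: "!!y. y \<in> {a..b} ==> (f has_real_derivative f' y) (at y within {a..b})"
  "!!y. y \<in> {a..b} ==> (f' has_real_derivative f'' y) (at y within {a..b})" "continuous_on {a..b} f''"
  and th: "th > 0"
 shows "\<exists>P. \<forall>y\<in>{a..b}. \<bar>poly P y - f y\<bar> \<le> th \<and> \<bar>poly (pderiv P) y - f' y\<bar> \<le> th \<and> \<bar>poly (pderiv (pderiv P)) y - f'' y\<bar> \<le> th"
proof -
 define m where "m = (b - a) + 1"
 have m: "m \<ge> 1" "b - a \<le> m" "m \<le> m\<^sup>2" using ab by (auto simp: m_def power2_eq_square)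
 \<comment> \<open>Each of the two integrations multiplies the approximation error by at most the
   length of the interval.\<close>
 define th' where "th' = th / m\<^sup>2"
 have th': "th' > 0" using th m by (simp add: th'_def)
 obtain g where "real_polynomial_function g" and g: "!!x. x \<in> {a..b} ==> \<bar>f'' x - g x\<bar> < th'"
  using Stone_Weierstrass_real_polynomial_function[OF compact_Icc f(3) th'] by blast
 then obtain c n where gc: "g = (%x. \<Sum>i\<le>n. c i * x ^ i)" using real_polynomial_function_iff_sum by metis
 define p2 where "p2 = (\<Sum>i\<le>n. monom (c i) i)"
 have p2: "\<bar>poly p2 y - f'' y\<bar> \<le> th'" if "y \<in> {a..b}" for y
  using g[OF that] by (simp add: p2_def gc poly_sum poly_monom abs_minus_commute)
 obtain p1 where p1: "pderiv p1 = p2" "!!y. y \<in> {a..b} ==> \<bar>poly p1 y - f' y\<bar> \<le> (b - a) * th'"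
  using polynomial_antiderivative_approx[OF less_imp_le[OF ab] f(2) p2] by blast
 obtain P where P: "pderiv P = p1" "!!y. y \<in> {a..b} ==> \<bar>poly P y - f y\<bar> \<le> (b - a) * ((b - a) * th')"
  using polynomial_antiderivative_approx[OF less_imp_le[OF ab] f(1) p1(2)] by blast
 have m2: "m\<^sup>2 * th' = th" using m by (simp add: th'_def)
 have "(b - a) * th' \<le> m\<^sup>2 * th'" using m th' by (intro mult_right_mono) auto
 moreover have "(b - a) * ((b - a) * th') \<le> m * (m * th')" using m th' ab by (intro mult_mono) auto
 moreover have "1 * th' \<le> m\<^sup>2 * th'" using m th' by (intro mult_right_mono) auto
 ultimately have b: "(b - a) * th' \<le> th" "(b - a) * ((b - a) * th') \<le> th" "th' \<le> th"
  using m2 by (auto simp: power2_eq_square mult.assoc)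
 show ?thesis using P(2) p1(2) p2 b by (intro exI[of _ P] ballI) (simp add: P(1) p1(1), meson order_trans)
qed

lemma C2_derivatives:
 assumes d: "d > 0" and u0: "Ck_on 2 {-d..d} u0"
 shows "!!y. y \<in> {-d..d} ==> (u0 has_real_derivative D1 d u0 y) (at y within {-d..d})"
  "!!y. y \<in> {-d..d} ==> (D1 d u0 has_real_derivative D2 d u0 y) (at y within {-d..d})"
  "continuous_on {-d..d} u0" "continuous_on {-d..d} (D1 d u0)" "continuous_on {-d..d} (D2 d u0)"
proof -
 have u0': "Ck_on (Suc 1) {-d..d} u0" using u0 by (simp add: numeral_2_eq_2)
 have u1: "Ck_on (Suc 0) {-d..d} (D1 d u0)" using u0 by (simp add: numeral_2_eq_2)
 show 1: "!!y. y \<in> {-d..d} ==> (u0 has_real_derivative D1 d u0 y) (at y within {-d..d})"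
  by (rule partials_of_C1_interval[OF d u0'])
 show 2: "!!y. y \<in> {-d..d} ==> (D1 d u0 has_real_derivative D2 d u0 y) (at y within {-d..d})"
  by (rule partials_of_C1_interval[OF d u1])
 show "continuous_on {-d..d} u0" "continuous_on {-d..d} (D1 d u0)"
  by (rule DERIV_continuous_on[OF 1], assumption, rule DERIV_continuous_on[OF 2])
 show "continuous_on {-d..d} (D2 d u0)" using u1 by simp
qed

lemma shear_profile_exists:
 assumes d: "d > 0" and u0: "Ck_on 2 {-d..d} u0" and nz: "\<forall>y\<in>{-d..d}. D1 d u0 y \<noteq> 0"
 shows "\<exists>sg ka M. shear_profile d sg ka M u0"
proof -
 note C = C2_derivatives[OF d u0]
 define sg where "sg = (if D1 d u0 0 > 0 then 1 else - 1 :: real)"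
 have sg: "sg = 1 \<or> sg = -1" by (simp add: sg_def)
 then have sg2: "sg * sg = 1" by auto
 define g where "g y = sg * D1 d u0 y" for y
 have gc: "continuous_on {-d..d} g" unfolding g_def by (intro continuous_intros C)
 have gpos: "g y > 0" if y: "y \<in> {-d..d}" for y
 proof (rule ccontr)
  assume "\<not> g y > 0"
  moreover have "D1 d u0 0 \<noteq> 0" using nz d by simp
  then have "g 0 > 0" by (auto simp: g_def sg_def)
  moreover have "connected (g ` {-d..d})" by (intro connected_continuous_image gc) simp
  ultimately have "0 \<in> g ` {-d..d}" using connectedD_interval[of "g ` {-d..d}" "g y" "g 0" 0] y d by auto
  then show False using nz sg by (auto simp: g_def)
 qed
 obtain y0 where y0: "y0 \<in> {-d..d}" "!!y. y \<in> {-d..d} ==> g y0 \<le> g y"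
  using continuous_attains_inf[OF compact_Icc _ gc] d by fastforce
 define ka where "ka = g y0"
 have ka: "ka > 0" using gpos y0 by (simp add: ka_def)
 define e where "e = - (sg * d)"
 have e: "e \<in> {-d..d}" using sg d by (auto simp: e_def)
 have gap: "ka * (d + sg * y) \<le> u0 y - u0 e" if y: "y \<in> {-d..d}" for y
 proof (cases "y = e")
  case True
  then show ?thesis using sg2 by (simp add: e_def mult.assoc[symmetric])
 next
  case False
  have "\<exists>xi\<in>{-d..d}. u0 y - u0 e = D1 d u0 xi * (y - e)"
  proof (cases "e < y")
   case True
   show ?thesis
   proof (rule Icc_derivative_attains[OF C(1) _ True])
    fix xi assume "xi \<in> {e<..<y}" "u0 y - u0 e = D1 d u0 xi * (y - e)"
    then show ?thesis using e y by (intro bexI[of _ xi]) auto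
   qed (use e y in auto)
  next
   case F: False
   then have lt: "y < e" using False by simp
   show ?thesis
   proof (rule Icc_derivative_attains[OF C(1) _ lt])
    fix xi assume "xi \<in> {y<..<e}" "u0 e - u0 y = D1 d u0 xi * (e - y)"
    then show ?thesis using e y by (intro bexI[of _ xi]) (auto simp: algebra_simps)
   qed (use e y in auto)
  qed
  then obtain xi where xi: "xi \<in> {-d..d}" "u0 y - u0 e = D1 d u0 xi * (y - e)" by blast
  have ye: "y - e = sg * (d + sg * y)" by (simp add: e_def distrib_left mult.assoc[symmetric] sg2)
  have "u0 y - u0 e = g xi * (d + sg * y)" unfolding xi(2) ye g_def by (simp add: mult_ac)
  moreover have "0 \<le> d + sg * y" using sg y by auto
  ultimately show ?thesis using y0(2)[OF xi(1)] by (simp add: ka_def mult_right_mono)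
 qed
 have min: "shear_min d u0 = u0 e" unfolding shear_min_def
 proof (rule cInf_eq_minimum)
  fix x assume "x \<in> u0 ` {-d..d}"
  then obtain y where y: "y \<in> {-d..d}" "x = u0 y" by blast
  have "0 \<le> ka * (d + sg * y)" using ka sg y(1) by (intro mult_nonneg_nonneg) auto
  then show "u0 e \<le> x" using gap[OF y(1)] y(2) by simp
 qed (use e in simp)
 have "compact (u0 ` {-d..d})" by (rule compact_continuous_image[OF C(3) compact_Icc])
 then obtain B where B: "!!y. y \<in> {-d..d} ==> \<bar>u0 y\<bar> \<le> B"
  using compact_imp_bounded bounded_iff by (metis imageI real_norm_def)
 have "shear_profile d sg ka (B + \<bar>u0 e\<bar> + 1) u0"
 proof
  show "B + \<bar>u0 e\<bar> + 1 > 0" using B[OF e] by linarith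
  show "u0 y - shear_min d u0 \<le> B + \<bar>u0 e\<bar> + 1" if "y \<in> {-d..d}" for y using B[OF that] unfolding min by linarith
 qed (use d sg ka C gap min in auto)
 then show ?thesis by blast
qed

text \<open>Replacing \<open>u0\<close> by \<open>u0 - et s\<^sup>2\<close>, with \<open>s\<close> the distance to the minimum point, raises the potential
 by at least \<open>2 et / M\<close>. This strictness leaves room for a polynomial approximation and for moving
 the wave speed below the minimum.\<close>

lemma (in shear_profile) neutral_profile:
 assumes u0: "Ck_on 2 {-d..d} u0" and \<beta>: "\<beta> > (SUP y\<in>{-d..d}. D2 d u0 y)"
  and k: "k > 0" "k\<^sup>2 \<le> - lambda1 d u0 \<beta> (shear_min d u0)" and ep: "ep > 0"
 shows "\<exists>U cs ph ph'. (\<forall>y\<in>{-d..d}. \<bar>poly U y - u0 y\<bar> \<le> ep \<and> \<bar>poly (pderiv U) y - D1 d u0 y\<bar> \<le> ep \<and>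
   \<bar>poly (pderiv (pderiv U)) y - D2 d u0 y\<bar> \<le> ep \<and> \<beta> - poly (pderiv (pderiv U)) y > 0 \<and> poly U y > cs) \<and>
  sol2 (-d) d (%y. k\<^sup>2 - (\<beta> - poly (pderiv (pderiv U)) y) / (poly U y - cs)) (%_. 0) ph ph' \<and>
  ph (-d) = 0 \<and> ph' (-d) = 1 \<and> ph d = 0 \<and> (\<forall>y\<in>{-d<..<d}. ph y > 0)"
proof -
 note C = C2_derivatives[OF d u0]
 have dd: "- d < d" using d by simp
 define T where "T = 3 + 4 * d + 4 * d\<^sup>2"
 have T: "T > 0" using d by (simp add: T_def add_pos_nonneg)
 define et where "et = min (ka / (2 * d)) (ep / T)"
 have et: "et > 0" using ka d ep T by (simp add: et_def)
 have et1: "et * (2 * d) \<le> ka"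
 proof -
  have "et \<le> ka / (2 * d)" by (simp add: et_def)
  then show ?thesis using d by (simp add: field_simps)
 qed
 have et2: "et * T \<le> ep"
 proof -
  have "et \<le> ep / T" by (simp add: et_def)
  then show ?thesis using T by (simp add: field_simps)
 qed
 have et2': "3 * et + 4 * d * et + 4 * d\<^sup>2 * et \<le> ep" using et2 by (simp add: T_def algebra_simps)
 then have et3: "3 * et + 4 * (d * et) + 4 * (d\<^sup>2 * et) \<le> ep" by (simp only: mult.assoc)
 obtain ze where ze: "test_function d ze" "Z ze > 0" "Q \<beta> ze < (lambda1 d u0 \<beta> (shear_min d u0) + et / M) * Z ze"
  using lambda1_test_function[of "et / M" \<beta>] et M by auto
 obtain r where r: "0 < r" "r < d" "!!y. r \<le> \<bar>y\<bar> ==> ze y = 0 \<and> deriv ze y = 0"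
  using test_function_support[OF d ze(1)] by blast
 define ta where "ta = d - r"
 have ta: "ta > 0" using r by (simp add: ta_def)
 define de where "de = et * ta\<^sup>2 / 2"
 have de: "de > 0" using et ta by (simp add: de_def)
 define th where "th = min et (de / 2)"
 have th: "th > 0" "th \<le> et" "th \<le> de / 2" using et de by (auto simp: th_def)
 define c1 where "c1 = shear_min d u0 - de"
 define s where "s y = d + sg * y" for y
 have sg2: "sg * sg = 1" using sg by auto
 have s: "0 \<le> s y" "s y \<le> 2 * d" if "y \<in> {-d..d}" for y using sg that by (auto simp: s_def)
 have ds: "(s has_real_derivative sg) (at y within S)" for y S unfolding s_def by (auto intro!: derivative_eq_intros)
 have V1: "((%y. u0 y - et * (s y)\<^sup>2) has_real_derivative D1 d u0 y - 2 * et * sg * s y) (at y within {-d..d})" if "y \<in> {-d..d}" for y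
  by (rule DERIV_cong[OF DERIV_diff[OF C(1)[OF that] DERIV_cmult[OF DERIV_power[OF ds, of 2]]]]) simp
 have V2: "((%y. D1 d u0 y - 2 * et * sg * s y) has_real_derivative D2 d u0 y - 2 * et) (at y within {-d..d})" if "y \<in> {-d..d}" for y
  by (rule DERIV_cong[OF DERIV_diff[OF C(2)[OF that] DERIV_cmult[OF ds]]]) (use sg2 in \<open>simp add: mult.assoc\<close>)
 obtain U where U: "!!y. y \<in> {-d..d} ==> \<bar>poly U y - (u0 y - et * (s y)\<^sup>2)\<bar> \<le> th \<and> \<bar>poly (pderiv U) y - (D1 d u0 y - 2 * et * sg * s y)\<bar> \<le> th \<and>
   \<bar>poly (pderiv (pderiv U)) y - (D2 d u0 y - 2 * et)\<bar> \<le> th"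
 proof -
  have "continuous_on {-d..d} (%y. D2 d u0 y - 2 * et)" by (intro continuous_intros C)
  then show thesis using polynomial_C2_approx[OF dd V1 V2 _ th(1)] that by blast
 qed
 have u2: "D2 d u0 y < \<beta>" if y: "y \<in> {-d..d}" for y
 proof -
  have "bdd_above (D2 d u0 ` {-d..d})"
   by (intro bounded_imp_bdd_above compact_imp_bounded compact_continuous_image C compact_Icc)
  then have "D2 d u0 y \<le> (SUP y\<in>{-d..d}. D2 d u0 y)" by (rule cSUP_upper[OF y])
  then show ?thesis using \<beta> by simp
 qed
 have U2: "\<beta> - poly (pderiv (pderiv U)) y \<ge> \<beta> - D2 d u0 y + et" if "y \<in> {-d..d}" for y
  using U[OF that] th(2) by linarith
 have U2pos: "\<beta> - poly (pderiv (pderiv U)) y > 0" if "y \<in> {-d..d}" for y using U2[OF that] u2[OF that] et by linarith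
 have Uc1: "poly U y - c1 \<ge> de / 2" if y: "y \<in> {-d..d}" for y
 proof -
  have "et * (s y)\<^sup>2 = (et * s y) * s y" by (simp add: power2_eq_square)
  also have "... \<le> ka * s y"
  proof (rule mult_right_mono[OF _ s(1)[OF y]])
   have "et * s y \<le> et * (2 * d)" using mult_left_mono[OF s(2)[OF y], of et] et by simp
   then show "et * s y \<le> ka" using et1 by linarith
  qed
  also have "... \<le> u0 y - shear_min d u0" using gap[OF y] by (simp add: s_def)
  finally show ?thesis using U[OF y] th(3) by (simp add: c1_def) linarith
 qed
 define p where "p = (%(c, y). k\<^sup>2 - (\<beta> - poly (pderiv (pderiv U)) y) / (poly U y - c))"
 obtain B where B: "B \<ge> 0" "!!y. y \<in> {-d..d} ==> \<bar>poly ([:\<beta>:] - pderiv (pderiv U)) y\<bar> \<le> B"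
  using poly_bounded_on[of "-d" d "[:\<beta>:] - pderiv (pderiv U)"] by blast
 define c0 where "c0 = c1 - (B / k\<^sup>2 + 1)"
 have "0 \<le> B / k\<^sup>2" using B(1) by simp
 then have c01: "c0 \<le> c1" by (simp add: c0_def)
 have pc: "continuous_on ({c0..c1} \<times> {-d..d}) p"
 proof -
  have "poly U (snd z) - fst z \<noteq> 0" if "z \<in> {c0..c1} \<times> {-d..d}" for z using Uc1[of "snd z"] de that by auto
  then show ?thesis unfolding p_def split_beta by (intro continuous_intros) auto
 qed
 have p0: "p (c0, y) > 0" if y: "y \<in> {-d<..<d}" for y
 proof -
  have y': "y \<in> {-d..d}" using y by auto
  have g: "poly U y - c0 \<ge> B / k\<^sup>2 + 1" using Uc1[OF y'] de by (simp add: c0_def)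
  have pos: "B / k\<^sup>2 + 1 > 0" using B k by (simp add: add_nonneg_pos)
  have "(\<beta> - poly (pderiv (pderiv U)) y) / (poly U y - c0) \<le> B / (B / k\<^sup>2 + 1)"
   using B(2)[OF y'] g pos B(1) by (intro frac_le) auto
  also have "... < k\<^sup>2" using B(1) k pos by (simp add: field_simps)
  finally show ?thesis by (simp add: p_def)
 qed
 have pI: "continuous_on I (%y. p (c1, y))"
 proof -
  have "poly U y - c1 \<noteq> 0" if "y \<in> I" for y using Uc1[of y] de that by auto
  then show ?thesis unfolding p_def by (auto intro!: continuous_intros)
 qed
 have neg: "LI (%y. (deriv ze y)\<^sup>2 + p (c1, y) * (ze y)\<^sup>2) < 0"
 proof -
  have "LI (%y. (deriv ze y)\<^sup>2 + p (c1, y) * (ze y)\<^sup>2) \<le> LI (%y. ((deriv ze y)\<^sup>2 - q \<beta> y * (ze y)\<^sup>2) + (k\<^sup>2 - et / M) * (ze y)\<^sup>2)"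
  proof (rule set_integral_mono)
   show "set_integrable lborel I (%y. (deriv ze y)\<^sup>2 + p (c1, y) * (ze y)\<^sup>2)"
    by (intro set_integral_add(1) test_integrable(1)[OF ze(1) pI] test_integrable(2)[OF ze(1) pI])
   show "set_integrable lborel I (%y. ((deriv ze y)\<^sup>2 - q \<beta> y * (ze y)\<^sup>2) + (k\<^sup>2 - et / M) * (ze y)\<^sup>2)"
    by (intro set_integral_add(1) set_integral_diff(1) test_integrable(1)[OF ze(1) pI] test_integrable(2)[OF ze(1)] q_cont continuous_on_const)
   fix y assume y: "y \<in> I"
   show "(deriv ze y)\<^sup>2 + p (c1, y) * (ze y)\<^sup>2 \<le> ((deriv ze y)\<^sup>2 - q \<beta> y * (ze y)\<^sup>2) + (k\<^sup>2 - et / M) * (ze y)\<^sup>2"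
   proof (cases "r \<le> \<bar>y\<bar>")
    case False
    have y': "y \<in> {-d..d}" using y by auto
    have "ta \<le> s y" using False sg by (auto simp: ta_def s_def)
    then have "et * ta\<^sup>2 \<le> et * (s y)\<^sup>2" using ta et by (intro mult_left_mono power_mono) auto
    then have "2 * de \<le> et * (s y)\<^sup>2" by (simp add: de_def)
    then have le: "poly U y - c1 \<le> D y" using U[OF y'] th(3) de by (simp add: c1_def D_def) linarith
    have "q \<beta> y + et / M \<le> q \<beta> y + et / D y"
     using D_pos[OF y] upper[OF y'] et M by (intro add_left_mono divide_left_mono) (auto simp: D_def)
    also have "... = (\<beta> - D2 d u0 y + et) / D y" by (simp add: q_def add_divide_distrib)
    also have "... \<le> (\<beta> - poly (pderiv (pderiv U)) y) / (poly U y - c1)"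
     using U2[OF y'] U2pos[OF y'] le Uc1[OF y'] de by (intro frac_le) auto
    finally have "p (c1, y) \<le> k\<^sup>2 - et / M - q \<beta> y" by (simp add: p_def)
    then have "p (c1, y) * (ze y)\<^sup>2 \<le> (k\<^sup>2 - et / M - q \<beta> y) * (ze y)\<^sup>2" by (rule mult_right_mono) simp
    then show ?thesis by (simp add: algebra_simps)
   qed (simp add: r(3))
  qed
  also have "... = Q \<beta> ze + LI (%y. (k\<^sup>2 - et / M) * (ze y)\<^sup>2)" unfolding Q_def
   by (intro set_integral_add(2) set_integral_diff(1) test_integrable(1)[OF ze(1) pI] test_integrable(2)[OF ze(1)] q_cont continuous_on_const)
  also have "LI (%y. (k\<^sup>2 - et / M) * (ze y)\<^sup>2) = (k\<^sup>2 - et / M) * Z ze" by (simp only: set_integral_mult_right Z_def)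
  also have "Q \<beta> ze + (k\<^sup>2 - et / M) * Z ze < (lambda1 d u0 \<beta> (shear_min d u0) + et / M) * Z ze + (k\<^sup>2 - et / M) * Z ze"
   using ze(3) by simp
  also have "... = (lambda1 d u0 \<beta> (shear_min d u0) + k\<^sup>2) * Z ze" by (simp add: algebra_simps)
  also have "... \<le> 0" using k(2) ze(2) by (intro mult_nonpos_nonneg) auto
  finally show ?thesis .
 qed
 have p1: "\<exists>y\<in>{-d<..<d}. h y \<le> 0" if h: "sol2 (-d) d (%y. p (c1, y)) (%_. 0) h h'" for h h'
 proof (rule ccontr)
  assume "\<not> ?thesis"
  then have pos: "h y > 0" if "y \<in> I" for y using that by force
  have at: "at y within {-d..d} = at y" if "y \<in> I" for y using that by (intro at_within_Icc_at) auto
  have "0 \<le> LI (%y. (deriv ze y)\<^sup>2 + p (c1, y) * (ze y)\<^sup>2)"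
  proof (rule jacobi_inequality[OF d ze(1) pI, of h h'])
   fix y assume y: "y \<in> I"
   then have y': "y \<in> {-d..d}" by auto
   show "(h has_real_derivative h' y) (at y)" "(h' has_real_derivative p (c1, y) * h y) (at y)"
    using sol2D[OF h y'] unfolding at[OF y] by simp_all
  qed (rule pos)
  then show False using neg by simp
 qed
 have "\<exists>c ph ph'. c \<in> {c0..c1} \<and> sol2 (-d) d (%y. p (c, y)) (%_. 0) ph ph' \<and>
  ph (-d) = 0 \<and> ph' (-d) = 1 \<and> ph d = 0 \<and> (\<forall>y\<in>{-d<..<d}. ph y > 0)"
 proof (rule shooting[OF dd c01 pc p0])
  fix h h' assume "sol2 (-d) d (%y. p (c1, y)) (%_. 0) h h'"
  then show "\<exists>y\<in>{-d<..<d}. h y \<le> 0" by (rule p1)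
 qed blast+
 then obtain c ph ph' where c: "c \<in> {c0..c1}" "sol2 (-d) d (%y. p (c, y)) (%_. 0) ph ph'"
  "ph (-d) = 0" "ph' (-d) = 1" "ph d = 0" "\<forall>y\<in>{-d<..<d}. ph y > 0" by blast
 have "\<bar>poly U y - u0 y\<bar> \<le> ep \<and> \<bar>poly (pderiv U) y - D1 d u0 y\<bar> \<le> ep \<and>
   \<bar>poly (pderiv (pderiv U)) y - D2 d u0 y\<bar> \<le> ep \<and> \<beta> - poly (pderiv (pderiv U)) y > 0 \<and> poly U y > c" if y: "y \<in> {-d..d}" for y
 proof -
  have n: "0 \<le> d * et" "0 \<le> d\<^sup>2 * et" using d et by simp_all
  have "(s y)\<^sup>2 \<le> (2 * d)\<^sup>2" using s[OF y] by (intro power_mono)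
  then have "et * (s y)\<^sup>2 \<le> 4 * (d\<^sup>2 * et)" using mult_left_mono[of "(s y)\<^sup>2" "(2 * d)\<^sup>2" et] et by (simp add: power_mult_distrib mult_ac)
  moreover have "0 \<le> et * (s y)\<^sup>2" using et by simp
  ultimately have 1: "\<bar>poly U y - u0 y\<bar> \<le> ep" using U[OF y] th(2) et3 n et by linarith
  have "\<bar>2 * et * sg * s y\<bar> \<le> 4 * (d * et)"
   using sg s[OF y] et mult_left_mono[OF s(2)[OF y], of et] by (auto simp: abs_mult mult_ac)
  then have 2: "\<bar>poly (pderiv U) y - D1 d u0 y\<bar> \<le> ep" using U[OF y] th(2) et3 n et by linarith
  have 3: "\<bar>poly (pderiv (pderiv U)) y - D2 d u0 y\<bar> \<le> ep" using U[OF y] th(2) et3 n et by linarith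
  have "poly U y > c" using Uc1[OF y] de c(1) by auto
  with 1 2 3 U2pos[OF y] show ?thesis by blast
 qed
 then show ?thesis
  using c(2-6) unfolding p_def prod.case by (intro exI[of _ U] exI[of _ c] exI[of _ ph] exI[of _ ph']) blast
qed

section \<open>Failure of inviscid damping\<close>

lemma (in wave_flow) initial_values: "(%q. uu (0, q)) = u1" "(%q. vv (0, q)) = v1" by (auto simp: uu_def vv_def)

theorem damping_fails_if:
 assumes d: "d > 0" and L: "L > 0" and u0: "Ck_on 2 {-d..d} u0"
  and approx: "!!ep. ep > 0 ==> \<exists>U cs ph ph'. (\<forall>y\<in>{-d..d}. \<bar>poly U y - u0 y\<bar> \<le> ep \<and> \<bar>poly (pderiv U) y - D1 d u0 y\<bar> \<le> ep \<and>
   \<bar>poly (pderiv (pderiv U)) y - D2 d u0 y\<bar> \<le> ep \<and> \<beta> - poly (pderiv (pderiv U)) y > 0 \<and> poly U y > cs) \<and>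
   sol2 (-d) d (%y. (2 * pi / L)\<^sup>2 - (\<beta> - poly (pderiv (pderiv U)) y) / (poly U y - cs)) (%_. 0) ph ph' \<and>
   ph (-d) = 0 \<and> ph' (-d) = 1 \<and> ph d = 0 \<and> (\<forall>y\<in>{-d<..<d}. ph y > 0)"
 shows "inviscid_damping_fails d L \<beta> u0" unfolding inviscid_damping_fails_def
proof (intro allI impI)
 fix ep :: real assume ep: "ep > 0"
 note C = C2_derivatives[OF d u0]
 define k where "k = 2 * pi / L"
 have k: "k > 0" "k * L = 2 * pi" using L by (simp_all add: k_def)
 have e4: "ep / 4 > 0" using ep by simp
 obtain U cs ph ph' where A: "\<forall>y\<in>{-d..d}. \<bar>poly U y - u0 y\<bar> \<le> ep / 4 \<and> \<bar>poly (pderiv U) y - D1 d u0 y\<bar> \<le> ep / 4 \<and>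
   \<bar>poly (pderiv (pderiv U)) y - D2 d u0 y\<bar> \<le> ep / 4 \<and> \<beta> - poly (pderiv (pderiv U)) y > 0 \<and> poly U y > cs"
  and ph: "sol2 (-d) d (%y. k\<^sup>2 - (\<beta> - poly (pderiv (pderiv U)) y) / (poly U y - cs)) (%_. 0) ph ph'"
   "ph (-d) = 0" "ph' (-d) = 1" "ph d = 0" "\<forall>y\<in>{-d<..<d}. ph y > 0" using approx[OF e4] unfolding k_def by blast
 have close: "\<bar>poly U y - u0 y\<bar> \<le> ep / 4 \<and> \<bar>poly (pderiv U) y - D1 d u0 y\<bar> \<le> ep / 4 \<and>
   \<bar>poly (pderiv (pderiv U)) y - D2 d u0 y\<bar> \<le> ep / 4"
  and U2: "\<beta> - poly (pderiv (pderiv U)) y > 0" and Ucs: "poly U y > cs" if "y \<in> {-d..d}" for y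
  using A that by blast+
 obtain E where E: "pderiv E = U - [:cs:]" using antiderivative_poly by blast
 define G where "G = pderiv U - [:0, \<beta>:]"
 define q where "q y = (\<beta> - poly (pderiv (pderiv U)) y) / (poly U y - cs)" for y
 have dG: "poly (pderiv G) y = poly (pderiv (pderiv U)) y - \<beta>" for y by (simp add: G_def pderiv_diff pderiv_pCons)
 have qc: "continuous_on {-d..d} q"
  unfolding q_def using Ucs by (intro continuous_intros) (auto simp: less_imp_neq[symmetric])
 interpret S: wave_setup d k E G q ph ph'
 proof
  fix y assume y: "y \<in> {-d..d}"
  show "poly (pderiv E) y > 0" using Ucs[OF y] by (simp add: E)
  show "q y * poly (pderiv E) y + poly (pderiv G) y = 0" using Ucs[OF y] by (simp add: q_def dG E)
  show "q y > 0" using Ucs[OF y] U2[OF y] by (simp add: q_def)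
 qed (use d k qc ph in \<open>auto simp: q_def\<close>)
 have "compact (q ` {-d..d})" by (rule compact_continuous_image[OF qc compact_Icc])
 then obtain Qb where Qb: "!!y. y \<in> {-d..d} ==> \<bar>q y\<bar> \<le> Qb"
  using compact_imp_bounded bounded_iff by (metis imageI real_norm_def)
 obtain y0 where y0: "y0 \<in> {-d..d}" "!!y. y \<in> {-d..d} ==> poly U y0 \<le> poly U y"
 proof -
  have "continuous_on {-d..d} (poly U)" "{-d..d} \<noteq> {}" using d by (auto intro!: continuous_intros)
  then show thesis using continuous_attains_inf[OF compact_Icc, of "-d" d "poly U"] that by blast
 qed
 define mub where "mub = (poly U y0 - cs) / 4"
 have mub: "mub > 0" using Ucs[OF y0(1)] by (simp add: mub_def)
 have near: "\<exists>ro>0. \<forall>s. \<bar>s - x\<bar> < ro --> \<bar>poly U s - poly U x\<bar> < 2 * mub" for x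
  using DERIV_isCont[OF poly_DERIV[of U x]] mub unfolding continuous_at_eps_delta dist_real_def by (meson mult_pos_pos zero_less_numeral)
 obtain ro1 where ro1: "ro1 > 0" "!!s. \<bar>s - d\<bar> < ro1 ==> \<bar>poly U s - poly U d\<bar> < 2 * mub" using near[of d] by blast
 obtain ro2 where ro2: "ro2 > 0" "!!s. \<bar>s - (-d)\<bar> < ro2 ==> \<bar>poly U s - poly U (-d)\<bar> < 2 * mub" using near[of "-d"] by blast
 define ro where "ro = min ro1 ro2 / 2"
 have ro: "ro > 0" "ro < ro1" "ro < ro2" using ro1(1) ro2(1) by (auto simp: ro_def)
 have gap: "2 * mub \<le> poly U s - cs" if s: "s \<in> {-d-ro..d+ro}" for s
 proof -
  have "4 * mub = poly U y0 - cs" by (simp add: mub_def)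
  then have U0: "poly U y \<ge> cs + 4 * mub" if "y \<in> {-d..d}" for y using y0(2)[OF that] by linarith
  have e: "poly U d \<ge> cs + 4 * mub" "poly U (-d) \<ge> cs + 4 * mub" using d by (auto intro!: U0)
  consider "s \<in> {-d..d}" | "s > d" | "s < -d" by force
  then show ?thesis
  proof cases
   case 1 then show ?thesis using U0[of s] mub by simp
  next
   case 2 then show ?thesis using ro1(2)[of s] ro e s by auto
  next
   case 3 then show ?thesis using ro2(2)[of s] ro e s by auto
  qed
 qed
 obtain M1 where M1: "!!s. s \<in> {-d-ro..d+ro} ==> \<bar>poly (pderiv U) s\<bar> \<le> M1" "M1 \<ge> 0" using poly_bounded_on by blast
 obtain M2 where M2: "!!s. s \<in> {-d-ro..d+ro} ==> \<bar>poly (pderiv G) s\<bar> \<le> M2" "M2 \<ge> 0" using poly_bounded_on by blast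
 obtain M3 where M3: "!!s. s \<in> {-d-ro..d+ro} ==> \<bar>poly (pderiv (pderiv G)) s\<bar> \<le> M3" "M3 \<ge> 0" using poly_bounded_on by blast
 define M where "M = M1 + M2 + M3"
 have M: "\<bar>poly (pderiv U) s\<bar> \<le> M \<and> \<bar>poly (pderiv G) s\<bar> \<le> M \<and> \<bar>poly (pderiv (pderiv G)) s\<bar> \<le> M"
  if "s \<in> {-d-ro..d+ro}" for s using M1(1)[OF that] M2(1)[OF that] M3(1)[OF that] M1(2) M2(2) M3(2) by (simp add: M_def)
 obtain Cw a1 where Cw: "Cw > 0" and a1: "a1 > 0"
  and ex: "\<forall>a. 0 < a \<and> a \<le> a1 --> (\<exists>mu w w' g e. \<bar>mu\<bar> \<le> mub \<and> wave_modes d k E G q Cw a mu w w' g e)"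
  using S.wave_modes_exist[OF mub] by (elim exE conjE)
 define Bq Mk where "Bq = wave_flow.Bq k Cw Qb" and "Mk = wave_flow.Mk k"
 define K where "K = Bq * Mk + M * ((M * Cw + Bq * Mk) / mub + Cw)"
 define a where "a = min a1 (min (ro / (2 * Cw)) (ep / (4 * (\<bar>K\<bar> + 1))))"
 have "ro / (2 * Cw) > 0" "ep / (4 * (\<bar>K\<bar> + 1)) > 0" using ro Cw ep by (simp_all add: add_nonneg_pos)
 then have a: "a > 0" "a \<le> a1" using a1 by (simp_all add: a_def)
 have aC: "Cw * a < ro"
 proof -
  have "a \<le> ro / (2 * Cw)" by (simp add: a_def)
  then have "Cw * a \<le> ro / 2" using Cw by (simp add: field_simps)
  then show ?thesis using ro by linarith
 qed
 have aK: "a * K \<le> ep / 4"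
 proof -
  have "a \<le> ep / (4 * (\<bar>K\<bar> + 1))" by (simp add: a_def)
  then have "a * (\<bar>K\<bar> + 1) \<le> ep / 4" by (simp add: field_simps add_pos_nonneg)
  moreover have "a * K \<le> a * (\<bar>K\<bar> + 1)" using a by (intro mult_left_mono) auto
  ultimately show ?thesis by linarith
 qed
 obtain mu w w' g e where mu: "\<bar>mu\<bar> \<le> mub" and modes: "wave_modes d k E G q Cw a mu w w' g e" using ex[rule_format, OF conjI[OF a]] by (elim exE conjE)
 interpret W: wave_flow d L \<beta> k cs mu "cs + mu" U E G q w w' g e Cw a Qb ro mub
 proof
  fix s assume "s \<in> {-d-ro..d+ro}"
  then show "mub \<le> poly U s - (cs + mu)" using gap[of s] mu by linarith
 qed (use d L k E modes a Cw aC qc Qb mub in \<open>auto simp: G_def\<close>)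
 note I = W.initial_C2[OF M C(1,2,5) close]
 have small: "ep / 4 + a * (W.Bq * W.Mk + M * ((M * Cw + W.Bq * W.Mk) / mub + Cw)) < ep"
  using aK ep unfolding K_def Bq_def Mk_def by linarith
 have "Ck_norm 2 (strip d) (%(x, y). W.uu (0, x, y) - u0 y) < ep"
  using I(3) small fun_cong[OF W.initial_values(1)] by simp
 moreover have "Ck_norm 2 (strip d) (%q. W.vv (0, q)) < ep" using I(4) small unfolding W.initial_values by simp
 ultimately show "\<exists>u v. global_solution d L \<beta> u v \<and>
    Ck_on 2 (strip d) (%q. u (0, q)) \<and> Ck_on 2 (strip d) (%q. v (0, q)) \<and>
    Ck_norm 2 (strip d) (%(x, y). u (0, x, y) - u0 y) < ep \<and>
    Ck_norm 2 (strip d) (%q. v (0, q)) < ep \<and>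
    \<not> converges_to_shear d L u v"
  using W.solution W.no_convergence I(1,2) W.initial_values by (intro exI[of _ W.uu] exI[of _ W.vv]) simp
qed

theorem theorem5p18:
  fixes d L \<beta> :: real and u0 :: "real \<Rightarrow> real"
  assumes "d > 0" and "L > 0" and "\<beta> \<ge> 0"
    and "Ck_on 2 {-d..d} u0"
    and "\<forall>y\<in>{-d..d}. D1 d u0 y \<noteq> 0"
    and "\<beta> > max (SUP y\<in>{-d..d}. D2 d u0 y) (lambda1_inv0 d u0)"
    and "L \<ge> 2 * pi / sqrt (- lambda1 d u0 \<beta> (shear_min d u0))"
  shows "lyapunov_stable d L \<beta> u0 \<and> inviscid_damping_fails d L \<beta> u0"
proof
 have \<beta>: "\<beta> > (SUP y\<in>{-d..d}. D2 d u0 y)" "\<beta> > lambda1_inv0 d u0" using assms(6) by auto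
 show "lyapunov_stable d L \<beta> u0" by (rule monotone_profile_stable[OF assms(1,2,4) \<beta>(1)])
 obtain sg ka M where "shear_profile d sg ka M u0" using shear_profile_exists[OF assms(1,4,5)] by blast
 then interpret shear_profile d sg ka M u0 .
 define \<Lambda> where "\<Lambda> = - lambda1 d u0 \<beta> (shear_min d u0)"
 have \<Lambda>: "\<Lambda> > 0" using lambda1_negative[OF \<beta>(2)] by (simp add: \<Lambda>_def)
 have "2 * pi / L \<le> sqrt \<Lambda>"
  using assms(2,7) \<Lambda> unfolding \<Lambda>_def[symmetric] by (simp add: field_simps)
 then have "(2 * pi / L)\<^sup>2 \<le> (sqrt \<Lambda>)\<^sup>2" using assms(2) by (intro power_mono) auto
 then have k: "(2 * pi / L)\<^sup>2 \<le> - lambda1 d u0 \<beta> (shear_min d u0)" using \<Lambda> by (simp add: \<Lambda>_def)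
 have k0: "2 * pi / L > 0" using assms(2) by simp
 show "inviscid_damping_fails d L \<beta> u0"
  by (rule damping_fails_if[OF assms(1,2,4)]) (rule neutral_profile[OF assms(4) \<beta>(1) k0 k])
qed

end
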